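(* Let $G$ be a non-commutative stratified group, let $N$ be any homogeneous norm on $G$ and, for $\alpha>0$, let $w_\alpha=e^{-N^\alpha}$. Then $\mathcal L^{w_\alpha}$ is a self-adjoint extension of $\mathcal L^{w_\alpha}_0$ for every $\alpha>0$. When $\alpha\ge1$, $\mathcal L^{w_\alpha}$ is the unique self-adjoint extension of $\mathcal L^{w_\alpha}_0$.
   Context: A stratified group $G$ is a connected, simply connected Lie group whose Lie algebra has a decomposition $\mathfrak g=\mathfrak g_1\oplus\cdots\oplus\mathfrak g_\nu$ with $[\mathfrak g_1,\mathfrak g_{k-1}]=\mathfrak g_k$ for $k\le\nu$ and $[\mathfrak g_1,\mathfrak g_\nu]=0$. Dilations: $\delta_r(\sum_k Y_k)=\sum_k r^kY_k$ on $\mathfrak g$ ($Y_k\in\mathfrak g_k$), transferred to $G$ by $\delta_r(\exp Y)=\exp\delta_r(Y)$. A homogeneous norm on $G$ is a continuous function $N\colon G\to[0,\infty)$ which is $C^\infty$ on $G\setminus\{e\}$ and satisfies $N(\delta_r y)=rN(y)$ for $r>0$, $N(y^{-1})=N(y)$, and $N(y)=0$ iff $y=e$. $dy$ is a (bi-invariant) Haar measure. Fix a basis $X_1,\dots,X_{n_1}$ of left-invariant vector fields for $\mathfrak g_1$ and the inner product on $\mathfrak g_1$ making it orthonormal. $\nabla_{\mathcal H}f=\sum_j(X_jf)X_j$ is the horizontal gradient, $\mathcal L=-\sum_jX_j^2$ the sub-Laplacian (distributional derivatives), and $\nabla_{\mathcal H} f\cdot\nabla_{\mathcal H} g=\sum_j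 (X_jf)(X_jg)$. $C_c^\infty$ is the space of smooth compactly supported (complex) functions on $G$. For a weight $w$ (here $w=w_\alpha$): $L^2(w)=L^2(G,w(y)\,dy)$, $L^2(w;\mathfrak g_1)$ is the analogous space of $\mathfrak g_1$-valued functions, and $S^2_1(w)=\{f\in L^2(w)\colon\nabla_{\mathcal H}f\in L^2(w;\mathfrak g_1)\}$. $\mathcal L^w$ is the positive self-adjoint operator on $L^2(w)$ associated with the closed form $\mathfrak t(f,g)=(\nabla_{\mathcal H}f,\nabla_{\mathcal H}g)_{L^2(w)}$, $\mathrm{Dom}(\mathfrak t)=S^2_1(w)$: $f\in\mathrm{Dom}(\mathcal L^w)$ iff $f\in S^2_1(w)$ and there is $\tilde f\in L^2(w)$ with $(\tilde f,g)_{L^2(w)}=\mathfrak t(f,g)$ for all $g\in S^2_1(w)$, and then $\mathcal L^wf=\tilde f$. $\mathcal L^w_0=\mathcal L-\frac{\nabla_{\mathcal H}w}{w}\cdot\nabla_{\mathcal H}$ with domain $C_c^\infty$, as an operator on $L^2(w)$. *)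

theory Defs
  imports "HOL-Analysis.Analysis"
begin

section \<open>Smooth functions and Lie groups\<close>

text \<open>
  Groups are written additively, since the library's class of topological groups is
  \<^class>\<open>topological_group_add\<close>.  That class does not include commutativity: \<open>x + y\<close> is the group
  product, \<open>- x\<close> the inverse and \<open>0\<close> the identity element \<open>e\<close>.
\<close>

primrec ck_on ::
  "nat \<Rightarrow> 'a::real_normed_vector set \<Rightarrow> ('a \<Rightarrow> 'b::real_normed_vector) \<Rightarrow> bool" where
  "ck_on 0 S f \<longleftrightarrow> continuous_on S f"
| "ck_on (Suc k) S f \<longleftrightarrow>
     (\<forall>x\<in>S. f differentiable (at x)) \<and>
     (\<forall>v. ck_on k S (\<lambda>x. frechet_derivative f (at x) v))"

text \<open>Used only for open subsets \<open>S\<close> of Euclidean spaces.\<close>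

definition smooth_on :: "'a::real_normed_vector set \<Rightarrow> ('a \<Rightarrow> 'b::real_normed_vector) \<Rightarrow> bool" where
  "smooth_on S f \<longleftrightarrow> (\<forall>k. ck_on k S f)"

type_synonym ('g, 'e) chart = "'g set \<times> ('g \<Rightarrow> 'e)"

definition is_chart :: "('g::topological_space, 'e::euclidean_space) chart \<Rightarrow> bool" where
  "is_chart c \<longleftrightarrow> (case c of (U, \<phi>) \<Rightarrow>
     open U \<and> open (\<phi> ` U) \<and> homeomorphism U (\<phi> ` U) \<phi> (inv_into U \<phi>))"

definition smooth_atlas :: "('g::topological_space, 'e::euclidean_space) chart set \<Rightarrow> bool" where
  "smooth_atlas A \<longleftrightarrow>
     (\<forall>c\<in>A. is_chart c) \<and>
     (\<Union>c\<in>A. fst c) = UNIV \<and>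
     (\<forall>(U, \<phi>)\<in>A. \<forall>(V, \<psi>)\<in>A. smooth_on (\<phi> ` (U \<inter> V)) (\<psi> \<circ> inv_into U \<phi>))"

text \<open>Smoothness of a function on an open subset \<open>W\<close> of the manifold.\<close>

definition msmooth_on ::
  "('g::topological_space, 'e::euclidean_space) chart set \<Rightarrow> 'g set
     \<Rightarrow> ('g \<Rightarrow> 'b::real_normed_vector) \<Rightarrow> bool" where
  "msmooth_on A W f \<longleftrightarrow> (\<forall>(U, \<phi>)\<in>A. smooth_on (\<phi> ` (U \<inter> W)) (f \<circ> inv_into U \<phi>))"

definition lie_group ::
  "('g::{topological_group_add, t2_space, second_countable_topology}, 'e::euclidean_space) chart set
     \<Rightarrow> bool" where
  "lie_group A \<longleftrightarrow>
     smooth_atlas A \<and>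
     (\<forall>(U, \<phi>)\<in>A. \<forall>(V, \<psi>)\<in>A. \<forall>(W, \<eta>)\<in>A.
        smooth_on {(\<phi> x, \<psi> y) | x y. x \<in> U \<and> y \<in> V \<and> x + y \<in> W}
          (\<lambda>(a, b). \<eta> (inv_into U \<phi> a + inv_into V \<psi> b))) \<and>
     (\<forall>(U, \<phi>)\<in>A. \<forall>(V, \<psi>)\<in>A.
        smooth_on {\<phi> x | x. x \<in> U \<and> - x \<in> V} (\<lambda>a. \<psi> (- inv_into U \<phi> a)))"

section \<open>The Lie algebra and the exponential map\<close>

text \<open>
  The Lie algebra is the tangent space at the identity, identified with the model space \<open>'e\<close> by
  means of a fixed chart around the identity; another choice of chart changes it by a linear
  isomorphism.  The vector \<open>v\<close> stands for the left-invariant vector field \<open>left_inv_field A v\<close>,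
  which differentiates \<open>f\<close> at \<open>x\<close> along a curve through \<open>x\<close> of the form \<open>x + c t\<close>,
  where \<open>c 0 = 0\<close> and \<open>c\<close> has velocity \<open>v\<close> at \<open>t = 0\<close>.
\<close>

definition id_chart ::
  "('g::{topological_group_add, t2_space, second_countable_topology}, 'e::euclidean_space) chart set
     \<Rightarrow> ('g, 'e) chart" where
  "id_chart A = (SOME c. c \<in> A \<and> 0 \<in> fst c)"

definition left_inv_field ::
  "('g::{topological_group_add, t2_space, second_countable_topology}, 'e::euclidean_space) chart set
     \<Rightarrow> 'e \<Rightarrow> ('g \<Rightarrow> 'b::real_normed_vector) \<Rightarrow> 'g \<Rightarrow> 'b" where
  "left_inv_field A v f x = (case id_chart A of (U, \<phi>) \<Rightarrow>
     frechet_derivative (\<lambda>a. f (x + inv_into U \<phi> a)) (at (\<phi> 0)) v)"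

definition lie_bracket ::
  "('g::{topological_group_add, t2_space, second_countable_topology}, 'e::euclidean_space) chart set
     \<Rightarrow> 'e \<Rightarrow> 'e \<Rightarrow> 'e" where
  "lie_bracket A u v = (THE w. \<forall>f :: 'g \<Rightarrow> real. msmooth_on A UNIV f \<longrightarrow>
     (\<forall>x. left_inv_field A w f x =
          left_inv_field A u (left_inv_field A v f) x - left_inv_field A v (left_inv_field A u f) x))"

text \<open>The maximal integral curve, starting at the identity, of the left-invariant field of \<open>v\<close>.\<close>

definition integral_curve ::
  "('g::{topological_group_add, t2_space, second_countable_topology}, 'e::euclidean_space) chart set
     \<Rightarrow> 'e \<Rightarrow> (real \<Rightarrow> 'g) \<Rightarrow> bool" where
  "integral_curve A v \<gamma> \<longleftrightarrow>
     \<gamma> 0 = 0 \<and>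
     (\<forall>f :: 'g \<Rightarrow> real. msmooth_on A UNIV f \<longrightarrow>
        (\<forall>t. ((\<lambda>s. f (\<gamma> s)) has_real_derivative left_inv_field A v f (\<gamma> t)) (at t)))"

definition lie_exp ::
  "('g::{topological_group_add, t2_space, second_countable_topology}, 'e::euclidean_space) chart set
     \<Rightarrow> 'e \<Rightarrow> 'g" where
  "lie_exp A v = (THE \<gamma>. integral_curve A v \<gamma>) 1"

section \<open>Stratified groups\<close>

definition layer_decomp ::
  "(nat \<Rightarrow> 'e::euclidean_space set) \<Rightarrow> nat \<Rightarrow> 'e \<Rightarrow> (nat \<Rightarrow> 'e) \<Rightarrow> bool" where
  "layer_decomp \<gg> \<nu> Y y \<longleftrightarrow>
     (\<forall>k\<in>{1..\<nu>}. y k \<in> \<gg> k) \<and> (\<forall>k. k \<notin> {1..\<nu>} \<longrightarrow> y k = 0) \<and> Y = (\<Sum>k=1..\<nu>. y k)"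

text \<open>The bracket of two subspaces is the span of the brackets of their elements.\<close>

definition stratified_group ::
  "('g::{topological_group_add, t2_space, second_countable_topology}, 'e::euclidean_space) chart set
     \<Rightarrow> nat \<Rightarrow> (nat \<Rightarrow> 'e set) \<Rightarrow> bool" where
  "stratified_group A \<nu> \<gg> \<longleftrightarrow>
     lie_group A \<and> connected (UNIV :: 'g set) \<and> simply_connected (UNIV :: 'g set) \<and>
     \<nu> \<ge> 1 \<and>
     (\<forall>k\<in>{1..\<nu>}. subspace (\<gg> k)) \<and>
     (\<forall>Y. \<exists>!y. layer_decomp \<gg> \<nu> Y y) \<and>
     (\<forall>k\<in>{2..\<nu>}. span {lie_bracket A u v | u v. u \<in> \<gg> 1 \<and> v \<in> \<gg> (k - 1)} = \<gg> k) \<and>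
     (\<forall>u\<in>\<gg> 1. \<forall>v\<in>\<gg> \<nu>. lie_bracket A u v = 0)"

definition algebra_dilation ::
  "nat \<Rightarrow> (nat \<Rightarrow> 'e::euclidean_space set) \<Rightarrow> real \<Rightarrow> 'e \<Rightarrow> 'e" where
  "algebra_dilation \<nu> \<gg> r Y = (\<Sum>k=1..\<nu>. r ^ k *\<^sub>R (THE y. layer_decomp \<gg> \<nu> Y y) k)"

text \<open>On a stratified group \<open>lie_exp A\<close> is a bijection, so the inverse below is genuine.\<close>

definition group_dilation ::
  "('g::{topological_group_add, t2_space, second_countable_topology}, 'e::euclidean_space) chart set
     \<Rightarrow> nat \<Rightarrow> (nat \<Rightarrow> 'e set) \<Rightarrow> real \<Rightarrow> 'g \<Rightarrow> 'g" where
  "group_dilation A \<nu> \<gg> r x = lie_exp A (algebra_dilation \<nu> \<gg> r (inv (lie_exp A) x))"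

definition homogeneous_norm ::
  "('g::{topological_group_add, t2_space, second_countable_topology}, 'e::euclidean_space) chart set
     \<Rightarrow> nat \<Rightarrow> (nat \<Rightarrow> 'e set) \<Rightarrow> ('g \<Rightarrow> real) \<Rightarrow> bool" where
  "homogeneous_norm A \<nu> \<gg> N \<longleftrightarrow>
     continuous_on UNIV N \<and> (\<forall>y. N y \<ge> 0) \<and> msmooth_on A (- {0}) N \<and>
     (\<forall>r>0. \<forall>y. N (group_dilation A \<nu> \<gg> r y) = r * N y) \<and>
     (\<forall>y. N (- y) = N y) \<and> (\<forall>y. N y = 0 \<longleftrightarrow> y = 0)"

text \<open>Only left invariance is asked for; on a stratified group right invariance follows.\<close>

definition haar_measure :: "'g::{topological_group_add, t2_space} measure \<Rightarrow> bool" where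
  "haar_measure \<mu> \<longleftrightarrow>
     sets \<mu> = sets borel \<and>
     (\<forall>x. \<forall>E\<in>sets borel. emeasure \<mu> ((\<lambda>y. x + y) ` E) = emeasure \<mu> E) \<and>
     (\<forall>K. compact K \<longrightarrow> emeasure \<mu> K < \<infinity>) \<and>
     (\<forall>U. open U \<and> U \<noteq> {} \<longrightarrow> emeasure \<mu> U > 0)"

section \<open>Operators on \<open>L\<^sup>2\<close> spaces\<close>

definition L2 :: "'a measure \<Rightarrow> ('a \<Rightarrow> complex) set" where
  "L2 M = {f \<in> borel_measurable M. integrable M (\<lambda>x. (cmod (f x))\<^sup>2)}"

definition L2_inner :: "'a measure \<Rightarrow> ('a \<Rightarrow> complex) \<Rightarrow> ('a \<Rightarrow> complex) \<Rightarrow> complex" where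
  "L2_inner M f g = (LINT x|M. f x * cnj (g x))"

text \<open>
  An unbounded operator is given by its graph.  The elements of \<open>L\<^sup>2\<close> being classes of functions
  modulo equality almost everywhere, graphs consist of pairs of representatives: they are closed
  under change of representatives, and single-valued up to equality almost everywhere.
\<close>

definition L2_operator :: "'a measure \<Rightarrow> (('a \<Rightarrow> complex) \<times> ('a \<Rightarrow> complex)) set \<Rightarrow> bool" where
  "L2_operator M T \<longleftrightarrow>
     T \<subseteq> L2 M \<times> L2 M \<and>
     ((\<lambda>x. 0), (\<lambda>x. 0)) \<in> T \<and>
     (\<forall>(f, f')\<in>T. \<forall>(g, g')\<in>T. \<forall>c.
        ((\<lambda>x. f x + c * g x), (\<lambda>x. f' x + c * g' x)) \<in> T) \<and>
     (\<forall>(f, f')\<in>T. \<forall>g\<in>L2 M. \<forall>g'\<in>L2 M.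
        (AE x in M. g x = f x) \<and> (AE x in M. g' x = f' x) \<longrightarrow> (g, g') \<in> T) \<and>
     (\<forall>(f, f')\<in>T. \<forall>(g, g')\<in>T. (AE x in M. f x = g x) \<longrightarrow> (AE x in M. f' x = g' x))"

definition densely_defined ::
  "'a measure \<Rightarrow> (('a \<Rightarrow> complex) \<times> ('a \<Rightarrow> complex)) set \<Rightarrow> bool" where
  "densely_defined M T \<longleftrightarrow>
     (\<forall>h\<in>L2 M. \<forall>\<epsilon>>0. \<exists>f\<in>Domain T. sqrt (LINT x|M. (cmod (h x - f x))\<^sup>2) < \<epsilon>)"

definition L2_adjoint ::
  "'a measure \<Rightarrow> (('a \<Rightarrow> complex) \<times> ('a \<Rightarrow> complex)) set
     \<Rightarrow> (('a \<Rightarrow> complex) \<times> ('a \<Rightarrow> complex)) set" where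
  "L2_adjoint M T = {(g, g'). g \<in> L2 M \<and> g' \<in> L2 M \<and>
     (\<forall>(f, f')\<in>T. L2_inner M f' g = L2_inner M f g')}"

definition self_adjoint ::
  "'a measure \<Rightarrow> (('a \<Rightarrow> complex) \<times> ('a \<Rightarrow> complex)) set \<Rightarrow> bool" where
  "self_adjoint M T \<longleftrightarrow> L2_operator M T \<and> densely_defined M T \<and> L2_adjoint M T = T"

definition self_adjoint_extension ::
  "'a measure \<Rightarrow> (('a \<Rightarrow> complex) \<times> ('a \<Rightarrow> complex)) set
     \<Rightarrow> (('a \<Rightarrow> complex) \<times> ('a \<Rightarrow> complex)) set \<Rightarrow> bool" where
  "self_adjoint_extension M T\<^sub>0 T \<longleftrightarrow> self_adjoint M T \<and> T\<^sub>0 \<subseteq> T"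

section \<open>Weighted sub-Laplacians\<close>

definition test_functions ::
  "('g::topological_space, 'e::euclidean_space) chart set \<Rightarrow> ('g \<Rightarrow> complex) set" where
  "test_functions A = {\<phi>. msmooth_on A UNIV \<phi> \<and> compact (closure {x. \<phi> x \<noteq> 0})}"

definition locally_integrable :: "'g::topological_space measure \<Rightarrow> ('g \<Rightarrow> complex) \<Rightarrow> bool" where
  "locally_integrable \<mu> f \<longleftrightarrow>
     f \<in> borel_measurable \<mu> \<and> (\<forall>K. compact K \<longrightarrow> set_integrable \<mu> K f)"

text \<open>
  \<open>h\<close> is the distributional derivative of \<open>f\<close> along the left-invariant field of \<open>v\<close>; the sign is
  that of the formal transpose of the field, which is divergence-free for the Haar measure \<open>\<mu>\<close>.
\<close>

definition is_weak_deriv ::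
  "('g::{topological_group_add, t2_space, second_countable_topology}, 'e::euclidean_space) chart set
     \<Rightarrow> 'g measure \<Rightarrow> 'e \<Rightarrow> ('g \<Rightarrow> complex) \<Rightarrow> ('g \<Rightarrow> complex) \<Rightarrow> bool" where
  "is_weak_deriv A \<mu> v f h \<longleftrightarrow>
     locally_integrable \<mu> f \<and> locally_integrable \<mu> h \<and>
     (\<forall>\<phi>\<in>test_functions A.
        (LINT x|\<mu>. h x * \<phi> x) = - (LINT x|\<mu>. f x * left_inv_field A v \<phi> x))"

definition weak_deriv ::
  "('g::{topological_group_add, t2_space, second_countable_topology}, 'e::euclidean_space) chart set
     \<Rightarrow> 'g measure \<Rightarrow> 'e \<Rightarrow> ('g \<Rightarrow> complex) \<Rightarrow> 'g \<Rightarrow> complex" where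
  "weak_deriv A \<mu> v f = (SOME h. is_weak_deriv A \<mu> v f h)"

definition weighted :: "'g measure \<Rightarrow> ('g \<Rightarrow> real) \<Rightarrow> 'g measure" where
  "weighted \<mu> w = density \<mu> (\<lambda>x. ennreal (w x))"

text \<open>
  \<open>B\<close> is the chosen basis of the first layer.  A horizontal vector field \<open>\<Sum>X\<in>B. h X *\<^sub>R X\<close> is
  handled through its coordinates \<open>h X\<close>; as \<open>B\<close> is orthonormal for the inner product on the first
  layer, it lies in the weighted \<open>L\<^sup>2\<close> space exactly if all its coordinates do.
\<close>

definition sobolev ::
  "('g::{topological_group_add, t2_space, second_countable_topology}, 'e::euclidean_space) chart set
     \<Rightarrow> 'e set \<Rightarrow> 'g measure \<Rightarrow> ('g \<Rightarrow> real) \<Rightarrow> ('g \<Rightarrow> complex) set" where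
  "sobolev A B \<mu> w = {f \<in> L2 (weighted \<mu> w).
     \<forall>X\<in>B. \<exists>h\<in>L2 (weighted \<mu> w). is_weak_deriv A \<mu> X f h}"

definition dirichlet_form ::
  "('g::{topological_group_add, t2_space, second_countable_topology}, 'e::euclidean_space) chart set
     \<Rightarrow> 'e set \<Rightarrow> 'g measure \<Rightarrow> ('g \<Rightarrow> real) \<Rightarrow> ('g \<Rightarrow> complex) \<Rightarrow> ('g \<Rightarrow> complex) \<Rightarrow> complex" where
  "dirichlet_form A B \<mu> w f g =
     (\<Sum>X\<in>B. L2_inner (weighted \<mu> w) (weak_deriv A \<mu> X f) (weak_deriv A \<mu> X g))"

definition weighted_sublaplacian ::
  "('g::{topological_group_add, t2_space, second_countable_topology}, 'e::euclidean_space) chart set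
     \<Rightarrow> 'e set \<Rightarrow> 'g measure \<Rightarrow> ('g \<Rightarrow> real) \<Rightarrow> (('g \<Rightarrow> complex) \<times> ('g \<Rightarrow> complex)) set" where
  "weighted_sublaplacian A B \<mu> w = {(f, f').
     f \<in> sobolev A B \<mu> w \<and> f' \<in> L2 (weighted \<mu> w) \<and>
     (\<forall>g\<in>sobolev A B \<mu> w. L2_inner (weighted \<mu> w) f' g = dirichlet_form A B \<mu> w f g)}"

definition drift_sublaplacian ::
  "('g::{topological_group_add, t2_space, second_countable_topology}, 'e::euclidean_space) chart set
     \<Rightarrow> 'e set \<Rightarrow> ('g \<Rightarrow> real) \<Rightarrow> ('g \<Rightarrow> complex) \<Rightarrow> 'g \<Rightarrow> complex" where
  "drift_sublaplacian A B w \<phi> x =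
     - (\<Sum>X\<in>B. left_inv_field A X (left_inv_field A X \<phi>) x)
     - (\<Sum>X\<in>B. complex_of_real (left_inv_field A X w x / w x) * left_inv_field A X \<phi> x)"

text \<open>
  The operator with domain the test functions (up to equality almost everywhere).  That the images
  lie in the weighted \<open>L\<^sup>2\<close> space is not built in, so that no test function is dropped
  from the domain; it is a consequence of being contained in an operator on that space.
\<close>

definition minimal_weighted_sublaplacian ::
  "('g::{topological_group_add, t2_space, second_countable_topology}, 'e::euclidean_space) chart set
     \<Rightarrow> 'e set \<Rightarrow> 'g measure \<Rightarrow> ('g \<Rightarrow> real) \<Rightarrow> (('g \<Rightarrow> complex) \<times> ('g \<Rightarrow> complex)) set" where
  "minimal_weighted_sublaplacian A B \<mu> w = {(f, f').
     f \<in> borel_measurable (weighted \<mu> w) \<and> f' \<in> borel_measurable (weighted \<mu> w) \<and>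
     (\<exists>\<phi>\<in>test_functions A.
        (AE x in weighted \<mu> w. f x = \<phi> x) \<and>
        (AE x in weighted \<mu> w. f' x = drift_sublaplacian A B w \<phi> x))}"

text \<open>In Isabelle \<open>0 powr \<alpha> = 0\<close>, so the weight has the right value \<open>1\<close> at the identity.\<close>

definition exp_weight :: "('g \<Rightarrow> real) \<Rightarrow> real \<Rightarrow> 'g \<Rightarrow> real" where
  "exp_weight N \<alpha> y = exp (- (N y powr \<alpha>))"

end

theory Submission imports Defs begin

text \<open>
  Self-adjointness.  The closed form defines a symmetric operator \<open>L\<close>, and \<open>L + 1\<close> is onto, because
  \<open>f + L f = H\<close> is the orthogonal projection of \<open>(H, 0)\<close> to the graph of the gradient (\<open>Lw_onto\<close>); hence
  \<open>L\<close> is self-adjoint.  It extends the minimal operator as soon as integration by parts against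
  \<open>w X\<^sub>v f\<close> is allowed.  This function is singular at the identity only, and points are removable
  (\<open>remove_point\<close>), because the ball of radius \<open>\<epsilon>\<close> has volume \<open>O(\<epsilon>\<^sup>2)\<close> (\<open>sc_2\<close>): a non-commutative
  group has two independent horizontal directions.

  Uniqueness.  One has to show that \<open>u\<close> vanishes if it is orthogonal to the range of \<open>L\<^sub>0 + 1\<close>.  The
  function \<open>U = w cnj u\<close> solves the adjoint equation weakly.  Not being smooth, it cannot
  be tested with itself; it is mollified by left convolution, which commutes with left-invariant fields,
  though not with the drift; for \<open>\<alpha> \<ge> 1\<close> the drift \<open>X\<^sub>v w / w\<close> is locally bounded, and the error disappears in the
  limit.  Testing the mollified equation with \<open>\<chi>\<^sup>2 cnj V / w\<close> (\<open>energy_estimate\<close>) bounds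
  \<open>\<chi> U\<close> by \<open>\<bar>\<nabla>\<chi>\<bar> U\<close> in \<open>L\<^sup>2(1/w)\<close>, and cutoffs \<open>\<chi>\<close> with gradient \<open>O(1/R)\<close> give \<open>U = 0\<close>.

  Both parts need the structure of the group: dilations are automorphisms, right translations
  and inversion preserve the measure, and sublevel sets of \<open>N\<close> are compact.  The first fact follows from
  a product \<open>star\<close> on the Lie algebra with \<open>exp (star V Y) = exp V exp Y\<close> (\<open>E_star\<close>), obtained
  by solving the equation of the curve \<open>exp V exp (t Y)\<close> in logarithmic coordinates, together with
  the bijectivity of \<open>exp\<close>.  The measure is unimodular, because its modular function is dilation
  invariant and bounded near the identity (\<open>modular_1\<close>).
\<close>

section \<open>Calculus of smooth maps\<close>

lemma ck_on_subset: "ck_on k S f ==> T <= S ==> ck_on k T f"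
 by (induction k arbitrary: f) (auto intro: continuous_on_subset)

lemma smooth_on_subset: "smooth_on S f ==> T <= S ==> smooth_on T f"
 by (auto simp: smooth_on_def intro: ck_on_subset)

lemma ck_on_cong:
 assumes "open S" "!!x. x : S ==> f x = g x" "ck_on k S f"
 shows "ck_on k S g"
 using assms(2,3)
proof (induction k arbitrary: f g)
 case 0
 thus ?case by (auto cong: continuous_on_cong)
next
 case (Suc k)
 have d: "(g has_derivative frechet_derivative f (at x)) (at x)" if "x : S" for x
  using Suc.prems that assms(1)
  by (auto intro!: has_derivative_transform_within_open[of f _ x UNIV S g]
    simp: frechet_derivative_works)
 have "frechet_derivative g (at x) = frechet_derivative f (at x)" if "x : S" for x
  using frechet_derivative_at[OF d[OF that]] by simp
 moreover have "g differentiable at x" if "x : S" for x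
  using d[OF that] by (auto simp: differentiable_def)
 ultimately show ?case
  using Suc.prems(2) Suc.IH[of "%x. frechet_derivative f (at x) v" "%x. frechet_derivative g (at x) v" for v]
  by auto
qed

lemma ck_on_SucI:
 assumes "open S" "!!x. x : S ==> (f has_derivative D x) (at x)" "!!v. ck_on k S (%x. D x v)"
 shows "ck_on (Suc k) S f"
proof -
 have "frechet_derivative f (at x) = D x" if "x : S" for x
  using frechet_derivative_at[OF assms(2)[OF that]] by simp
 thus ?thesis
  using assms by (auto simp: differentiable_def intro: ck_on_cong[OF assms(1) _ assms(3)])
qed

lemma ck_on_SucD:
 "ck_on (Suc k) S f ==> x : S ==> (f has_derivative frechet_derivative f (at x)) (at x)"
 by (simp add: frechet_derivative_works[symmetric])

lemma ck_on_Suc_le: "ck_on (Suc k) S f ==> ck_on k S f"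
proof (induction k arbitrary: f)
 case 0
 thus ?case
  by (auto intro!: continuous_at_imp_continuous_on differentiable_imp_continuous_within)
qed auto

lemma smooth_on_has_derivative:
 "smooth_on S f ==> x : S ==> (f has_derivative frechet_derivative f (at x)) (at x)"
 unfolding smooth_on_def by (blast intro: ck_on_SucD)

lemma smooth_on_continuous: "smooth_on S f ==> continuous_on S f"
 unfolding smooth_on_def using ck_on.simps(1) by blast

lemma smooth_on_derivative: "smooth_on S f ==> smooth_on S (%x. frechet_derivative f (at x) v)"
 unfolding smooth_on_def by (metis ck_on.simps(2))

lemma smooth_on_cong: "open S ==> (!!x. x : S ==> f x = g x) ==> smooth_on S f ==> smooth_on S g"
 unfolding smooth_on_def using ck_on_cong by blast

lemma ck_on_locally: "(!!x. x : S ==> EX T. open T & x : T & ck_on k T f) ==> ck_on k S f"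
proof (induction k arbitrary: f)
 case 0
 thus ?case
  by (metis ck_on.simps(1) continuous_at_imp_continuous_on continuous_on_eq_continuous_at)
next
 case (Suc k)
 thus ?case by (simp, metis)
qed

lemma smooth_on_locally:
 "(!!x. x : S ==> EX T. open T & x : T & smooth_on T f) ==> smooth_on S f"
 unfolding smooth_on_def by (metis ck_on_locally)

lemma ck_on_const: "ck_on k S (%x. c)"
 by (induction k arbitrary: c) auto

lemma smooth_on_const [simp, intro]: "smooth_on S (%x. c)"
 by (simp add: smooth_on_def ck_on_const)

lemma ck_on_bounded_linear: "bounded_linear f ==> open S ==> ck_on k S f"
proof (cases k)
 case (Suc j)
 assume "bounded_linear f" "open S"
 thus ?thesis
  unfolding Suc
  by (intro ck_on_SucI[where D="%_. f"] bounded_linear_imp_has_derivative ck_on_const)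
qed (simp add: linear_continuous_on)

lemma smooth_on_bounded_linear: "bounded_linear f ==> open S ==> smooth_on S f"
 by (simp add: smooth_on_def ck_on_bounded_linear)

lemma smooth_on_id [simp, intro]: "open S ==> smooth_on S (%x. x)"
 by (simp add: smooth_on_bounded_linear bounded_linear_ident)

lemma ck_on_bounded_linear_comp:
 assumes "bounded_linear h" "open S"
 shows "ck_on k S f ==> ck_on k S (%x. h (f x))"
proof (induction k arbitrary: f)
 case 0
 thus ?case using assms(1) by (auto intro: linear_continuous_on_compose bounded_linear.continuous_on)
next
 case (Suc k)
 show ?case
  using Suc.IH Suc.prems
  by (intro ck_on_SucI[OF assms(2), where D="%x v. h (frechet_derivative f (at x) v)"]
    bounded_linear.has_derivative[OF assms(1)] ck_on_SucD[OF Suc.prems]) auto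
qed

lemma smooth_on_linear_comp:
 "bounded_linear h ==> open S ==> smooth_on S f ==> smooth_on S (%x. h (f x))"
 by (simp add: smooth_on_def ck_on_bounded_linear_comp)

lemma ck_on_add:
 assumes "open S"
 shows "ck_on k S f ==> ck_on k S g ==> ck_on k S (%x. f x + g x)"
proof (induction k arbitrary: f g)
 case (Suc k)
 show ?case
  using Suc.IH Suc.prems
  by (intro ck_on_SucI[OF assms,
     where D="%x v. frechet_derivative f (at x) v + frechet_derivative g (at x) v"]
    has_derivative_add ck_on_SucD[OF Suc.prems(1)] ck_on_SucD[OF Suc.prems(2)]) auto
qed (auto intro: continuous_on_add)

lemma smooth_on_add:
 "open S ==> smooth_on S f ==> smooth_on S g ==> smooth_on S (%x. f x + g x)"
 by (simp add: smooth_on_def ck_on_add)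

lemma ck_on_sum:
 assumes "open S" "!!i. i : I ==> ck_on k S (f i)"
 shows "ck_on k S (%x. \<Sum>i\<in>I. f i x)"
proof (cases "finite I")
 case True
 thus ?thesis
  using assms by (induction I rule: finite_induct) (auto intro: ck_on_add ck_on_const)
qed (simp add: ck_on_const)

text \<open>By the product rule the derivative is a sum of two products of the same kind, of lower order.\<close>

lemma ck_on_bilinear:
 assumes b: "bounded_bilinear b" and S: "open S"
 shows "ck_on k S f ==> ck_on k S g ==> ck_on k S (%x. b (f x) (g x))"
proof (induction k arbitrary: f g)
 case 0
 thus ?case using bounded_bilinear.continuous_on[OF b] by auto
next
 case (Suc k)
 note IH = Suc.IH and pre = Suc.prems and le = Suc.prems[THEN ck_on_Suc_le]
 have "ck_on k S (%x. frechet_derivative f (at x) v)" "ck_on k S (%x. frechet_derivative g (at x) v)" for v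
  using pre by auto
 thus ?case
  using le IH
  by (intro ck_on_SucI[OF S, where D="%x v. b (f x) (frechet_derivative g (at x) v)
     + b (frechet_derivative f (at x) v) (g x)"]
    bounded_bilinear.FDERIV[OF b] ck_on_SucD[OF pre(1)] ck_on_SucD[OF pre(2)] ck_on_add[OF S]) auto
qed

lemma smooth_on_bilinear:
 "bounded_bilinear b ==> open S ==> smooth_on S f ==> smooth_on S g ==> smooth_on S (%x. b (f x) (g x))"
 by (simp add: smooth_on_def ck_on_bilinear)

lemmas smooth_on_mult = smooth_on_bilinear[OF bounded_bilinear_mult]
 and smooth_on_scaleR = smooth_on_bilinear[OF bounded_bilinear_scaleR]
 and smooth_on_inner = smooth_on_bilinear[OF bounded_bilinear_inner]
 and smooth_on_minus = smooth_on_linear_comp[OF bounded_linear_minus[OF bounded_linear_ident]]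

lemma smooth_on_diff:
 "open S ==> smooth_on S f ==> smooth_on S g ==> smooth_on S (%x. f x - g x)"
 using smooth_on_add[of S f "%x. - g x"] smooth_on_minus[of S g] by simp

lemma smooth_on_Pair:
 assumes "open S" "smooth_on S f" "smooth_on S g"
 shows "smooth_on S (%x. (f x, g x))"
proof -
 have "bounded_linear (%x. (x, 0))" "bounded_linear (%y. (0, y))"
  by (auto intro: bounded_linear_Pair bounded_linear_ident bounded_linear_zero)
 from smooth_on_add[OF assms(1) smooth_on_linear_comp[OF this(1) assms(1,2)]
   smooth_on_linear_comp[OF this(2) assms(1,3)]]
 show ?thesis by simp
qed

text \<open>
 The chain rule is applied to partial derivatives of the outer function, so that
 the order of differentiability can be raised one step at a time.
\<close>

lemma ck_on_compose:
 fixes f :: "'a::real_normed_vector => 'b::euclidean_space"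
 assumes S: "open S" and sub: "f ` S <= T"
 shows "ck_on k T g ==> ck_on k S f ==> ck_on k S (%x. g (f x))"
proof (induction k arbitrary: g)
 case 0
 thus ?case using sub by (auto intro: continuous_on_compose2)
next
 case (Suc k)
 let ?Dg = "%y. frechet_derivative g (at y)" and ?Df = "%x. frechet_derivative f (at x)"
 have "((%x. g (f x)) has_derivative (%v. \<Sum>i\<in>Basis. (?Df x v \<bullet> i) *\<^sub>R ?Dg (f x) i)) (at x)"
  if x: "x : S" for x
 proof -
  have D: "(g has_derivative ?Dg (f x)) (at (f x))" using ck_on_SucD[OF Suc.prems(1)] sub x by blast
  hence lin: "linear (?Dg (f x))" using has_derivative_bounded_linear bounded_linear.linear by blast
  have "?Dg (f x) w = (\<Sum>i\<in>Basis. (w \<bullet> i) *\<^sub>R ?Dg (f x) i)" for w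
  proof -
   have "?Dg (f x) w = ?Dg (f x) (\<Sum>i\<in>Basis. (w \<bullet> i) *\<^sub>R i)"
    by (simp only: euclidean_representation)
   also have "... = (\<Sum>i\<in>Basis. (w \<bullet> i) *\<^sub>R ?Dg (f x) i)"
    by (simp only: linear_sum[OF lin] linear_cmul[OF lin])
   finally show ?thesis .
  qed
  hence "(%v. \<Sum>i\<in>Basis. (?Df x v \<bullet> i) *\<^sub>R ?Dg (f x) i) = (%v. ?Dg (f x) (?Df x v))"
   by (intro ext) (rule sym)
  thus ?thesis
   using has_derivative_compose[OF ck_on_SucD[OF Suc.prems(2) x] D] by (simp only:)
 qed
 thus ?case
 proof (rule ck_on_SucI[OF S])
  show "ck_on k S (%x. \<Sum>i\<in>Basis. (?Df x v \<bullet> i) *\<^sub>R ?Dg (f x) i)" for v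
   using Suc.IH Suc.prems ck_on_Suc_le[OF Suc.prems(2)]
   by (intro ck_on_sum[OF S] ck_on_bilinear[OF bounded_bilinear_scaleR S]
     ck_on_bounded_linear_comp[OF bounded_linear_inner_left S]) auto
 qed
qed

lemma smooth_on_compose:
 fixes f :: "'a::real_normed_vector => 'b::euclidean_space"
 shows "open S ==> smooth_on T g ==> smooth_on S f ==> f ` S <= T ==> smooth_on S (%x. g (f x))"
 by (simp add: smooth_on_def ck_on_compose)

text \<open>Applied to functions for which all derivatives belong to one family with a known recursion.\<close>

lemma smooth_on_real_derivatives:
 fixes G :: "nat => real => real"
 assumes S: "open S" and G: "!!n x. x : S ==> (G n has_real_derivative G (Suc n) x) (at x)"
 shows "smooth_on S (G n)"
proof -
 have "ck_on k S (G n)" for k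
 proof (induction k arbitrary: n)
  case 0
  thus ?case using G by (simp, meson DERIV_isCont continuous_at_imp_continuous_on)
 next
  case (Suc k)
  have "(G n has_derivative (%v. v * G (Suc n) x)) (at x)" if "x : S" for x
   using G[OF that, of n] by (simp add: has_field_derivative_def mult_commute_abs)
  thus ?case
   using Suc by (intro ck_on_SucI[OF S])
    (auto intro: ck_on_bilinear[OF bounded_bilinear_mult S] ck_on_const)
 qed
 thus ?thesis by (simp add: smooth_on_def)
qed

lemma smooth_on_exp: "smooth_on UNIV (exp :: real => real)"
 using smooth_on_real_derivatives[of UNIV "%_. exp"] by (auto intro: DERIV_exp)

lemma smooth_on_powr: "smooth_on {0<..} (%x::real. x powr a)"
proof -
 define G where "G = (%n x. (\<Prod>i<n. a - real i)*x powr (a - real n))"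
 have "(G n has_real_derivative G (Suc n) x) (at x)" if "x : {0<..}" for n x
  unfolding G_def
  using that DERIV_cmult[OF has_real_derivative_powr[of x "a - real n"], of "\<Prod>i<n. a - real i"]
  by (simp add: algebra_simps)
 hence "smooth_on {0<..} (G 0)" by (intro smooth_on_real_derivatives) auto
 moreover have "G 0 = (%x. x powr a)" by (simp add: G_def fun_eq_iff)
 ultimately show ?thesis by simp
qed

section \<open>A smooth cutoff on the line\<close>

lemma poly_exp_tendsto_0: "((%y. poly p y*exp (- y)) \<longlongrightarrow> (0::real)) at_top"
proof -
 have "((%y. coeff p i*(y ^ i/exp y)) \<longlongrightarrow> 0) at_top" for i
  using tendsto_mult_left[OF tendsto_power_div_exp_0[of i], of "coeff p i"] by simp
 hence "((%y. \<Sum>i\<le>degree p. coeff p i*(y ^ i/exp y)) \<longlongrightarrow> (\<Sum>i\<le>degree p. 0)) at_top"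
  by (intro tendsto_sum)
 moreover have "(\<Sum>i\<le>degree p. coeff p i*(y ^ i/exp y)) = poly p y*exp (- y)" for y
  by (simp add: poly_altdef sum_distrib_right exp_minus divide_inverse mult.assoc)
 ultimately show ?thesis by simp
qed

text \<open>
 The derivatives of \<open>exp (- 1 / x)\<close> are products with polynomials in \<open>1 / x\<close>; the family indexed by the
 polynomial is therefore closed under differentiation.
\<close>

definition flat :: "real poly => real => real" where
 "flat p x = (if x > 0 then poly p (1/x)*exp (- (1/x)) else 0)"

lemma flat_has_derivative:
 "(flat p has_real_derivative flat ([:0, 0, 1:]*(p - pderiv p)) x) (at x)"
proof -
 consider "x > 0" | "x < 0" | "x = 0" by linarith
 thus ?thesis
 proof cases
  case 1
  have "((%x. poly p (1/x)*exp (- (1/x))) has_real_derivative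
    flat ([:0, 0, 1:]*(p - pderiv p)) x) (at x)"
   using 1 unfolding flat_def
   by (auto intro!: derivative_eq_intros poly_DERIV DERIV_chain2[of "poly p"] simp: field_simps power2_eq_square)
  thus ?thesis
   by (rule has_field_derivative_transform_within_open[where S="{0<..}"]) (use 1 in \<open>auto simp: flat_def\<close>)
 next
  case 2
  have "((%x. 0) has_real_derivative flat ([:0, 0, 1:]*(p - pderiv p)) x) (at x)"
   using 2 by (auto simp: flat_def)
  thus ?thesis
   by (rule has_field_derivative_transform_within_open[where S="{..<0}"]) (use 2 in \<open>auto simp: flat_def\<close>)
 next
  case 3
  have "((%x. flat p x/x) \<longlongrightarrow> 0) (at_right 0)"
  proof (rule Lim_transform_eventually)
   show "((%x. poly ([:0, 1:]*p) (inverse x)*exp (- inverse x)) \<longlongrightarrow> (0::real)) (at_right 0)"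
    by (rule filterlim_compose[OF poly_exp_tendsto_0 filterlim_inverse_at_top_right])
  qed (auto simp: eventually_at_filter flat_def field_simps)
  moreover have "((%x. flat p x/x) \<longlongrightarrow> 0) (at_left 0)"
   by (rule tendsto_eventually) (auto simp: eventually_at_filter flat_def)
  ultimately have "((%x. flat p x/x) \<longlongrightarrow> 0) (at 0)"
   using filterlim_split_at by blast
  thus ?thesis using 3 by (simp add: has_field_derivative_iff flat_def)
 qed
qed

lemma smooth_on_flat: "smooth_on UNIV (flat 1)"
proof -
 let ?s = "%p. [:0, 0, 1:]*(p - pderiv p)"
 have "smooth_on UNIV (flat ((?s ^^ 0) 1))"
  by (rule smooth_on_real_derivatives[of UNIV "%n. flat ((?s ^^ n) 1)"])
   (simp_all only: funpow.simps o_apply open_UNIV flat_has_derivative)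
 thus ?thesis by simp
qed

lemma flat_1: "flat 1 x > 0 \<longleftrightarrow> x > 0" "flat 1 x >= 0" "x <= 0 ==> flat 1 x = 0"
 by (auto simp: flat_def)

definition cutoff :: "real => real" where
 "cutoff x = flat 1 (2 - x)*(flat 1 (2 - x) + flat 1 (x - 1)) powr (- 1)"

lemma cutoff_denominator: "flat 1 (2 - x) + flat 1 (x - 1) > 0"
 using flat_1(1)[of "2 - x"] flat_1(1)[of "x - 1"] flat_1(2)[of "2 - x"] flat_1(2)[of "x - 1"]
 by (smt (verit))

lemma smooth_on_cutoff: "smooth_on UNIV cutoff"
proof -
 have a: "smooth_on UNIV (%x. flat 1 (2 - x))" "smooth_on UNIV (%x. flat 1 (x - 1))"
  by (auto intro!: smooth_on_compose[OF _ smooth_on_flat] smooth_on_diff)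
 have "smooth_on UNIV (%x. (flat 1 (2 - x) + flat 1 (x - 1)) powr (- 1))"
  by (rule smooth_on_compose[OF open_UNIV smooth_on_powr smooth_on_add[OF open_UNIV a]])
   (use cutoff_denominator in auto)
 thus ?thesis
  unfolding cutoff_def[abs_def] by (rule smooth_on_mult[OF open_UNIV a(1)])
qed

lemma cutoff_eq_1: "x <= 1 ==> cutoff x = 1" and cutoff_eq_0: "x >= 2 ==> cutoff x = 0"
 and cutoff_range: "0 <= cutoff x" "cutoff x <= 1"
 using flat_1(3)[of "x - 1"] flat_1(3)[of "2 - x"] cutoff_denominator[of x] flat_1(2)[of "2 - x"] flat_1(2)[of "x - 1"]
 by (auto simp: cutoff_def powr_minus field_simps)

section \<open>Symmetry of second derivatives\<close>

text \<open>
 Two applications of the mean value theorem turn the second difference into a mixed derivative.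
 Exchanging the two directions then gives the symmetry.
\<close>

lemma mixed_difference:
 fixes F :: "'a::real_normed_vector => real"
 assumes F: "smooth_on S F" and h: "0 < h"
  and sub: "!!s t. 0 <= s ==> s <= h ==> 0 <= t ==> t <= h ==> z + s *\<^sub>R u + t *\<^sub>R v : S"
 shows "EX s t. 0 <= s & s <= h & 0 <= t & t <= h \<and>
  F (z + h *\<^sub>R u + h *\<^sub>R v) - F (z + h *\<^sub>R u) - F (z + h *\<^sub>R v) + F z =
  h*h*frechet_derivative (%x. frechet_derivative F (at x) u) (at (z + s *\<^sub>R u + t *\<^sub>R v)) v"
proof -
 define F1 where "F1 = (%x. frechet_derivative F (at x) u)"
 define F2 where "F2 = (%x. frechet_derivative F1 (at x) v)"
 have F1: "smooth_on S F1" unfolding F1_def by (rule smooth_on_derivative[OF F])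
 have ds: "((%s. F (z + s *\<^sub>R u + t *\<^sub>R v)) has_real_derivative F1 (z + s *\<^sub>R u + t *\<^sub>R v)) (at s)"
  if "0 <= s" "s <= h" "0 <= t" "t <= h" for s t
 proof -
  have "((%s. z + s *\<^sub>R u + t *\<^sub>R v) has_derivative (%d. d *\<^sub>R u)) (at s)"
   by (auto intro!: derivative_eq_intros)
  note d = has_derivative_compose[OF this smooth_on_has_derivative[OF F sub[OF that]]]
  have "frechet_derivative F (at (z + s *\<^sub>R u + t *\<^sub>R v)) (d *\<^sub>R u) = d*F1 (z + s *\<^sub>R u + t *\<^sub>R v)" for d
   unfolding F1_def
   using linear_cmul[OF bounded_linear.linear[OF has_derivative_bounded_linear[OF smooth_on_has_derivative[OF F sub[OF that]]]]]
   by simp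
  thus ?thesis using d by (simp add: has_field_derivative_def mult_commute_abs)
 qed
 have dt: "((%t. F1 (z + s *\<^sub>R u + t *\<^sub>R v)) has_real_derivative F2 (z + s *\<^sub>R u + t *\<^sub>R v)) (at t)"
  if "0 <= s" "s <= h" "0 <= t" "t <= h" for s t
 proof -
  have "((%t. z + s *\<^sub>R u + t *\<^sub>R v) has_derivative (%d. d *\<^sub>R v)) (at t)"
   by (auto intro!: derivative_eq_intros)
  note d = has_derivative_compose[OF this smooth_on_has_derivative[OF F1 sub[OF that]]]
  have "frechet_derivative F1 (at (z + s *\<^sub>R u + t *\<^sub>R v)) (d *\<^sub>R v) = d*F2 (z + s *\<^sub>R u + t *\<^sub>R v)" for d
   unfolding F2_def
   using linear_cmul[OF bounded_linear.linear[OF has_derivative_bounded_linear[OF smooth_on_has_derivative[OF F1 sub[OF that]]]]]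
   by simp
  thus ?thesis using d by (simp add: has_field_derivative_def mult_commute_abs)
 qed
 let ?g = "%s. F (z + s *\<^sub>R u + h *\<^sub>R v) - F (z + s *\<^sub>R u)"
 have "((%s. ?g s) has_real_derivative (F1 (z + s *\<^sub>R u + h *\<^sub>R v) - F1 (z + s *\<^sub>R u))) (at s)"
  if "0 <= s" "s <= h" for s
  using ds[OF that, of h] ds[OF that, of 0] h by (auto intro!: DERIV_diff)
 from MVT2[OF h, of ?g, OF this] obtain s where s: "0 < s" "s < h"
  and 1: "?g h - ?g 0 = h*(F1 (z + s *\<^sub>R u + h *\<^sub>R v) - F1 (z + s *\<^sub>R u))" by auto
 from MVT2[OF h, of "%t. F1 (z + s *\<^sub>R u + t *\<^sub>R v)", OF dt] s obtain t where t: "0 < t" "t < h"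
  and 2: "F1 (z + s *\<^sub>R u + h *\<^sub>R v) - F1 (z + s *\<^sub>R u + 0 *\<^sub>R v) = h*F2 (z + s *\<^sub>R u + t *\<^sub>R v)"
  by auto
 have "?g h - ?g 0 = h*h*F2 (z + s *\<^sub>R u + t *\<^sub>R v)" using 1 2 by simp
 thus ?thesis
  unfolding F2_def F1_def using s t by (intro exI[of _ s] exI[of _ t]) (auto simp: algebra_simps)
qed

lemma second_derivative_symmetric:
 fixes F :: "'a::real_normed_vector => real"
 assumes S: "open S" and F: "smooth_on S F" and z: "z : S"
 shows "frechet_derivative (%x. frechet_derivative F (at x) u) (at z) v =
  frechet_derivative (%x. frechet_derivative F (at x) v) (at z) u" (is "?a u v z = ?a v u z")
proof -
 have cont: "continuous_on S (?a u v)" for u v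
  by (intro smooth_on_continuous smooth_on_derivative F)
 obtain eps where eps: "eps > 0" "ball z eps <= S" using S z openE by blast
 define h where "h = (%n::nat. eps/(norm u + norm v + 1)*inverse (real (Suc n)))"
 have c: "norm u + norm v + 1 > 0" by (simp add: add_nonneg_pos)
 have hp: "h n > 0" for n
  unfolding h_def using eps(1) c by (intro mult_pos_pos divide_pos_pos) auto
 have hlt: "h n*(norm u + norm v) < eps" for n
 proof -
  have "h n*(norm u + norm v) < h n*(norm u + norm v + 1)" using hp[of n] by simp
  also have "... = eps*inverse (real (Suc n))"
   unfolding h_def using c by simp
  also have "... <= eps*1" using eps(1) by (intro mult_left_mono) (auto simp: field_simps)
  finally show ?thesis by simp
 qed
 have h0: "h \<longlonglongrightarrow> 0"
  unfolding h_def using tendsto_mult_left[OF LIMSEQ_inverse_real_of_nat, of "eps/(norm u + norm v + 1)"] by simp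
 have in_S: "z + s *\<^sub>R u + t *\<^sub>R v : S" if "0 <= s" "s <= h n" "0 <= t" "t <= h n" for s t n
 proof -
  have "norm (s *\<^sub>R u + t *\<^sub>R v) <= s*norm u + t*norm v"
   using norm_triangle_ineq[of "s *\<^sub>R u" "t *\<^sub>R v"] that by simp
  also have "... <= h n*(norm u + norm v)"
   using that by (simp add: distrib_left add_mono mult_right_mono)
  finally have "z + s *\<^sub>R u + t *\<^sub>R v : ball z eps"
   using hlt[of n] by (simp add: dist_norm algebra_simps norm_minus_commute)
  thus ?thesis using eps by blast
 qed
 have conv: "(%n. z + s n *\<^sub>R u + t n *\<^sub>R v) \<longlonglongrightarrow> z"
  if "!!n. 0 <= s n & s n <= h n & 0 <= t n & t n <= h n" for s t u v
 proof -
  have "s \<longlonglongrightarrow> 0" "t \<longlonglongrightarrow> 0"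
   using that by (auto intro!: tendsto_sandwich[OF _ _ tendsto_const h0])
  hence "(%n. z + s n *\<^sub>R u + t n *\<^sub>R v) \<longlonglongrightarrow> z + 0 *\<^sub>R u + 0 *\<^sub>R v"
   by (intro tendsto_intros)
  thus ?thesis by simp
 qed
 have "EX s t. 0 <= s & s <= h n & 0 <= t & t <= h n \<and>
  F (z + h n *\<^sub>R u + h n *\<^sub>R v) - F (z + h n *\<^sub>R u) - F (z + h n *\<^sub>R v) + F z =
  h n*h n*?a u v (z + s *\<^sub>R u + t *\<^sub>R v)" for n
  by (rule mixed_difference[OF F hp in_S])
 then obtain s t where st: "!!n. 0 <= s n & s n <= h n & 0 <= t n & t n <= h n"
  and 1: "!!n. F (z + h n *\<^sub>R u + h n *\<^sub>R v) - F (z + h n *\<^sub>R u) - F (z + h n *\<^sub>R v) + F z =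
  h n*h n*?a u v (z + s n *\<^sub>R u + t n *\<^sub>R v)" by metis
 have in_S': "z + s *\<^sub>R v + t *\<^sub>R u : S" if "0 <= s" "s <= h n" "0 <= t" "t <= h n" for s t n
  using in_S[OF that(3,4,1,2)] by (simp only: add.assoc add.commute[of "s *\<^sub>R v"])
 have "EX s t. 0 <= s & s <= h n & 0 <= t & t <= h n \<and>
  F (z + h n *\<^sub>R v + h n *\<^sub>R u) - F (z + h n *\<^sub>R v) - F (z + h n *\<^sub>R u) + F z =
  h n*h n*?a v u (z + s *\<^sub>R v + t *\<^sub>R u)" for n
  by (rule mixed_difference[OF F hp in_S'])
 then obtain s' t' where st': "!!n. 0 <= s' n & s' n <= h n & 0 <= t' n & t' n <= h n"
  and 2: "!!n. F (z + h n *\<^sub>R v + h n *\<^sub>R u) - F (z + h n *\<^sub>R v) - F (z + h n *\<^sub>R u) + F z =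
  h n*h n*?a v u (z + s' n *\<^sub>R v + t' n *\<^sub>R u)" by metis
 have eq: "?a u v (z + s n *\<^sub>R u + t n *\<^sub>R v) = ?a v u (z + s' n *\<^sub>R v + t' n *\<^sub>R u)" for n
 proof -
  have "F (z + h n *\<^sub>R v + h n *\<^sub>R u) = F (z + h n *\<^sub>R u + h n *\<^sub>R v)"
   by (simp only: add.assoc add.commute[of "h n *\<^sub>R v"])
  hence "h n*h n*?a u v (z + s n *\<^sub>R u + t n *\<^sub>R v) = h n*h n*?a v u (z + s' n *\<^sub>R v + t' n *\<^sub>R u)"
   using 1[of n] 2[of n] by linarith
  thus ?thesis using hp[of n] by simp
 qed
 have lim: "(%n. ?a u v (x n)) \<longlonglongrightarrow> ?a u v z" if "x \<longlonglongrightarrow> z" for u v x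
 proof -
  have "isCont (?a u v) z" using cont[of u v] S z by (simp add: continuous_on_eq_continuous_at)
  thus ?thesis by (rule isCont_tendsto_compose[OF _ that])
 qed
 show ?thesis
  using LIMSEQ_unique[OF lim[where u=u and v=v, OF conv[where u=u and v=v, OF st]]]
   lim[where u=v and v=u, OF conv[where u=v and v=u, OF st']] eq by simp
qed

section \<open>Smooth maps into a Lie group\<close>

locale lie_grp =
 fixes A :: "('g::{topological_group_add, t2_space, second_countable_topology}, 'e::euclidean_space) chart set"
 assumes lie: "lie_group A"
begin

lemma chartD:
 assumes "(V, eta) : A"
 shows "open V" "open (eta ` V)" "continuous_on V eta" "continuous_on (eta ` V) (inv_into V eta)"
  "!!x. x : V ==> inv_into V eta (eta x) = x" "!!a. a : eta ` V ==> eta (inv_into V eta a) = a"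
  "!!a. a : eta ` V ==> inv_into V eta a : V"
proof -
 have "is_chart (V, eta)" using lie assms unfolding lie_group_def smooth_atlas_def by blast
 hence "open V" "open (eta ` V)" and h: "homeomorphism V (eta ` V) eta (inv_into V eta)"
  by (auto simp: is_chart_def)
 thus "open V" "open (eta ` V)" "continuous_on V eta" "continuous_on (eta ` V) (inv_into V eta)"
  "!!x. x : V ==> inv_into V eta (eta x) = x" "!!a. a : eta ` V ==> eta (inv_into V eta a) = a"
  "!!a. a : eta ` V ==> inv_into V eta a : V"
  by (auto simp: homeomorphism_def inv_into_into)
qed

lemma chart_at: obtains V eta where "(V, eta) : A" "x : V"
proof -
 have "x : (\<Union>c\<in>A. fst c)" using lie unfolding lie_group_def smooth_atlas_def by blast
 thus ?thesis using that by force
qed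

lemma chart_preimage:
 assumes "(V, eta) : A"
 shows "eta ` (V Int W) = {a : eta ` V. inv_into V eta a : W}"
 using chartD[OF assms] by (auto simp: image_iff)

lemma preimage_open:
 assumes "open S" "continuous_on S F" "open W"
 shows "open {s : S. F s : W}"
proof -
 have "{s : S. F s : W} = S Int F -` W" by blast
 thus ?thesis using continuous_open_preimage[OF assms(2,1,3)] by (simp only:)
qed

lemma chart_image_open:
 assumes c: "(V, eta) : A" and W: "open W"
 shows "open (eta ` (V Int W))"
 using preimage_open[OF chartD(2,4)[OF c] W] unfolding chart_preimage[OF c] .

lemma msmoothD: "msmooth_on A W f ==> (V, eta) : A ==> smooth_on (eta ` (V Int W)) (%a. f (inv_into V eta a))"
 unfolding msmooth_on_def o_def by blast

lemma msmoothI: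
 "(!!V eta. (V, eta) : A ==> smooth_on (eta ` (V Int W)) (%a. f (inv_into V eta a))) ==> msmooth_on A W f"
 unfolding msmooth_on_def o_def by blast

lemma transition_smooth:
 "(U, phi) : A ==> (V, eta) : A ==> smooth_on (phi ` (U Int V)) (%a. eta (inv_into U phi a))"
 using lie unfolding lie_group_def smooth_atlas_def o_def by blast

lemma smooth_group_add:
 assumes "(U, phi) : A" "(V, psi) : A" "(W, eta) : A"
 shows "smooth_on {(phi x, psi y) | x y. x : U & y : V & x + y : W}
     (%(a, b). eta (inv_into U phi a + inv_into V psi b))"
proof -
 note * = conjunct1[OF conjunct2[OF lie[unfolded lie_group_def]]]
 show ?thesis
  using bspec[OF bspec[OF bspec[OF * assms(1), unfolded prod.case] assms(2), unfolded prod.case] assms(3),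
    unfolded prod.case] .
qed

lemma smooth_group_uminus:
 assumes "(U, phi) : A" "(V, psi) : A"
 shows "smooth_on {phi x | x. x : U & - x : V} (%a. psi (- inv_into U phi a))"
proof -
 note * = conjunct2[OF conjunct2[OF lie[unfolded lie_group_def]]]
 show ?thesis using bspec[OF bspec[OF * assms(1), unfolded prod.case] assms(2), unfolded prod.case] .
qed

text \<open>
 Every smoothness statement about the group is reduced to compositions of maps from open
 subsets of Euclidean spaces into the group.
\<close>

definition gsmooth :: "'b::euclidean_space set => ('b => 'g) => bool" where
 "gsmooth S F \<longleftrightarrow> open S & continuous_on S F \<and>
   (\<forall>(V, eta)\<in>A. smooth_on {s : S. F s : V} (%s. eta (F s)))"

lemma gsmoothD:
 assumes "gsmooth S F"
 shows "open S" "continuous_on S F" "(V, eta) : A ==> smooth_on {s : S. F s : V} (%s. eta (F s))"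
 using assms unfolding gsmooth_def by blast+

lemma gsmooth_const: "open S ==> gsmooth S (%_. x)"
 by (auto simp: gsmooth_def)

lemma gsmooth_chart: "(V, eta) : A ==> gsmooth (eta ` V) (inv_into V eta)"
 using transition_smooth chartD(2,4) unfolding gsmooth_def chart_preimage[symmetric]
 by (auto simp: chart_preimage[symmetric])

lemma gsmooth_compose:
 fixes f :: "'b::euclidean_space => 'c::euclidean_space"
 assumes F: "gsmooth T F" and S: "open S" and f: "smooth_on S f" and sub: "f ` S <= T"
 shows "gsmooth S (%s. F (f s))"
 unfolding gsmooth_def
proof (intro conjI S, goal_cases)
 case 1
 show ?case using F smooth_on_continuous[OF f] sub by (auto simp: gsmooth_def intro: continuous_on_compose2)
 hence o: "open {s : S. F (f s) : V}" if "open V" for V using preimage_open[OF S _ that] by blast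
 case 2
 show ?case
 proof safe
  fix V eta assume c: "(V, eta) : A"
  have "smooth_on {t : T. F t : V} (%t. eta (F t))" using F c by (auto simp: gsmooth_def)
  thus "smooth_on {s : S. F (f s) : V} (%s. eta (F (f s)))"
   by (rule smooth_on_compose[OF o[OF chartD(1)[OF c]]]) (use sub in \<open>auto intro: smooth_on_subset[OF f]\<close>)
 qed
qed

lemma gsmooth_fst:
 assumes "gsmooth S F" "open T"
 shows "gsmooth (S \<times> T) (%s. F (fst s))"
 using gsmoothD(1)[OF assms(1)] assms(2)
 by (intro gsmooth_compose[OF assms(1)] open_Times smooth_on_bounded_linear bounded_linear_fst) auto

lemma gsmooth_snd:
 assumes "gsmooth T F" "open S"
 shows "gsmooth (S \<times> T) (%s. F (snd s))"
 using gsmoothD(1)[OF assms(1)] assms(2)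
 by (intro gsmooth_compose[OF assms(1)] open_Times smooth_on_bounded_linear bounded_linear_snd) auto

lemma gsmooth_add:
 fixes F H :: "'b::euclidean_space => 'g"
 assumes F: "gsmooth S F" and H: "gsmooth S H"
 shows "gsmooth S (%s. F s + H s)"
proof -
 have S: "open S" and cF: "continuous_on S F" and cH: "continuous_on S H"
  using F H by (auto simp: gsmooth_def)
 have c: "continuous_on S (%s. F s + H s)" by (intro continuous_on_add cF cH)
 have "smooth_on {s : S. F s + H s : W} (%s. \<zeta> (F s + H s))" if w: "(W, \<zeta>) : A" for W \<zeta>
 proof (rule smooth_on_locally)
  fix s assume s: "s : {s : S. F s + H s : W}"
  obtain U phi where u: "(U, phi) : A" "F s : U" by (rule chart_at)
  obtain V psi where v: "(V, psi) : A" "H s : V" by (rule chart_at)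
  let ?T = "{s : S. F s : U} Int {s : S. H s : V} Int {s : S. F s + H s : W}"
  let ?m = "%(a, b). \<zeta> (inv_into U phi a + inv_into V psi b)"
  let ?D = "{(phi x, psi y) | x y. x : U & y : V & x + y : W}"
  have T: "open ?T"
   using preimage_open[OF S cF chartD(1)[OF u(1)]] preimage_open[OF S cH chartD(1)[OF v(1)]]
    preimage_open[OF S c chartD(1)[OF w]] by (intro open_Int)
  have "smooth_on ?D ?m"
   by (rule smooth_group_add[OF u(1) v(1) w])
  moreover have "smooth_on ?T (%s. (phi (F s), psi (H s)))"
   by (intro smooth_on_Pair T smooth_on_subset[OF gsmoothD(3)[OF F u(1)]]
     smooth_on_subset[OF gsmoothD(3)[OF H v(1)]]) auto
  ultimately have "smooth_on ?T (%s. ?m (phi (F s), psi (H s)))"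
   by (rule smooth_on_compose[OF T]) auto
  hence "smooth_on ?T (%s. \<zeta> (F s + H s))"
   by (rule smooth_on_cong[OF T, rotated]) (auto simp: chartD(5)[OF u(1)] chartD(5)[OF v(1)])
  thus "EX T. open T & s : T & smooth_on T (%s. \<zeta> (F s + H s))"
   using T s u v by (intro exI[of _ ?T]) auto
 qed
 thus ?thesis using S c by (auto simp: gsmooth_def)
qed

lemma gsmooth_uminus:
 fixes F :: "'b::euclidean_space => 'g"
 assumes F: "gsmooth S F"
 shows "gsmooth S (%s. - F s)"
proof -
 have S: "open S" and cF: "continuous_on S F" using F by (auto simp: gsmooth_def)
 have c: "continuous_on S (%s. - F s)" by (intro continuous_on_minus cF)
 have "smooth_on {s : S. - F s : W} (%s. \<zeta> (- F s))" if w: "(W, \<zeta>) : A" for W \<zeta>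
 proof (rule smooth_on_locally)
  fix s assume s: "s : {s : S. - F s : W}"
  obtain U phi where u: "(U, phi) : A" "F s : U" by (rule chart_at)
  let ?T = "{s : S. F s : U} Int {s : S. - F s : W}"
  have T: "open ?T"
   using preimage_open[OF S cF chartD(1)[OF u(1)]] preimage_open[OF S c chartD(1)[OF w]] by (intro open_Int)
  have "smooth_on {phi x | x. x : U & - x : W} (%a. \<zeta> (- inv_into U phi a))"
   by (rule smooth_group_uminus[OF u(1) w])
  moreover have "smooth_on ?T (%s. phi (F s))"
   by (intro smooth_on_subset[OF gsmoothD(3)[OF F u(1)]]) auto
  ultimately have "smooth_on ?T (%s. \<zeta> (- inv_into U phi (phi (F s))))"
   by (rule smooth_on_compose[OF T]) auto
  hence "smooth_on ?T (%s. \<zeta> (- F s))"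
   by (rule smooth_on_cong[OF T, rotated]) (auto simp: chartD(5)[OF u(1)])
  thus "EX T. open T & s : T & smooth_on T (%s. \<zeta> (- F s))"
   using T s u by (intro exI[of _ ?T]) auto
 qed
 thus ?thesis using S c by (auto simp: gsmooth_def)
qed

lemma msmooth_compose:
 fixes F :: "'b::euclidean_space => 'g"
 assumes f: "msmooth_on A W f" and W: "open W" and F: "gsmooth S F" and sub: "F ` S <= W"
 shows "smooth_on S (%s. f (F s))"
proof (rule smooth_on_locally)
 have S: "open S" and cF: "continuous_on S F" using F by (auto simp: gsmooth_def)
 fix s assume s: "s : S"
 obtain U phi where u: "(U, phi) : A" "F s : U" by (rule chart_at)
 let ?T = "{s : S. F s : U}"
 have T: "open ?T" by (rule preimage_open[OF S cF chartD(1)[OF u(1)]])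
 have "smooth_on (phi ` (U Int W)) (f \<circ> inv_into U phi)" using f u(1) by (auto simp: msmooth_on_def)
 moreover have "smooth_on ?T (%s. phi (F s))" using F u(1) by (auto simp: gsmooth_def)
 ultimately have "smooth_on ?T (%s. (f \<circ> inv_into U phi) (phi (F s)))"
  by (rule smooth_on_compose[OF T]) (use sub in auto)
 hence "smooth_on ?T (%s. f (F s))"
  by (rule smooth_on_cong[OF T, rotated]) (auto simp: chartD(5)[OF u(1)])
 thus "EX T. open T & s : T & smooth_on T (%s. f (F s))"
  using T s u by (intro exI[of _ ?T]) auto
qed

section \<open>Smooth functions on a Lie group\<close>

lemma msmooth_subset: "msmooth_on A W f ==> W' <= W ==> msmooth_on A W' f"
 by (auto simp: msmooth_on_def elim!: ballE intro: smooth_on_subset)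

lemma msmooth_cong:
 assumes "open W" "msmooth_on A W f" "!!x. x : W ==> f x = g x"
 shows "msmooth_on A W g"
 unfolding msmooth_on_def
proof safe
 fix V eta assume c: "(V, eta) : A"
 hence "smooth_on (eta ` (V Int W)) (f \<circ> inv_into V eta)" using assms by (auto simp: msmooth_on_def)
 thus "smooth_on (eta ` (V Int W)) (g \<circ> inv_into V eta)"
  by (rule smooth_on_cong[OF chart_image_open[OF c assms(1)], rotated])
   (auto simp: assms(3) chartD(5)[OF c])
qed

lemma msmooth_locally:
 assumes "!!x. x : W ==> EX P. open P & x : P & msmooth_on A P f"
 shows "msmooth_on A W f"
 unfolding msmooth_on_def
proof safe
 fix V eta assume c: "(V, eta) : A"
 show "smooth_on (eta ` (V Int W)) (f \<circ> inv_into V eta)"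
 proof (rule smooth_on_locally)
  fix a assume "a : eta ` (V Int W)"
  then obtain x where x: "x : V" "x : W" "a = eta x" by auto
  with assms obtain P where P: "open P" "x : P" "msmooth_on A P f" by blast
  thus "EX T. open T & a : T & smooth_on T (f \<circ> inv_into V eta)"
   using x c chart_image_open[OF c P(1)] by (intro exI[of _ "eta ` (V Int P)"]) (auto simp: msmooth_on_def)
 qed
qed

lemma msmooth_const [simp]: "msmooth_on A W (%_. c)"
 by (rule msmoothI) simp

lemma msmooth_linear_comp: "bounded_linear h ==> open W ==> msmooth_on A W f ==> msmooth_on A W (%x. h (f x))"
 by (rule msmoothI, rule smooth_on_linear_comp) (simp_all add: chart_image_open msmoothD)

lemma msmooth_add: "open W ==> msmooth_on A W f ==> msmooth_on A W g ==> msmooth_on A W (%x. f x + g x)"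
 by (rule msmoothI, rule smooth_on_add) (simp_all add: chart_image_open msmoothD)

lemma msmooth_bilinear:
 "bounded_bilinear b ==> open W ==> msmooth_on A W f ==> msmooth_on A W g ==> msmooth_on A W (%x. b (f x) (g x))"
 by (rule msmoothI, rule smooth_on_bilinear[of b]) (simp_all add: chart_image_open msmoothD)

lemmas msmooth_mult = msmooth_bilinear[OF bounded_bilinear_mult]
 and msmooth_scaleR = msmooth_bilinear[OF bounded_bilinear_scaleR]
 and msmooth_minus = msmooth_linear_comp[OF bounded_linear_minus[OF bounded_linear_ident]]
 and msmooth_of_real = msmooth_linear_comp[OF bounded_linear_of_real]
 and msmooth_cnj = msmooth_linear_comp[OF bounded_linear_cnj]

lemma msmooth_real_comp:
 fixes h :: "real => 'b::real_normed_vector"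
 assumes "open W" "msmooth_on A W f" "smooth_on T h" "f ` W <= T"
 shows "msmooth_on A W (%x. h (f x))"
 unfolding msmooth_on_def
proof safe
 fix V eta assume c: "(V, eta) : A"
 show "smooth_on (eta ` (V Int W)) ((%x. h (f x)) \<circ> inv_into V eta)"
  unfolding o_def
  by (rule smooth_on_compose[OF chart_image_open[OF c assms(1)] assms(3)])
   (use assms(2,4) c in \<open>auto simp: msmooth_on_def o_def chartD(5)[OF c]\<close>)
qed

lemma msmooth_continuous:
 assumes "open W" "msmooth_on A W f"
 shows "continuous_on W f"
proof (rule continuous_at_imp_continuous_on, rule ballI)
 fix x assume x: "x : W"
 obtain V eta where c: "(V, eta) : A" "x : V" by (rule chart_at)
 have o: "open (V Int W)" using chartD(1)[OF c(1)] assms(1) by auto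
 have "continuous_on (eta ` (V Int W)) (f \<circ> inv_into V eta)"
  unfolding o_def by (rule smooth_on_continuous[OF msmoothD[OF assms(2) c(1)]])
 moreover have "continuous_on (V Int W) eta" using chartD(3)[OF c(1)] by (rule continuous_on_subset) auto
 ultimately have "continuous_on (V Int W) (%y. (f \<circ> inv_into V eta) (eta y))"
  by (rule continuous_on_compose2) auto
 hence "continuous_on (V Int W) f"
  by (rule continuous_on_eq) (auto simp: chartD(5)[OF c(1)])
 thus "isCont f x" using x c o by (simp add: continuous_on_eq_continuous_at)
qed

lemma msmooth_Un:
 assumes "open W" "open W'" "msmooth_on A W f" "msmooth_on A W' f"
 shows "msmooth_on A (W \<union> W') f"
 using assms by (intro msmooth_locally) auto

lemma msmooth_zero_outside:
 assumes "open W" "msmooth_on A W f" "closed C" "C <= W" "!!x. x ~: C ==> f x = 0"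
 shows "msmooth_on A UNIV f"
proof -
 have "msmooth_on A (- C) f"
  by (rule msmooth_cong[of "- C" "%_. 0"]) (use assms in auto)
 hence "msmooth_on A (W \<union> - C) f" using assms by (intro msmooth_Un) auto
 moreover have "W \<union> - C = UNIV" using assms by auto
 ultimately show ?thesis by simp
qed

lemma msmooth_translate:
 assumes "open W" "msmooth_on A W f"
 shows "msmooth_on A {x. y + x + z : W} (%x. f (y + x + z))"
 unfolding msmooth_on_def
proof safe
 fix V eta assume c: "(V, eta) : A"
 have "continuous_on UNIV (%x. y + x + z)" by (intro continuous_intros)
 hence o: "open {x. y + x + z : W}" using preimage_open[of UNIV "%x. y + x + z" W] assms(1) by simp
 let ?S = "eta ` (V Int {x. y + x + z : W})"
 have S: "open ?S" by (rule chart_image_open[OF c o])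
 have "gsmooth ?S (%a. inv_into V eta a)"
  by (rule gsmooth_compose[OF gsmooth_chart[OF c] S smooth_on_id[OF S]]) auto
 hence "gsmooth ?S (%a. y + inv_into V eta a + z)"
  by (intro gsmooth_add gsmooth_const S)
 from msmooth_compose[OF assms(2,1) this]
 show "smooth_on ?S ((%x. f (y + x + z)) \<circ> inv_into V eta)"
  unfolding o_def by (rule meta_mp) (auto simp: chartD(5)[OF c])
qed

text \<open>
 The cutoff of the squared distance in a chart, continued by zero; the support is compact in the
 Hausdorff space of the group, hence closed.
\<close>

lemma bump:
 assumes "open W" "x : W"
 obtains f :: "'g => real" and K P where "msmooth_on A UNIV f" "!!y. 0 <= f y" "!!y. f y <= 1"
  "open P" "x : P" "!!y. y : P ==> f y = 1" "compact K" "K <= W" "!!y. y ~: K ==> f y = 0"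
proof -
 obtain V eta where c: "(V, eta) : A" "x : V" by (rule chart_at)
 note d = chartD[OF c(1)]
 have "open (eta ` (V Int W))" by (rule chart_image_open[OF c(1) assms(1)])
 then obtain r where r: "r > 0" "cball (eta x) r <= eta ` (V Int W)"
  using c(2) assms(2) by (metis IntI image_eqI open_contains_cball)
 define K where "K = inv_into V eta ` cball (eta x) r"
 have K: "compact K"
  unfolding K_def using r by (intro compact_continuous_image continuous_on_subset[OF d(4)]) auto
 have KW: "K <= V Int W" using r d(5) unfolding K_def by force
 define q where "q = (%y. 2*(1/r)^2*((eta y - eta x) \<bullet> (eta y - eta x)))"
 define f where "f = (%y. if y : K then cutoff (q y) else 0)"
 have "cutoff (q y) = 0" if "y : V" "y ~: K" for y
 proof (rule cutoff_eq_0)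
  have "eta y ~: cball (eta x) r" using that d(5) by (metis K_def imageI)
  hence "r\<^sup>2 <= (eta y - eta x) \<bullet> (eta y - eta x)"
   using r(1) power_mono[of r "dist (eta x) (eta y)" 2] by (simp add: dist_norm power2_norm_eq_inner[symmetric] norm_minus_commute)
  thus "2 <= q y" using r(1) by (simp add: q_def field_simps)
 qed
 hence fV: "f y = cutoff (q y)" if "y : V" for y using that by (auto simp: f_def)
 have "msmooth_on A V f"
 proof -
  have chart: "msmooth_on A V eta"
   unfolding msmooth_on_def
  proof safe
   fix U phi assume u: "(U, phi) : A"
   show "smooth_on (phi ` (U Int V)) (eta \<circ> inv_into U phi)"
    unfolding o_def by (rule transition_smooth[OF u c(1)])
  qed
  have dl: "msmooth_on A V (%y. eta y - eta x)"
   using msmooth_add[OF d(1) chart msmooth_const[of V "- eta x"]] by simp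
  have "msmooth_on A V q"
   unfolding q_def by (intro msmooth_mult msmooth_bilinear[OF bounded_bilinear_inner] d(1) dl msmooth_const)
  from msmooth_real_comp[OF d(1) this smooth_on_cutoff] have "msmooth_on A V (%y. cutoff (q y))" by simp
  thus ?thesis by (rule msmooth_cong[OF d(1)]) (simp add: fV)
 qed
 hence sm: "msmooth_on A UNIV f"
  by (rule msmooth_zero_outside[OF d(1) _ compact_imp_closed[OF K]]) (use KW in \<open>auto simp: f_def\<close>)
 define P where "P = {y : V. eta y : ball (eta x) (r/2)}"
 have "open P" unfolding P_def by (rule preimage_open[OF d(1,3) open_ball])
 moreover have "x : P" using c r by (auto simp: P_def)
 moreover have "f y = 1" if "y : P" for y
 proof -
  have "(eta y - eta x) \<bullet> (eta y - eta x) <= (r/2)^2"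
   using that power_mono[of "dist (eta x) (eta y)" "r/2" 2]
   by (auto simp: P_def dist_norm power2_norm_eq_inner[symmetric] norm_minus_commute)
  moreover have "(r/2)^2 = r\<^sup>2/4" by (simp add: power_divide)
  moreover have "(eta y - eta x) \<bullet> (eta y - eta x) >= 0" by (rule inner_ge_zero)
  ultimately have "2*((eta y - eta x) \<bullet> (eta y - eta x)) <= r\<^sup>2" by linarith
  hence "q y <= 1" using r(1) by (simp add: q_def field_simps)
  thus ?thesis using that fV cutoff_eq_1 by (auto simp: P_def)
 qed
 ultimately show ?thesis
  using sm K KW cutoff_range by (intro that[of f P K]) (auto simp: f_def)
qed

lemma smooth_functions_separate:
 assumes "!!f :: 'g => real. msmooth_on A UNIV f ==> f x = f y"
 shows "x = y"
proof (rule ccontr)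
 assume "x ~= y"
 hence "open (- {y})" "x : - {y}" by auto
 then obtain f :: "'g => real" and K P where f: "msmooth_on A UNIV f" "x : P" "!!z. z : P ==> f z = 1"
  "K <= - {y}" "!!z. z ~: K ==> f z = 0" by (rule bump) blast
 have "f x = 1" "f y = 0" using f by auto
 thus False using assms[OF f(1)] by simp
qed

section \<open>Left-invariant vector fields\<close>

definition chU :: "'g set" where "chU = fst (id_chart A)"
definition phi :: "'g => 'e" where "phi = snd (id_chart A)"
definition psi :: "'e => 'g" where "psi = inv_into chU phi"
definition p0 :: 'e where "p0 = phi 0"

lemma id_chart_in: "(chU, phi) : A" "0 : chU"
proof -
 obtain V eta where "(V, eta) : A" "0 : V" by (rule chart_at)
 hence "EX c. c : A & 0 : fst c" by (intro exI[of _ "(V, eta)"]) simp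
 hence "id_chart A : A & 0 : fst (id_chart A)" unfolding id_chart_def by (rule someI_ex)
 thus "(chU, phi) : A" "0 : chU" by (auto simp: chU_def phi_def)
qed

lemmas idc = chartD[OF id_chart_in(1), folded psi_def]
lemmas gsmooth_psi = gsmooth_chart[OF id_chart_in(1), folded psi_def]

lemma p0 [simp]: "p0 : phi ` chU" "psi p0 = 0" "phi 0 = p0"
 using id_chart_in idc(5) by (auto simp: p0_def)

abbreviation X :: "'e => ('g => 'b::real_normed_vector) => 'g => 'b" where
 "X == left_inv_field A"

lemma X_def: "X v f x = frechet_derivative (%a. f (x + psi a)) (at p0) v"
 by (simp add: left_inv_field_def chU_def phi_def psi_def p0_def split: prod.split)

lemma gsmooth_right: "gsmooth (phi ` chU) (%a. x + psi a)"
 by (intro gsmooth_add gsmooth_const gsmooth_psi idc)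

lemma X_has_derivative:
 assumes "open W" "msmooth_on A W f" "x : W"
 shows "((%a. f (x + psi a)) has_derivative (%v. X v f x)) (at p0)"
proof -
 let ?S = "{a : phi ` chU. x + psi a : W}"
 have S: "open ?S" using gsmooth_right[of x] preimage_open assms(1) by (auto simp: gsmooth_def)
 have "gsmooth ?S (%a. x + psi a)"
  by (rule gsmooth_compose[OF gsmooth_right S smooth_on_id[OF S]]) auto
 from msmooth_compose[OF assms(2,1) this] have "smooth_on ?S (%a. f (x + psi a))" by auto
 from smooth_on_has_derivative[OF this] assms(3) show ?thesis by (simp add: X_def)
qed

lemma X_eqI: "((%a. f (x + psi a)) has_derivative D) (at p0) ==> X v f x = D v"
 unfolding X_def using frechet_derivative_at by metis

lemma linear_X:
 assumes "open W" "msmooth_on A W f" "x : W"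
 shows "linear (%v. X v f x)"
 using X_has_derivative[OF assms] has_derivative_bounded_linear bounded_linear.linear by blast

lemma X_cong:
 assumes "open W" "x : W" "!!y. y : W ==> f y = g y"
 shows "X v f x = X v g x"
proof -
 let ?S = "{a : phi ` chU. x + psi a : W}"
 have S: "open ?S" using gsmooth_right[of x] preimage_open assms(1) by (auto simp: gsmooth_def)
 have "p0 : ?S" using assms by simp
 hence "((%a. f (x + psi a)) has_derivative D) (at p0) \<longleftrightarrow> ((%a. g (x + psi a)) has_derivative D) (at p0)" for D
  using has_derivative_transform_within_open[OF _ S \<open>p0 : ?S\<close>, of "%a. f (x + psi a)" D UNIV "%a. g (x + psi a)"]
   has_derivative_transform_within_open[OF _ S \<open>p0 : ?S\<close>, of "%a. g (x + psi a)" D UNIV "%a. f (x + psi a)"]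
   assms(3) by auto
 thus ?thesis unfolding X_def frechet_derivative_def by simp
qed

lemma X_const [simp]: "X v (%_. c) x = 0"
 using X_eqI[of "%_. c" x "%_. 0" v] by simp

lemma X_add:
 assumes "open W" "msmooth_on A W f" "msmooth_on A W g" "x : W"
 shows "X v (%x. f x + g x) x = X v f x + X v g x"
 by (rule X_eqI[OF has_derivative_add[OF X_has_derivative[OF assms(1,2,4)] X_has_derivative[OF assms(1,3,4)]]])

lemma X_linear_comp:
 assumes "bounded_linear h" "open W" "msmooth_on A W f" "x : W"
 shows "X v (%x. h (f x)) x = h (X v f x)"
 by (rule X_eqI[OF bounded_linear.has_derivative[OF assms(1) X_has_derivative[OF assms(2-4)]]])

lemmas X_minus = X_linear_comp[OF bounded_linear_minus[OF bounded_linear_ident]]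
 and X_of_real = X_linear_comp[OF bounded_linear_of_real]
 and X_cnj = X_linear_comp[OF bounded_linear_cnj]

lemma X_bilinear:
 assumes "bounded_bilinear b" "open W" "msmooth_on A W f" "msmooth_on A W g" "x : W"
 shows "X v (%x. b (f x) (g x)) x = b (f x) (X v g x) + b (X v f x) (g x)"
 using X_eqI[OF bounded_bilinear.FDERIV[OF assms(1) X_has_derivative[OF assms(2,3,5)] X_has_derivative[OF assms(2,4,5)]]]
 by simp

lemmas X_mult = X_bilinear[OF bounded_bilinear_mult]

lemma X_real_comp:
 fixes h :: "real => real"
 assumes "open W" "msmooth_on A W f" "x : W" "(h has_real_derivative h') (at (f x))"
 shows "X v (%x. h (f x)) x = h'*X v f x"
proof (rule X_eqI[of "%x. h (f x)" x "%v. h'*X v f x"])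
 have "(h has_derivative (%t. h'*t)) (at (f (x + psi p0)))" using assms(4) by (simp add: has_field_derivative_def)
 from has_derivative_compose[OF X_has_derivative[OF assms(1-3)] this]
 show "((%a. h (f (x + psi a))) has_derivative (%v. h'*X v f x)) (at p0)" .
qed

lemma X_translate: "X v (%x. f (y + x)) x = X v f (y + x)"
 by (simp add: X_def add.assoc)

lemma msmooth_X:
 assumes W: "open W" and f: "msmooth_on A W f"
 shows "msmooth_on A W (X v f)"
 unfolding msmooth_on_def
proof safe
 fix V eta assume c: "(V, eta) : A"
 let ?\<theta> = "inv_into V eta"
 let ?S = "eta ` (V Int W)"
 let ?M = "%s. ?\<theta> (fst s) + psi (snd s)"
 let ?T = "{s : eta ` V \<times> phi ` chU. ?M s : W}"
 let ?K = "%s. f (?M s)"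
 have M: "gsmooth (eta ` V \<times> phi ` chU) ?M"
  by (intro gsmooth_add gsmooth_fst gsmooth_snd gsmooth_chart c gsmooth_psi idc chartD[OF c])
 hence T: "open ?T" using preimage_open W by (auto simp: gsmooth_def)
 have "gsmooth ?T ?M" by (rule gsmooth_compose[OF M T smooth_on_id[OF T]]) auto
 from msmooth_compose[OF f W this] have K: "smooth_on ?T ?K" by auto
 have S: "open ?S" by (rule chart_image_open[OF c W])
 have in_T: "(a, p0) : ?T" if "a : ?S" for a
  using that by (auto simp: chartD(5)[OF c])
 have "smooth_on ?S (%a. frechet_derivative ?K (at (a, p0)) (0, v))"
  by (rule smooth_on_compose[OF S smooth_on_derivative[OF K] smooth_on_Pair[OF S smooth_on_id[OF S] smooth_on_const]])
   (use in_T in auto)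
 moreover have "X v f (?\<theta> a) = frechet_derivative ?K (at (a, p0)) (0, v)" if "a : ?S" for a
 proof (rule X_eqI[of f "?\<theta> a" "%v. frechet_derivative ?K (at (a, p0)) (0, v)"])
  have "((%b. (a, b)) has_derivative (%v. (0, v))) (at p0)" by (auto intro!: derivative_eq_intros)
  from has_derivative_compose[OF this smooth_on_has_derivative[OF K in_T[OF that]]]
  show "((%b. f (?\<theta> a + psi b)) has_derivative (%v. frechet_derivative ?K (at (a, p0)) (0, v))) (at p0)" by simp
 qed
 ultimately show "smooth_on ?S (X v f \<circ> ?\<theta>)"
  by (elim smooth_on_cong[OF S, rotated]) simp
qed

end

section \<open>Velocities of curves in a Lie group\<close>

context lie_grp
begin

lemmas group_normalize = add.assoc minus_add minus_minus left_minus right_minus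
 minus_add_cancel add_minus_cancel add_0_left add_0_right

text \<open>
 Only curves through the identity have a velocity here; other curves are translated to it.  No
 differentiability is asked away from the parameter \<open>0\<close>.
\<close>

definition gvel :: "(real => 'g) => 'e => bool" where
 "gvel g v \<longleftrightarrow> g 0 = 0 & isCont g 0 & ((%h. phi (g h)) has_vector_derivative v) (at 0)"

lemma gvel_in_chart: "gvel g v ==> \<forall>\<^sub>F h in at 0. g h : chU"
 using idc(1) id_chart_in(2) unfolding gvel_def continuous_within by (metis topological_tendstoD)

lemma gvel_compose:
 assumes F: "((%a. F (psi a)) has_derivative D) (at p0)" and g: "gvel g v"
 shows "((%h. F (g h)) has_vector_derivative D v) (at 0)"
proof -
 have "((%h. phi (g h)) has_derivative (%h. h *\<^sub>R v)) (at 0)"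
  using g by (simp add: gvel_def has_vector_derivative_def)
 moreover have "phi (g 0) = p0" using g by (simp add: gvel_def)
 ultimately have "((%h. F (psi (phi (g h)))) has_derivative (%h. D (h *\<^sub>R v))) (at 0)"
  using has_derivative_compose[of "%h. phi (g h)" _ 0 UNIV "%a. F (psi a)" D] F by simp
 hence "((%h. F (g h)) has_derivative (%h. D (h *\<^sub>R v))) (at 0)"
 proof (rule has_derivative_transform_eventually)
  show "\<forall>\<^sub>F h in at 0. F (psi (phi (g h))) = F (g h)"
   using gvel_in_chart[OF g] by eventually_elim (simp add: idc(5))
  show "F (psi (phi (g 0))) = F (g 0)" using g by (simp add: gvel_def)
 qed simp
 thus ?thesis
  using linear_cmul[OF bounded_linear.linear[OF has_derivative_bounded_linear[OF F]]]
  by (simp add: has_vector_derivative_def)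
qed

lemma gvel_X:
 assumes "open W" "msmooth_on A W f" "x : W" "gvel g v"
 shows "((%h. f (x + g h)) has_vector_derivative X v f x) (at 0)"
 using gvel_compose[of "%y. f (x + y)", OF X_has_derivative[OF assms(1-3)] assms(4)] .

lemma gvel_map:
 assumes "((%a. phi (kappa (psi a))) has_derivative D) (at p0)" "isCont kappa 0" "kappa 0 = 0" "gvel g v"
 shows "gvel (%h. kappa (g h)) (D v)"
 using gvel_compose[of "%y. phi (kappa y)", OF assms(1,4)] assms(2-4)
 by (auto simp: gvel_def intro: isCont_o2)

lemma gvel_unique: "gvel g u ==> gvel g v ==> u = v"
 unfolding gvel_def using vector_derivative_unique_at by blast

lemma isCont_psi: "isCont psi p0"
 using idc(2,4) p0(1) continuous_on_eq_continuous_at by blast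

lemma gvel_psi: "gvel (%h. psi (p0 + h *\<^sub>R u)) u"
proof -
 have "isCont (%h. p0 + h *\<^sub>R u) (0::real)" by (intro continuous_intros)
 moreover have "isCont psi (p0 + 0 *\<^sub>R u)" using isCont_psi by simp
 ultimately have c: "isCont (%h. psi (p0 + h *\<^sub>R u)) (0::real)" by (rule isCont_o2)
 have "((%h. p0 + h *\<^sub>R u) \<longlongrightarrow> p0 + 0 *\<^sub>R u) (at 0)" by (intro tendsto_intros)
 from topological_tendstoD[OF this idc(2)]
 have "\<forall>\<^sub>F h in at 0. p0 + h *\<^sub>R u : phi ` chU" by simp
 hence ev: "\<forall>\<^sub>F h in at 0. p0 + h *\<^sub>R u = phi (psi (p0 + h *\<^sub>R u))"
  by eventually_elim (simp add: idc(6))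
 have "((%h. p0 + h *\<^sub>R u) has_derivative (%h. h *\<^sub>R u)) (at 0)"
  by (auto intro!: derivative_eq_intros)
 from has_derivative_transform_eventually[OF this ev]
 have "((%h. phi (psi (p0 + h *\<^sub>R u))) has_derivative (%h. h *\<^sub>R u)) (at 0)" by simp
 thus ?thesis using c by (simp add: gvel_def has_vector_derivative_def)
qed

lemma gsmooth_phi_derivative:
 assumes "gsmooth S F" "s : S" "F s : chU"
 shows "((%s. phi (F s)) has_derivative frechet_derivative (%s. phi (F s)) (at s)) (at s)"
 by (rule smooth_on_has_derivative[OF gsmoothD(3)[OF assms(1) id_chart_in(1)]]) (use assms in auto)

lemma gvel_add:
 assumes g: "gvel g u" and k: "gvel k v"
 shows "gvel (%h. g h + k h) (u + v)"
proof -
 let ?M = "%s. psi (fst s) + psi (snd s)"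
 let ?D = "frechet_derivative (%s. phi (?M s)) (at (p0, p0))"
 have "gsmooth (phi ` chU \<times> phi ` chU) ?M"
  by (intro gsmooth_add gsmooth_fst gsmooth_snd gsmooth_psi idc)
 from gsmooth_phi_derivative[OF this, of "(p0, p0)"]
 have D: "((%s. phi (?M s)) has_derivative ?D) (at (p0, p0))" using id_chart_in by simp
 hence lin: "linear ?D" using has_derivative_bounded_linear bounded_linear.linear by blast
 have p: "(%a. phi (psi a)) a = a" if "a : phi ` chU" for a using that idc(6) by simp
 have "((%a. (a, p0)) has_derivative (%u. (u, 0))) (at p0)" by (auto intro!: derivative_eq_intros)
 from has_derivative_compose[OF this D] have "((%a. phi (psi a)) has_derivative (%u. ?D (u, 0))) (at p0)" by simp
 from has_derivative_transform_within_open[OF this idc(2) p0(1) p]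
 have "((%a. a) has_derivative (%u. ?D (u, 0))) (at p0)" .
 from fun_cong[OF has_derivative_unique[OF this has_derivative_ident]]
 have 1: "?D (u, 0) = u" for u .
 have "((%a. (p0, a)) has_derivative (%u. (0, u))) (at p0)" by (auto intro!: derivative_eq_intros)
 from has_derivative_compose[OF this D] have "((%a. phi (psi a)) has_derivative (%u. ?D (0, u))) (at p0)" by simp
 from has_derivative_transform_within_open[OF this idc(2) p0(1) p]
 have "((%a. a) has_derivative (%u. ?D (0, u))) (at p0)" .
 from fun_cong[OF has_derivative_unique[OF this has_derivative_ident]]
 have 2: "?D (0, u) = u" for u .
 have uv: "?D (u, v) = u + v" for u v
  using linear_add[OF lin, of "(u, 0)" "(0, v)"] 1 2 by simp
 have "((%h. (phi (g h), phi (k h))) has_derivative (%h. (h *\<^sub>R u, h *\<^sub>R v))) (at 0)"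
  using g k by (intro has_derivative_Pair) (auto simp: gvel_def has_vector_derivative_def)
 from has_derivative_compose[OF this, of "%s. phi (?M s)" ?D] D g k
 have "((%h. phi (psi (phi (g h)) + psi (phi (k h)))) has_derivative (%h. h *\<^sub>R (u + v))) (at 0)"
  by (simp add: gvel_def uv scaleR_add_right)
 hence "((%h. phi (g h + k h)) has_derivative (%h. h *\<^sub>R (u + v))) (at 0)"
 proof (rule has_derivative_transform_eventually)
  show "\<forall>\<^sub>F h in at 0. phi (psi (phi (g h)) + psi (phi (k h))) = phi (g h + k h)"
   using gvel_in_chart[OF g] gvel_in_chart[OF k] by eventually_elim (simp add: idc(5))
 qed (use g k in \<open>auto simp: gvel_def\<close>)
 moreover have "isCont (%h. g h + k h) 0" using g k unfolding gvel_def by (intro continuous_add) auto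
 ultimately show ?thesis using g k by (simp add: gvel_def has_vector_derivative_def)
qed

lemma gvel_zero: "gvel (%_. 0) 0"
 by (simp add: gvel_def)

lemma gvel_uminus:
 assumes g: "gvel g u"
 shows "gvel (%h. - g h) (- u)"
proof -
 have "gsmooth (phi ` chU) (%a. - psi a)" by (intro gsmooth_uminus gsmooth_psi)
 from gsmooth_phi_derivative[OF this, of p0]
 obtain D where "((%a. phi (- psi a)) has_derivative D) (at p0)" using id_chart_in by auto
 moreover have "isCont uminus (0::'g)" by (intro continuous_intros)
 ultimately have "gvel (%h. - g h) (D u)" using gvel_map[of uminus D g u] g by simp
 moreover have "u + D u = 0"
  using gvel_unique[OF gvel_add[OF g calculation], of 0] gvel_zero by simp
 ultimately show ?thesis using minus_unique[of u "D u"] by simp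
qed

section \<open>The adjoint representation\<close>

definition Ad :: "'g => 'e => 'e" where
 "Ad x u = frechet_derivative (%a. phi (x + psi a + - x)) (at p0) u"

lemma Ad_has_derivative: "((%a. phi (x + psi a + - x)) has_derivative Ad x) (at p0)"
proof -
 have "gsmooth (phi ` chU) (%a. x + psi a + - x)" by (intro gsmooth_add gsmooth_const gsmooth_psi idc)
 from gsmooth_phi_derivative[OF this, of p0] show ?thesis
  using id_chart_in unfolding Ad_def by simp
qed

lemma linear_Ad: "linear (Ad x)"
 using Ad_has_derivative has_derivative_bounded_linear bounded_linear.linear by blast

lemma gvel_Ad: "gvel g u ==> gvel (%h. x + g h + - x) (Ad x u)"
proof (rule gvel_map[OF Ad_has_derivative])
 show "isCont (%y. x + y + - x) 0" by (intro continuous_intros)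
qed simp_all

lemma Ad_add: "Ad (x + y) u = Ad x (Ad y u)"
proof (rule gvel_unique)
 show "gvel (%h. x + y + psi (p0 + h *\<^sub>R u) + - (x + y)) (Ad (x + y) u)" by (rule gvel_Ad[OF gvel_psi])
 show "gvel (%h. x + y + psi (p0 + h *\<^sub>R u) + - (x + y)) (Ad x (Ad y u))"
  using gvel_Ad[OF gvel_Ad[OF gvel_psi, of y], of x] by (simp only: group_normalize)
qed

lemma Ad_0 [simp]: "Ad 0 u = u"
 using gvel_unique[OF gvel_Ad[OF gvel_psi, of 0 u] ] gvel_psi[of u] by simp

lemma Ad_minus_cancel [simp]: "Ad x (Ad (- x) u) = u" "Ad (- x) (Ad x u) = u"
 by (simp_all add: Ad_add[symmetric])

section \<open>Curves with prescribed velocity\<close>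

text \<open>The velocity in the left trivialization of the tangent bundle.\<close>

definition cvel :: "(real => 'g) => 'e => real => bool" where
 "cvel c v t \<longleftrightarrow> gvel (%h. - c t + c (t + h)) v"

lemma cvel_add:
 assumes "cvel c u t" "cvel d v t"
 shows "cvel (%t. c t + d t) (Ad (- d t) u + v) t"
proof -
 have "gvel (%h. (- d t + (- c t + c (t + h)) + - (- d t)) + (- d t + d (t + h))) (Ad (- d t) u + v)"
  using assms unfolding cvel_def by (intro gvel_add gvel_Ad)
 thus ?thesis by (simp only: cvel_def group_normalize)
qed

lemma cvel_uminus:
 assumes "cvel c u t"
 shows "cvel (%t. - c t) (- Ad (c t) u) t"
proof -
 have "gvel (%h. c t + - (- c t + c (t + h)) + - c t) (Ad (c t) (- u))"
  using assms unfolding cvel_def by (intro gvel_uminus gvel_Ad)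
 thus ?thesis by (simp only: cvel_def group_normalize linear_neg[OF linear_Ad])
qed

lemma cvel_left_translate: "cvel c v t ==> cvel (%t. x + c t) v t"
 by (simp only: cvel_def group_normalize)

lemma cvel_X:
 assumes "open W" "msmooth_on A W f" "c t : W" "cvel c v t"
 shows "((%s. f (c s)) has_vector_derivative X v f (c t)) (at t)"
proof -
 have "((%h. f (c t + (- c t + c (t + h)))) has_vector_derivative X v f (c t)) (at 0)"
  by (rule gvel_X[OF assms(1-3)]) (use assms(4) in \<open>simp add: cvel_def\<close>)
 hence "((%h. f (c (t + h))) has_vector_derivative X v f (c t)) (at (t - t))"
  by (simp add: add.assoc[symmetric])
 moreover have "((%s. s - t) has_vector_derivative 1) (at t)"
  by (auto intro!: derivative_eq_intros)
 ultimately have "((%h. f (c (t + h))) \<circ> (%s. s - t) has_vector_derivative 1 *\<^sub>R X v f (c t)) (at t)"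
  by (intro vector_diff_chain_at)
 thus ?thesis by (simp add: o_def)
qed

text \<open>Smooth functions are constant along such a curve and separate points.\<close>

lemma cvel_zero_constant:
 assumes "a <= b" "continuous_on {a..b} c" "!!t. a < t ==> t < b ==> cvel c 0 t"
 shows "c a = c b"
proof (rule smooth_functions_separate)
 fix f :: "'g => real" assume f: "msmooth_on A UNIV f"
 show "f (c a) = f (c b)"
 proof (cases "a = b")
  case False
  hence ab: "a < b" using assms by simp
  have "continuous_on {a..b} (%t. f (c t))"
   by (rule continuous_on_compose2[OF msmooth_continuous[OF open_UNIV f] assms(2)]) auto
  moreover have "((%t. f (c t)) has_real_derivative 0) (at t)" if "a < t" "t < b" for t
   using cvel_X[OF open_UNIV f _ assms(3)[OF that]] linear_0[OF linear_X[OF open_UNIV f]]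
   by (simp add: has_real_derivative_iff_has_vector_derivative)
  ultimately show ?thesis using DERIV_isconst_end[OF ab, of "%t. f (c t)"] by simp
 qed simp
qed

text \<open>The difference of two curves of equal velocity has velocity zero.\<close>

lemma cvel_determines_curve:
 assumes "a <= b" "continuous_on {a..b} c" "continuous_on {a..b} d" "c a = d a"
  and "!!t. a < t ==> t < b ==> cvel c (y t) t" "!!t. a < t ==> t < b ==> cvel d (y t) t"
 shows "c b = d b"
proof -
 have "c a + - d a = c b + - d b"
 proof (rule cvel_zero_constant[OF assms(1)])
  show "continuous_on {a..b} (%t. c t + - d t)" by (intro continuous_intros assms)
  show "cvel (%t. c t + - d t) 0 t" if "a < t" "t < b" for t
   using cvel_add[OF assms(5)[OF that] cvel_uminus[OF assms(6)[OF that]]] by simp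
 qed
 thus ?thesis using assms(4) by (metis add.right_inverse add_minus_cancel minus_minus neg_eq_iff_add_eq_0)
qed

lemma cvel_affine:
 assumes "cvel c v (a + b*t)"
 shows "cvel (%t. c (a + b*t)) (b *\<^sub>R v) t"
proof -
 let ?g = "%h. - c (a + b*t) + c (a + b*t + h)"
 have g: "gvel ?g v" using assms by (simp add: cvel_def)
 have "((%h. b*h) has_derivative (%h. b*h)) (at 0)" by (auto intro!: derivative_eq_intros)
 moreover have "((%h. phi (?g h)) has_derivative (%h. h *\<^sub>R v)) (at (b*0))"
  using g by (simp add: gvel_def has_vector_derivative_def)
 ultimately have "((%h. phi (?g (b*h))) has_derivative (%h. (b*h) *\<^sub>R v)) (at 0)"
  by (rule has_derivative_compose)
 moreover have "isCont (%h. ?g (b*h)) 0"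
 proof (rule isCont_o2[where f="%h. b*h" and g="?g"])
  show "isCont ?g (b*0)" using g by (simp add: gvel_def)
 qed (intro continuous_intros)
 ultimately have "gvel (%h. ?g (b*h)) (b *\<^sub>R v)"
  using g by (simp add: gvel_def has_vector_derivative_def mult.commute)
 thus ?thesis by (simp add: cvel_def algebra_simps)
qed

section \<open>Coordinates near the identity\<close>

text \<open>The chart at the identity, cut off to a globally defined smooth function.\<close>

lemma coordinates:
 obtains P \<beta> and f :: "'g => 'e" and K where "open P" "0 : P" "P <= K" "compact K" "K <= chU"
  "msmooth_on A UNIV f" "!!y. y : P ==> f y = phi y - p0" "!!y. y : chU ==> f y = \<beta> y *\<^sub>R (phi y - p0)"
  "msmooth_on A UNIV \<beta>" "!!y. y : P ==> \<beta> y = 1" "!!y. y ~: K ==> \<beta> y = (0::real)" "!!y. y ~: K ==> f y = 0"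
proof -
 obtain \<beta> :: "'g => real" and P K where b: "msmooth_on A UNIV \<beta>" "open P" "0 : P" "!!y. y : P ==> \<beta> y = 1"
  "compact K" "K <= chU" "!!y. y ~: K ==> \<beta> y = 0"
  by (rule bump[OF idc(1) id_chart_in(2)]) blast
 define f where "f = (%y. if y : chU then \<beta> y *\<^sub>R (phi y - p0) else 0)"
 have "msmooth_on A chU phi" by (rule msmoothI) (use transition_smooth[OF _ id_chart_in(1)] in auto)
 from msmooth_add[OF idc(1) this msmooth_const[of chU "- p0"]] have "msmooth_on A chU (%y. phi y - p0)" by simp
 hence "msmooth_on A chU (%y. \<beta> y *\<^sub>R (phi y - p0))"
  by (intro msmooth_scaleR idc(1) msmooth_subset[OF b(1)]) auto
 hence "msmooth_on A chU f" by (rule msmooth_cong[OF idc(1)]) (simp add: f_def)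
 hence sm: "msmooth_on A UNIV f"
  by (rule msmooth_zero_outside[OF idc(1) _ compact_imp_closed[OF b(5)] b(6)]) (use b in \<open>auto simp: f_def\<close>)
 have PK: "P <= K" using b(4,7) by (metis subsetI zero_neq_one)
 show ?thesis
  by (rule that[OF b(2,3) PK b(5,6) sm _ _ b(1,4,7)]) (use b PK in \<open>auto simp: f_def\<close>)
qed

lemma X_coordinates:
 assumes "open P" "0 : P" "!!y. y : P ==> f y = phi y - p0"
 shows "X v f 0 = v"
proof (rule X_eqI[of f 0 "%v. v"])
 let ?S = "{a : phi ` chU. psi a : P}"
 have "open ?S" by (rule preimage_open[OF idc(2,4) assms(1)])
 thus "((%a. f (0 + psi a)) has_derivative (%v. v)) (at p0)"
  by (rule has_derivative_transform_within_open[rotated, where f="%a. a - p0"])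
   (use assms in \<open>auto simp: idc(5) intro!: derivative_eq_intros\<close>)
qed

lemma X_injective:
 assumes "!!f :: 'g => real. msmooth_on A UNIV f ==> X u f 0 = X v f 0"
 shows "u = v"
proof (rule euclidean_eqI)
 obtain P and f :: "'g => 'e" where f: "open P" "0 : P" "msmooth_on A UNIV f" "!!y. y : P ==> f y = phi y - p0"
  by (rule coordinates) blast
 fix i :: 'e assume "i : Basis"
 have l: "bounded_linear (%x::'e. x \<bullet> i)" by (rule bounded_linear_inner_left)
 have "X w (%x. f x \<bullet> i) 0 = w \<bullet> i" for w
  using X_linear_comp[OF l open_UNIV f(3), of 0 w] X_coordinates[OF f(1,2,4)] by simp
 thus "u \<bullet> i = v \<bullet> i" using assms[OF msmooth_linear_comp[OF l open_UNIV f(3)]] by simp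
qed

section \<open>The Lie bracket\<close>

definition ad :: "'e => 'e => 'e" where
 "ad v u = frechet_derivative (%a. Ad (psi a) u) (at p0) v"

lemma Ad_smooth: "smooth_on (phi ` chU) (%a. Ad (psi a) u)"
proof -
 let ?M = "%s. psi (fst s) + psi (snd s) + - psi (fst s)"
 let ?T = "{s : phi ` chU \<times> phi ` chU. ?M s : chU}"
 let ?K = "%s. phi (?M s)"
 have M: "gsmooth (phi ` chU \<times> phi ` chU) ?M"
  by (intro gsmooth_add gsmooth_uminus gsmooth_fst gsmooth_snd gsmooth_psi idc)
 have K: "smooth_on ?T ?K" by (rule gsmoothD(3)[OF M id_chart_in(1)])
 have in_T: "(a, p0) : ?T" if "a : phi ` chU" for a using that id_chart_in by auto
 have "smooth_on (phi ` chU) (%a. frechet_derivative ?K (at (a, p0)) (0, u))"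
  by (rule smooth_on_compose[OF idc(2) smooth_on_derivative[OF K] smooth_on_Pair[OF idc(2) smooth_on_id[OF idc(2)] smooth_on_const]])
   (use in_T id_chart_in in auto)
 moreover have "frechet_derivative ?K (at (a, p0)) (0, u) = Ad (psi a) u" if "a : phi ` chU" for a
 proof -
  have "((%b. (a, b)) has_derivative (%v. (0, v))) (at p0)" by (auto intro!: derivative_eq_intros)
  from has_derivative_compose[OF this smooth_on_has_derivative[OF K in_T[OF that]]]
  have "((%b. phi (psi a + psi b + - psi a)) has_derivative (%v. frechet_derivative ?K (at (a, p0)) (0, v))) (at p0)" by simp
  from fun_cong[OF has_derivative_unique[OF this Ad_has_derivative]] show ?thesis .
 qed
 ultimately show ?thesis by (rule smooth_on_cong[OF idc(2), rotated])
qed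

lemma Ad_ad_has_derivative: "((%a. Ad (psi a) u) has_derivative (%v. ad v u)) (at p0)"
 using smooth_on_has_derivative[OF Ad_smooth p0(1)] by (simp add: ad_def)

lemma gvel_ad: "gvel g v ==> ((%h. Ad (g h) u) has_vector_derivative ad v u) (at 0)"
 by (rule gvel_compose[OF Ad_ad_has_derivative])

text \<open>
 The mixed second derivatives of \<open>f (x + psi a + psi b)\<close> are symmetric, and exchanging the two
 factors introduces the conjugation whose derivative is \<open>ad\<close>.
\<close>

lemma X_ad:
 fixes f :: "'g => real"
 assumes f: "msmooth_on A UNIV f"
 shows "X (ad v u) f x = X v (X u f) x - X u (X v f) x"
proof -
 let ?S = "phi ` chU"
 let ?F = "%s. f (x + psi (fst s) + psi (snd s))"
 let ?D = "%s. frechet_derivative ?F (at s)"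
 have T: "open (?S \<times> ?S)" by (intro open_Times idc)
 have F: "smooth_on (?S \<times> ?S) ?F"
  by (rule msmooth_compose[OF f open_UNIV]) (auto intro!: gsmooth_add gsmooth_const gsmooth_fst gsmooth_snd gsmooth_psi idc T)
 have DF: "(?F has_derivative ?D s) (at s)" if "s : ?S \<times> ?S" for s by (rule smooth_on_has_derivative[OF F that])
 have D2: "((%s. ?D s w) has_derivative frechet_derivative (%s. ?D s w) (at s)) (at s)" if "s : ?S \<times> ?S" for s w
  by (rule smooth_on_has_derivative[OF smooth_on_derivative[OF F] that])
 have pp: "(p0, p0) : ?S \<times> ?S" by simp
 have left: "((%a. (a, b)) has_derivative (%v. (v, 0))) (at p)"
  and right: "((%a. (b, a)) has_derivative (%v. (0, v))) (at p)" for b p :: 'e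
  by (auto intro!: derivative_eq_intros)
 have lin: "linear (?D (p0, p0))" using DF[OF pp] has_derivative_bounded_linear bounded_linear.linear by blast
 have R: "msmooth_on A UNIV (%z. f (z + y))" for y
  using msmooth_translate[OF open_UNIV f, of 0 y] by simp
 have 1: "X w f (x + psi a) = ?D (a, p0) (0, w)" if "a : ?S" for a w
  using has_derivative_compose[OF right DF, of a p0] that by (intro X_eqI) simp
 have 2: "X w (%z. f (z + psi a)) x = ?D (p0, a) (w, 0)" if "a : ?S" for a w
  using has_derivative_compose[OF left DF, of p0 a] that by (intro X_eqI) simp
 have 3: "X w f (x + y) = X (Ad y w) (%z. f (z + y)) x" for w y
 proof -
  have "((%h. f (x + y + psi (p0 + h *\<^sub>R w))) has_vector_derivative X w f (x + y)) (at 0)"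
   by (rule gvel_X[OF open_UNIV f _ gvel_psi]) simp
  moreover have "((%h. f (x + (y + psi (p0 + h *\<^sub>R w) + - y) + y)) has_vector_derivative X (Ad y w) (%z. f (z + y)) x) (at 0)"
   by (rule gvel_X[OF open_UNIV R _ gvel_Ad[OF gvel_psi]]) simp
  ultimately show ?thesis by (simp add: add.assoc vector_derivative_unique_at)
 qed
 have eq: "?D (a, p0) (0, u) = ?D (p0, a) (Ad (psi a) u, 0)" if "a : ?S" for a
  using 1[OF that] 2[OF that] 3 by metis
 have XX: "X w' (X w f) x = frechet_derivative (%s. ?D s (0, w)) (at (p0, p0)) (w', 0)" for w w'
 proof (rule X_eqI[of "X w f" x "%w'. frechet_derivative (%s. ?D s (0, w)) (at (p0, p0)) (w', 0)"])
  show "((%a. X w f (x + psi a)) has_derivative (%w'. frechet_derivative (%s. ?D s (0, w)) (at (p0, p0)) (w', 0))) (at p0)"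
   by (rule has_derivative_transform_within_open[OF has_derivative_compose[OF left D2[OF pp]] idc(2) p0(1)])
    (simp add: 1)
 qed
 let ?R = "%v. \<Sum>i\<in>Basis. (u \<bullet> i) *\<^sub>R frechet_derivative (%s. ?D s (i, 0)) (at (p0, p0)) (0, v)
   + (ad v u \<bullet> i) *\<^sub>R ?D (p0, p0) (i, 0)"
 have exp: "?D (p0, a) (y, 0) = (\<Sum>i\<in>Basis. (y \<bullet> i) *\<^sub>R ?D (p0, a) (i, 0))" if "a : ?S" for a y
 proof -
  have l: "linear (%y. ?D (p0, a) (y, 0))"
   using has_derivative_compose[OF left DF, of p0 a] that has_derivative_bounded_linear bounded_linear.linear by fastforce
  have "?D (p0, a) (y, 0) = ?D (p0, a) (\<Sum>i\<in>Basis. (y \<bullet> i) *\<^sub>R i, 0)" by (simp only: euclidean_representation)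
  thus ?thesis by (simp only: linear_sum[OF l] linear_cmul[OF l])
 qed
 have "((%a. \<Sum>i\<in>Basis. (Ad (psi a) u \<bullet> i) *\<^sub>R ?D (p0, a) (i, 0)) has_derivative ?R) (at p0)"
 proof (rule has_derivative_sum)
  fix i :: 'e
  have "((%a. Ad (psi a) u \<bullet> i) has_derivative (%v. ad v u \<bullet> i)) (at p0)"
   by (rule bounded_linear.has_derivative[OF bounded_linear_inner_left Ad_ad_has_derivative])
  from has_derivative_scaleR[OF this has_derivative_compose[OF right D2[OF pp], of "(i, 0)"]]
  show "((%a. (Ad (psi a) u \<bullet> i) *\<^sub>R ?D (p0, a) (i, 0)) has_derivative
   (%v. (u \<bullet> i) *\<^sub>R frechet_derivative (%s. ?D s (i, 0)) (at (p0, p0)) (0, v) + (ad v u \<bullet> i) *\<^sub>R ?D (p0, p0) (i, 0))) (at p0)"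
   by simp
 qed
 hence "((%a. X u f (x + psi a)) has_derivative ?R) (at p0)"
  by (rule has_derivative_transform_within_open[OF _ idc(2) p0(1)])
   (rule trans[OF 1 trans[OF eq exp], symmetric])
 from X_eqI[OF this] have "X v (X u f) x = ?R v" .
 also have "... = (\<Sum>i\<in>Basis. (u \<bullet> i) *\<^sub>R frechet_derivative (%s. ?D s (0, v)) (at (p0, p0)) (i, 0))
   + (\<Sum>i\<in>Basis. (ad v u \<bullet> i) *\<^sub>R ?D (p0, p0) (i, 0))"
  unfolding second_derivative_symmetric[OF T F pp, of "(_, 0)" "(0, v)"] by (rule sum.distrib)
 also have "(\<Sum>i\<in>Basis. (ad v u \<bullet> i) *\<^sub>R ?D (p0, p0) (i, 0)) = X (ad v u) f x"
  using exp[OF p0(1), of "ad v u"] 2[OF p0(1), of "ad v u"] by simp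
 also have "(\<Sum>i\<in>Basis. (u \<bullet> i) *\<^sub>R frechet_derivative (%s. ?D s (0, v)) (at (p0, p0)) (i, 0)) = X u (X v f) x"
 proof -
  have "linear (%w'. X w' (X v f) x)" by (rule linear_X[OF open_UNIV msmooth_X[OF open_UNIV f]]) simp
  note l = this[unfolded XX]
  have "X u (X v f) x = frechet_derivative (%s. ?D s (0, v)) (at (p0, p0)) (\<Sum>i\<in>Basis. (u \<bullet> i) *\<^sub>R i, 0)"
   by (simp only: euclidean_representation XX)
  thus ?thesis by (simp only: linear_sum[OF l] linear_cmul[OF l])
 qed
 finally show ?thesis by simp
qed

lemma lie_bracket_ad: "lie_bracket A v u = ad v u"
 unfolding lie_bracket_def
proof (rule the_equality)
 show "\<forall>f::'g => real. msmooth_on A UNIV f --> (ALL x. X (ad v u) f x = X v (X u f) x - X u (X v f) x)"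
  using X_ad by blast
 show "w = ad v u" if "\<forall>f::'g => real. msmooth_on A UNIV f --> (ALL x. X w f x = X v (X u f) x - X u (X v f) x)" for w
  by (rule X_injective) (simp add: X_ad that)
qed

lemma ad_linear_left: "linear (%v. ad v u)"
 using Ad_ad_has_derivative has_derivative_bounded_linear bounded_linear.linear by blast

lemma ad_antisym: "ad u v = - ad v u"
proof (rule X_injective)
 fix f :: "'g => real" assume f: "msmooth_on A UNIV f"
 show "X (ad u v) f 0 = X (- ad v u) f 0"
  using linear_neg[OF linear_X[OF open_UNIV f]] by (simp add: X_ad[OF f])
qed

lemma ad_self [simp]: "ad u u = 0"
proof -
 have "ad u u + ad u u = 0" using ad_antisym[of u u] by (metis add.right_inverse)
 hence "2 *\<^sub>R ad u u = 0" by (simp add: scaleR_2)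
 thus ?thesis by simp
qed

lemma ad_linear_right: "linear (ad v)"
 using linear_compose_neg[OF ad_linear_left[of v]] unfolding ad_antisym[of v, symmetric] .

lemma bounded_bilinear_ad: "bounded_bilinear ad"
 by (rule bilinear_conv_bounded_bilinear[THEN iffD1]) (simp add: bilinear_def ad_linear_left ad_linear_right)

lemma jacobi: "ad (ad u v) w = ad u (ad v w) - ad v (ad u w)"
proof (rule X_injective)
 fix f :: "'g => real" assume f: "msmooth_on A UNIV f"
 have eq: "X (ad u v) f = (%x. X u (X v f) x + - X v (X u f) x)" for u v
  by (rule ext) (simp add: X_ad[OF f])
 have "X w (X (ad u v) f) 0 = X w (X u (X v f)) 0 - X w (X v (X u f)) 0" for w u v
 proof -
  have m: "msmooth_on A UNIV (X u (X v f))" for u v by (intro msmooth_X f open_UNIV)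
  show ?thesis
   unfolding eq X_add[OF open_UNIV m msmooth_minus[OF open_UNIV m] UNIV_I] X_minus[OF open_UNIV m UNIV_I] by simp
 qed
 thus "X (ad (ad u v) w) f 0 = X (ad u (ad v w) - ad v (ad u w)) f 0"
  using linear_diff[OF linear_X[OF open_UNIV f]] f by (simp add: X_ad msmooth_X)
qed

end

section \<open>Ordinary differential equations with a Lipschitz right-hand side\<close>

text \<open>Banach's fixed point theorem, for the integral operator on bounded continuous functions.\<close>

lemma picard_lindelof:
 fixes f :: "'a::euclidean_space => 'a"
 assumes L: "L-lipschitz_on UNIV f"
 obtains tau a where "0 < tau" "a 0 = x0" "!!t. \<bar>t\<bar> < tau ==> (a has_vector_derivative f (a t)) (at t)"
proof -
 have L0: "L >= 0" using L by (rule lipschitz_on_nonneg)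
 define tau where "tau = 1/(8*L + 8)"
 have tau: "0 < tau" and tauL: "4 * tau*L <= 1/2" using L0 by (auto simp: tau_def field_simps)
 define cl where "cl = (%t. max (- tau) (min tau t))"
 have cl: "cl t : {- tau..tau}" for t using tau by (auto simp: cl_def)
 have cf: "continuous_on UNIV f" using L by (rule lipschitz_on_continuous_on)
 define J where "J = (%(a :: real \<Rightarrow>\<^sub>C 'a) t. integral {- tau..t} (%s. f (a s)))"
 have cfa: "continuous_on S (%s. f (apply_bcontfun a s))" for a S
  by (rule continuous_on_compose2[OF cf]) (auto intro: continuous_on_subset[OF continuous_on_apply_bcontfun])
 hence int: "(%s. f (apply_bcontfun a s)) integrable_on {- tau..t}" for a t
  by (intro integrable_continuous_real)
 define T where "T = (%a t. x0 + J a (cl t) - J a 0)"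
 have cJ: "continuous_on {- tau..tau} (J a)" for a
  unfolding J_def by (rule indefinite_integral_continuous_1[OF int])
 have TB: "T a : bcontfun" for a
 proof -
  have "bounded (J a ` {- tau..tau})" by (rule compact_imp_bounded[OF compact_continuous_image[OF cJ compact_Icc]])
  then obtain B where "ALL x:J a ` {- tau..tau}. norm x <= B" unfolding bounded_iff by blast
  hence B: "norm (J a t) <= B" if "t : {- tau..tau}" for t using that by blast
  show ?thesis
  proof (rule bcontfun_normI)
  have "continuous_on UNIV (%t. J a (cl t))"
   by (rule continuous_on_compose2[OF cJ]) (use cl in \<open>auto simp: cl_def intro!: continuous_intros\<close>)
  thus "continuous_on UNIV (T a)" unfolding T_def by (intro continuous_intros)
  show "norm (T a t) <= norm x0 + B + B" for t
  proof -
   have "norm (T a t) <= norm (x0 + J a (cl t)) + norm (J a 0)" unfolding T_def by (rule norm_triangle_ineq4)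
   also have "... <= norm x0 + norm (J a (cl t)) + norm (J a 0)" using norm_triangle_ineq[of x0 "J a (cl t)"] by simp
   also have "... <= norm x0 + B + B" using B[OF cl, of t] B[of 0] tau by simp
   finally show ?thesis .
  qed
  qed
 qed
 have dJ: "norm (J a t - J b t) <= 2 * tau*(L*dist a b)" if t: "t : {- tau..tau}" for a b t
 proof -
  have "J a t - J b t = integral {- tau..t} (%s. f (a s) - f (b s))"
   unfolding J_def by (rule Henstock_Kurzweil_Integration.integral_diff[OF int int, symmetric])
  also have "norm ... <= (L*dist a b)*(t - - tau)"
  proof (rule integral_bound)
   show "continuous_on {- tau..t} (%s. f (a s) - f (b s))" by (intro continuous_intros cfa)
   show "norm (f (a s) - f (b s)) <= L*dist a b" for s
    using lipschitz_onD[OF L, of "a s" "b s"] dist_bounded[of a s b] L0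
    by (simp add: dist_norm) (meson mult_left_mono order_trans)
  qed (use t in simp)
  also have "... <= (L*dist a b)*(2 * tau)" using t L0 by (intro mult_left_mono) auto
  finally show ?thesis by (simp add: mult_ac)
 qed
 have "\<exists>!a. Bcontfun (T a) = a"
 proof (rule banach_fix_type[of "1/2"])
  show "ALL a b. dist (Bcontfun (T a)) (Bcontfun (T b)) <= 1/2*dist a b"
  proof (intro allI dist_bound)
   fix a b t
   have "T a t - T b t = (J a (cl t) - J b (cl t)) - (J a 0 - J b 0)" by (simp add: T_def)
   hence "norm (T a t - T b t) <= norm (J a (cl t) - J b (cl t)) + norm (J a 0 - J b 0)"
    using norm_triangle_ineq4 by metis
   also have "... <= (4 * tau*L)*dist a b"
    using dJ[OF cl[of t], of a b] dJ[of 0 a b] tau by (simp add: mult_ac)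
   also have "... <= 1/2*dist a b" using tauL by (intro mult_right_mono) auto
   finally show "dist (Bcontfun (T a) t) (Bcontfun (T b) t) <= 1/2*dist a b"
    by (simp add: Bcontfun_inverse[OF TB] dist_norm)
  qed
 qed auto
 then obtain a where a: "Bcontfun (T a) = a" by blast
 hence aT: "apply_bcontfun a = T a" using Bcontfun_inverse[OF TB, of a] by simp
 show ?thesis
 proof (rule that[OF tau, of "apply_bcontfun a"])
  show "a 0 = x0" unfolding aT using tau by (simp add: T_def cl_def)
  fix t :: real assume t: "\<bar>t\<bar> < tau"
  have "(J a has_vector_derivative f (a t)) (at t within {- tau..tau})"
   unfolding J_def by (rule integral_has_vector_derivative[OF cfa]) (use t in auto)
  hence "(J a has_vector_derivative f (a t)) (at t)"
   using t by (simp add: at_within_Icc_at)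
  hence "((%t. x0 + J a t - J a 0) has_vector_derivative f (a t)) (at t)"
   by (auto intro!: derivative_eq_intros)
  hence "(T a has_vector_derivative f (a t)) (at t)"
   by (rule has_vector_derivative_transform_within_open[of _ _ _ "{- tau<..<tau}"])
    (use t in \<open>auto simp: T_def cl_def min_def max_def\<close>)
  thus "(a has_vector_derivative f (a t)) (at t)" by (simp only: aT[symmetric])
 qed
qed

lemma smooth_on_lipschitz:
 fixes f :: "'a::euclidean_space => 'b::real_normed_vector"
 assumes f: "smooth_on S f" and K: "compact K" "convex K" "K <= S"
 obtains L where "L-lipschitz_on K f"
proof -
 have "EX B. ALL x:K. norm (frechet_derivative f (at x) i) <= B" for i
 proof -
  have "continuous_on K (%x. frechet_derivative f (at x) i)"
   by (rule continuous_on_subset[OF smooth_on_continuous[OF smooth_on_derivative[OF f]] K(3)])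
  from compact_imp_bounded[OF compact_continuous_image[OF this K(1)]] show ?thesis
   by (auto simp: bounded_iff)
 qed
 then obtain B where B: "!!i x. x : K ==> norm (frechet_derivative f (at x) i) <= B i" by metis
 have D: "(f has_derivative frechet_derivative f (at x)) (at x within K)" if "x : K" for x
  using smooth_on_has_derivative[OF f] K(3) that by (blast intro: has_derivative_at_withinI)
 have on: "onorm (frechet_derivative f (at x)) <= (\<Sum>i\<in>Basis. \<bar>B i\<bar>)" if x: "x : K" for x
 proof (rule onorm_bound)
  let ?D = "frechet_derivative f (at x)"
  have lin: "linear ?D" using D[OF x] has_derivative_bounded_linear bounded_linear.linear by blast
  fix v
  have "?D v = ?D (\<Sum>i\<in>Basis. (v \<bullet> i) *\<^sub>R i)" by (simp only: euclidean_representation)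
  also have "... = (\<Sum>i\<in>Basis. (v \<bullet> i) *\<^sub>R ?D i)" by (simp only: linear_sum[OF lin] linear_cmul[OF lin])
  also have "norm ... <= (\<Sum>i\<in>Basis. norm v * \<bar>B i\<bar>)"
  proof (rule sum_norm_le)
   fix i :: 'a assume "i : Basis"
   thus "norm ((v \<bullet> i) *\<^sub>R ?D i) <= norm v * \<bar>B i\<bar>"
    using Basis_le_norm[of i v] B[OF x, of i] by (auto intro!: mult_mono)
  qed
  finally show "norm (?D v) <= (\<Sum>i\<in>Basis. \<bar>B i\<bar>)*norm v" by (simp add: sum_distrib_left mult.commute)
 qed (auto intro: sum_nonneg)
 have "(\<Sum>i\<in>Basis. \<bar>B i\<bar>)-lipschitz_on K f"
 proof (rule lipschitz_onI)
  show "dist (f x) (f y) <= (\<Sum>i\<in>Basis. \<bar>B i\<bar>)*dist x y" if "x : K" "y : K" for x y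
   using differentiable_bound[OF K(2) D on, of y x] that by (simp add: dist_norm norm_minus_commute)
 qed (auto intro: sum_nonneg)
 thus ?thesis by (rule that)
qed

section \<open>One-parameter subgroups\<close>

context lie_grp
begin

lemma gvel_cong:
 assumes g: "gvel g v" and ev: "\<forall>\<^sub>F h in nhds 0. g h = k h"
 shows "gvel k v"
proof -
 have 0: "k 0 = 0" using g eventually_nhds_x_imp_x[OF ev] by (simp add: gvel_def)
 have "isCont k 0" using g isCont_cong[OF ev] by (simp add: gvel_def)
 moreover have "((%h. phi (k h)) has_derivative (%h. h *\<^sub>R v)) (at 0)"
  by (rule has_derivative_transform_eventually[of "%h. phi (g h)"])
   (use g 0 ev in \<open>auto simp: gvel_def has_vector_derivative_def eventually_at_filter elim: eventually_mono\<close>)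
 ultimately show ?thesis using 0 by (simp add: gvel_def has_vector_derivative_def)
qed

lemma cvel_isCont:
 assumes "cvel c v t"
 shows "isCont c t"
proof -
 have "isCont (%h. - c t + c (t + h)) (t - t)" using assms by (simp add: cvel_def gvel_def)
 from isCont_o2[of t "%s. s - t", OF _ this] have "isCont (%s. - c t + c s) t" by simp
 from continuous_add[OF continuous_const this] have "isCont (%s. c t + (- c t + c s)) t" .
 thus ?thesis by (simp only: group_normalize)
qed

lemma cvel_line_unique:
 assumes "!!s. s : closed_segment 0 t ==> cvel c (y s) s" "!!s. s : closed_segment 0 t ==> cvel d (y s) s" "c 0 = d 0"
 shows "c t = d t"
proof -
 let ?\<sigma> = "if t >= 0 then 1 else - 1 :: real"
 have seg: "0 + ?\<sigma> * s : closed_segment 0 t" if "s : {0..\<bar>t\<bar>}" for s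
  using that by (auto simp: closed_segment_eq_real_ivl split: if_splits)
 have cc: "cvel (%s. c (0 + ?\<sigma> * s)) (?\<sigma> *\<^sub>R y (0 + ?\<sigma> * s)) s" "cvel (%s. d (0 + ?\<sigma> * s)) (?\<sigma> *\<^sub>R y (0 + ?\<sigma> * s)) s"
  if "s : {0..\<bar>t\<bar>}" for s
  by (rule cvel_affine[OF assms(1)[OF seg[OF that]]], rule cvel_affine[OF assms(2)[OF seg[OF that]]])
 have "c (0 + ?\<sigma> * \<bar>t\<bar>) = d (0 + ?\<sigma> * \<bar>t\<bar>)"
 proof (rule cvel_determines_curve[of 0 "\<bar>t\<bar>" "%s. c (0 + ?\<sigma> * s)" "%s. d (0 + ?\<sigma> * s)" "%s. ?\<sigma> *\<^sub>R y (0 + ?\<sigma> * s)"])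
  show "continuous_on {0..\<bar>t\<bar>} (%s. c (0 + ?\<sigma> * s))" "continuous_on {0..\<bar>t\<bar>} (%s. d (0 + ?\<sigma> * s))"
   by (intro continuous_at_imp_continuous_on ballI cvel_isCont[OF cc(1)] cvel_isCont[OF cc(2)]; assumption)+
  show "cvel (%s. c (0 + ?\<sigma> * s)) (?\<sigma> *\<^sub>R y (0 + ?\<sigma> * s)) s" "cvel (%s. d (0 + ?\<sigma> * s)) (?\<sigma> *\<^sub>R y (0 + ?\<sigma> * s)) s"
   if "0 < s" "s < \<bar>t\<bar>" for s using cc[of s] that by auto
 qed (use assms(3) in auto)
 thus ?thesis by (auto split: if_splits)
qed

text \<open>
 A left-invariant field is a smooth vector field in the chart around the identity, so that it has
 an integral curve there for a short time.
\<close>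

lemma local_integral_curve:
 obtains tau gamma where "0 < tau" "gamma 0 = 0" "!!t. \<bar>t\<bar> < tau ==> cvel gamma v t"
proof -
 let ?M = "%s. psi (fst s) + psi (snd s)"
 let ?T = "{s : phi ` chU \<times> phi ` chU. ?M s : chU}"
 let ?K = "%s. phi (?M s)"
 have M: "gsmooth (phi ` chU \<times> phi ` chU) ?M"
  by (intro gsmooth_add gsmooth_fst gsmooth_snd gsmooth_psi idc)
 have K: "smooth_on ?T ?K" by (rule gsmoothD(3)[OF M id_chart_in(1)])
 have in_T: "(a, p0) : ?T" if "a : phi ` chU" for a using that id_chart_in idc(7) by auto
 define \<xi> where "\<xi> = (%a. frechet_derivative ?K (at (a, p0)) (0, v))"
 have sm: "smooth_on (phi ` chU) \<xi>"
  unfolding \<xi>_def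
  by (rule smooth_on_compose[OF idc(2) smooth_on_derivative[OF K] smooth_on_Pair[OF idc(2) smooth_on_id[OF idc(2)] smooth_on_const]])
   (use in_T in auto)
 obtain r where r: "r > 0" "cball p0 r <= phi ` chU" using idc(2) p0(1) open_contains_cball by blast
 obtain L where L: "L-lipschitz_on (cball p0 r) \<xi>"
  by (rule smooth_on_lipschitz[OF sm compact_cball convex_cball r(2)])
 let ?q = "closest_point (cball p0 r)"
 have "L-lipschitz_on UNIV (%a. \<xi> (?q a))"
 proof (rule lipschitz_onI)
  have ne: "cball p0 r ~= {}" using r(1) by auto
  fix a b :: 'e
  have "dist (\<xi> (?q a)) (\<xi> (?q b)) <= L*dist (?q a) (?q b)"
   by (rule lipschitz_onD[OF L]) (rule closest_point_in_set[OF closed_cball ne])+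
  also have "... <= L*dist a b"
   by (intro mult_left_mono closest_point_lipschitz lipschitz_on_nonneg[OF L]) (use ne in auto)
  finally show "dist (\<xi> (?q a)) (\<xi> (?q b)) <= L*dist a b" .
 qed (rule lipschitz_on_nonneg[OF L])
 from picard_lindelof[OF this] obtain tau0 a where a: "0 < tau0" "a 0 = p0"
  "!!t. \<bar>t\<bar> < tau0 ==> (a has_vector_derivative \<xi> (?q (a t))) (at t)" by blast
 have "isCont a 0" using a(1) a(3)[of 0] has_vector_derivative_continuous by auto
 then obtain tau1 where tau1: "tau1 > 0" "!!t. \<bar>t\<bar> < tau1 ==> dist (a t) p0 < r"
  unfolding continuous_at_eps_delta using r(1) a(2) by (metis diff_zero dist_real_def)
 define tau where "tau = min tau0 tau1"
 have at: "a t : ball p0 r" "a t : phi ` chU" if "\<bar>t\<bar> < tau" for t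
  using tau1(2)[of t] r(2) that by (auto simp: tau_def dist_commute)
 have da: "(a has_vector_derivative \<xi> (a t)) (at t)" if "\<bar>t\<bar> < tau" for t
  using a(3)[of t] at(1)[OF that] that closest_point_self[of "a t" "cball p0 r"] by (auto simp: tau_def)
 show ?thesis
 proof (rule that[of tau "%t. psi (a t)"])
  show "0 < tau" "psi (a 0) = 0" using a tau1 by (auto simp: tau_def)
  fix t assume t: "\<bar>t\<bar> < tau"
  let ?x = "psi (a t)"
  let ?E = "%b. phi (- ?x + psi b)"
  have E: "gsmooth (phi ` chU) (%b. - ?x + psi b)" by (intro gsmooth_add gsmooth_const gsmooth_psi idc)
  have DE: "(?E has_derivative frechet_derivative ?E (at (a t))) (at (a t))"
   by (rule gsmooth_phi_derivative[OF E at(2)[OF t]]) (use id_chart_in in simp)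
  have R: "((%b. ?K (a t, b)) has_derivative (%v. frechet_derivative ?K (at (a t, p0)) (0, v))) (at p0)"
  proof -
   have "((%b. (a t, b)) has_derivative (%v. (0, v))) (at p0)" by (auto intro!: derivative_eq_intros)
   from has_derivative_compose[OF this smooth_on_has_derivative[OF K in_T[OF at(2)[OF t]]]] show ?thesis .
  qed
  have ev: "\<forall>\<^sub>F b in at p0. b : phi ` chU & ?x + psi b : chU"
  proof -
   have "open {b : phi ` chU. ?x + psi b : chU}"
    by (rule preimage_open[OF idc(2) _ idc(1)]) (intro continuous_intros idc)
   moreover have "p0 : {b : phi ` chU. ?x + psi b : chU}" using idc(7)[OF at(2)[OF t]] by simp
   ultimately show ?thesis using eventually_at_topological by blast
  qed
  have "((%b. ?E (?K (a t, b))) has_derivative (%w. frechet_derivative ?E (at (a t)) (frechet_derivative ?K (at (a t, p0)) (0, w)))) (at p0)"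
   by (rule has_derivative_compose[OF R]) (use DE idc(6)[OF at(2)[OF t]] in simp)
  hence "((%b. b) has_derivative (%w. frechet_derivative ?E (at (a t)) (frechet_derivative ?K (at (a t, p0)) (0, w)))) (at p0)"
  proof (rule has_derivative_transform_eventually)
   show "\<forall>\<^sub>F b in at p0. ?E (?K (a t, b)) = b"
    using ev by eventually_elim (simp add: idc(5) idc(6) add.assoc[symmetric])
   show "?E (?K (a t, p0)) = p0" using idc(6)[OF at(2)[OF t]] by simp
  qed simp
  from fun_cong[OF has_derivative_unique[OF this has_derivative_ident], of v]
  have v: "frechet_derivative ?E (at (a t)) (\<xi> (a t)) = v" by (simp add: \<xi>_def)
  have "((%h. t + h) has_derivative (%h. h)) (at 0)" by (auto intro!: derivative_eq_intros)
  from has_derivative_compose[OF this, of a "%h. h *\<^sub>R \<xi> (a t)"]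
  have ah: "((%h. a (t + h)) has_derivative (%h. h *\<^sub>R \<xi> (a t))) (at 0)"
   using da[OF t] by (simp add: has_vector_derivative_def)
  from has_derivative_compose[OF this, of ?E] DE
  have "((%h. ?E (a (t + h))) has_derivative (%h. frechet_derivative ?E (at (a t)) (h *\<^sub>R \<xi> (a t)))) (at 0)" by simp
  hence "((%h. ?E (a (t + h))) has_vector_derivative v) (at 0)"
   using linear_cmul[OF bounded_linear.linear[OF has_derivative_bounded_linear[OF DE]]] v
   by (simp add: has_vector_derivative_def)
  moreover have "isCont (%h. - ?x + psi (a (t + h))) 0"
  proof -
   have "isCont (%h. a (t + h)) 0" using ah by (rule has_derivative_continuous)
   moreover have "isCont psi (a (t + 0))" using at(2)[OF t] idc(2,4) continuous_on_eq_continuous_at by fastforce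
   ultimately have "isCont (%h. psi (a (t + h))) 0" by (rule isCont_o2)
   thus ?thesis by (intro continuous_intros)
  qed
  ultimately show "cvel (%t. psi (a t)) v t" by (simp add: cvel_def gvel_def)
 qed
qed

lemma funpow_double_commute:
 fixes x y :: 'g
 assumes "x + y = y + x"
 shows "((%z. z + z) ^^ n) (x + y) = ((%z. z + z) ^^ n) x + ((%z. z + z) ^^ n) y"
 using assms
proof (induction n arbitrary: x y)
 case (Suc n)
 have "(x + y) + (x + y) = (x + x) + (y + y)" by (metis Suc.prems add.assoc)
 moreover have "(x + x) + (y + y) = (y + y) + (x + x)" by (metis Suc.prems add.assoc)
 ultimately show ?case using Suc.IH[of "x + x" "y + y"] by (simp add: funpow_Suc_right del: funpow.simps)
qed simp

text \<open>
 The local integral curve is a local homomorphism by uniqueness; it is extended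
 to the whole line by \<open>gamma t = 2\<^sup>n gamma (t / 2\<^sup>n)\<close>, written with repeated doubling.
\<close>

lemma one_parameter_subgroup_exists:
 obtains gamma where "!!s t. gamma (s + t) = gamma s + gamma t" "gvel gamma v"
proof -
 obtain tau g where tau: "0 < tau" and g: "g 0 = 0" "!!t. \<bar>t\<bar> < tau ==> cvel g v t"
  by (rule local_integral_curve[of v]) blast
 have add: "g (s + t) = g s + g t" if "\<bar>s\<bar> < tau/2" "\<bar>t\<bar> < tau/2" for s t
 proof (rule cvel_line_unique[of t "%t. g (s + t)" "%_. v" "%t. g s + g t"])
  fix u assume "u : closed_segment 0 t"
  hence "\<bar>u\<bar> < tau/2" using that by (auto simp: closed_segment_eq_real_ivl split: if_splits)
  hence "cvel g v (s + 1*u)" "cvel g v u" using that g by (intro g; simp)+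
  thus "cvel (%t. g (s + t)) v u" "cvel (%t. g s + g t) v u"
   using cvel_affine[of g v s 1 u] cvel_left_translate by auto
 qed (use g in simp)
 let ?D = "%z::'g. z + z"
 let ?ok = "%t n. \<bar>t\<bar>/2 ^ n < tau/2"
 have mono: "?ok t (n + k)" if "?ok t n" for t n k
 proof -
  have "\<bar>t\<bar>/2 ^ (n + k) <= \<bar>t\<bar>/2 ^ n" by (intro divide_left_mono) (auto intro: power_increasing)
  thus ?thesis using that by linarith
 qed
 have indep: "(?D ^^ (n + k)) (g (t/2 ^ (n + k))) = (?D ^^ n) (g (t/2 ^ n))" if ok: "?ok t n" for t n k
 proof (induction k)
  case (Suc k)
  have "\<bar>t/2 ^ Suc (n + k)\<bar> < tau/2" using mono[OF ok, of "Suc k"] by (simp add: abs_divide)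
  from add[OF this this] have "g (t/2 ^ (n + k)) = ?D (g (t/2 ^ Suc (n + k)))" by simp
  thus ?case using Suc by (simp add: funpow_Suc_right del: funpow.simps)
 qed simp
 have ex: "EX n. ?ok t n" for t
 proof -
  obtain n where "2 * \<bar>t\<bar>/tau < 2 ^ n" using real_arch_pow[of 2 "2 * \<bar>t\<bar>/tau"] by auto
  thus ?thesis using tau by (intro exI[of _ n]) (simp add: field_simps)
 qed
 define gamma where "gamma = (%t. (?D ^^ (SOME n. ?ok t n)) (g (t/2 ^ (SOME n. ?ok t n))))"
 have gamma: "gamma t = (?D ^^ n) (g (t/2 ^ n))" if "?ok t n" for t n
 proof -
  define k where "k = (SOME n. ?ok t n)"
  have k: "?ok t k" unfolding k_def using someI_ex[OF ex] .
  show ?thesis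
   unfolding gamma_def k_def[symmetric] using indep[OF that, of k] indep[OF k, of n] by (simp add: add.commute)
 qed
 show ?thesis
 proof (rule that[of gamma])
  fix s t
  obtain k l m where klm: "?ok s k" "?ok t l" "?ok (s + t) m" using ex by metis
  let ?n = "k + l + m"
  have ok: "?ok s ?n" "?ok t ?n" "?ok (s + t) ?n"
   using mono[OF klm(1), of "l + m"] mono[OF klm(2), of "k + m"] mono[OF klm(3), of "k + l"]
   by (simp_all add: add_ac)
  hence a: "\<bar>s/2 ^ ?n\<bar> < tau/2" "\<bar>t/2 ^ ?n\<bar> < tau/2" by (simp_all add: abs_divide)
  have "g (s/2 ^ ?n) + g (t/2 ^ ?n) = g (t/2 ^ ?n) + g (s/2 ^ ?n)"
   using add[OF a] add[OF a(2,1)] by (simp add: add.commute)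
  from funpow_double_commute[OF this, of ?n] show "gamma (s + t) = gamma s + gamma t"
   unfolding gamma[OF ok(1)] gamma[OF ok(2)] gamma[OF ok(3)] using add[OF a] by (simp add: add_divide_distrib)
 next
  have "gvel g v" using g(2)[of 0] tau g(1) by (simp add: cvel_def)
  moreover have "\<forall>\<^sub>F h in nhds 0. g h = gamma h"
  proof -
   have "\<forall>\<^sub>F h in nhds 0. h : {- tau/2<..<tau/2}" using tau by (intro eventually_nhds_in_open) auto
   thus ?thesis by eventually_elim (use gamma[of _ 0] in auto)
  qed
  ultimately show "gvel gamma v" by (rule gvel_cong)
 qed
qed

lemma integral_curve_continuous:
 assumes "integral_curve A v gamma"
 shows "isCont gamma t"
 unfolding continuous_within
proof (rule topological_tendstoI)
 fix W assume W: "open W" "gamma t : W"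
 then obtain f :: "'g => real" and P K where f: "msmooth_on A UNIV f" "gamma t : P" "!!y. y : P ==> f y = 1"
  "K <= W" "!!y. y ~: K ==> f y = 0" by (rule bump) blast
 have "((%s. f (gamma s)) has_real_derivative X v f (gamma t)) (at t)"
  using assms f(1) by (simp add: integral_curve_def)
 from DERIV_isCont[OF this] have "((%s. f (gamma s)) \<longlongrightarrow> 1) (at t)"
  using f(2,3) by (simp add: continuous_within)
 from order_tendstoD(1)[OF this, of 0] have "\<forall>\<^sub>F s in at t. 0 < f (gamma s)" by simp
 thus "\<forall>\<^sub>F s in at t. gamma s : W" by eventually_elim (use f(4,5) in force)
qed

lemma integral_curve_cvel:
 assumes ic: "integral_curve A v gamma"
 shows "cvel gamma v t"
proof -
 obtain P and f :: "'g => 'e" where f: "open P" "0 : P" "msmooth_on A UNIV f" "!!y. y : P ==> f y = phi y - p0"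
  by (rule coordinates) blast
 have fx: "msmooth_on A UNIV (%y. f (- gamma t + y))"
  using msmooth_translate[OF open_UNIV f(3), of "- gamma t" 0] by simp
 have shift: "((%h. t + h) has_derivative (%h. h)) (at 0)" by (auto intro!: derivative_eq_intros)
 have "((%h. f (- gamma t + gamma (t + h)) \<bullet> i) has_derivative (%h. (h *\<^sub>R v) \<bullet> i)) (at 0)" for i
 proof -
  have l: "bounded_linear (%x::'e. x \<bullet> i)" by (rule bounded_linear_inner_left)
  have "X v (%y. f (- gamma t + y) \<bullet> i) (gamma t) = X v (%y. f (- gamma t + y)) (gamma t) \<bullet> i"
   by (rule X_linear_comp[OF l open_UNIV fx]) simp
  also have "... = v \<bullet> i" unfolding X_translate using X_coordinates[OF f(1,2,4)] by simp
  finally have "((%s. f (- gamma t + gamma s) \<bullet> i) has_real_derivative v \<bullet> i) (at (t + 0))"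
   using ic[unfolded integral_curve_def, THEN conjunct2, rule_format, OF msmooth_linear_comp[OF l open_UNIV fx], of t]
   by simp
  hence "((%s. f (- gamma t + gamma s) \<bullet> i) has_derivative (%h. (v \<bullet> i)*h)) (at (t + 0))"
   by (simp add: has_field_derivative_def)
  from has_derivative_compose[OF shift this] show ?thesis by (simp add: mult.commute)
 qed
 hence 1: "((%h. f (- gamma t + gamma (t + h))) has_derivative (%h. h *\<^sub>R v)) (at 0)"
  by (subst has_derivative_componentwise_within) blast
 have "isCont (%h. t + h) 0" by (intro continuous_intros)
 moreover have "isCont gamma (t + 0)" by (rule integral_curve_continuous[OF ic])
 ultimately have "isCont (%h. gamma (t + h)) 0" by (rule isCont_o2)
 hence c: "isCont (%h. - gamma t + gamma (t + h)) 0" by (intro continuous_intros)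
 hence ev: "\<forall>\<^sub>F h in at 0. - gamma t + gamma (t + h) : P"
  using topological_tendstoD[OF _ f(1)] f(2) unfolding continuous_within by fastforce
 have "((%h. p0 + f (- gamma t + gamma (t + h))) has_derivative (%h. h *\<^sub>R v)) (at 0)"
  using has_derivative_add[OF has_derivative_const 1, of p0] by simp
 hence "((%h. phi (- gamma t + gamma (t + h))) has_derivative (%h. h *\<^sub>R v)) (at 0)"
  by (rule has_derivative_transform_eventually)
   (use ev f(2,4) in \<open>auto elim!: eventually_mono\<close>)
 thus ?thesis using c by (simp add: cvel_def gvel_def has_vector_derivative_def)
qed

lemma hom_cvel:
 assumes "!!s t. gamma (s + t) = gamma s + gamma t" "gvel gamma v"
 shows "cvel gamma v t"
 using assms by (simp add: cvel_def add.assoc[symmetric])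

lemma integral_curve_eq:
 assumes "!!s t. gamma (s + t) = gamma s + gamma t" "gvel gamma v"
 shows "integral_curve A v c \<longleftrightarrow> c = gamma"
proof
 assume c: "integral_curve A v c"
 have "c 0 = gamma 0" using c assms(2) by (simp add: integral_curve_def gvel_def)
 thus "c = gamma"
  using cvel_line_unique[of _ c "%_. v" gamma] integral_curve_cvel[OF c] hom_cvel[OF assms] by blast
next
 have "integral_curve A v gamma"
  unfolding integral_curve_def
 proof (intro conjI allI impI)
  show "gamma 0 = 0" using assms(2) by (simp add: gvel_def)
  show "((%s. f (gamma s)) has_real_derivative X v f (gamma t)) (at t)" if "msmooth_on A UNIV f" for f t
   using cvel_X[OF open_UNIV that _ hom_cvel[OF assms]]
   by (simp add: has_real_derivative_iff_has_vector_derivative)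
 qed
 thus "integral_curve A v c" if "c = gamma" using that by simp
qed

abbreviation E :: "'e => 'g" where "E == lie_exp A"

lemma lie_exp_eq:
 assumes "!!s t. gamma (s + t) = gamma s + gamma t" "gvel gamma v"
 shows "gamma t = E (t *\<^sub>R v)"
proof -
 define delta where "delta = (%s. gamma (0 + t * s))"
 have "cvel delta (t *\<^sub>R v) 0" unfolding delta_def by (rule cvel_affine[OF hom_cvel[OF assms]])
 moreover have "gamma 0 = 0" using assms(2) by (simp add: gvel_def)
 ultimately have "gvel delta (t *\<^sub>R v)" by (simp add: cvel_def delta_def)
 hence "integral_curve A (t *\<^sub>R v) c \<longleftrightarrow> c = delta" for c
  by (intro integral_curve_eq) (simp_all add: delta_def distrib_left assms(1))
 thus ?thesis by (simp add: lie_exp_def delta_def)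
qed

lemma E_add: "E ((s + t) *\<^sub>R v) = E (s *\<^sub>R v) + E (t *\<^sub>R v)"
 and gvel_E: "gvel (%t. E (t *\<^sub>R v)) v"
proof -
 obtain gamma where gamma: "!!s t. gamma (s + t) = gamma s + gamma t" "gvel gamma v" by (rule one_parameter_subgroup_exists) blast
 have eq: "gamma = (%t. E (t *\<^sub>R v))" using lie_exp_eq[OF gamma] by (rule ext)
 show "E ((s + t) *\<^sub>R v) = E (s *\<^sub>R v) + E (t *\<^sub>R v)" "gvel (%t. E (t *\<^sub>R v)) v"
  using gamma(1)[of s t] gamma(2) unfolding eq by auto
qed

lemma cvel_E: "cvel (%t. E (t *\<^sub>R v)) v t"
 by (rule hom_cvel[OF E_add gvel_E])

lemma E_0 [simp]: "E 0 = 0"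
 using gvel_E[of 0] by (simp add: gvel_def)

lemma E_minus: "E (- v) = - E v"
proof -
 have "E v + E (- v) = 0" using E_add[of 1 "- 1" v] by simp
 from minus_unique[OF this] show ?thesis by simp
qed

end

section \<open>The graded Lie algebra of a stratified group\<close>

locale stratified =
 fixes A :: "('g::{topological_group_add, t2_space, second_countable_topology}, 'e::euclidean_space) chart set"
  and nu :: nat and \<gg> :: "nat => 'e set"
 assumes strat: "stratified_group A nu \<gg>"
begin

sublocale lie_grp A
 using strat by unfold_locales (simp add: stratified_group_def)

definition layer :: "nat => 'e set" where
 "layer k = (if k : {1..nu} then \<gg> k else {0})"

definition proj :: "nat => 'e => 'e" where
 "proj k Y = (THE y. layer_decomp \<gg> nu Y y) k"

lemma subspace_layer: "subspace (layer k)"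
 using strat by (auto simp: stratified_group_def layer_def)

lemma layer_decomp_iff: "layer_decomp \<gg> nu Y y \<longleftrightarrow> (ALL k. y k : layer k) & Y = (\<Sum>k=1..nu. y k)"
 by (auto simp: layer_decomp_def layer_def)

lemma layer_decomp_proj: "layer_decomp \<gg> nu Y (%k. proj k Y)"
proof -
 have "\<exists>!y. layer_decomp \<gg> nu Y y" using strat by (simp add: stratified_group_def)
 from theI'[OF this] show ?thesis by (simp add: proj_def)
qed

lemma proj_layer: "proj k Y : layer k" and proj_sum: "Y = (\<Sum>k=1..nu. proj k Y)"
 using layer_decomp_proj[of Y] by (auto simp: layer_decomp_iff)

lemma sum_proj [simp]: "(\<Sum>k=Suc 0..nu. proj k Y) = Y"
 using proj_sum[of Y] by simp

lemma proj_eqI: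
 assumes "!!k. y k : layer k" "Y = (\<Sum>k=1..nu. y k)"
 shows "proj k Y = y k"
proof -
 have "\<exists>!y. layer_decomp \<gg> nu Y y" using strat by (simp add: stratified_group_def)
 moreover have "layer_decomp \<gg> nu Y y" using assms by (simp add: layer_decomp_iff)
 ultimately have "(THE y. layer_decomp \<gg> nu Y y) = y" by blast
 thus ?thesis by (simp add: proj_def)
qed

lemma linear_proj: "linear (proj k)"
proof (rule linearI)
 fix X Y :: 'e and c :: real
 show "proj k (X + Y) = proj k X + proj k Y"
  by (rule proj_eqI[of "%k. proj k X + proj k Y"])
   (auto simp: sum.distrib intro: subspace_add[OF subspace_layer] proj_layer)
 show "proj k (c *\<^sub>R X) = c *\<^sub>R proj k X"
  by (rule proj_eqI[of "%k. c *\<^sub>R proj k X"])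
   (auto simp: scaleR_sum_right[symmetric] intro: subspace_scale[OF subspace_layer] proj_layer)
qed

lemma proj_of_layer:
 assumes "Y : layer j"
 shows "proj k Y = (if k = j then Y else 0)"
proof (rule proj_eqI[of "%k. if k = j then Y else 0"])
 show "(if k = j then Y else 0) : layer k" for k using assms subspace_0[OF subspace_layer] by simp
 show "Y = (\<Sum>k=1..nu. if k = j then Y else 0)"
  using assms by (auto simp: layer_def split: if_splits)
qed

lemma bounded_linear_proj: "bounded_linear (proj k)"
 using linear_proj linear_conv_bounded_linear by blast

lemma proj_outside: "k ~: {1..nu} ==> proj k Y = 0"
 using proj_layer[of k Y] by (auto simp: layer_def)

lemma bracket_first_layer:
 assumes "u : layer 1" "v : layer j"
 shows "ad u v : layer (1 + j)"
proof -
 have 1: "1 : {1..nu}" using strat by (simp add: stratified_group_def)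
 consider "j ~: {1..nu}" | "j = nu" "1 <= j" | "1 <= j" "j < nu" by fastforce
 thus ?thesis
 proof cases
  case 1
  hence "v = 0" using assms(2) by (auto simp: layer_def split: if_splits)
  thus ?thesis using linear_0[OF ad_linear_right] subspace_0[OF subspace_layer] by simp
 next
  case 2
  hence "lie_bracket A u v = 0" using assms 1 strat by (auto simp: stratified_group_def layer_def)
  thus ?thesis using subspace_0[OF subspace_layer] by (simp add: lie_bracket_ad)
 next
  case 3
  hence eq: "span {lie_bracket A u v | u v. u : \<gg> 1 & v : \<gg> j} = \<gg> (1 + j)"
   using strat unfolding stratified_group_def by (auto dest: bspec[of _ _ "1 + j"])
  have mem: "lie_bracket A u v : {lie_bracket A u v | u v. u : \<gg> 1 & v : \<gg> j}"
  proof -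
   have "u : \<gg> 1" "v : \<gg> j" using assms 1 3 by (auto simp: layer_def split: if_splits)
   thus ?thesis by blast
  qed
  show ?thesis using span_base[OF mem] 3 unfolding eq by (simp add: lie_bracket_ad layer_def)
 qed
qed

text \<open>By the Jacobi identity the relations for the first layer propagate to all layers.\<close>

lemma bracket_layers: "u : layer i ==> v : layer j ==> ad u v : layer (i + j)"
proof (induction i arbitrary: u v j)
 case 0
 hence "u = 0" by (simp add: layer_def)
 thus ?case using linear_0[OF ad_linear_left] subspace_0[OF subspace_layer] by simp
next
 case (Suc i)
 show ?case
 proof (cases "i = 0")
  case True
  thus ?thesis using Suc.prems bracket_first_layer by simp
 next
  case False
  show ?thesis
  proof (cases "Suc i <= nu")
   case True
   hence "span {lie_bracket A u v | u v. u : \<gg> 1 & v : \<gg> i} = \<gg> (Suc i)"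
    using strat False unfolding stratified_group_def by (auto dest: bspec[of _ _ "Suc i"])
   hence "u : span {ad a b | a b. a : layer 1 & b : layer i}"
    using Suc.prems(1) True False by (simp add: layer_def lie_bracket_ad)
   hence "ALL j. ALL v:layer j. ad u v : layer (Suc i + j)"
   proof (rule span_induct[where P="%u. ALL j. ALL v:layer j. ad u v : layer (Suc i + j)"])
    show "subspace {u. ALL j. ALL v:layer j. ad u v : layer (Suc i + j)}"
     unfolding subspace_def using subspace_layer
     by (auto simp: linear_0[OF ad_linear_left] linear_add[OF ad_linear_left] linear_cmul[OF ad_linear_left]
       intro: subspace_0 subspace_add subspace_scale)
    fix x assume "x : {ad a b | a b. a : layer 1 & b : layer i}"
    then obtain a b where ab: "x = ad a b" "a : layer 1" "b : layer i" by blast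
    have "ad x v : layer (Suc i + j)" if v: "v : layer j" for j v
    proof -
     have "ad a (ad b v) : layer (1 + (i + j))" by (intro bracket_first_layer ab Suc.IH v)
     moreover have "ad b (ad a v) : layer (i + (1 + j))" by (intro bracket_first_layer ab Suc.IH v)
     ultimately show ?thesis unfolding ab(1) jacobi using subspace_diff[OF subspace_layer] by simp
    qed
    thus "ALL j. ALL v:layer j. ad x v : layer (Suc i + j)" by blast
   qed
   thus ?thesis using Suc.prems(2) by blast
  next
   case False
   hence "u = 0" using Suc.prems(1) by (simp add: layer_def)
   thus ?thesis using linear_0[OF ad_linear_left] subspace_0[OF subspace_layer] by simp
  qed
 qed
qed

lemma ad_sum_sum: "ad (\<Sum>i\<in>I. u i) (\<Sum>j\<in>J. v j) = (\<Sum>i\<in>I. \<Sum>j\<in>J. ad (u i) (v j))"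
 by (simp only: linear_sum[OF ad_linear_left]) (simp only: linear_sum[OF ad_linear_right])

abbreviation dil :: "real => 'e => 'e" where "dil == algebra_dilation nu \<gg>"

lemma dil_proj: "dil r Y = (\<Sum>k=1..nu. r ^ k *\<^sub>R proj k Y)"
 by (simp add: algebra_dilation_def proj_def)

lemma linear_dil: "linear (dil r)"
 unfolding dil_proj[abs_def]
 by (auto intro!: linear_compose_sum linear_compose_scale_right linear_proj)

lemma bounded_linear_dil: "bounded_linear (dil r)"
 using linear_dil linear_conv_bounded_linear by blast

lemma proj_dil: "proj k (dil r Y) = r ^ k *\<^sub>R proj k Y"
 by (rule proj_eqI[of "%k. r ^ k *\<^sub>R proj k Y"])
  (auto simp: dil_proj intro: subspace_scale[OF subspace_layer] proj_layer)

lemma dil_layer: "Y : layer k ==> dil r Y = r ^ k *\<^sub>R Y"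
 by (auto simp: dil_proj proj_of_layer if_distrib[of "%x. _ *\<^sub>R x"] layer_def cong: if_cong split: if_splits)

lemma dil_dil: "dil r (dil s Y) = dil (r * s) Y"
 by (simp add: dil_proj[of r] dil_proj[of "r * s"] proj_dil power_mult_distrib)

lemma dil_1 [simp]: "dil 1 Y = Y"
 by (simp add: dil_proj)

lemma dil_ad: "dil r (ad u v) = ad (dil r u) (dil r v)"
proof -
 have "ad (dil r u) (dil r v) = (\<Sum>i=1..nu. \<Sum>j=1..nu. ad (r ^ i *\<^sub>R proj i u) (r ^ j *\<^sub>R proj j v))"
  unfolding dil_proj by (rule ad_sum_sum)
 also have "... = (\<Sum>i=1..nu. \<Sum>j=1..nu. dil r (ad (proj i u) (proj j v)))"
  by (intro sum.cong refl)
   (simp add: dil_layer[OF bracket_layers[OF proj_layer proj_layer]] power_add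
    linear_cmul[OF ad_linear_left] linear_cmul[OF ad_linear_right])
 also have "... = dil r (ad (\<Sum>i=1..nu. proj i u) (\<Sum>j=1..nu. proj j v))"
  unfolding ad_sum_sum by (simp add: linear_sum[OF linear_dil])
 finally show ?thesis by simp
qed

text \<open>The descending central filtration, on which brackets act nilpotently.\<close>

definition FF :: "nat => 'e set" where
 "FF k = {Y. \<forall>j<k. proj j Y = 0}"

lemma subspace_FF: "subspace (FF k)"
 unfolding FF_def subspace_def by (simp add: linear_0[OF linear_proj] linear_add[OF linear_proj] linear_cmul[OF linear_proj])

lemma FF_1 [simp]: "Y : FF (Suc 0)" "Y : FF 0"
 by (simp_all add: FF_def proj_outside)

lemma FF_zero: "Y : FF (Suc nu) ==> Y = 0"
 by (subst proj_sum) (simp add: FF_def)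

lemma FF_mono: "j <= k ==> FF k <= FF j"
 by (auto simp: FF_def)

lemma FF_sum: "Y : FF k ==> Y = (\<Sum>j\<in>{1..nu} Int {k..}. proj j Y)"
 by (subst proj_sum[of Y], rule sum.mono_neutral_right) (auto simp: FF_def not_le)

lemma ad_FF:
 assumes "u : FF i" "v : FF j"
 shows "ad u v : FF (i + j)"
proof -
 have "ad (proj a u) (proj b v) : FF (i + j)" if "i <= a" "j <= b" for a b
  using proj_of_layer[OF bracket_layers[OF proj_layer proj_layer], of _ a u b v] that by (auto simp: FF_def)
 hence "ad (\<Sum>j\<in>{1..nu} Int {i..}. proj j u) (\<Sum>k\<in>{1..nu} Int {j..}. proj k v) : FF (i + j)"
  unfolding ad_sum_sum by (intro subspace_sum[OF subspace_FF]) auto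
 thus ?thesis using FF_sum[OF assms(1)] FF_sum[OF assms(2)] by simp
qed

abbreviation adn :: "'e => nat => 'e => 'e" where
 "adn Z n V == (ad Z ^^ n) V"

lemma linear_adn: "linear (adn Z n)"
 by (induction n) (auto simp: o_def intro: linear_compose[unfolded o_def] ad_linear_right linear_id[unfolded id_def])

lemma adn_FF: "V : FF k ==> adn Z n V : FF (k + n)"
proof (induction n)
 case (Suc n)
 thus ?case using ad_FF[of Z "Suc 0" "adn Z n V" "k + n"] by simp
qed simp

lemma adn_nilpotent: "n >= nu ==> adn Z n V = 0"
 using adn_FF[of V "Suc 0" n Z] FF_mono[of "Suc nu" "Suc n"] by (auto intro: FF_zero)

lemma adn_self: "adn Z (Suc n) Z = 0"
 by (simp add: funpow_Suc_right linear_0[OF linear_adn] del: funpow.simps)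

lemma dil_adn: "dil r (adn Z n V) = adn (dil r Z) n (dil r V)"
 by (induction n) (simp_all add: dil_ad)

lemma continuous_on_adn:
 "continuous_on S f ==> continuous_on S g ==> continuous_on S (%s. adn (f s) n (g s))"
 by (induction n) (auto intro: bounded_bilinear.continuous_on[OF bounded_bilinear_ad])

lemma adn_diff_FF:
 assumes "Z - Z' : FF k" "V - V' : FF k"
 shows "adn Z (Suc n) V - adn Z' (Suc n) V' : FF (Suc k)"
proof -
 have step: "ad Z a - ad Z' a' : FF (Suc k)" if "a - a' : FF k" for a a'
 proof -
  have "ad Z a - ad Z' a' = ad (Z - Z') a + ad Z' (a - a')"
   by (simp add: linear_diff[OF ad_linear_left] linear_diff[OF ad_linear_right])
  moreover have "ad (Z - Z') a : FF (Suc k)" using ad_FF[OF assms(1), of a "Suc 0"] by simp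
  moreover have "ad Z' (a - a') : FF (Suc k)" using ad_FF[OF _ that, of Z' "Suc 0"] by simp
  ultimately show ?thesis using subspace_add[OF subspace_FF] by simp
 qed
 show ?thesis
 proof (induction n)
  case 0
  thus ?case using step[OF assms(2)] by simp
 next
  case (Suc n)
  thus ?case using step[of "adn Z (Suc n) V"] FF_mono[of k "Suc k"] by auto
 qed
qed

section \<open>The differential of the exponential map\<close>

lemma Ad_E_derivative: "((%s. Ad (E (s *\<^sub>R Z)) u) has_vector_derivative Ad (E (s *\<^sub>R Z)) (ad Z u)) (at s)"
proof -
 have bl: "bounded_linear (Ad x)" for x using linear_Ad linear_conv_bounded_linear by blast
 have "((%h. Ad (E (h *\<^sub>R Z)) u) has_vector_derivative ad Z u) (at (s - s))"
  using gvel_ad[OF gvel_E] by simp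
 moreover have "((%x. x - s) has_vector_derivative 1) (at s)" by (auto intro!: derivative_eq_intros)
 ultimately have "((%x. Ad (E ((x - s) *\<^sub>R Z)) u) has_vector_derivative ad Z u) (at s)"
  using vector_diff_chain_at[of "%x. x - s" 1 s] by (simp add: o_def)
 from bounded_linear.has_vector_derivative[OF bl[of "E (s *\<^sub>R Z)"] this]
 show ?thesis
  by (simp add: Ad_add[symmetric] E_add[symmetric] scaleR_add_left[symmetric])
qed

text \<open>
 The derivative of \<open>Ad (exp (s Z))\<close> is its composition with \<open>ad Z\<close>; the exponential series is finite,
 as \<open>ad Z\<close> is nilpotent.
\<close>

lemma Ad_E: "Ad (E (t *\<^sub>R Z)) V = (\<Sum>n\<le>nu. (t ^ n/fact n) *\<^sub>R adn Z n V)"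
proof -
 define a where "a = (%n s. Ad (E (s *\<^sub>R Z)) (adn Z n V))"
 define e where "e = (%n s. (t - s) ^ n/fact n)"
 define P where "P = (%s. \<Sum>n\<le>nu. e n s *\<^sub>R a n s)"
 define f where "f = (%s n. if n = 0 then 0 else e (n - 1) s *\<^sub>R a n s)"
 have a': "(a n has_vector_derivative a (Suc n) s) (at s)" for n s
  unfolding a_def using Ad_E_derivative[of Z "adn Z n V" s] by simp
 have e': "(e n has_real_derivative (if n = 0 then 0 else - e (n - 1) s)) (at s)" for n s
 proof (cases n)
  case (Suc m)
  have "((%s. (t - s) ^ Suc m) has_real_derivative - (real (Suc m)*(t - s) ^ m)) (at s)"
   by (rule derivative_eq_intros refl | simp)+
  from DERIV_cdivide[OF this, of "fact (Suc m)"] show ?thesis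
   unfolding e_def Suc by (simp only: fact_Suc of_nat_mult mult_minus_right minus_divide_left[symmetric]
    mult_divide_mult_cancel_left[OF of_nat_neq_0] nat.simps if_False diff_Suc_1)
 qed (simp add: e_def)
 have "(P has_vector_derivative 0) (at s)" for s
 proof -
  have "((%s. e n s *\<^sub>R a n s) has_vector_derivative f s (Suc n) - f s n) (at s)" for n
   using has_vector_derivative_scaleR[OF e'[of n s] a'[of n s]] by (cases n) (simp_all add: f_def)
  hence "(P has_vector_derivative (\<Sum>n\<le>nu. f s (Suc n) - f s n)) (at s)"
   unfolding P_def by (intro has_vector_derivative_sum)
  moreover have "(\<Sum>n\<le>nu. f s (Suc n) - f s n) = f s (Suc nu) - f s 0"
   using sum_lessThan_telescope[of "f s" "Suc nu"] by (simp only: lessThan_Suc_atMost)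
  moreover have "f s (Suc nu) = 0"
   unfolding f_def a_def using adn_nilpotent[of "Suc nu" Z V] linear_0[OF linear_Ad] by simp
  moreover have "f s 0 = 0" by (simp add: f_def)
  ultimately show ?thesis by simp
 qed
 then obtain c where "!!s. s : UNIV ==> P s = c"
  using has_derivative_zero_constant[of UNIV P] by (auto simp: has_vector_derivative_def)
 hence "P t = P 0" by simp
 moreover have "P t = a 0 t"
 proof -
  have "P t = (\<Sum>n\<in>{0}. e n t *\<^sub>R a n t)"
   unfolding P_def by (rule sum.mono_neutral_right) (auto simp: e_def)
  thus ?thesis by (simp add: e_def)
 qed
 ultimately show ?thesis by (simp add: P_def a_def e_def)
qed

text \<open>The series of \<open>(1 - exp (- ad Z)) / ad Z\<close>, the differential of \<open>exp\<close> in the left trivialization.\<close>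

definition Dexp :: "'e => 'e => 'e" where
 "Dexp Z V = (\<Sum>n\<le>nu. ((- 1) ^ n/fact (Suc n)) *\<^sub>R adn Z n V)"

definition Kexp :: "'e => 'e => 'e" where
 "Kexp Z V = - (\<Sum>n<nu. ((- 1) ^ Suc n/fact (Suc (Suc n))) *\<^sub>R adn Z (Suc n) V)"

lemma Dexp_Kexp: "Dexp Z V = V - Kexp Z V"
 unfolding Dexp_def Kexp_def
 by (simp add: sum.atMost_shift del: funpow.simps fact_Suc)

lemma linear_Dexp: "linear (Dexp Z)"
 unfolding Dexp_def[abs_def] by (auto intro!: linear_compose_sum linear_compose_scale_right linear_adn)

lemma continuous_on_Dexp:
 "continuous_on S f ==> continuous_on S g ==> continuous_on S (%s. Dexp (f s) (g s))"
 unfolding Dexp_def by (intro continuous_intros continuous_on_adn)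

lemma continuous_on_Kexp:
 "continuous_on S f ==> continuous_on S g ==> continuous_on S (%s. Kexp (f s) (g s))"
 unfolding Kexp_def by (intro continuous_intros continuous_on_adn)

lemma Kexp_diff_FF:
 assumes "Z - Z' : FF k" "V - V' : FF k"
 shows "Kexp Z V - Kexp Z' V' : FF (Suc k)"
proof -
 have "Kexp Z' V' - Kexp Z V = (\<Sum>n<nu. ((- 1) ^ Suc n/fact (Suc (Suc n))) *\<^sub>R (adn Z (Suc n) V - adn Z' (Suc n) V'))"
  unfolding Kexp_def by (simp add: sum_subtractf scaleR_diff_right del: funpow.simps fact_Suc power_Suc)
 also have "... : FF (Suc k)"
  by (intro subspace_sum[OF subspace_FF] subspace_scale[OF subspace_FF] adn_diff_FF assms)
 finally show ?thesis using subspace_neg[OF subspace_FF] by force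
qed

lemma Kexp_FF: "V : FF k ==> Kexp Z V : FF (Suc k)"
 unfolding Kexp_def
proof (intro subspace_neg[OF subspace_FF] subspace_sum[OF subspace_FF] subspace_scale[OF subspace_FF])
 fix n assume "V : FF k"
 from adn_FF[OF this, of "Suc n" Z] show "adn Z (Suc n) V : FF (Suc k)"
  using FF_mono[of "Suc k" "k + Suc n"] by auto
qed

lemma dil_Kexp: "dil r (Kexp Z V) = Kexp (dil r Z) (dil r V)"
 unfolding Kexp_def
 by (simp add: linear_neg[OF linear_dil] linear_sum[OF linear_dil] linear_cmul[OF linear_dil] dil_adn del: funpow.simps)

lemma Dexp_injective: "Dexp Z V = 0 ==> V = 0"
proof -
 assume "Dexp Z V = 0"
 hence V: "V = Kexp Z V" by (simp add: Dexp_Kexp)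
 have "V : FF k" for k
 proof (induction k)
  case (Suc k)
  thus ?case using Kexp_FF[OF Suc, of Z] V by simp
 qed simp
 thus "V = 0" by (rule FF_zero)
qed

lemma Dexp_lower_bound: "\<exists>kappa>0. ALL Z V. norm Z <= R --> kappa*norm V <= norm (Dexp Z V)"
proof (cases "cball (0::'e) R = {}")
 case True
 hence "R < 0" by simp
 hence "\<not> norm Z <= R" for Z :: 'e using norm_ge_zero[of Z] by linarith
 thus ?thesis by (intro exI[of _ 1]) simp
next
 case False
 let ?S = "cball (0::'e) R \<times> sphere (0::'e) 1"
 have "compact ?S" by (intro compact_Times compact_cball compact_sphere)
 moreover have "?S ~= {}" using False vector_choose_size[of 1] by auto
 moreover have "continuous_on ?S (%s. norm (Dexp (fst s) (snd s)))"
  by (intro continuous_intros continuous_on_Dexp)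
 ultimately have "EX s:?S. ALL s':?S. norm (Dexp (fst s) (snd s)) <= norm (Dexp (fst s') (snd s'))"
  by (rule continuous_attains_inf)
 then obtain s where s: "s : ?S" "!!s'. s' : ?S ==> norm (Dexp (fst s) (snd s)) <= norm (Dexp (fst s') (snd s'))"
  by blast
 have "snd s ~= 0" using s(1) by auto
 hence pos: "norm (Dexp (fst s) (snd s)) > 0" using Dexp_injective by auto
 have "norm (Dexp (fst s) (snd s))*norm V <= norm (Dexp Z V)" if "norm Z <= R" for Z V
 proof (cases "V = 0")
  case False
  have "norm (Dexp (fst s) (snd s)) <= norm (Dexp Z ((1/norm V) *\<^sub>R V))"
   using s(2)[of "(Z, (1/norm V) *\<^sub>R V)"] that False by simp
  thus ?thesis using False by (simp add: linear_cmul[OF linear_Dexp] field_simps)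
 qed simp
 thus ?thesis using pos by blast
qed

lemma adn_bound: "\<exists>C\<ge>0. ALL Y V n. norm Y <= R --> n <= nu --> norm (adn Y n V) <= C*norm V"
proof -
 obtain M where M: "M >= 0" "!!u v. norm (ad u v) <= norm u*norm v * M"
  using bounded_bilinear.nonneg_bounded[OF bounded_bilinear_ad] by blast
 let ?q = "max 1 (M * \<bar>R\<bar>)"
 have q: "norm (adn Y n V) <= ?q ^ n*norm V" if "norm Y <= R" for Y V n
 proof (induction n)
  case (Suc n)
  have "norm (adn Y (Suc n) V) <= norm Y*norm (adn Y n V)*M" using M(2) by simp
  also have "... = (M*norm Y)*norm (adn Y n V)" by simp
  also have "... <= ?q*(?q ^ n*norm V)"
   using that M(1) by (intro mult_mono Suc) (auto intro!: max.coboundedI2 mult_left_mono)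
  finally show ?case by simp
 qed simp
 have "norm (adn Y n V) <= ?q ^ nu*norm V" if "norm Y <= R" "n <= nu" for Y V n
  using q[OF that(1), of n V] power_increasing[OF that(2), of ?q] by (meson max.cobounded1 mult_right_mono norm_ge_zero order_trans)
 thus ?thesis by (intro exI[of _ "?q ^ nu"]) auto
qed

end

context lie_grp
begin

lemma X_bounded:
 assumes f: "msmooth_on A UNIV f" and K: "compact K" "!!y. y ~: K ==> f y = 0"
 shows "\<exists>C\<ge>0. ALL x v. norm (X v f x) <= C*norm v"
proof -
 have "EX B. ALL x:K. norm (X i f x) <= B" for i
  using compact_imp_bounded[OF compact_continuous_image[OF continuous_on_subset[OF msmooth_continuous[OF open_UNIV msmooth_X[OF open_UNIV f]]] K(1)]]
  by (auto simp: bounded_iff)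
 then obtain B where B: "!!i x. x : K ==> norm (X i f x) <= B i" by metis
 have "X v f x = 0" if "x ~: K" for x v
  using X_cong[of "- K" x f "%_. 0" v] compact_imp_closed[OF K(1)] K(2) that by auto
 hence B': "norm (X i f x) <= \<bar>B i\<bar>" for i x using B[of x i] by (cases "x : K") auto
 have "norm (X v f x) <= (\<Sum>i\<in>Basis. \<bar>B i\<bar>)*norm v" for x v
 proof -
  have lin: "linear (%v. X v f x)" by (rule linear_X[OF open_UNIV f]) simp
  have "X v f x = X (\<Sum>i\<in>Basis. (v \<bullet> i) *\<^sub>R i) f x" by (simp only: euclidean_representation)
  also have "... = (\<Sum>i\<in>Basis. (v \<bullet> i) *\<^sub>R X i f x)" by (simp only: linear_sum[OF lin] linear_cmul[OF lin])
  also have "norm ... <= (\<Sum>i\<in>Basis. norm v * \<bar>B i\<bar>)"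
  proof (rule sum_norm_le)
   fix i :: 'e assume "i : Basis"
   thus "norm ((v \<bullet> i) *\<^sub>R X i f x) <= norm v * \<bar>B i\<bar>"
    using Basis_le_norm[of i v] B' by (auto intro!: mult_mono)
  qed
  finally show ?thesis by (simp add: sum_distrib_left mult.commute)
 qed
 thus ?thesis by (intro exI[of _ "\<Sum>i\<in>Basis. \<bar>B i\<bar>"]) (auto intro: sum_nonneg)
qed

lemma cvel_mean_value:
 fixes f :: "'g => 'b::real_normed_vector"
 assumes f: "msmooth_on A UNIV f" and c: "!!s. s : {0..1} ==> cvel c (y s) s"
  and q: "!!s. s : {0..1} ==> (q has_vector_derivative y' s) (at s)"
  and B: "!!s. s : {0..1} ==> norm (X (y s) f (c s) - y' s) <= B" and t: "t : {0..1}"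
 shows "norm ((f (c t) - q t) - (f (c 0) - q 0)) <= B"
proof -
 have B0: "0 <= B" using B[of 0] norm_ge_zero by (meson atLeastAtMost_iff order_trans zero_le_one order_refl)
 have d: "((%s. f (c s) - q s) has_derivative (%h. h *\<^sub>R (X (y s) f (c s) - y' s))) (at s within {0..1})" if "s : {0..1}" for s
  using has_vector_derivative_diff[OF cvel_X[OF open_UNIV f _ c[OF that]] q[OF that]]
  by (simp add: has_vector_derivative_def has_derivative_at_withinI)
 have "norm ((f (c t) - q t) - (f (c 0) - q 0)) <= B*norm (t - 0)"
 proof (rule differentiable_bound[OF _ d])
  show "onorm (%h. h *\<^sub>R (X (y s) f (c s) - y' s)) <= B" if "s : {0..1}" for s
   by (rule onorm_bound[OF B0]) (use mult_left_mono[OF B[OF that] abs_ge_zero] in \<open>simp add: mult.commute\<close>)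
 qed (use t in auto)
 also have "... <= B*1" using t B0 by (intro mult_left_mono) auto
 finally show ?thesis by simp
qed

text \<open>
 Two smooth functions with bounded derivatives detect that a point is near the identity: without
 \<open>\<beta>\<close> the coordinate function could be small far away.
\<close>

lemma neighbourhood_of_identity:
 assumes "open W" "0 : W"
 obtains \<beta> :: "'g => real" and f :: "'g => 'e" and C eta where "C >= 0" "0 < eta" "eta < 1"
  "msmooth_on A UNIV f" "msmooth_on A UNIV \<beta>" "f 0 = 0" "\<beta> 0 = 1" "!!v. X v f 0 = v"
  "!!x v. norm (X v f x) <= C*norm v" "!!x v. norm (X v \<beta> x) <= C*norm v"
  "!!x. norm (f x) < eta ==> 1 - \<beta> x < eta ==> x : W & f x = phi x - p0"
proof -
 obtain P \<beta> and f :: "'g => 'e" and K where f: "open P" "0 : P" "P <= K" "compact K" "K <= chU"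
  "msmooth_on A UNIV f" "!!y. y : P ==> f y = phi y - p0" "!!y. y : chU ==> f y = \<beta> y *\<^sub>R (phi y - p0)"
  "msmooth_on A UNIV \<beta>" "!!y. y : P ==> \<beta> y = 1" "!!y. y ~: K ==> \<beta> y = (0::real)" "!!y. y ~: K ==> f y = 0"
  by (rule coordinates) blast
 obtain C1 where C1: "C1 >= 0" "!!x v. norm (X v f x) <= C1*norm v" using X_bounded[OF f(6,4,12)] by blast
 obtain C2 where C2: "C2 >= 0" "!!x v. norm (X v \<beta> x) <= C2*norm v" using X_bounded[OF f(9,4,11)] by blast
 have "open {a : phi ` chU. psi a : W Int P}" by (rule preimage_open[OF idc(2,4)]) (use assms f in auto)
 moreover have "p0 : {a : phi ` chU. psi a : W Int P}" using assms f by auto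
 ultimately obtain r where r: "r > 0" "ball p0 r <= {a : phi ` chU. psi a : W Int P}" using openE by blast
 define eta where "eta = min (1/2) (r/2)"
 show ?thesis
 proof (rule that[of "max C1 C2" eta f \<beta>])
  fix x assume x: "norm (f x) < eta" "1 - \<beta> x < eta"
  hence b: "\<beta> x > 1/2" by (simp add: eta_def)
  hence xU: "x : chU" using f(5) f(11)[of x] by force
  have "\<beta> x*norm (phi x - p0) < r/2" using x b f(8)[OF xU] by (simp add: eta_def)
  moreover have "1/2*norm (phi x - p0) <= \<beta> x*norm (phi x - p0)" using b by (intro mult_right_mono) auto
  ultimately have "norm (phi x - p0) < r" by simp
  hence "phi x : ball p0 r" by (simp add: dist_norm norm_minus_commute)
  hence "psi (phi x) : W Int P" using r by blast
  thus "x : W & f x = phi x - p0" using idc(5)[OF xU] f(7) by auto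
 next
  show "norm (X v f x) <= max C1 C2*norm v" "norm (X v \<beta> x) <= max C1 C2*norm v" for x v
   by (rule order_trans[OF C1(2) mult_right_mono] order_trans[OF C2(2) mult_right_mono]; simp)+
 qed (use f r C1(1) X_coordinates[OF f(1,2,7)] in \<open>auto simp: eta_def\<close>)
qed

end

context stratified
begin

text \<open>
 The curve \<open>s \<mapsto> E (- s X) + E (s Y)\<close> starts at the identity and has the velocity
 \<open>Ad (E (- s Y)) (Y - X)\<close>, which is proportional to \<open>Y - X\<close>.  Hence it stays close to the identity,
 and its end point has approximately the coordinates \<open>Dexp Y (Y - X)\<close>.
\<close>

lemma exp_displacement:
 assumes W: "open W" "0 : W" and eps: "eps > 0"
 shows "\<exists>delta>0. ALL X Y. norm Y <= R --> norm (Y - X) < delta --> - E X + E Y : W \<and>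
  norm (phi (- E X + E Y) - p0 - Dexp Y (Y - X)) <= eps*norm (Y - X)"
proof -
 obtain C1 where C1: "C1 >= 0" "!!Y V n. norm Y <= R ==> n <= nu ==> norm (adn Y n V) <= C1*norm V"
  using adn_bound by blast
 define C where "C = (real nu + 1)*C1 + 1"
 have C: "C > 0" using C1(1) by (simp add: C_def add_nonneg_pos)
 define eps' where "eps' = eps/C"
 have eps': "eps' > 0" using eps C by (simp add: eps'_def)
 obtain \<beta> :: "'g => real" and f :: "'g => 'e" and M eta where f: "M >= 0" "0 < eta" "eta < 1"
  "msmooth_on A UNIV f" "msmooth_on A UNIV \<beta>" "f 0 = 0" "\<beta> 0 = 1" "!!v. X v f 0 = v"
  "!!x v. norm (X v f x) <= M*norm v" "!!x v. norm (X v \<beta> x) <= M*norm v"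
  "!!x. norm (f x) < eta ==> 1 - \<beta> x < eta ==> x : W & f x = phi x - p0"
  by (rule neighbourhood_of_identity[OF W]) blast
 define Q0 where "Q0 = {x. ALL i:Basis. norm (X i f x - i) < eps'/real DIM('e)}"
 have "open Q0"
 proof -
  have "Q0 = (\<Inter>i\<in>Basis. {x. norm (X i f x - i) < eps'/real DIM('e)})" by (auto simp: Q0_def)
  moreover have "open {x. norm (X i f x - i) < eps'/real DIM('e)}" for i
   by (intro open_Collect_less continuous_intros msmooth_continuous[OF open_UNIV msmooth_X[OF open_UNIV f(4)]])
  ultimately show ?thesis by auto
 qed
 moreover have "0 : Q0" using f(8) eps' by (simp add: Q0_def)
 ultimately obtain \<beta>2 :: "'g => real" and f2 :: "'g => 'e" and M2 eta2 where f2: "M2 >= 0" "0 < eta2" "eta2 < 1"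
  "msmooth_on A UNIV f2" "msmooth_on A UNIV \<beta>2" "f2 0 = 0" "\<beta>2 0 = 1"
  "!!x v. norm (X v f2 x) <= M2*norm v" "!!x v. norm (X v \<beta>2 x) <= M2*norm v"
  "!!x. norm (f2 x) < eta2 ==> 1 - \<beta>2 x < eta2 ==> x : Q0"
  by (rule neighbourhood_of_identity) blast
 have Of: "norm (X v f x - v) <= eps'*norm v" if x: "x : Q0" for x v
 proof -
  have lin: "linear (%v. X v f x)" by (rule linear_X[OF open_UNIV f(4)]) simp
  have "X v f x = X (\<Sum>i\<in>Basis. (v \<bullet> i) *\<^sub>R i) f x" by (simp only: euclidean_representation)
  also have "... = (\<Sum>i\<in>Basis. (v \<bullet> i) *\<^sub>R X i f x)" by (simp only: linear_sum[OF lin] linear_cmul[OF lin])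
  finally have "X v f x - v = (\<Sum>i\<in>Basis. (v \<bullet> i) *\<^sub>R X i f x) - (\<Sum>i\<in>Basis. (v \<bullet> i) *\<^sub>R i)"
   by (simp only: euclidean_representation)
  also have "... = (\<Sum>i\<in>Basis. (v \<bullet> i) *\<^sub>R (X i f x - i))"
   by (simp only: sum_subtractf[symmetric] scaleR_diff_right)
  also have "norm ... <= (\<Sum>i\<in>(Basis::'e set). norm v * (eps'/real DIM('e)))"
  proof (rule sum_norm_le)
   fix i :: 'e assume i: "i : Basis"
   hence "norm (X i f x - i) <= eps'/real DIM('e)" using x by (auto simp: Q0_def intro: less_imp_le)
   thus "norm ((v \<bullet> i) *\<^sub>R (X i f x - i)) <= norm v * (eps'/real DIM('e))"
    using Basis_le_norm[OF i, of v] mult_mono[of "\<bar>v \<bullet> i\<bar>" "norm v" "norm (X i f x - i)" "eps'/real DIM('e)"] by simp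
  qed
  also have "... = eps'*norm v" by simp
  finally show ?thesis .
 qed
 define delta where "delta = min eta eta2/((M + M2 + 1)*C)"
 have delta: "delta > 0" using f(1,2) f2(1,2) C by (simp add: delta_def add_nonneg_pos)
 show ?thesis
 proof (intro exI conjI allI impI)
  show "delta > 0" by fact
  fix X' Y :: 'e assume Y: "norm Y <= R" and d: "norm (Y - X') < delta"
  define V where "V = Y - X'"
  define c where "c = (%s. E (s *\<^sub>R (- X')) + E (s *\<^sub>R Y))"
  define y where "y = (%s. \<Sum>n\<le>nu. ((- s) ^ n/fact n) *\<^sub>R adn Y n V)"
  define q where "q = (%s. \<Sum>n\<le>nu. ((- 1) ^ n * s ^ Suc n/fact (Suc n)) *\<^sub>R adn Y n V)"
  have cv: "cvel c (y s) s" for s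
  proof -
   have "cvel c (Ad (- E (s *\<^sub>R Y)) (- X') + Y) s" unfolding c_def by (intro cvel_add cvel_E)
   moreover have "Ad (- E (s *\<^sub>R Y)) (- X') + Y = y s"
   proof -
    have e: "- E (s *\<^sub>R Y) = E ((- s) *\<^sub>R Y)" using E_minus[of "s *\<^sub>R Y"] by simp
    have "Ad (- E (s *\<^sub>R Y)) Y = Y"
    proof -
     have "(\<Sum>n\<le>nu. ((- s) ^ n/fact n) *\<^sub>R adn Y n Y) = (\<Sum>n\<in>{0}. ((- s) ^ n/fact n) *\<^sub>R adn Y n Y)"
     proof (rule sum.mono_neutral_right)
      show "ALL n:{..nu} - {0}. ((- s) ^ n/fact n) *\<^sub>R adn Y n Y = 0"
      proof
       fix n assume "n : {..nu} - {0}"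
       then obtain m where "n = Suc m" by (cases n) auto
       thus "((- s) ^ n/fact n) *\<^sub>R adn Y n Y = 0" by (simp only: adn_self scaleR_zero_right)
      qed
     qed auto
     thus ?thesis unfolding e Ad_E by simp
    qed
    hence "Ad (- E (s *\<^sub>R Y)) (- X') + Y = Ad (- E (s *\<^sub>R Y)) V"
     unfolding V_def by (simp add: linear_diff[OF linear_Ad] linear_neg[OF linear_Ad])
    thus ?thesis unfolding e Ad_E y_def .
   qed
   ultimately show ?thesis by simp
  qed
  have yb: "norm (y s) <= C*norm V" if "s : {0..1}" for s
  proof -
   have "norm (y s) <= (\<Sum>n\<le>nu. C1*norm V)"
    unfolding y_def
   proof (rule sum_norm_le)
    fix n assume n: "n : {..nu}"
    have "\<bar>s\<bar> ^ n <= 1" using that by (intro power_le_one) auto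
    moreover have "(1::real) <= fact n" by (rule fact_ge_1)
    ultimately have "\<bar>s\<bar> ^ n <= fact n" by linarith
    hence "\<bar>(- s) ^ n/fact n\<bar> <= 1" by (simp add: power_abs divide_le_eq)
    thus "norm (((- s) ^ n/fact n) *\<^sub>R adn Y n V) <= C1*norm V"
     using C1(2)[OF Y, of n V] n mult_mono[of "\<bar>(- s) ^ n/fact n\<bar>" 1 "norm (adn Y n V)" "C1*norm V"] by simp
   qed
   also have "... = (real nu + 1)*C1*norm V" by simp
   also have "... <= C*norm V" by (intro mult_right_mono) (simp_all add: C_def)
   finally show ?thesis .
  qed
  have q': "(q has_vector_derivative y s) (at s)" for s
   unfolding q_def y_def
  proof (intro has_vector_derivative_sum)
   fix n
   have "((%s. (- 1) ^ n * s ^ Suc n/fact (Suc n)) has_real_derivative ((- 1) ^ n*(real (Suc n) * s ^ n)/fact (Suc n))) (at s)"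
    by (rule derivative_eq_intros refl | simp)+
   moreover have "(- 1) ^ n*(real (Suc n) * s ^ n)/fact (Suc n) = (- s) ^ n/fact n"
    unfolding power_minus[of s] fact_Suc of_nat_mult by simp
   ultimately show "((%s. ((- 1) ^ n * s ^ Suc n/fact (Suc n)) *\<^sub>R adn Y n V) has_vector_derivative ((- s) ^ n/fact n) *\<^sub>R adn Y n V) (at s)"
    using has_vector_derivative_scaleR[OF _ has_vector_derivative_const] by fastforce
  qed
  have q0: "q 0 = 0" and q1: "q 1 = Dexp Y V" by (simp_all add: q_def Dexp_def)
  have small: "norm (g (c s) - g 0) < min eta eta2"
   if g: "msmooth_on A UNIV g" "!!x v. norm (X v g x) <= m*norm v" and m: "0 <= m" "m <= M + M2" and s: "s : {0..1}"
   for g :: "'g => 'b::real_normed_vector" and m s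
  proof -
   have "norm ((g (c s) - 0) - (g (c 0) - 0)) <= m*(C*norm V)"
   proof (rule cvel_mean_value[OF g(1) cv _ _ s])
    show "norm (X (y s) g (c s) - 0) <= m*(C*norm V)" if "s : {0..1}" for s
     using order_trans[OF g(2) mult_left_mono[OF yb[OF that] m(1)]] by simp
   qed auto
   also have "... <= (M + M2 + 1)*(C*norm V)" using m C by (intro mult_right_mono) auto
   also have "... < (M + M2 + 1)*(C * delta)"
    using d f(1) f2(1) C by (intro mult_strict_left_mono) (auto simp: V_def)
   also have "... = min eta eta2"
   proof -
    have "(M + M2 + 1)*C ~= 0" using f(1) f2(1) C by (metis add_nonneg_pos add_nonneg_nonneg less_numeral_extra(1) mult_eq_0_iff less_irrefl)
    thus ?thesis by (simp add: delta_def)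
   qed
   finally show ?thesis by (simp add: c_def)
  qed
  have cO: "c s : Q0" if "s : {0..1}" for s
  proof (rule f2(10))
   show "norm (f2 (c s)) < eta2" using small[OF f2(4) f2(8,1) _ that] f(1) f2(6) by simp
   show "1 - \<beta>2 (c s) < eta2" using small[OF f2(5) f2(9,1) _ that] f(1) f2(7) by (simp add: abs_less_iff)
  qed
  have cW: "c 1 : W" "f (c 1) = phi (c 1) - p0"
  proof -
   have "norm (f (c 1)) < eta" using small[OF f(4) f(9,1), of 1] f2(1) f(6) by simp
   moreover have "1 - \<beta> (c 1) < eta" using small[OF f(5) f(10,1), of 1] f2(1) f(7) by (simp add: abs_less_iff)
   ultimately show "c 1 : W" "f (c 1) = phi (c 1) - p0" using f(11)[of "c 1"] by auto
  qed
  have "norm ((f (c 1) - q 1) - (f (c 0) - q 0)) <= eps'*(C*norm V)"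
  proof (rule cvel_mean_value[OF f(4) cv q'])
   show "norm (X (y s) f (c s) - y s) <= eps'*(C*norm V)" if "s : {0..1}" for s
    using order_trans[OF Of[OF cO[OF that]] mult_left_mono[OF yb[OF that]]] eps' by simp
  qed simp
  hence "norm (f (c 1) - Dexp Y V) <= eps*norm V"
   using C f(6) by (simp add: q0 q1 c_def eps'_def)
  thus "norm (phi (- E X' + E Y) - p0 - Dexp Y (Y - X')) <= eps*norm (Y - X')" "- E X' + E Y : W"
   using cW by (simp_all add: c_def V_def E_minus)
 qed
qed

end

section \<open>The exponential map is a local homeomorphism\<close>

lemma has_vector_derivative_quotient:
 "(f has_vector_derivative D) (at t) \<longleftrightarrow> ((%h. (1/h) *\<^sub>R (f (t + h) - f t)) \<longlongrightarrow> D) (at 0)"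
proof -
 have *: "norm (f (t + h) - f t - h *\<^sub>R D)/norm h = norm ((1/h) *\<^sub>R (f (t + h) - f t) - D)" if "h ~= 0" for h
 proof -
  have "(1/h) *\<^sub>R (f (t + h) - f t) - D = (1/h) *\<^sub>R (f (t + h) - f t - h *\<^sub>R D)"
   using that by (simp add: scaleR_diff_right)
  thus ?thesis by simp
 qed
 have "((%h. norm (f (t + h) - f t - h *\<^sub>R D)/norm h) \<longlongrightarrow> 0) (at 0) \<longleftrightarrow>
  ((%h. norm ((1/h) *\<^sub>R (f (t + h) - f t) - D)) \<longlongrightarrow> 0) (at 0)"
  by (rule filterlim_cong[OF refl refl]) (use * in \<open>auto simp: eventually_at_filter\<close>)
 thus ?thesis
  unfolding has_vector_derivative_def has_derivative_at tendsto_norm_zero_iff LIM_zero_iff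
  by (simp add: bounded_linear_scaleR_left)
qed

context stratified
begin

lemma isCont_E: "isCont E Z"
 unfolding continuous_within
proof (rule topological_tendstoI)
 fix W assume W: "open W" "E Z : W"
 have "continuous_on UNIV (%x. E Z + x)" by (intro continuous_intros)
 hence "open {x : UNIV. E Z + x : W}" by (rule preimage_open[OF open_UNIV _ W(1)])
 from exp_displacement[OF this, of 1 "norm Z + 1"] obtain delta where delta': "delta > 0"
  "!!V Y. norm Y <= norm Z + 1 ==> norm (Y - V) < delta ==> E Z + (- E V + E Y) : W"
  using W(2) by auto
 have delta: "E Y : W" if "norm Y <= norm Z + 1" "norm (Y - Z) < delta" for Y
  using delta'(2)[OF that] by (simp only: group_normalize)
 have "\<forall>\<^sub>F Y in at Z. dist Y Z < min delta 1"
  using delta'(1) unfolding eventually_at by (intro exI[of _ "min delta 1"]) auto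
 thus "\<forall>\<^sub>F Y in at Z. E Y : W"
 proof eventually_elim
  case (elim Y)
  hence "norm Y <= norm Z + 1" using norm_triangle_ineq2[of Y Z] by (simp add: dist_norm)
  thus ?case using elim delta by (simp add: dist_norm)
 qed
qed

lemma continuous_on_E: "continuous_on S f ==> continuous_on S (%s. E (f s))"
 using continuous_on_compose2[of UNIV E S f] continuous_at_imp_continuous_on[of UNIV E] isCont_E by auto

lemma cvel_E_comp:
 assumes Z: "(Z has_vector_derivative Z') (at t)"
 shows "cvel (%s. E (Z s)) (Dexp (Z t) Z') t"
proof -
 define \<Delta> where "\<Delta> = (%h. Z (t + h) - Z t)"
 define g where "g = (%h. - E (Z t) + E (Z (t + h)))"
 define q where "q = (%h. Dexp (Z (t + h)) ((1/h) *\<^sub>R \<Delta> h))"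
 define r where "r = (%h. (1/h) *\<^sub>R (phi (g h) - p0) - q h)"
 have lim\<Delta>: "((%h. (1/h) *\<^sub>R \<Delta> h) \<longlongrightarrow> Z') (at 0)"
  using Z unfolding has_vector_derivative_quotient \<Delta>_def .
 have "isCont Z t" by (rule has_vector_derivative_continuous[OF Z])
 hence "isCont (%h. Z (t + h)) 0" using isCont_o2[of 0 "%h. t + h" Z] by simp
 hence contZ: "((%h. Z (t + h)) \<longlongrightarrow> Z t) (at 0)" by (simp add: continuous_within)
 have "isCont (%h. E (Z (t + h))) 0"
  by (rule isCont_o2[of 0 "%h. Z (t + h)" E]) (use \<open>isCont (%h. Z (t + h)) 0\<close> isCont_E in auto)
 hence cg: "isCont g 0" unfolding g_def by (intro continuous_intros)
 have "continuous_on UNIV (%s. Dexp (fst s) (snd s))" by (intro continuous_on_Dexp continuous_intros)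
 hence "isCont (%s. Dexp (fst s) (snd s)) (Z t, Z')" by (simp add: continuous_on_eq_continuous_at)
 from isCont_tendsto_compose[OF this tendsto_Pair[OF contZ lim\<Delta>]]
 have limq: "(q \<longlongrightarrow> Dexp (Z t) Z') (at 0)" by (simp add: q_def)
 have "(r \<longlongrightarrow> 0) (at 0)"
 proof (rule tendstoI)
  fix e :: real assume e: "e > 0"
  define eps where "eps = e/(norm Z' + 1)"
  have eps: "eps > 0" using e by (simp add: eps_def add_nonneg_pos)
  obtain delta where delta: "delta > 0" "!!V Y. norm Y <= norm (Z t) + 1 ==> norm (Y - V) < delta ==>
   norm (phi (- E V + E Y) - p0 - Dexp Y (Y - V)) <= eps*norm (Y - V)"
   using exp_displacement[OF open_UNIV _ eps] by blast
  have "\<forall>\<^sub>F h in at 0. dist (Z (t + h)) (Z t) < min delta 1" using tendstoD[OF contZ, of "min delta 1"] delta(1) by simp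
  moreover have "\<forall>\<^sub>F h in at 0. norm ((1/h) *\<^sub>R \<Delta> h) < norm Z' + 1"
   using order_tendstoD(2)[OF tendsto_norm[OF lim\<Delta>], of "norm Z' + 1"] by simp
  moreover have "\<forall>\<^sub>F h in at 0. h ~= (0::real)" by (simp add: eventually_at_filter)
  ultimately show "\<forall>\<^sub>F h in at 0. dist (r h) 0 < e"
  proof eventually_elim
   case (elim h)
   have "norm (Z (t + h)) <= norm (Z t) + 1" "norm (Z (t + h) - Z t) < delta"
    using elim(1) norm_triangle_ineq2[of "Z (t + h)" "Z t"] by (simp_all add: dist_norm)
   from delta(2)[OF this] have 1: "norm (phi (g h) - p0 - Dexp (Z (t + h)) (\<Delta> h)) <= eps*norm (\<Delta> h)"
    by (simp add: g_def \<Delta>_def)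
   have "r h = (1/h) *\<^sub>R (phi (g h) - p0 - Dexp (Z (t + h)) (\<Delta> h))"
    by (simp add: r_def q_def scaleR_diff_right linear_cmul[OF linear_Dexp])
   hence "norm (r h) = \<bar>1/h\<bar>*norm (phi (g h) - p0 - Dexp (Z (t + h)) (\<Delta> h))" by simp
   also have "... <= \<bar>1/h\<bar>*(eps*norm (\<Delta> h))" using 1 by (rule mult_left_mono) simp
   also have "... = eps*norm ((1/h) *\<^sub>R \<Delta> h)" by simp
   also have "... < eps*(norm Z' + 1)" using elim(2) eps by (rule mult_strict_left_mono)
   also have "... = e"
   proof -
    have "norm Z' + 1 ~= 0" using norm_ge_zero[of Z'] by linarith
    thus ?thesis by (simp add: eps_def)
   qed
   finally show ?case by simp
  qed
 qed
 from tendsto_add[OF this limq] have "((%h. (1/h) *\<^sub>R (phi (g h) - p0)) \<longlongrightarrow> Dexp (Z t) Z') (at 0)"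
  by (simp add: r_def)
 moreover have "g 0 = 0" by (simp add: g_def)
 ultimately have "((%h. phi (g h)) has_vector_derivative Dexp (Z t) Z') (at 0)"
  by (simp add: has_vector_derivative_quotient)
 thus ?thesis using cg \<open>g 0 = 0\<close> by (simp add: cvel_def gvel_def g_def)
qed

lemma E_locally_injective: "\<exists>rho>0. inj_on E (ball Z rho)"
proof -
 obtain kappa where kappa: "kappa > 0" "!!Y V. norm Y <= norm Z + 1 ==> kappa*norm V <= norm (Dexp Y V)"
  using Dexp_lower_bound by blast
 have "kappa/2 > 0" using kappa by simp
 from exp_displacement[OF open_UNIV _ this, of "norm Z + 1"] obtain delta where delta: "delta > 0"
  "!!V Y. norm Y <= norm Z + 1 ==> norm (Y - V) < delta ==>
   norm (phi (- E V + E Y) - p0 - Dexp Y (Y - V)) <= kappa/2*norm (Y - V)"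
  by blast
 have "inj_on E (ball Z (min 1 (delta/2)))"
 proof (rule inj_onI)
  fix X' Y assume *: "X' : ball Z (min 1 (delta/2))" "Y : ball Z (min 1 (delta/2))" "E X' = E Y"
  have Y: "norm Y <= norm Z + 1"
   using * norm_triangle_ineq2[of Y Z] by (simp add: dist_norm norm_minus_commute)
  have "norm (Y - X') < delta"
   using * dist_triangle[of Y X' Z] by (simp add: dist_norm norm_minus_commute)
  from delta(2)[OF Y this] have "norm (Dexp Y (Y - X')) <= kappa/2*norm (Y - X')" using *(3) by simp
  hence "kappa*norm (Y - X') <= kappa/2*norm (Y - X')" using kappa(2)[OF Y, of "Y - X'"] by simp
  thus "X' = Y" using kappa(1) by simp
 qed
 thus ?thesis using delta(1) by (intro exI[of _ "min 1 (delta/2)"]) auto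
qed

text \<open>Locally injective, hence open by invariance of domain.\<close>

lemma E_open_map:
 assumes S: "open S"
 shows "open (E ` S)"
proof (subst open_subopen, safe)
 fix Z assume Z: "Z : S"
 obtain rho where rho: "rho > 0" "inj_on E (ball Z rho)" using E_locally_injective by blast
 let ?h = "%Y. - E Z + E Y"
 have h: "continuous_on T ?h" for T by (intro continuous_intros continuous_on_E continuous_on_id)
 have "open {Y : ball Z rho Int S. ?h Y : chU}" by (intro preimage_open open_Int open_ball S h idc)
 moreover have "Z : {Y : ball Z rho Int S. ?h Y : chU}" using rho Z id_chart_in by simp
 ultimately obtain r where r: "r > 0" "ball Z r <= {Y : ball Z rho Int S. ?h Y : chU}" using openE by blast
 let ?F = "%Y. phi (?h Y)"
 have "continuous_on (ball Z r) ?F"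
  by (rule continuous_on_compose2[OF idc(3) h]) (use r in auto)
 moreover have "inj_on ?F (ball Z r)"
 proof (rule inj_onI)
  fix a b assume ab: "a : ball Z r" "b : ball Z r" "?F a = ?F b"
  hence "psi (?F a) = psi (?F b)" by simp
  moreover have "?h a : chU" "?h b : chU" using ab r by blast+
  ultimately have "E a = E b" by (simp add: idc(5))
  thus "a = b" using rho(2) ab r by (auto dest!: inj_onD)
 qed
 ultimately have o: "open (?F ` ball Z r)" by (intro invariance_of_domain_gen) auto
 let ?T = "{x. - E Z + x : chU & phi (- E Z + x) : ?F ` ball Z r}"
 have "continuous_on UNIV (%x. - E Z + x)" by (intro continuous_intros)
 from preimage_open[OF open_UNIV this preimage_open[OF idc(1,3) o]]
 have "open {x : UNIV. - E Z + x : {y : chU. phi y : ?F ` ball Z r}}" .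
 hence "open ?T" by simp
 moreover have "E Z : ?T" using id_chart_in r(1) by (auto intro!: image_eqI[of _ _ Z])
 moreover have "?T <= E ` S"
 proof safe
  fix x Y assume x: "- E Z + x : chU" "phi (- E Z + x) = ?F Y" "Y : ball Z r"
  have "?h Y : chU" "Y : S" using x(3) r by blast+
  hence "- E Z + x = ?h Y" using x(1,2) idc(5) by metis
  thus "x : E ` S" using \<open>Y : S\<close> by simp
 qed
 ultimately show "EX T. open T & E Z : T & T <= E ` S" by blast
qed

section \<open>The Campbell-Hausdorff product\<close>

text \<open>
 The product \<open>E V + E Y\<close> is the end point of a curve \<open>t \<mapsto> E (Z t)\<close> with \<open>Z 0 = V\<close> and velocity
 \<open>Y\<close>, that is \<open>Dexp (Z t) (Z' t) = Y\<close>, or \<open>Z' = Y + Kexp Z Z'\<close>.  Since \<open>Kexp\<close> raises the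
 filtration, the Picard iteration for \<open>Z'\<close> becomes stationary after \<open>nu\<close> steps.
\<close>

primrec bchW :: "nat => 'e => 'e => real => 'e" where
 "bchW 0 V Y t = 0"
| "bchW (Suc n) V Y t = Y + Kexp (V + integral {0..t} (bchW n V Y)) (bchW n V Y t)"

definition star :: "'e => 'e => 'e" where
 "star V Y = V + integral {0..1} (bchW nu V Y)"

lemma continuous_on_primitive:
 fixes w :: "'b::topological_space => real => 'c::euclidean_space"
 assumes w: "continuous_on ({0..1} \<times> UNIV) (%(t, p). w p t)"
 shows "continuous_on ({0..1} \<times> UNIV) (%(t, p). integral {0..t} (w p))"
proof -
 have "continuous_on (({0..1} \<times> UNIV) \<times> cbox 0 1) (%(a, s). w (snd a) (fst a * s))"
 proof -
  have "continuous_on (({0..1} \<times> UNIV) \<times> cbox 0 1) (%x. (%(t, p). w p t) ((fst (fst x) * snd x), snd (fst x)))"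
   by (rule continuous_on_compose2[OF w]) (auto intro!: continuous_intros mult_le_one)
  thus ?thesis by (simp add: split_def)
 qed
 hence "continuous_on ({0..1} \<times> UNIV) (%a. integral (cbox 0 1) (%s. w (snd a) (fst a * s)))"
  by (rule integral_continuous_on_param)
 hence "continuous_on ({0..1} \<times> UNIV) (%a. fst a *\<^sub>R integral (cbox 0 1) (%s. w (snd a) (fst a * s)))"
  by (intro continuous_intros)
 thus ?thesis
 proof (rule continuous_on_eq)
  fix a :: "real \<times> 'b" assume a: "a : {0..1} \<times> UNIV"
  have "continuous_on {0..1} (%t. (%(t, p). w p t) (t, snd a))"
   by (rule continuous_on_compose2[OF w]) (auto intro!: continuous_intros)
  hence c: "continuous_on {0..1} (w (snd a))" by simp
  have "((%s. fst a *\<^sub>R w (snd a) (fst a * s)) has_integral integral {fst a*0..fst a*1} (w (snd a))) {0..1}"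
   by (rule has_integral_substitution[OF _ _ _ c])
    (use a in \<open>auto intro!: derivative_eq_intros mult_le_one\<close>)
  hence "((%s. fst a *\<^sub>R w (snd a) (fst a * s)) has_integral integral {0..fst a} (w (snd a))) {0..1}" by simp
  from integral_unique[OF this] show "fst a *\<^sub>R integral (cbox 0 1) (%s. w (snd a) (fst a * s)) = (%(t, p). integral {0..t} (w p)) a"
   by (simp add: split_def)
 qed
qed

lemma continuous_bchW: "continuous_on ({0..1} \<times> UNIV) (%(t, p). bchW n (fst p) (snd p) t)"
proof (induction n)
 case 0
 thus ?case by (simp add: split_def)
next
 case (Suc n)
 have "continuous_on ({0..1} \<times> UNIV) (%a. snd (snd a) + Kexp (fst (snd a) + (%(t, p). integral {0..t} (bchW n (fst p) (snd p))) a)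
   ((%(t, p). bchW n (fst p) (snd p) t) a))"
  by (intro continuous_intros continuous_on_Kexp Suc continuous_on_primitive[of "%p. bchW n (fst p) (snd p)"])
 thus ?case by (simp add: split_def)
qed

lemma continuous_bchW_1: "continuous_on {0..1} (bchW n V Y)"
proof -
 have "continuous_on {0..1} (%t. (%(t, p). bchW n (fst p) (snd p) t) (t, (V, Y)))"
  by (rule continuous_on_compose2[OF continuous_bchW]) (auto intro!: continuous_intros)
 thus ?thesis by simp
qed

lemma bchW_integrable: "t : {0..1} ==> bchW n V Y integrable_on {0..t}"
 by (rule integrable_continuous_real, rule continuous_on_subset[OF continuous_bchW_1]) auto

lemma continuous_star: "continuous_on UNIV (%p. star (fst p) (snd p))"
proof -
 have "continuous_on UNIV (%p. (%(t, p). integral {0..t} (bchW nu (fst p) (snd p))) (1, p))"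
  by (rule continuous_on_compose2[OF continuous_on_primitive[OF continuous_bchW]]) (auto intro!: continuous_intros)
 thus ?thesis unfolding star_def by (intro continuous_intros) simp
qed

lemma integral_FF:
 assumes "f integrable_on S" "!!s. s : S ==> f s : FF k"
 shows "integral S f : FF k"
 unfolding FF_def
proof safe
 fix j assume "j < k"
 have "proj j (integral S f) = integral S (proj j \<circ> f)"
  by (rule integral_linear[OF assms(1) bounded_linear_proj, symmetric])
 also have "... = integral S (%_. 0)"
  by (rule Henstock_Kurzweil_Integration.integral_cong) (use assms(2) \<open>j < k\<close> in \<open>auto simp: FF_def\<close>)
 finally show "proj j (integral S f) = 0" by simp
qed

lemma bchW_diff: "t : {0..1} ==> bchW (Suc n) V Y t - bchW n V Y t : FF (Suc n)"
proof (induction n arbitrary: t)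
 case (Suc n)
 have i: "bchW m V Y integrable_on {0..t}" for m by (rule bchW_integrable[OF Suc.prems])
 have "integral {0..t} (%s. bchW (Suc n) V Y s - bchW n V Y s) : FF (Suc n)"
  using Suc by (intro integral_FF Henstock_Kurzweil_Integration.integrable_diff i) auto
 hence "(V + integral {0..t} (bchW (Suc n) V Y)) - (V + integral {0..t} (bchW n V Y)) : FF (Suc n)"
  by (simp only: add_diff_cancel_left Henstock_Kurzweil_Integration.integral_diff[OF i i])
 from Kexp_diff_FF[OF this Suc.IH[OF Suc.prems]]
 show ?case unfolding bchW.simps(2)[of "Suc n"] bchW.simps(2)[of n "V" Y t] by (simp only: add_diff_cancel_left)
qed simp

lemma bchW_fixed_point:
 assumes "t : {0..1}"
 shows "Dexp (V + integral {0..t} (bchW nu V Y)) (bchW nu V Y t) = Y"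
proof -
 have "bchW (Suc nu) V Y t = bchW nu V Y t" using FF_zero[OF bchW_diff[OF assms, of nu]] by simp
 thus ?thesis by (simp add: Dexp_Kexp algebra_simps)
qed

lemma E_star: "E (star V Y) = E V + E Y"
proof -
 let ?Z = "%t. V + integral {0..t} (bchW nu V Y)"
 have "E (?Z 1) = E V + E (1 *\<^sub>R Y)"
 proof (rule cvel_determines_curve[of 0 1 "%t. E (?Z t)" "%t. E V + E (t *\<^sub>R Y)" "%_. Y"])
  have "continuous_on {0..1} ?Z"
   by (intro continuous_intros indefinite_integral_continuous_1 bchW_integrable) simp
  thus "continuous_on {0..1} (%t. E (?Z t))" by (rule continuous_on_E)
  show "continuous_on {0..1} (%t. E V + E (t *\<^sub>R Y))" by (intro continuous_intros continuous_on_E)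
  fix t :: real assume t: "0 < t" "t < 1"
  have "((%t. integral {0..t} (bchW nu V Y)) has_vector_derivative bchW nu V Y t) (at t within {0..1})"
   by (rule integral_has_vector_derivative[OF continuous_bchW_1]) (use t in auto)
  hence "(?Z has_vector_derivative bchW nu V Y t) (at t)"
   using t by (auto simp: at_within_Icc_at intro!: derivative_eq_intros)
  from cvel_E_comp[OF this] show "cvel (%t. E (?Z t)) Y t" using bchW_fixed_point[of t V Y] t by simp
  show "cvel (%t. E V + E (t *\<^sub>R Y)) Y t" by (rule cvel_left_translate[OF cvel_E])
 qed simp_all
 thus ?thesis by (simp add: star_def)
qed

lemma dil_bchW: "t : {0..1} ==> dil r (bchW n V Y t) = bchW n (dil r V) (dil r Y) t"
proof (induction n arbitrary: t)
 case 0
 thus ?case by (simp add: linear_0[OF linear_dil])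
next
 case (Suc n)
 have "dil r (integral {0..t} (bchW n V Y)) = integral {0..t} (dil r \<circ> bchW n V Y)"
  by (rule integral_linear[OF bchW_integrable[OF Suc.prems] bounded_linear_dil, symmetric])
 also have "... = integral {0..t} (bchW n (dil r V) (dil r Y))"
  by (rule Henstock_Kurzweil_Integration.integral_cong) (use Suc in auto)
 finally show ?case using Suc by (simp add: linear_add[OF linear_dil] dil_Kexp)
qed

lemma dil_star: "dil r (star V Y) = star (dil r V) (dil r Y)"
proof -
 have "dil r (integral {0..1} (bchW nu V Y)) = integral {0..1} (dil r \<circ> bchW nu V Y)"
  by (rule integral_linear[OF bchW_integrable bounded_linear_dil, symmetric]) simp
 also have "... = integral {0..1} (bchW nu (dil r V) (dil r Y))"
  by (rule Henstock_Kurzweil_Integration.integral_cong) (use dil_bchW in auto)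
 finally show ?thesis by (simp add: star_def linear_add[OF linear_dil])
qed

lemma proj_1_star: "proj 1 (star V Y) = proj 1 V + proj 1 Y"
proof -
 have nu: "nu >= 1" using strat by (simp add: stratified_group_def)
 have "proj 1 (bchW nu V Y t) = proj 1 Y" for t
 proof -
  have "Kexp Z V : FF (Suc (Suc 0))" for Z V by (rule Kexp_FF) simp
  hence "proj 1 (bchW (Suc (nu - 1)) V Y t) = proj 1 Y"
   by (simp add: linear_add[OF linear_proj] FF_def)
  thus ?thesis using nu by simp
 qed
 moreover have "proj 1 (integral {0..1} (bchW nu V Y)) = integral {0..1} (proj 1 \<circ> bchW nu V Y)"
  by (rule integral_linear[OF bchW_integrable bounded_linear_proj, symmetric]) simp
 ultimately show ?thesis by (simp add: star_def linear_add[OF linear_proj] o_def)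
qed

lemma star_0_0 [simp]: "star 0 0 = 0"
proof -
 have K0: "Kexp Z 0 = 0" for Z by (simp add: Kexp_def linear_0[OF linear_adn] linear_0[OF ad_linear_right] del: funpow.simps)
 have "bchW n 0 0 t = 0" for n t
 proof (induction n arbitrary: t)
  case (Suc n)
  thus ?case using K0 by simp
 qed simp
 hence "bchW nu 0 0 = (%_. 0)" by (rule ext)
 thus ?thesis by (simp add: star_def)
qed

section \<open>The exponential map is a homeomorphism\<close>

text \<open>The range is an open subgroup of a connected group.\<close>

lemma E_surjective: "range E = UNIV"
proof -
 have op: "open (range E)" by (rule E_open_map) simp
 have add: "x + y : range E" if "x : range E" "y : range E" for x y
 proof -
  from that obtain V Y where "x = E V" "y = E Y" by blast
  hence "x + y = E (star V Y)" by (simp add: E_star)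
  thus ?thesis by simp
 qed
 have uminus: "- x : range E" if "x : range E" for x
 proof -
  from that obtain V where "x = E V" by blast
  hence "- x = E (- V)" by (simp add: E_minus)
  thus ?thesis by simp
 qed
 have "open (- range E)"
 proof (subst open_subopen, safe)
  fix y assume y: "y ~: range E"
  let ?T = "{x : UNIV. - y + x : range E}"
  have "open ?T" by (rule preimage_open[OF open_UNIV _ op]) (intro continuous_intros)
  moreover have "y : ?T" using E_0 by (metis (mono_tags, lifting) UNIV_I left_minus mem_Collect_eq rangeI)
  moreover have "x ~: range E" if "- y + x : range E" for x
  proof
   assume x: "x : range E"
   have "x + - (- y + x) : range E" by (rule add[OF x uminus[OF that]])
   thus False using y by (simp only: group_normalize)
  qed
  ultimately show "EX T. open T & y : T & T <= - range E" by (intro exI[of _ ?T]) auto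
 qed
 moreover have "connected (UNIV :: 'g set)" using strat by (simp add: stratified_group_def)
 ultimately have "range E = {} | - range E = {}" using connectedD[of UNIV "range E" "- range E"] op by auto
 thus ?thesis by auto
qed

lemma E_local_section:
 obtains W lg where "open W" "0 : W" "continuous_on W lg" "!!x. x : W ==> E (lg x) = x" "lg 0 = 0"
proof -
 obtain rho where rho: "rho > 0" "inj_on E (ball 0 rho)" using E_locally_injective by blast
 let ?lg = "inv_into (ball 0 rho) E"
 have "continuous_on (E ` ball 0 rho) ?lg"
 proof (rule continuous_on_inverse_open_map[of "ball 0 rho" E])
  show "continuous_on (ball 0 rho) E" by (rule continuous_on_E[OF continuous_on_id, of "ball 0 rho"])
  show "openin (top_of_set (E ` ball 0 rho)) (E ` U)" if "openin (top_of_set (ball 0 rho)) U" for U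
   using that E_open_map[of U] by (auto simp: openin_open_eq[OF E_open_map[OF open_ball]] openin_open_eq[OF open_ball])
 qed (use rho in auto)
 moreover have "?lg 0 = 0" using inv_into_f_f[OF rho(2), of 0] rho(1) by simp
 ultimately show ?thesis
  using that[of "E ` ball 0 rho" ?lg] E_open_map[of "ball 0 rho"] rho(1) f_inv_into_f[of _ E "ball 0 rho"]
  by (metis E_0 centre_in_ball imageI open_ball)
qed

text \<open>
 A map into the group lifts along \<open>E\<close> in one stroke: its value at \<open>s\<close> is the product of the
 small increments along the segment from \<open>0\<close> to \<open>s\<close>, to which the local inverse of \<open>E\<close> applies.
\<close>

lemma E_lift:
 fixes h :: "real \<times> real => 'g"
 assumes S: "compact S" "convex S" "0 : S" and h: "continuous_on S h" "h 0 = 0"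
 obtains H where "continuous_on S H" "!!s. s : S ==> E (H s) = h s" "H 0 = 0"
proof -
 obtain W lg where W: "open W" "0 : W" "continuous_on W lg" "!!x. x : W ==> E (lg x) = x" "lg 0 = 0"
  by (rule E_local_section) blast
 obtain f :: "'g => real" and P K where f: "msmooth_on A UNIV f" "0 : P" "!!y. y : P ==> f y = 1"
  "K <= W" "!!y. y ~: K ==> f y = 0" by (rule bump[OF W(1,2)]) blast
 have scale: "r *\<^sub>R s : S" if "s : S" "0 <= r" "r <= 1" for r s
  using convexD[OF S(2) that(1) S(3), of r "1 - r"] that by simp
 let ?F = "%p. f (- h (fst p) + h (snd p))"
 have "continuous_on (S \<times> S) ?F"
  by (rule continuous_on_compose2[OF msmooth_continuous[OF open_UNIV f(1)]])
   (auto intro!: continuous_intros continuous_on_compose2[OF h(1)])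
 hence "uniformly_continuous_on (S \<times> S) ?F" by (rule compact_uniformly_continuous) (intro compact_Times S)
 then obtain d where d: "d > 0" "!!p p'. p : S \<times> S ==> p' : S \<times> S ==> dist p' p < d ==> dist (?F p') (?F p) < 1"
  unfolding uniformly_continuous_on_def by (meson zero_less_one)
 have near: "- h s + h s' : W" if "s : S" "s' : S" "dist s' s < d" for s s'
 proof -
  have "dist (?F (s, s')) (?F (s, s)) < 1" by (rule d(2)) (use that in \<open>auto simp: dist_Pair_Pair\<close>)
  hence "f (- h s + h s') ~= 0" using f(2,3) by (auto simp: dist_real_def)
  thus ?thesis using f(4,5) by blast
 qed
 obtain M where M: "M > 0" "!!s. s : S ==> norm s <= M" using compact_imp_bounded[OF S(1)] bounded_pos by blast
 obtain n :: nat where n: "M/d < n" using reals_Archimedean2 by blast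
 hence n0: "n > 0" using M(1) d(1) by (metis divide_pos_pos of_nat_0_less_iff order.strict_trans)
 let ?p = "%k s. (real k/real n) *\<^sub>R s"
 have pS: "?p k s : S" if "s : S" "k <= n" for k s using scale[OF that(1), of "real k/real n"] that n0 by simp
 define l where "l = (%k s. rec_nat 0 (%k y. star y (lg (- h (?p k s) + h (?p (Suc k) s)))) k)"
 have l: "l 0 s = 0" "l (Suc k) s = star (l k s) (lg (- h (?p k s) + h (?p (Suc k) s)))" for k s by (simp_all add: l_def)
 have inW: "- h (?p k s) + h (?p (Suc k) s) : W" if "s : S" "k < n" for k s
 proof (rule near)
  have "?p (Suc k) s - ?p k s = (1/real n) *\<^sub>R s"
   by (simp add: scaleR_diff_left[symmetric] add_divide_distrib)
  hence "dist (?p (Suc k) s) (?p k s) = norm s/n" by (simp add: dist_norm)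
  also have "... <= M/n" using M(2)[OF that(1)] by (simp add: divide_right_mono)
  also have "... < d" using n d(1) n0 by (simp add: field_simps)
  finally show "dist (?p (Suc k) s) (?p k s) < d" .
 next
  show "?p k s : S" "?p (Suc k) s : S" by (rule pS[OF that(1)], use that in simp)+
 qed
 have lift: "k <= n ==> s : S ==> E (l k s) = h (?p k s)" for k s
 proof (induction k)
  case 0
  thus ?case using h(2) by (simp add: l zero_prod_def)
 next
  case (Suc k)
  thus ?case using W(4)[OF inW[of s k]] by (simp only: l E_star) (simp add: add.assoc[symmetric])
 qed
 have cont: "k <= n ==> continuous_on S (l k)" for k
 proof (induction k)
  case 0
  thus ?case by (simp add: l)
 next
  case (Suc k)
  have hp: "continuous_on S (%s. h (?p j s))" if "j <= n" for j
   by (rule continuous_on_compose2[OF h(1)]) (use pS[OF _ that] in \<open>auto intro!: continuous_intros\<close>)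
  have "continuous_on S (%s. - h (?p k s) + h (?p (Suc k) s))"
   by (intro continuous_on_add continuous_on_minus hp) (use Suc.prems in auto)
  hence "continuous_on S (%s. lg (- h (?p k s) + h (?p (Suc k) s)))"
   by (rule continuous_on_compose2[OF W(3)]) (intro image_subsetI inW, use Suc.prems in auto)
  hence "continuous_on S (%s. (%p. star (fst p) (snd p)) (l k s, lg (- h (?p k s) + h (?p (Suc k) s))))"
   using Suc by (intro continuous_on_compose2[OF continuous_star] continuous_on_Pair) auto
  thus ?case unfolding l by simp
 qed
 have "l k 0 = 0" for k by (induction k) (simp_all add: l W(5))
 thus ?thesis
  using that[of "l n"] cont[of n] lift[of n] n0 by simp
qed

lemma E_lift_unique:
 fixes f g :: "'b::topological_space => 'e"
 assumes S: "connected S" "a : S" "b : S" and f: "continuous_on S f" and g: "continuous_on S g"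
  and eq: "!!s. s : S ==> E (f s) = E (g s)" "f a = g a"
 shows "f b = g b"
proof -
 have "ALL s:S. \<forall>\<^sub>F t in at s within S. (f s = g s) = (f t = g t)"
 proof
  fix s assume s: "s : S"
  have lim: "(f \<longlongrightarrow> f s) (at s within S)" "(g \<longlongrightarrow> g s) (at s within S)" using f g s by (auto simp: continuous_on)
  show "\<forall>\<^sub>F t in at s within S. (f s = g s) = (f t = g t)"
  proof (cases "f s = g s")
   case True
   obtain rho where rho: "rho > 0" "inj_on E (ball (f s) rho)" using E_locally_injective by blast
   have "\<forall>\<^sub>F t in at s within S. t : S" by (simp add: eventually_at_filter)
   thus ?thesis
    using tendstoD[OF lim(1) rho(1)] tendstoD[OF lim(2) rho(1)]
   proof eventually_elim
    case (elim t)
    hence "f t = g t" using inj_onD[OF rho(2) eq(1)[of t]] True by (simp add: dist_commute)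
    thus ?case using True by simp
   qed
  next
   case False
   have "((%t. f t - g t) \<longlongrightarrow> f s - g s) (at s within S)" by (intro tendsto_intros lim)
   from tendsto_imp_eventually_ne[OF this, of 0] False show ?thesis by (auto elim: eventually_mono)
  qed
 qed
 from connected_local_const[OF S this] eq(2) show ?thesis by simp
qed

text \<open>
 If \<open>E V = E Y\<close>, the loop \<open>E (t V) - E (t Y)\<close> is contractible and lifts to a loop at \<open>0\<close> in the
 algebra; multiplication with \<open>t Y\<close> gives two lifts of one curve, ending in \<open>V\<close> and \<open>Y\<close>.
\<close>

lemma inj_E: "inj E"
proof (rule injI)
 fix V Y assume XY: "E V = E Y"
 let ?I = "{0..1::real}"
 define p where "p = (%t. E (t *\<^sub>R V) + - E (t *\<^sub>R Y))"
 have "simply_connected (UNIV :: 'g set)" using strat by (simp add: stratified_group_def)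
 moreover have "path p" unfolding path_def p_def by (intro continuous_intros continuous_on_E)
 moreover have "pathfinish p = pathstart p" using XY by (simp add: pathfinish_def pathstart_def p_def)
 ultimately have "homotopic_loops UNIV p (%_. 0)"
  unfolding simply_connected_def by (auto simp: path_def pathfinish_def pathstart_def)
 then obtain h where h: "continuous_on (?I \<times> ?I) h" "!!t. t : ?I ==> h (0, t) = p t"
  "!!t. t : ?I ==> h (1, t) = 0" "!!s. s : ?I ==> h (s, 1) = h (s, 0)"
  unfolding homotopic_loops by (auto simp: pathfinish_def pathstart_def)
 have "h 0 = 0" using h(2)[of 0] by (simp add: p_def zero_prod_def)
 then obtain H where H: "continuous_on (?I \<times> ?I) H" "!!s. s : ?I \<times> ?I ==> E (H s) = h s" "H 0 = 0"
  using E_lift[OF compact_Times[OF compact_Icc compact_Icc] convex_Times[OF convex_real_interval(5) convex_real_interval(5)] _ h(1)]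
  by (metis (no_types, lifting) SigmaI atLeastAtMost_iff order_refl zero_le_one zero_prod_def)
 have cH1: "continuous_on ?I (%t. H (s, t))" if "s : ?I" for s
  by (rule continuous_on_compose2[OF H(1)]) (use that in \<open>auto intro!: continuous_intros\<close>)
 have cH2: "continuous_on ?I (%s. H (s, t))" if "t : ?I" for t
  by (rule continuous_on_compose2[OF H(1)]) (use that in \<open>auto intro!: continuous_intros\<close>)
 have I: "connected ?I" "0 : ?I" "1 : ?I" by auto
 have "H (1, 1) = H (1, 0)"
  by (rule E_lift_unique[OF I cH1[OF I(3)] continuous_on_const]) (use H(2) h(3) in auto)
 hence H1: "H (0, 1) = H (0, 0)"
  by (intro E_lift_unique[OF I(1,3,2) cH2[OF I(3)] cH2[OF I(2)]]) (use H(2) h(4) in auto)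
 have H0: "H (0, 0) = 0" using H(3) by (simp add: zero_prod_def)
 have starc: "continuous_on ?I (%t. star (f t) (t *\<^sub>R Y))" if "continuous_on ?I f" for f
 proof -
  have "continuous_on ?I (%t. (%p. star (fst p) (snd p)) (f t, t *\<^sub>R Y))"
   by (intro continuous_on_compose2[OF continuous_star] continuous_on_Pair that continuous_intros) auto
  thus ?thesis by simp
 qed
 have "star (H (0, 1)) (1 *\<^sub>R Y) = 1 *\<^sub>R V"
  by (rule E_lift_unique[OF I starc[OF cH1[OF I(2)]]])
   (use H(2) h(2) H0 in \<open>auto simp: E_star p_def intro!: continuous_intros\<close>)
 moreover have "star 0 (1 *\<^sub>R Y) = 1 *\<^sub>R Y"
  by (rule E_lift_unique[OF I starc[OF continuous_on_const]]) (auto simp: E_star intro!: continuous_intros)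
 ultimately show "V = Y" using H1 H0 by simp
qed

definition Log :: "'g => 'e" where "Log = inv E"

lemma E_Log [simp]: "E (Log x) = x" and Log_E [simp]: "Log (E v) = v"
 using E_surjective inj_E by (auto simp: Log_def surj_f_inv_f inv_f_f)

lemma Log_0 [simp]: "Log 0 = 0"
 using Log_E[of 0] by simp

lemma Log_add: "Log (x + y) = star (Log x) (Log y)"
 using Log_E[of "star (Log x) (Log y)"] by (simp add: E_star)

lemma continuous_on_Log: "continuous_on S f ==> continuous_on S (%s. Log (f s))"
proof -
 have "continuous_on (range E) (inv E)"
  by (rule continuous_on_inverse_open_map[of UNIV E])
   (use continuous_on_E[OF continuous_on_id] inj_E E_open_map E_surjective in \<open>auto simp: inv_f_f\<close>)
 hence "continuous_on UNIV Log" by (simp add: E_surjective Log_def)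
 thus "continuous_on S f ==> continuous_on S (%s. Log (f s))" by (rule continuous_on_compose2) auto
qed

section \<open>Dilations\<close>

abbreviation delta :: "real => 'g => 'g" where "delta == group_dilation A nu \<gg>"

lemma delta_eq: "delta r x = E (dil r (Log x))"
 by (simp add: group_dilation_def Log_def)

lemma delta_E: "delta r (E v) = E (dil r v)"
 by (simp add: delta_eq)

lemma delta_add: "delta r (x + y) = delta r x + delta r y"
 by (simp add: delta_eq Log_add dil_star E_star)

lemma delta_0 [simp]: "delta r 0 = 0"
 by (simp add: delta_eq linear_0[OF linear_dil])

lemma delta_delta: "delta r (delta s x) = delta (r * s) x"
 by (simp add: delta_eq dil_dil)

lemma delta_1 [simp]: "delta 1 x = x"
 by (simp add: delta_eq)

lemma delta_inverse: "r ~= 0 ==> delta r (delta (1/r) x) = x" "r ~= 0 ==> delta (1/r) (delta r x) = x"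
 by (simp_all add: delta_delta)

lemma continuous_on_proj_Log: "continuous_on S f ==> continuous_on S (%s. proj k (Log (f s)))"
 by (intro bounded_linear.continuous_on[OF bounded_linear_proj] continuous_on_Log)

lemma continuous_on_delta: "continuous_on S f ==> continuous_on S g ==> continuous_on S (%s. delta (f s) (g s))"
 unfolding delta_eq dil_proj
 by (intro continuous_on_E continuous_intros continuous_on_proj_Log)

definition horizontal :: "'g => 'e" where
 "horizontal x = proj 1 (Log x)"

lemma horizontal_add: "horizontal (x + y) = horizontal x + horizontal y"
 using proj_1_star by (simp add: horizontal_def Log_add)

lemma continuous_on_horizontal: "continuous_on S f ==> continuous_on S (%s. horizontal (f s))"
 unfolding horizontal_def by (rule continuous_on_proj_Log)

lemma layer_generated:
 assumes "1 <= k"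
 shows "layer (Suc k) <= span {ad x y | x y. x : layer 1 & y : layer k}"
proof (cases "Suc k <= nu")
 case True
 hence "span {lie_bracket A u v | u v. u : \<gg> 1 & v : \<gg> k} = \<gg> (Suc k)"
  using strat assms unfolding stratified_group_def by (auto dest: bspec[of _ _ "Suc k"])
 thus ?thesis using True assms by (simp add: layer_def lie_bracket_ad)
qed (auto simp: layer_def span_zero)

text \<open>If the first layer were at most one-dimensional, all brackets would vanish.\<close>

lemma noncommutative_first_layer:
 assumes nc: "\<exists>x y :: 'g. x + y ~= y + x"
 obtains u v and f g :: "'e => real" where "u : layer 1" "v : layer 1" "linear f" "linear g"
  "f u = 1" "f v = 0" "g u = 0" "g v = 1"
proof -
 have "\<not> layer 1 <= span {a}" for a
 proof
  assume 1: "layer 1 <= span {a}"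
  have b1: "ad x y = 0" if "x : layer 1" "y : layer 1" for x y
  proof -
   have "x : span {a}" "y : span {a}" using 1 that by blast+
   then obtain c d where "x = c *\<^sub>R a" "y = d *\<^sub>R a" unfolding span_singleton by blast
   thus ?thesis by (simp add: linear_cmul[OF ad_linear_left] linear_cmul[OF ad_linear_right])
  qed
  have z: "layer (Suc (Suc k)) <= {0}" for k
  proof (induction k)
   case 0
   have "{ad x y | x y. x : layer 1 & y : layer (Suc 0)} <= {0}" using b1 by auto
   from span_mono[OF this] show ?case using layer_generated[of "Suc 0"] by auto
  next
   case (Suc k)
   have "{ad x y | x y. x : layer 1 & y : layer (Suc (Suc k))} <= {0}"
    using Suc linear_0[OF ad_linear_right] by auto
   from span_mono[OF this] show ?case using layer_generated[of "Suc (Suc k)"] by auto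
  qed
  have "Y : layer 1" for Y
  proof -
   have p0: "proj k Y = 0" if k: "k ~= 1" for k
   proof (cases k)
    case (Suc j)
    then obtain i where "k = Suc (Suc i)" using k by (cases j) auto
    thus ?thesis using z[of i] proj_layer[of k Y] by auto
   qed (simp add: proj_outside)
   have "Y = (\<Sum>k=1..nu. proj k Y)" by (rule proj_sum)
   also have "... = (\<Sum>k=1..nu. if k = 1 then proj k Y else 0)" by (intro sum.cong refl) (simp add: p0)
   finally have "Y = (\<Sum>k=1..nu. if k = 1 then proj k Y else 0)" .
   hence "Y = (if 1 : {1..nu} then proj 1 Y else 0)" by (simp only: sum.delta finite_atLeastAtMost)
   thus ?thesis using proj_layer[of 1 Y] subspace_0[OF subspace_layer] by (metis (full_types))
  qed
  hence ad0: "ad x y = 0" for x y using b1 by blast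
  have K0: "Kexp Z V = 0" for Z V unfolding Kexp_def by (simp add: ad0)
  have nu: "nu >= 1" using strat by (simp add: stratified_group_def)
  have "bchW (Suc n) V Y t = Y" for n V Y t by (simp add: K0)
  hence "bchW nu V Y = (%_. Y)" for V Y using nu by (metis Suc_le_D One_nat_def ext)
  hence "star V Y = V + Y" for V Y by (simp add: star_def)
  hence "E V + E Y = E Y + E V" for V Y by (metis E_star add.commute)
  thus False using nc by (metis E_Log)
 qed
 then obtain u v where uv: "u : layer 1" "u ~: span {0}" "v : layer 1" "v ~: span {u}" by (meson subsetI)
 have ne: "u ~= v" "u ~= 0" using uv by (auto simp: span_base)
 have "independent {v, u}"
  using uv(4) ne by (simp add: independent_insert)
 hence ext: "\<exists>f :: 'e => real. linear f & (ALL x:{v, u}. f x = g x)" for g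
  by (rule linear_independent_extend)
 obtain f :: "'e => real" where f: "linear f" "f u = 1" "f v = 0"
  using ext[of "%x. if x = u then 1 else 0"] ne by auto
 obtain g :: "'e => real" where g: "linear g" "g u = 0" "g v = 1"
  using ext[of "%x. if x = v then 1 else 0"] ne by auto
 show ?thesis by (rule that[OF uv(1,3) f(1) g(1) f(2,3) g(2,3)])
qed

end

section \<open>Haar measures\<close>

lemma haar_sets: "haar_measure mu ==> sets mu = sets borel"
 and haar_space: "haar_measure mu ==> space mu = UNIV"
 by (auto simp: haar_measure_def dest: sets_eq_imp_space_eq)

lemma haar_open_pos: "haar_measure mu ==> open U ==> x : U ==> 0 < emeasure mu U"
 unfolding haar_measure_def by (metis empty_iff)

lemma left_translate_image: "(%y. x + y) ` E = {y. - x + y : E}" for x :: "'g::group_add"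
 by (auto simp: add.assoc[symmetric] image_iff intro!: bexI[of _ "- x + _"])

lemma measurable_haar: "haar_measure kappa ==> f : measurable borel M ==> f : measurable kappa M"
 by (subst measurable_cong_sets[OF haar_sets refl])

lemma measurable_haar_cont: "haar_measure kappa ==> continuous_on UNIV f ==> f : measurable kappa borel"
 by (rule measurable_haar[OF _ borel_measurable_continuous_onI])

lemma haar_preimage:
 assumes "haar_measure kappa" "continuous_on UNIV f" "Y : sets borel"
 shows "{y. f y : Y} : sets borel" "emeasure (distr kappa borel f) Y = emeasure kappa {y. f y : Y}"
proof -
 have f: "f : borel_measurable borel" by (rule borel_measurable_continuous_onI[OF assms(2)])
 show "{y. f y : Y} : sets borel" using measurable_sets[OF f assms(3)] by (simp add: vimage_def)
 show "emeasure (distr kappa borel f) Y = emeasure kappa {y. f y : Y}"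
  using emeasure_distr[OF measurable_haar[OF assms(1) f] assms(3)] by (simp add: haar_space[OF assms(1)] vimage_def)
qed

lemma haar_left:
 fixes kappa :: "'g::{topological_group_add, t2_space} measure"
 shows "haar_measure kappa ==> Y : sets borel ==> emeasure kappa {y. x + y : Y} = emeasure kappa Y"
proof -
 assume "haar_measure kappa" "Y : sets borel"
 hence "emeasure kappa ((%y. - x + y) ` Y) = emeasure kappa Y" unfolding haar_measure_def by blast
 thus "emeasure kappa {y. x + y : Y} = emeasure kappa Y" unfolding left_translate_image minus_minus .
qed

lemma haar_distr_left:
 fixes mu :: "'g::{topological_group_add, t2_space} measure"
 assumes "haar_measure mu"
 shows "distr mu borel (%y. x + y) = mu"
 using haar_sets[OF assms] haar_left[OF assms] haar_preimage(2)[OF assms, of "%y. x + y"]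
 by (intro measure_eqI) (simp_all add: continuous_on_add continuous_on_const continuous_on_id)

text \<open>
 The hypothesis holds for automorphisms and for right translations, and for the inversion once right
 translations preserve the measure.
\<close>

lemma haar_distr:
 fixes mu :: "'g::{topological_group_add, t2_space} measure" and T S :: "'g => 'g"
 assumes mu: "haar_measure mu" and T: "continuous_on UNIV T" "continuous_on UNIV S" "!!y. T (S y) = y" "!!y. S (T y) = y"
  and inv: "!!x Y. Y : sets borel ==> emeasure mu {y. x + T y : Y} = emeasure mu {y. T y : Y}"
 shows "haar_measure (distr mu borel T)"
 unfolding haar_measure_def
proof (intro conjI allI ballI impI)
 note em = haar_preimage(2)[OF mu T(1)]
 fix x and E :: "'g set" assume E: "E : sets borel"
 have "{y. - x + y : E} : sets borel" by (rule haar_preimage(1)[OF mu _ E]) (intro continuous_intros)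
 thus "emeasure (distr mu borel T) ((%y. x + y) ` E) = emeasure (distr mu borel T) E"
  using inv[OF E, of "- x"] em E by (simp add: left_translate_image)
next
 fix K :: "'g set" assume K: "compact K"
 have "{y. T y : K} = S ` K" using T by (auto simp: image_iff) metis
 hence "compact {y. T y : K}" using compact_continuous_image[OF continuous_on_subset[OF T(2)] K] by simp
 thus "emeasure (distr mu borel T) K < \<infinity>"
  using haar_preimage(2)[OF mu T(1) borel_compact[OF K]] mu by (simp add: haar_measure_def)
next
 fix U :: "'g set" assume U: "open U & U ~= {}"
 hence "open {y. T y : U}" using open_vimage[OF _ T(1)] by (simp add: vimage_def)
 moreover obtain u where "u : U" using U by blast
 hence "S u : {y. T y : U}" by (simp add: T(3))
 ultimately show "0 < emeasure (distr mu borel T) U"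
  using haar_open_pos[OF mu] haar_preimage(2)[OF mu T(1), of U] U by simp
qed simp

locale carnot = stratified A nu \<gg>
 for A :: "('g::{topological_group_add, t2_space, second_countable_topology}, 'e::euclidean_space) chart set"
  and nu :: nat and \<gg> :: "nat => 'e set" +
 fixes B :: "'e set" and mu :: "'g measure" and N :: "'g => real"
 assumes noncommutative: "\<exists>x y :: 'g. x + y ~= y + x"
  and basis: "independent B" "span B = \<gg> 1"
  and haar: "haar_measure mu"
  and norm: "homogeneous_norm A nu \<gg> N"
begin

section \<open>The homogeneous norm\<close>

lemma N_continuous: "continuous_on S f ==> continuous_on S (%s. N (f s))"
 using norm continuous_on_compose2[of UNIV N S f] by (auto simp: homogeneous_norm_def)

lemma N_nonneg [simp]: "N x >= 0"
 and N_smooth: "msmooth_on A (- {0}) N"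
 and N_delta: "r > 0 ==> N (delta r x) = r*N x"
 and N_uminus [simp]: "N (- x) = N x"
 and N_eq_0 [simp]: "N x = 0 \<longleftrightarrow> x = 0"
 using norm by (auto simp: homogeneous_norm_def)

lemma N_0 [simp]: "N 0 = 0"
 by simp

lemma N_pos [simp]: "0 < N x \<longleftrightarrow> x ~= 0"
 using N_nonneg[of x] N_eq_0[of x] by linarith

lemma B_layer: "B <= layer 1"
 using basis(2) span_superset[of B] strat by (auto simp: layer_def stratified_group_def)

lemma finite_B: "finite B"
 using basis(1) by (rule independent_imp_finite)

lemma X_N_delta:
 assumes v: "v : layer 1" and x: "x ~= 0" and r: "r > 0"
 shows "X v N (delta r x) = X v N x"
proof -
 have o: "open (- {0::'g})" by (intro open_Compl closed_singleton)
 have x': "delta r x ~= 0" using N_delta[OF r, of x] x r by (metis N_eq_0 mult_eq_0_iff less_irrefl)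
 have dv: "dil r v = r *\<^sub>R v" using dil_layer[OF v] by simp
 have "((%h. N (x + E (h *\<^sub>R v))) has_vector_derivative X v N x) (at 0)"
  by (rule gvel_X[OF o N_smooth _ gvel_E]) (use x in simp)
 hence 1: "((%h. r*N (x + E (h *\<^sub>R v))) has_vector_derivative r*X v N x) (at 0)"
  by (rule has_vector_derivative_mult_right)
 have "r*N (x + E (h *\<^sub>R v)) = N (delta r x + E (h *\<^sub>R (r *\<^sub>R v)))" for h
  using N_delta[OF r, of "x + E (h *\<^sub>R v)"] by (simp add: delta_add delta_E linear_cmul[OF linear_dil] dv)
 moreover have "((%h. N (delta r x + E (h *\<^sub>R (r *\<^sub>R v)))) has_vector_derivative X (r *\<^sub>R v) N (delta r x)) (at 0)"
  by (rule gvel_X[OF o N_smooth _ gvel_E]) (use x' in simp)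
 ultimately have "r*X v N x = X (r *\<^sub>R v) N (delta r x)"
  using vector_derivative_unique_at[OF 1] by simp
 also have "... = r*X v N (delta r x)"
  using linear_cmul[OF linear_X[OF o N_smooth, of "delta r x"]] x' by simp
 finally show ?thesis using r by simp
qed

lemma delta_zero: "delta 0 x = 0"
proof -
 have "dil 0 Y = 0" for Y unfolding dil_proj by (rule sum.neutral) auto
 thus ?thesis by (simp add: delta_eq)
qed

text \<open>
 The path \<open>s \<mapsto> delta s y\<close> joins the identity to \<open>y\<close>; to leave a compact neighbourhood of
 the identity it has to cross a compact set on which \<open>N\<close> is bounded below.
\<close>

lemma N_sublevel_compact: "compact {x. N x <= R}"
proof -
 obtain f :: "'g => real" and K P where f: "open P" "0 : P" "!!y. y : P ==> f y = 1" "compact K" "!!y. y ~: K ==> f y = 0"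
  by (rule bump[OF open_UNIV UNIV_I, of 0]) blast
 have PK: "P <= K" using f(3,5) by (metis subsetI zero_neq_one)
 have cd: "compact (K - P)" by (rule compact_diff[OF f(4,1)])
 have "\<exists>c>0. ALL y:K - P. c <= N y"
 proof (cases "K - P = {}")
  case True
  thus ?thesis by (intro exI[of _ 1]) auto
 next
  case False
  have "continuous_on (K - P) N" by (rule N_continuous[OF continuous_on_id])
  from continuous_attains_inf[OF cd False this] obtain z where "z : K - P" "ALL y:K - P. N z <= N y" by blast
  moreover from this have "N z > 0" using f(2) by auto
  ultimately show ?thesis by blast
 qed
 then obtain c where c: "c > 0" "!!y. y : K - P ==> c <= N y" by blast
 have small: "y : K" if y: "N y < c" for y
 proof (rule ccontr)
  assume yK: "y ~: K"
  let ?p = "%s. delta s y"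
  have cp: "continuous_on {0..1} ?p" by (intro continuous_on_delta continuous_intros)
  hence con: "connected (?p ` {0..1})" by (rule connected_continuous_image) simp
  have in0: "0 : ?p ` {0..1}" using delta_zero by (auto intro!: image_eqI[of _ _ 0])
  have in1: "y : ?p ` {0..1}" by (auto intro!: image_eqI[of _ _ 1])
  have "\<not> ?p ` {0..1} <= P \<union> - K"
  proof
   assume "?p ` {0..1} <= P \<union> - K"
   moreover have "P Int - K Int ?p ` {0..1} = {}" using PK by blast
   ultimately have "P Int ?p ` {0..1} = {} | - K Int ?p ` {0..1} = {}"
    using connectedD[OF con f(1), of "- K"] compact_imp_closed[OF f(4)] by auto
   thus False using in0 in1 f(2) yK by blast
  qed
  then obtain s where s: "s : {0..1}" "?p s : K - P" by blast
  have "s ~= 0" using s f(2) delta_zero[of y] by auto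
  hence "N (?p s) = s*N y" using N_delta s(1) by simp
  also have "... <= N y" using s(1) by (simp add: mult_left_le_one_le)
  finally show False using c(2)[OF s(2)] y by simp
 qed
 have cl: "closed {x. N x <= R}" for R
  by (intro closed_Collect_le N_continuous continuous_intros)
 have "compact {x. N x <= R}" if R: "R > 0" for R
 proof -
  let ?r = "2 * R/c"
  have r: "?r > 0" using R c(1) by simp
  have "{x. N x <= R} <= delta ?r ` K"
  proof
   fix x assume x: "x : {x. N x <= R}"
   have "N (delta (1/?r) x) = (1/?r)*N x" using R c(1) by (intro N_delta) simp
   also have "... <= (1/?r) * R" using x R c(1) by (intro mult_left_mono) auto
   also have "... < c" using R c(1) by simp
   finally show "x : delta ?r ` K" using small delta_inverse(1)[of ?r x] r by (metis image_eqI less_irrefl)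
  qed
  moreover have "compact (delta ?r ` K)"
   by (intro compact_continuous_image continuous_on_delta continuous_intros f)
  ultimately show ?thesis using cl[of R] compact_Int_closed[of "delta ?r ` K" "{x. N x <= R}"] by (simp add: Int_absorb1)
 qed
 from compact_Int_closed[OF this[of "max R 1"] cl[of R]] show ?thesis
  by (simp add: Collect_conj_eq[symmetric] conj_commute) (smt (verit, ccfv_SIG) Collect_cong)
qed

lemma compact_N_bounded:
 assumes "compact K"
 obtains R where "R > 0" "K <= {x. N x < R}"
proof -
 have "bounded (N ` K)"
  by (intro compact_imp_bounded compact_continuous_image N_continuous continuous_on_id assms)
 then obtain a where "ALL x:N ` K. norm x <= a" unfolding bounded_iff by blast
 hence "K <= {x. N x < max (a + 1) 1}" by force
 thus ?thesis using that[of "max (a + 1) 1"] by simp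
qed

text \<open>\<open>X\<^sub>v N\<close> is invariant under dilations, hence determined on the compact set \<open>N = 1\<close>.\<close>

lemma X_N_bounded: "\<exists>C\<ge>0. ALL v:B. ALL x. x ~= 0 --> \<bar>X v N x\<bar> <= C"
proof -
 let ?S = "{x. N x <= 1} Int {x. 1 <= N x}"
 have S: "compact ?S"
  by (intro compact_Int_closed N_sublevel_compact closed_Collect_le N_continuous continuous_intros)
 have "EX C. ALL x. x ~= 0 --> \<bar>X v N x\<bar> <= C" if v: "v : B" for v
 proof -
  have sub: "?S <= - {0}" by auto
  have "open (- {0::'g})" by (intro open_Compl closed_singleton)
  hence "continuous_on ?S (X v N)"
   using msmooth_continuous[OF _ msmooth_X[OF _ N_smooth]] sub continuous_on_subset by blast
  hence "bounded (X v N ` ?S)" using S by (intro compact_imp_bounded compact_continuous_image)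
  then obtain C where C: "!!x. x : ?S ==> \<bar>X v N x\<bar> <= C" by (auto simp: bounded_iff)
  have "\<bar>X v N x\<bar> <= C" if x: "x ~= 0" for x
  proof -
   have r: "1/N x > 0" using x by simp
   have "X v N (delta (1/N x) x) = X v N x" using v B_layer x r by (intro X_N_delta) auto
   moreover have "N (delta (1/N x) x) = 1" using N_delta[OF r, of x] x by simp
   ultimately show ?thesis using C[of "delta (1/N x) x"] by simp
  qed
  thus ?thesis by blast
 qed
 then obtain C where C: "!!v x. v : B ==> x ~= 0 ==> \<bar>X v N x\<bar> <= C v" by metis
 have "\<bar>X v N x\<bar> <= (\<Sum>v\<in>B. \<bar>C v\<bar>)" if "v : B" "x ~= 0" for v x
  using C[OF that] member_le_sum[of v B "%v. \<bar>C v\<bar>"] finite_B that by force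
 thus ?thesis by (intro exI[of _ "\<Sum>v\<in>B. \<bar>C v\<bar>"]) (auto intro: sum_nonneg)
qed

section \<open>Uniqueness and invariance of the Haar measure\<close>

lemma haar_sigma_finite:
 fixes kappa :: "'g measure"
 assumes "haar_measure kappa"
 shows "sigma_finite_measure kappa"
proof
 let ?A = "range (%n::nat. {x. N x <= real n})"
 have "{x. N x <= real n} : sets borel" for n by (rule borel_compact[OF N_sublevel_compact])
 moreover have "\<Union>?A = UNIV" using real_arch_simple by auto
 moreover have "emeasure kappa {x. N x <= real n} ~= \<infinity>" for n
  using assms N_sublevel_compact[of "real n"] unfolding haar_measure_def by (metis less_irrefl)
 ultimately show "EX A. countable A & A <= sets kappa & \<Union> A = space kappa & (ALL a:A. emeasure kappa a ~= \<infinity>)"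
  using haar_sets[OF assms] haar_space[OF assms] by (intro exI[of _ ?A]) auto
qed

lemma measurable_haar_pair:
 fixes kappa kappa' :: "'g measure"
 assumes "haar_measure kappa" "haar_measure kappa'" "f : measurable borel M"
 shows "f : measurable (kappa \<Otimes>\<^sub>M kappa') M"
proof -
 have "sets (kappa \<Otimes>\<^sub>M kappa') = sets (borel \<Otimes>\<^sub>M borel)"
  by (rule sets_pair_measure_cong) (simp_all add: haar_sets assms)
 hence "sets (kappa \<Otimes>\<^sub>M kappa') = sets borel" by (simp only: borel_prod)
 from measurable_cong_sets[OF this refl] assms(3) show ?thesis by blast
qed

lemma haar_left_nn:
 fixes kappa :: "'g measure"
 assumes kappa: "haar_measure kappa" and f: "f : borel_measurable borel"
 shows "(\<integral>\<^sup>+y. f (x + y) \<partial>kappa) = (\<integral>\<^sup>+y. f y \<partial>kappa)"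
 by (subst (2) haar_distr_left[OF kappa, of x, symmetric], subst nn_integral_distr)
  (auto intro!: f measurable_haar[OF kappa] borel_measurable_continuous_onI continuous_intros)

abbreviation unit_ball :: "'g set" where "unit_ball == {x. N x < 1}"

lemma open_unit_ball: "open unit_ball"
 by (intro open_Collect_less N_continuous continuous_intros)

lemma haar_unit_ball:
 fixes kappa :: "'g measure"
 shows "haar_measure kappa ==> 0 < emeasure kappa unit_ball & emeasure kappa unit_ball < \<infinity>"
proof
 assume kappa: "haar_measure kappa"
 have "unit_ball ~= {}" using N_0 by (metis (mono_tags) empty_iff mem_Collect_eq zero_less_one)
 thus "0 < emeasure kappa unit_ball" using kappa open_unit_ball by (simp add: haar_measure_def)
 have "emeasure kappa unit_ball <= emeasure kappa {x. N x <= 1}"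
  using haar_sets[OF kappa] borel_compact[OF N_sublevel_compact] by (intro emeasure_mono) auto
 also have "... < \<infinity>" using kappa N_sublevel_compact by (simp add: haar_measure_def)
 finally show "emeasure kappa unit_ball < \<infinity>" .
qed

text \<open>
 Weil's argument: \<open>f (x) g (y + x) / D (x)\<close>, with \<open>D (x)\<close> the integral of \<open>g (y + x)\<close> in
 \<open>y\<close>, is integrated over \<open>kappa \<times> rho\<close> in two ways, using the left invariance of both measures.
\<close>

lemma haar_integral_formula:
 fixes rho :: "'g measure"
 assumes rho: "haar_measure rho"
 obtains J where "!!(kappa :: 'g measure) Y. haar_measure kappa ==> Y : sets borel ==> emeasure kappa Y = emeasure kappa unit_ball*J Y"
proof -
 define g :: "'g => ennreal" where "g = indicator unit_ball"
 have ub: "unit_ball : sets borel" using open_unit_ball by simp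
 have gm [measurable]: "g : borel_measurable borel" unfolding g_def using ub by simp
 define D where "D = (%x. \<integral>\<^sup>+t. g (t + x) \<partial>rho)"
 have plus: "(%p::'g \<times> 'g. fst p + snd p) : borel_measurable borel"
  and plus': "(%p::'g \<times> 'g. snd p + fst p) : borel_measurable borel"
  and diff: "(%p::'g \<times> 'g. - snd p + fst p) : borel_measurable borel"
  and um: "(%y::'g. - y) : borel_measurable borel"
  and tr: "(%y::'g. y + x) : borel_measurable borel" for x
  by (intro borel_measurable_continuous_onI continuous_intros)+
 interpret L: sigma_finite_measure rho by (rule haar_sigma_finite[OF rho])
 have sl: "sets rho = sets borel" by (rule haar_sets[OF rho])
 have Dm [measurable]: "D : borel_measurable borel"
 proof -
  have "(%p. g (snd p + fst p)) : borel_measurable borel" using measurable_compose[OF plus' gm] .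
  moreover have "sets (borel \<Otimes>\<^sub>M rho) = sets (borel :: ('g \<times> 'g) measure)"
  proof -
   have "sets ((borel :: 'g measure) \<Otimes>\<^sub>M rho) = sets (borel \<Otimes>\<^sub>M (borel :: 'g measure))"
    by (rule sets_pair_measure_cong[OF refl sl])
   thus ?thesis by (simp only: borel_prod)
  qed
  ultimately have "(%p. g (snd p + fst p)) : borel_measurable (borel \<Otimes>\<^sub>M rho)"
   by (subst measurable_cong_sets[OF _ refl])
  thus ?thesis unfolding D_def by (intro L.borel_measurable_nn_integral) (simp add: split_def)
 qed
 have D: "0 < D x" "D x < \<infinity>" for x
 proof -
  let ?V = "{t. t + x : unit_ball}"
  have "continuous_on UNIV (%t. t + x)" by (intro continuous_intros)
  hence o: "open ?V" using preimage_open[OF open_UNIV _ open_unit_ball] by simp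
  have "D x = (\<integral>\<^sup>+t. indicator ?V t \<partial>rho)" unfolding D_def g_def by (rule nn_integral_cong) (simp add: indicator_def)
  hence Dx: "D x = emeasure rho ?V" using o sl by (simp add: nn_integral_indicator)
  have "- x : ?V" using N_0 by simp
  thus "0 < D x" unfolding Dx by (rule haar_open_pos[OF rho o])
  have "?V <= (%t. t + - x) ` {y. N y <= 1}"
  proof
   fix t assume "t : ?V"
   thus "t : (%t. t + - x) ` {y. N y <= 1}" by (intro image_eqI[of _ _ "t + x"]) (auto simp: add.assoc)
  qed
  moreover have c: "compact ((%t. t + - x) ` {y. N y <= 1})"
   by (intro compact_continuous_image N_sublevel_compact continuous_intros)
  ultimately have "D x <= emeasure rho ((%t. t + - x) ` {y. N y <= 1})"
   unfolding Dx using sl borel_compact[OF c] by (intro emeasure_mono) auto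
  also have "... < \<infinity>" using rho c by (simp add: haar_measure_def)
  finally show "D x < \<infinity>" .
 qed
 define J where "J = (%Y. \<integral>\<^sup>+y. indicator Y (- y)/D (- y) \<partial>rho)"
 have "emeasure kappa Y = emeasure kappa unit_ball*J Y" if kappa: "haar_measure kappa" and Y: "Y : sets borel" for kappa Y
 proof -
  have sk: "sets kappa = sets borel" by (rule haar_sets[OF kappa])
  interpret K: sigma_finite_measure kappa by (rule haar_sigma_finite[OF kappa])
  interpret P: pair_sigma_finite kappa rho by unfold_locales
  define f :: "'g => ennreal" where "f = (%x. indicator Y x/D x)"
  have fm [measurable]: "f : borel_measurable borel" unfolding f_def using Y by measurable
  have "emeasure kappa Y = (\<integral>\<^sup>+x. indicator Y x \<partial>kappa)" using Y sk by simp
  also have "... = (\<integral>\<^sup>+x. \<integral>\<^sup>+y. f x*g (y + x) \<partial>rho \<partial>kappa)"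
  proof (rule nn_integral_cong)
   fix x
   have "(\<integral>\<^sup>+y. f x*g (y + x) \<partial>rho) = f x*D x"
    unfolding D_def using measurable_haar[OF rho measurable_compose[OF tr gm]] by (rule nn_integral_cmult)
   also have "... = indicator Y x"
    unfolding f_def using D[of x] by (simp add: ennreal_divide_times ennreal_divide_self)
   finally show "indicator Y x = (\<integral>\<^sup>+y. f x*g (y + x) \<partial>rho)" by simp
  qed
  also have "... = (\<integral>\<^sup>+y. \<integral>\<^sup>+x. f x*g (y + x) \<partial>kappa \<partial>rho)"
  proof (rule P.Fubini'[symmetric])
   have "(%p. f (fst p)*g (snd p + fst p)) : borel_measurable borel"
    by (intro borel_measurable_times_ennreal measurable_compose[OF plus' gm]
      measurable_compose[OF borel_measurable_continuous_onI fm] continuous_intros)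
   thus "(%(x, y). f x*g (y + x)) : borel_measurable (kappa \<Otimes>\<^sub>M rho)"
    using measurable_haar_pair[OF kappa rho] by (simp add: split_def)
  qed
  also have "... = (\<integral>\<^sup>+y. \<integral>\<^sup>+x. f (- y + x)*g x \<partial>kappa \<partial>rho)"
  proof (rule nn_integral_cong)
   fix y
   have "(%x. f (- y + x)*g x) : borel_measurable borel"
    by (intro borel_measurable_times_ennreal gm measurable_compose[OF borel_measurable_continuous_onI fm] continuous_intros)
   from haar_left_nn[OF kappa this, of y]
   show "(\<integral>\<^sup>+x. f x*g (y + x) \<partial>kappa) = (\<integral>\<^sup>+x. f (- y + x)*g x \<partial>kappa)" by (simp add: add.assoc[symmetric])
  qed
  also have "... = (\<integral>\<^sup>+x. \<integral>\<^sup>+y. f (- y + x)*g x \<partial>rho \<partial>kappa)"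
  proof (rule P.Fubini')
   have "(%p. f (- snd p + fst p)*g (fst p)) : borel_measurable borel"
    by (intro borel_measurable_times_ennreal measurable_compose[OF diff fm]
      measurable_compose[OF borel_measurable_continuous_onI gm] continuous_intros)
   thus "(%(x, y). f (- y + x)*g x) : borel_measurable (kappa \<Otimes>\<^sub>M rho)"
    using measurable_haar_pair[OF kappa rho] by (simp add: split_def)
  qed
  also have "... = (\<integral>\<^sup>+x. g x*J Y \<partial>kappa)"
  proof (rule nn_integral_cong)
   fix x
   have fd: "(%y. f (- y + x)) : borel_measurable borel" "(%y. f (- y)) : borel_measurable borel"
    by (intro measurable_compose[OF borel_measurable_continuous_onI fm] continuous_intros)+
   have "(\<integral>\<^sup>+y. f (- y + x)*g x \<partial>rho) = (\<integral>\<^sup>+y. f (- y + x) \<partial>rho)*g x"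
    by (rule nn_integral_multc[OF measurable_haar[OF rho fd(1)]])
   also have "(\<integral>\<^sup>+y. f (- y + x) \<partial>rho) = (\<integral>\<^sup>+y. f (- (x + y) + x) \<partial>rho)" by (rule haar_left_nn[OF rho fd(1), symmetric])
   also have "... = J Y" by (simp only: group_normalize J_def f_def)
   finally show "(\<integral>\<^sup>+y. f (- y + x)*g x \<partial>rho) = g x*J Y" by (simp add: mult.commute)
  qed
  also have "... = emeasure kappa unit_ball*J Y"
   unfolding g_def using ub sk by (simp add: nn_integral_multc)
  finally show ?thesis .
 qed
 thus ?thesis by (rule that)
qed

lemma haar_unique:
 fixes kappa :: "'g measure"
 assumes kappa: "haar_measure kappa"
 obtains c where "0 < c" "!!Y. Y : sets borel ==> emeasure kappa Y = ennreal c*emeasure mu Y"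
proof -
 obtain J where J: "!!(kappa :: 'g measure) Y. haar_measure kappa ==> Y : sets borel ==> emeasure kappa Y = emeasure kappa unit_ball*J Y"
  by (rule haar_integral_formula[OF haar]) blast
 obtain a where a: "emeasure kappa unit_ball = ennreal a" "0 < a"
  using haar_unit_ball[OF kappa] by (cases "emeasure kappa unit_ball") auto
 obtain b where b: "emeasure mu unit_ball = ennreal b" "0 < b"
  using haar_unit_ball[OF haar] by (cases "emeasure mu unit_ball") auto
 have "emeasure kappa Y = ennreal (a/b)*emeasure mu Y" if Y: "Y : sets borel" for Y
 proof -
  have "ennreal (a/b)*(ennreal b*J Y) = ennreal (a/b*b)*J Y"
   using a b by (simp only: ennreal_mult[of "a/b" b] mult.assoc divide_nonneg_pos less_imp_le)
  thus ?thesis using J[OF kappa Y] J[OF haar Y] a b by simp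
 qed
 thus ?thesis using that[of "a/b"] a b by simp
qed

lemma continuous_on_dil_point: "continuous_on UNIV (delta r)"
 by (rule continuous_on_delta[OF continuous_on_const continuous_on_id])

lemma continuous_on_right_translation: "continuous_on UNIV (%y::'g. y + a)"
 by (intro continuous_intros)

text \<open>Uniqueness of the Haar measure gives such a constant for dilations, right translations and inversion.\<close>

definition scales :: "('g => 'g) => real => bool" where
 "scales T c \<longleftrightarrow> 0 < c & (ALL Y:sets borel. emeasure mu {y. T y : Y} = ennreal c*emeasure mu Y)"

lemma scalesD: "scales T c ==> 0 < c" "scales T c ==> Y : sets borel ==> emeasure mu {y. T y : Y} = ennreal c*emeasure mu Y"
 by (auto simp: scales_def)

lemma scales_ex:
 assumes "continuous_on UNIV T" "continuous_on UNIV S" "!!y. T (S y) = y" "!!y. S (T y) = y"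
  "!!x Y. Y : sets borel ==> emeasure mu {y. x + T y : Y} = emeasure mu {y. T y : Y}"
 shows "EX c. scales T c"
 using haar_unique[OF haar_distr[OF haar assms]] haar_preimage(2)[OF haar assms(1)] unfolding scales_def by metis

lemma scales_unique:
 assumes "scales T a" "scales T b"
 shows "a = b"
proof -
 obtain c where "emeasure mu unit_ball = ennreal c" "0 < c"
  using haar_unit_ball[OF haar] by (cases "emeasure mu unit_ball") auto
 thus ?thesis
  using scalesD(2)[OF assms(1), of unit_ball] scalesD(2)[OF assms(2), of unit_ball] scalesD(1)[OF assms(1)] scalesD(1)[OF assms(2)] open_unit_ball
  by (simp add: ennreal_mult[symmetric])
qed

lemma scales_comp:
 assumes "scales T a" "scales S b" "continuous_on UNIV T"
 shows "scales (%y. T (S y)) (a*b)"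
 unfolding scales_def
proof (intro conjI ballI)
 show "0 < a*b" using assms by (simp add: scales_def)
 fix Y :: "'g set" assume Y: "Y : sets borel"
 show "emeasure mu {y. T (S y) : Y} = ennreal (a*b)*emeasure mu Y"
  using scalesD(2)[OF assms(2) haar_preimage(1)[OF haar assms(3) Y]] scalesD(2)[OF assms(1) Y] scalesD(1)[OF assms(1)] scalesD(1)[OF assms(2)]
  by (simp add: ennreal_mult mult_ac)
qed

lemma scales_id: "scales (%y. y) 1"
 by (simp add: scales_def)

definition sc :: "real => real" where "sc r = (SOME c. scales (delta r) c)"

definition modular :: "'g => real" where "modular a = (SOME c. scales (%y. y + a) c)"

lemma scales_sc:
 assumes r: "r > 0"
 shows "scales (delta r) (sc r)"
proof -
 have r0: "r ~= 0" using r by simp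
 have "EX c. scales (delta r) c"
 proof (rule scales_ex[of _ "delta (1/r)"])
 fix x and Y :: "'g set" assume Y: "Y : sets borel"
 have "{y. x + delta r y : Y} = {y. delta (1/r) x + y : {z. delta r z : Y}}" using delta_inverse[OF r0] by (simp add: delta_add)
 thus "emeasure mu {y. x + delta r y : Y} = emeasure mu {y. delta r y : Y}"
  using haar_left[OF haar haar_preimage(1)[OF haar continuous_on_dil_point Y]] by simp
 qed (simp_all add: continuous_on_dil_point delta_inverse r0)
 thus ?thesis unfolding sc_def by (rule someI_ex)
qed

lemma scales_modular: "scales (%y. y + a) (modular a)"
 unfolding modular_def
proof (rule someI_ex, rule scales_ex[OF continuous_on_right_translation continuous_on_right_translation[of "- a"]])
 fix x and Y :: "'g set" assume "Y : sets borel"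
 from haar_left[OF haar haar_preimage(1)[OF haar continuous_on_right_translation[of a] this], of x]
 show "emeasure mu {y. x + (y + a) : Y} = emeasure mu {y. y + a : Y}" by (simp add: add.assoc)
qed (simp_all add: add.assoc)

lemmas sc = scalesD[OF scales_sc]

lemma sc_mult: "r > 0 ==> s > 0 ==> sc (r * s) = sc r * sc s"
 using scales_comp[OF scales_sc scales_sc continuous_on_dil_point, of r s] scales_sc[of "r * s"]
 by (intro scales_unique[of "delta (r * s)"]) (simp_all add: delta_delta[abs_def])

lemma sc_1: "sc 1 = 1"
 using sc_mult[of 1 1] sc(1)[of 1] by simp

lemma sc_power: "sc (2 ^ k) = sc 2 ^ k"
 by (induction k) (simp_all add: sc_1 sc_mult)

lemma modular_add: "modular (a + b) = modular a*modular b"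
 using scales_comp[OF scales_modular scales_modular continuous_on_right_translation, of a b]
 by (intro scales_unique[OF scales_modular]) (simp add: add.assoc mult.commute)

lemma modular_delta:
 assumes r: "r > 0"
 shows "modular (delta r a) = modular a"
proof -
 have "scales (%y. delta r y + delta r a) (modular (delta r a) * sc r)"
  by (rule scales_comp[OF scales_modular scales_sc[OF r] continuous_on_right_translation])
 moreover have "scales (%y. delta r (y + a)) (sc r*modular a)"
  by (rule scales_comp[OF scales_sc[OF r] scales_modular continuous_on_dil_point])
 ultimately show ?thesis using scales_unique sc(1)[OF r] by (fastforce simp: delta_add)
qed

text \<open>
 The modular function is invariant under dilations and bounded near the identity, hence a
 bounded homomorphism into the positive reals.
\<close>

lemma modular_1: "modular a = 1"
proof -
 let ?K = "(%p. fst p + - snd p) ` ({x. N x <= 1} \<times> {x. N x <= 1})"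
 have K: "compact ?K"
  by (intro compact_continuous_image compact_Times N_sublevel_compact continuous_intros)
 obtain k where k: "emeasure mu ?K = ennreal k" "0 <= k"
  using haar K by (cases "emeasure mu ?K") (auto simp: haar_measure_def)
 obtain c where c: "emeasure mu unit_ball = ennreal c" "0 < c"
  using haar_unit_ball[OF haar] by (cases "emeasure mu unit_ball") auto
 note pos = scalesD(1)[OF scales_modular]
 have small: "modular a <= k/c" if "N a <= 1" for a
 proof -
  have "y : ?K" if "y + a : unit_ball" for y
   using that \<open>N a <= 1\<close> by (intro image_eqI[of _ _ "(y + a, a)"]) (auto simp: add.assoc)
  hence "emeasure mu {y. y + a : unit_ball} <= emeasure mu ?K"
   using borel_compact[OF K] haar_sets[OF haar] by (intro emeasure_mono) auto
  hence "modular a*c <= k"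
   using pos[of a] scalesD(2)[OF scales_modular, of unit_ball a] open_unit_ball c k by (simp add: ennreal_mult[symmetric])
  thus ?thesis using c by (simp add: field_simps)
 qed
 have bound: "modular a <= k/c" for a
 proof -
  have r: "1/(N a + 1) > 0" by (simp add: add_nonneg_pos)
  have "N (delta (1/(N a + 1)) a) <= 1"
   unfolding N_delta[OF r] using N_nonneg[of a] by (simp add: divide_le_eq not_less del: N_nonneg)
  thus ?thesis using small modular_delta[OF r, of a] by metis
 qed
 have m0: "modular 0 = 1" using scales_unique[OF scales_modular[of 0]] scales_id by simp
 have le: "modular a <= 1" for a
 proof (rule ccontr)
  assume "\<not> modular a <= 1"
  hence m: "modular a > 1" by simp
  have "EX b. modular b = modular a ^ n" for n
  proof (induction n)
   case 0
   show ?case using m0 by auto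
  next
   case (Suc n)
   thus ?case using modular_add by (metis power_Suc)
  qed
  moreover obtain n where "k/c < modular a ^ n" using real_arch_pow[OF m] by blast
  ultimately show False using bound by (metis not_le)
 qed
 have "modular a*modular (- a) = 1" using m0 modular_add[of a "- a"] by simp
 moreover have "modular a*modular (- a) <= modular a*1" using le[of "- a"] pos[of a] by (intro mult_left_mono) auto
 ultimately show ?thesis using le[of a] by simp
qed

lemma scales_1_distr:
 assumes "continuous_on UNIV T" "scales T 1"
 shows "distr mu borel T = mu"
 using haar_preimage(2)[OF haar assms(1)] scalesD(2)[OF assms(2)] by (intro measure_eqI) (auto simp: haar_sets[OF haar])

lemma mu_distr_left: "distr mu borel (%y. x + y) = mu"
 by (rule haar_distr_left[OF haar])

lemma mu_distr_right: "distr mu borel (%y. y + a) = mu"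
 using scales_modular[of a] by (intro scales_1_distr continuous_on_right_translation) (simp add: modular_1)

lemma mu_distr_uminus: "distr mu borel uminus = mu"
proof (rule scales_1_distr)
 show cu: "continuous_on UNIV (uminus :: 'g => 'g)" by (intro continuous_intros)
 have "EX c. scales uminus c"
 proof (rule scales_ex[OF cu cu])
  fix x and Y :: "'g set" assume Y: "Y : sets borel"
  have "emeasure mu {y. y + - x : {z. - z : Y}} = emeasure mu {y. - y : Y}"
   using scalesD(2)[OF scales_modular haar_preimage(1)[OF haar cu Y], of "- x"] by (simp add: modular_1)
  thus "emeasure mu {y. x + - y : Y} = emeasure mu {y. - y : Y}" by (simp add: minus_add)
 qed simp_all
 then obtain c where c: "scales uminus c" ..
 have "scales (%y. - (- y)) (c*c)" by (rule scales_comp[OF c c cu])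
 hence "c*c = 1" using scales_unique[OF scales_id] by simp
 hence "c = 1" using scalesD(1)[OF c] by (auto simp: square_eq_1_iff)
 thus "scales uminus 1" using c by simp
qed

section \<open>Volume of small balls\<close>

lemma closed_ball_finite: "emeasure mu {x. N x <= r} < \<infinity>"
 using haar N_sublevel_compact by (simp add: haar_measure_def)

text \<open>
 Non-commutativity gives two independent horizontal directions; the \<open>n\<^sup>2\<close> disjoint translates
 of a fixed set along a lattice in these directions shrink into a fixed compact set
 under \<open>delta (1 / n)\<close>, which bounds the scaling factor.
\<close>

lemma sc_2: "sc 2 <= 1/4"
proof -
 obtain u v and f g :: "'e => real" where uv: "u : layer 1" "v : layer 1" "linear f" "linear g"
  "f u = 1" "f v = 0" "g u = 0" "g v = 1" by (rule noncommutative_first_layer[OF noncommutative])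
 define q1 q2 where "q1 = (%x. f (horizontal x))" and "q2 = (%x. g (horizontal x))"
 have q_add: "q1 (x + y) = q1 x + q1 y" "q2 (x + y) = q2 x + q2 y" for x y
  by (simp_all add: q1_def q2_def horizontal_add linear_add uv)
 have q_cont: "continuous_on UNIV q1" "continuous_on UNIV q2"
  unfolding q1_def q2_def
  using uv(3,4) by (intro bounded_linear.continuous_on[OF _ continuous_on_horizontal[OF continuous_on_id]]; simp add: linear_conv_bounded_linear)+
 define a where "a = (%s t. E (s *\<^sub>R u + t *\<^sub>R v))"
 have lay: "s *\<^sub>R u + t *\<^sub>R v : layer 1" for s t
  by (intro subspace_add[OF subspace_layer] subspace_scale[OF subspace_layer] uv)
 have q_a: "q1 (a s t) = s" "q2 (a s t) = t" for s t
  by (simp_all add: a_def q1_def q2_def horizontal_def proj_of_layer[OF lay] linear_add linear_cmul uv)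
 have delta_a: "delta r (a s t) = a (r * s) (r*t)" for r s t
  by (simp add: a_def delta_E dil_layer[OF lay] scaleR_add_right)
 define W where "W = {x. N x < 1} Int {x. \<bar>q1 x\<bar> < 1/2} Int {x. \<bar>q2 x\<bar> < 1/2}"
 have W: "open W" unfolding W_def
  by (intro open_Int open_Collect_less continuous_intros q_cont N_continuous)
 have "0 : W" using q_add[of 0 0] N_0 by (simp add: W_def)
 hence W0: "0 < emeasure mu W" using W haar unfolding haar_measure_def by blast
 have "emeasure mu W <= emeasure mu {x. N x <= 1}"
  using borel_compact[OF N_sublevel_compact] haar_sets[OF haar] by (intro emeasure_mono) (auto simp: W_def)
 hence Wfin: "emeasure mu W < \<infinity>" using closed_ball_finite[of 1] by (rule le_less_trans)
 obtain w where w: "emeasure mu W = ennreal w" "0 < w" using W0 Wfin by (cases "emeasure mu W") auto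
 define D where "D = (%p. a (fst (fst p)) (snd (fst p)) + snd p) ` ((cbox (0, 0) (1, 1)) \<times> {x. N x <= 1})"
 have D: "compact D" unfolding D_def a_def
  by (intro compact_continuous_image compact_Times N_sublevel_compact compact_cbox continuous_intros continuous_on_E)
 obtain d where d: "emeasure mu D = ennreal d" "0 <= d"
  using haar D by (cases "emeasure mu D") (auto simp: haar_measure_def)
 have setsmu: "sets mu = sets borel" by (rule haar_sets[OF haar])
 have main: "real n*real n*w <= sc (1/real n)*d" if n: "n > 0" for n :: nat
 proof -
  define T where "T = (%(i, j). {y. - a (real i) (real j) + y : W})"
  let ?I = "{..<n} \<times> {..<n}"
  have cont: "continuous_on UNIV (%y. x + y)" for x :: 'g by (intro continuous_intros)
  have Tm: "T p : sets borel" for p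
   unfolding T_def using preimage_open[OF open_UNIV cont W] by (simp add: split_def)
  have Te: "emeasure mu (T p) = emeasure mu W" for p
   unfolding T_def split_def using haar_left[OF haar borel_open[OF W]] by simp
  have "disjoint_family_on T ?I"
   unfolding disjoint_family_on_def
  proof (intro ballI impI)
   fix p p' assume p: "p : ?I" "p' : ?I" "p ~= p'"
   have near: "\<bar>q1 y - real (fst p)\<bar> < 1/2 & \<bar>q2 y - real (snd p)\<bar> < 1/2" if "y : T p" for y p
   proof -
    let ?b = "a (real (fst p)) (real (snd p))"
    have "- ?b + y : W" using that by (simp add: T_def split_def)
    moreover have "q1 (?b + (- ?b + y)) = real (fst p) + q1 (- ?b + y)" "q2 (?b + (- ?b + y)) = real (snd p) + q2 (- ?b + y)"
     by (simp_all only: q_add q_a)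
    ultimately show ?thesis by (simp add: W_def group_normalize)
   qed
   show "T p Int T p' = {}"
   proof (rule ccontr)
    assume "T p Int T p' ~= {}"
    then obtain y where "y : T p" "y : T p'" by blast
    from near[OF this(1)] near[OF this(2)] have "fst p = fst p'" "snd p = snd p'" by linarith+
    thus False using p(3) by (simp add: prod_eq_iff)
   qed
  qed
  hence "(\<Sum>p\<in>?I. emeasure mu (T p)) = emeasure mu (\<Union>p\<in>?I. T p)"
   using Tm setsmu by (intro sum_emeasure) auto
  also have "... <= emeasure mu {y. delta (1/real n) y : D}"
  proof (rule emeasure_mono)
   show "{y. delta (1/real n) y : D} : sets mu"
    unfolding setsmu by (rule haar_preimage(1)[OF haar continuous_on_dil_point borel_compact[OF D]])
   show "(\<Union>p\<in>?I. T p) <= {y. delta (1/real n) y : D}"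
   proof safe
    fix i j y assume ij: "i < n" "j < n" "y : T (i, j)"
    let ?b = "a (real i) (real j)" and ?r = "1/real n"
    have r: "?r > 0" "?r <= 1" using n by auto
    have "N (- ?b + y) <= 1" using ij by (simp add: T_def W_def)
    hence "N (delta ?r (- ?b + y)) <= 1"
     using N_delta[OF r(1), of "- ?b + y"] mult_le_one[OF r(2) N_nonneg] by simp
    moreover have "delta ?r y = a (?r*real i) (?r*real j) + delta ?r (- ?b + y)"
    proof -
     have "delta ?r y = delta ?r (?b + (- ?b + y))" by (simp only: group_normalize)
     thus ?thesis by (simp only: delta_add delta_a)
    qed
    moreover have "(?r*real i, ?r*real j) : cbox (0, 0) (1, 1)"
     using ij n by (simp add: cbox_Pair_eq)
    ultimately show "delta ?r y : D" unfolding D_def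
     by (intro image_eqI[of _ _ "((?r*real i, ?r*real j), delta ?r (- ?b + y))"]) auto
   qed
  qed
  also have "... = ennreal (sc (1/real n)*d)"
   using sc[of "1/real n"] n borel_compact[OF D] d by (simp add: ennreal_mult)
  finally have "ennreal (real n*real n*w) <= ennreal (sc (1/real n)*d)"
   using w by (simp add: Te card_cartesian_product ennreal_of_nat_eq_real_of_nat ennreal_mult)
  thus ?thesis
   using sc(1)[of "1/real n"] n d by (subst (asm) ennreal_le_iff) auto
 qed
 have bd: "(4 * sc 2) ^ k <= d/w" for k
 proof -
  have "sc (2 ^ k) * sc (1/2 ^ k) = 1" using sc_mult[of "2 ^ k" "1/2 ^ k"] sc_1 by simp
  moreover have "2 ^ k*2 ^ k*w <= sc (1/2 ^ k)*d" using main[of "2 ^ k"] by simp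
  hence "sc (2 ^ k)*(2 ^ k*2 ^ k*w) <= sc (2 ^ k)*(sc (1/2 ^ k)*d)"
   using sc(1)[of "2 ^ k"] by (intro mult_left_mono) auto
  ultimately have "sc 2 ^ k*(2 ^ k*2 ^ k*w) <= d" by (simp add: sc_power mult.assoc[symmetric])
  moreover have "sc 2 ^ k*(2 ^ k*2 ^ k*w) = (4 * sc 2) ^ k*w"
  proof -
   have "(2::real) ^ k*2 ^ k = 4 ^ k" by (simp add: power_mult_distrib[symmetric])
   thus ?thesis by (simp only: power_mult_distrib mult.assoc mult.left_commute[of "sc 2 ^ k"])
  qed
  ultimately have "(4 * sc 2) ^ k*w <= d" by linarith
  thus ?thesis using w(2) by (simp add: pos_le_divide_eq)
 qed
 show ?thesis
 proof (rule ccontr)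
  assume "\<not> sc 2 <= 1/4"
  then obtain k where "d/w < (4 * sc 2) ^ k" using real_arch_pow[of "4 * sc 2"] by auto
  thus False using bd[of k] by simp
 qed
qed

lemma dyadic_ball: "emeasure mu {x. N x <= 1/2 ^ k} <= ennreal ((1/4) ^ k)*emeasure mu {x. N x <= 1}"
proof -
 have "{x. N x <= 1/2 ^ k} = {x. delta (2 ^ k) x : {x. N x <= 1}}" by (simp add: N_delta field_simps)
 hence "emeasure mu {x. N x <= 1/2 ^ k} = ennreal (sc 2 ^ k)*emeasure mu {x. N x <= 1}"
  using sc(2)[OF _ borel_compact[OF N_sublevel_compact], of "2 ^ k"] by (simp add: sc_power)
 also have "... <= ennreal ((1/4) ^ k)*emeasure mu {x. N x <= 1}"
  using sc_2 sc(1)[of 2] by (intro mult_right_mono ennreal_leI power_mono) auto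
 finally show ?thesis .
qed

lemma null_identity: "emeasure mu {0} = 0"
proof -
 obtain c where c: "emeasure mu {x. N x <= 1} = ennreal c" "0 <= c"
  using closed_ball_finite[of 1] by (cases "emeasure mu {x. N x <= 1}") auto
 have "emeasure mu {0} <= ennreal ((1/4) ^ k*c)" for k
 proof -
  have "emeasure mu {0} <= emeasure mu {x. N x <= 1/2 ^ k}"
   using borel_compact[OF N_sublevel_compact] haar_sets[OF haar] N_0 by (intro emeasure_mono) auto
  also have "... <= ennreal ((1/4) ^ k*c)" using dyadic_ball[of k] c by (simp add: ennreal_mult)
  finally show ?thesis .
 qed
 moreover have "(%k. ennreal ((1/4) ^ k*c)) \<longlonglongrightarrow> ennreal (0*c)"
  by (intro tendsto_ennrealI tendsto_intros LIMSEQ_realpow_zero) auto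
 ultimately have "emeasure mu {0} <= ennreal (0*c)" by (intro LIMSEQ_le_const) auto
 thus ?thesis by simp
qed

end

section \<open>The Hilbert space of square-integrable functions\<close>

definition L2_sqnorm :: "'a measure => ('a => complex) => real" where
 "L2_sqnorm M f = (LINT x|M. (cmod (f x))^2)"

lemma L2D: "f : L2 M ==> f : borel_measurable M" "f : L2 M ==> integrable M (%x. (cmod (f x))^2)"
 by (auto simp: L2_def)

lemma L2_sqnorm_nonneg [simp]: "L2_sqnorm M f >= 0"
 by (simp add: L2_sqnorm_def)

lemma cmod_mult_le: "2*(cmod a*cmod b) <= (cmod a)^2 + (cmod b)^2"
 using sum_squares_bound[of "cmod a" "cmod b"] by simp

lemma cmod_add_sq_le: "(cmod (a + b))^2 <= 2*(cmod a)^2 + 2*(cmod b)^2"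
proof -
 have "(cmod (a + b))^2 <= (cmod a + cmod b)^2" by (intro power_mono norm_triangle_ineq) simp
 also have "... <= 2*(cmod a)^2 + 2*(cmod b)^2"
  using cmod_mult_le[of a b] by (simp add: power2_sum)
 finally show ?thesis .
qed

lemma L2_add_scale:
 assumes f: "f : L2 M" and g: "g : L2 M"
 shows "(%x. f x + c*g x) : L2 M"
proof -
 have m: "(%x. f x + c*g x) : borel_measurable M" using L2D[OF f] L2D[OF g] by measurable
 have "integrable M (%x. (cmod (f x + c*g x))^2)"
 proof (rule Bochner_Integration.integrable_bound)
  show "integrable M (%x. 2*(cmod (f x))^2 + 2*((cmod c)^2*(cmod (g x))^2))"
   using L2D[OF f] L2D[OF g] by auto
  show "AE x in M. norm ((cmod (f x + c*g x))^2) <= norm (2*(cmod (f x))^2 + 2*((cmod c)^2*(cmod (g x))^2))"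
   using cmod_add_sq_le[of "f _" "c*g _"] by (simp add: norm_mult power_mult_distrib)
 qed (use m in measurable)
 thus ?thesis using m by (simp add: L2_def)
qed

lemma L2_zero [simp]: "(%x. 0) : L2 M"
 by (simp add: L2_def)

lemma L2_scale: "f : L2 M ==> (%x. c*f x) : L2 M"
 using L2_add_scale[OF L2_zero, of f M c] by simp

lemma L2_add: "f : L2 M ==> g : L2 M ==> (%x. f x + g x) : L2 M"
 using L2_add_scale[of f M g 1] by simp

lemma L2_diff: "f : L2 M ==> g : L2 M ==> (%x. f x - g x) : L2 M"
proof -
 assume fg: "f : L2 M" "g : L2 M"
 have eq: "(%x. f x + (- 1)*g x) = (%x. f x - g x)" by (intro ext) simp
 show "(%x. f x - g x) : L2 M" using L2_add_scale[OF fg, of "- 1"] unfolding eq .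
qed

lemma cnj_measurable [measurable]: "cnj : borel_measurable borel"
 by (intro borel_measurable_continuous_onI continuous_intros)

lemma L2_cong_AE: "f : L2 M ==> g : borel_measurable M ==> AE x in M. g x = f x ==> g : L2 M"
proof -
 assume f: "f : L2 M" and g: "g : borel_measurable M" and eq: "AE x in M. g x = f x"
 have "integrable M (%x. (cmod (g x))^2)"
 proof (rule integrable_cong_AE_imp[OF L2D(2)[OF f]])
  show "(%x. (cmod (g x))^2) : borel_measurable M" using g by measurable
  show "AE x in M. (cmod (f x))^2 = (cmod (g x))^2" using eq by eventually_elim simp
 qed
 thus "g : L2 M" using g by (simp add: L2_def)
qed

lemma L2_bounded_by:
 assumes "f : borel_measurable M" "integrable M h" "AE x in M. (cmod (f x))^2 <= h x"
 shows "f : L2 M"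
proof -
 have "integrable M (%x. (cmod (f x))^2)"
  by (rule Bochner_Integration.integrable_bound[OF assms(2)]) (use assms in auto)
 thus ?thesis using assms by (simp add: L2_def)
qed

lemma L2_mult_integrable:
 assumes f: "f : L2 M" and g: "g : L2 M"
 shows "integrable M (%x. f x*g x)"
proof (rule Bochner_Integration.integrable_bound)
 show "integrable M (%x. (cmod (f x))^2 + (cmod (g x))^2)" using L2D[OF f] L2D[OF g] by auto
 have "cmod (f x*g x) <= (cmod (f x))^2 + (cmod (g x))^2" for x
 proof -
  have "0 <= cmod (f x)*cmod (g x)" by simp
  thus ?thesis using cmod_mult_le[of "f x" "g x"] unfolding norm_mult by linarith
 qed
 thus "AE x in M. norm (f x*g x) <= norm ((cmod (f x))^2 + (cmod (g x))^2)" by simp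
qed (use L2D[OF f] L2D[OF g] in measurable)

lemma L2_cnj: "f : L2 M ==> (%x. cnj (f x)) : L2 M"
proof -
 assume f: "f : L2 M"
 have "(%x. cnj (f x)) : borel_measurable M" by (rule measurable_compose[OF L2D(1)[OF f] cnj_measurable])
 thus ?thesis using L2D(2)[OF f] by (simp add: L2_def)
qed

lemma L2_inner_integrable: "f : L2 M ==> g : L2 M ==> integrable M (%x. f x*cnj (g x))"
 by (intro L2_mult_integrable L2_cnj)

lemma L2_inner_add_left:
 assumes "f : L2 M" "g : L2 M" "h : L2 M"
 shows "L2_inner M (%x. f x + c*g x) h = L2_inner M f h + c*L2_inner M g h"
 unfolding L2_inner_def
 using L2_inner_integrable[OF assms(1,3)] L2_inner_integrable[OF assms(2,3)]
 by (simp add: distrib_right mult.assoc)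

lemma L2_inner_sym: "L2_inner M g f = cnj (L2_inner M f g)"
proof -
 have "cnj (L2_inner M f g) = (LINT x|M. cnj (f x*cnj (g x)))" unfolding L2_inner_def by (simp only: Bochner_Integration.integral_cnj)
 thus ?thesis by (simp add: L2_inner_def mult.commute)
qed

lemma L2_inner_add_right:
 assumes "f : L2 M" "g : L2 M" "h : L2 M"
 shows "L2_inner M h (%x. f x + c*g x) = L2_inner M h f + cnj c*L2_inner M h g"
 unfolding L2_inner_sym[of M h] L2_inner_add_left[OF assms] by simp

lemma L2_inner_diff_left:
 assumes "f : L2 M" "g : L2 M" "h : L2 M"
 shows "L2_inner M (%x. f x - g x) h = L2_inner M f h - L2_inner M g h"
 using L2_inner_add_left[OF assms, of "- 1"] by simp

lemma L2_inner_self: "L2_inner M f f = complex_of_real (L2_sqnorm M f)"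
proof -
 have "f x*cnj (f x) = complex_of_real ((cmod (f x))^2)" for x by (rule complex_norm_square[symmetric])
 thus ?thesis unfolding L2_inner_def L2_sqnorm_def by (simp only: integral_complex_of_real)
qed

lemma L2_inner_cong:
 assumes "f : borel_measurable M" "f' : borel_measurable M" "g : borel_measurable M" "g' : borel_measurable M"
  "AE x in M. f x = f' x" "AE x in M. g x = g' x"
 shows "L2_inner M f g = L2_inner M f' g'"
 unfolding L2_inner_def
proof (rule integral_cong_AE)
 show "(%x. f x*cnj (g x)) : borel_measurable M" "(%x. f' x*cnj (g' x)) : borel_measurable M"
  using assms(1-4) by (auto intro!: borel_measurable_times measurable_compose[OF _ cnj_measurable])
 show "AE x in M. f x*cnj (g x) = f' x*cnj (g' x)" using assms(5,6) by eventually_elim simp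
qed

lemma L2_sqnorm_eq_0:
 assumes "f : L2 M"
 shows "L2_sqnorm M f = 0 \<longleftrightarrow> (AE x in M. f x = 0)"
 unfolding L2_sqnorm_def using integral_nonneg_eq_0_iff_AE[OF L2D(2)[OF assms]] by simp

lemma L2_sqnorm_add:
 assumes f: "f : L2 M" and g: "g : L2 M"
 shows "L2_sqnorm M (%x. f x + c*g x) =
  L2_sqnorm M f + 2 * Re (cnj c*L2_inner M f g) + (cmod c)^2*L2_sqnorm M g"
proof -
 have "complex_of_real (L2_sqnorm M (%x. f x + c*g x)) = L2_inner M f f + cnj c*L2_inner M f g
   + c*(L2_inner M g f + cnj c*L2_inner M g g)"
  using f g by (simp add: L2_inner_self[symmetric] L2_inner_add_left L2_inner_add_right L2_add_scale)
 also have "... = complex_of_real (L2_sqnorm M f) + (cnj c*L2_inner M f g + cnj (cnj c*L2_inner M f g))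
   + (c*cnj c)*complex_of_real (L2_sqnorm M g)"
  unfolding L2_inner_self L2_inner_sym[of M g f] by (simp add: algebra_simps)
 also have "... = complex_of_real (L2_sqnorm M f + 2 * Re (cnj c*L2_inner M f g) + (cmod c)^2*L2_sqnorm M g)"
  unfolding complex_add_cnj complex_norm_square[symmetric] by (simp only: of_real_add of_real_mult)
 finally show ?thesis by (simp only: of_real_eq_iff)
qed

lemma L2_Cauchy_Schwarz:
 assumes f: "f : L2 M" and g: "g : L2 M"
 shows "(cmod (L2_inner M f g))^2 <= L2_sqnorm M f*L2_sqnorm M g"
proof (cases "L2_sqnorm M g = 0")
 case True
 hence "AE x in M. g x = 0" using L2_sqnorm_eq_0[OF g] by simp
 hence "L2_inner M f g = L2_inner M f (%_. 0)"
  using L2D(1)[OF f] L2D(1)[OF g] by (intro L2_inner_cong) auto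
 thus ?thesis by (simp add: L2_inner_def True)
next
 case False
 hence p: "L2_sqnorm M g > 0" using L2_sqnorm_nonneg[of M g] by linarith
 define a where "a = L2_inner M f g"
 define c where "c = - a/complex_of_real (L2_sqnorm M g)"
 have "cnj c * a = - complex_of_real ((cmod a)^2/L2_sqnorm M g)"
  using complex_norm_square[of a] p by (simp add: c_def mult.commute[of _ a])
 moreover have "(cmod c)^2 = (cmod a)^2/(L2_sqnorm M g)^2" by (simp add: c_def norm_divide power_divide)
 ultimately have "L2_sqnorm M (%x. f x + c*g x) = L2_sqnorm M f - (cmod a)^2/L2_sqnorm M g"
  unfolding L2_sqnorm_add[OF f g] a_def[symmetric] using p by (simp add: power2_eq_square)
 hence "0 <= L2_sqnorm M f - (cmod a)^2/L2_sqnorm M g" using L2_sqnorm_nonneg by metis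
 thus ?thesis using p by (simp add: a_def field_simps)
qed

lemma L2_sqnorm_add_le:
 assumes "f : L2 M" "g : L2 M"
 shows "L2_sqnorm M (%x. f x + g x) <= 2*L2_sqnorm M f + 2*L2_sqnorm M g"
proof -
 have "L2_sqnorm M (%x. f x + g x) <= (LINT x|M. 2*(cmod (f x))^2 + 2*(cmod (g x))^2)"
  unfolding L2_sqnorm_def
  using L2D(2)[OF assms(1)] L2D(2)[OF assms(2)] L2D(2)[OF L2_add[OF assms]]
  by (intro integral_mono cmod_add_sq_le) auto
 thus ?thesis using L2D(2)[OF assms(1)] L2D(2)[OF assms(2)] by (simp add: L2_sqnorm_def)
qed

lemma L2_sqnorm_minus_commute: "L2_sqnorm M (%x. f x - g x) = L2_sqnorm M (%x. g x - f x)"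
 by (simp add: L2_sqnorm_def norm_minus_commute)

text \<open>
 Completeness, for sequences of geometric speed.  With increments \<open>d k\<close> of square norm at most
 \<open>4\<^sup>-\<^sup>k\<close>, the bound \<open>\<bar>d k\<bar> \<le> 2\<^sup>-\<^sup>k + 2\<^sup>k \<bar>d k\<bar>\<^sup>2\<close> makes the sequence converge almost everywhere, and
 Fatou's lemma turns this limit into a limit in square norm.
\<close>

lemma L2_complete:
 assumes F: "!!n. F n : L2 M" and cauchy: "!!k n. k <= n ==> L2_sqnorm M (%x. F k x - F n x) <= (1/4) ^ k"
 obtains f where "f : L2 M" "(%n. L2_sqnorm M (%x. F n x - f x)) \<longlonglongrightarrow> 0"
proof -
 define d where "d = (%k x. F k x - F (Suc k) x)"
 have dL: "d k : L2 M" for k unfolding d_def by (intro L2_diff F)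
 have Fm [measurable]: "F n : borel_measurable M" and dm [measurable]: "d n : borel_measurable M" for n
  using L2D(1)[OF F] L2D(1)[OF dL] by auto
 have "(\<integral>\<^sup>+x. (\<Sum>k. ennreal (2 ^ k*(cmod (d k x))^2)) \<partial>M) = (\<Sum>k. \<integral>\<^sup>+x. ennreal (2 ^ k*(cmod (d k x))^2) \<partial>M)"
  by (rule nn_integral_suminf) measurable
 also have "... <= (\<Sum>k. ennreal ((1/2) ^ k))"
 proof (intro suminf_le allI)
  fix k
  have "(\<integral>\<^sup>+x. ennreal (2 ^ k*(cmod (d k x))^2) \<partial>M) = ennreal (2 ^ k*L2_sqnorm M (d k))"
   using L2D(2)[OF dL[of k]] by (subst nn_integral_eq_integral) (auto simp: L2_sqnorm_def)
  also have "... <= ennreal (2 ^ k*(1/4) ^ k)"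
   using cauchy[of k "Suc k"] by (intro ennreal_leI mult_left_mono) (auto simp: d_def)
  also have "(2::real) ^ k*(1/4) ^ k = (1/2) ^ k" by (simp add: power_mult_distrib[symmetric])
  finally show "(\<integral>\<^sup>+x. ennreal (2 ^ k*(cmod (d k x))^2) \<partial>M) <= ennreal ((1/2) ^ k)" .
 qed auto
 also have "... = ennreal (\<Sum>k. (1/2) ^ k)" by (rule suminf_ennreal2) (auto intro: summable_geometric)
 finally have "(\<integral>\<^sup>+x. (\<Sum>k. ennreal (2 ^ k*(cmod (d k x))^2)) \<partial>M) ~= \<infinity>" by (metis ennreal_less_top infinity_ennreal_def leD)
 hence "AE x in M. (\<Sum>k. ennreal (2 ^ k*(cmod (d k x))^2)) ~= \<infinity>" by (intro nn_integral_PInf_AE) measurable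
 hence conv: "AE x in M. convergent (%k. F k x)"
 proof eventually_elim
  case (elim x)
  have "summable (%k. d k x)"
  proof (rule summable_comparison_test, intro exI allI impI)
   show "summable (%k. (1/2) ^ k + 2 ^ k*(cmod (d k x))^2)"
    by (intro summable_add summable_geometric summable_suminf_not_top elim[unfolded infinity_ennreal_def]) simp_all
   fix k
   define t where "t = cmod (d k x)"
   have "0 <= (2 ^ k)*(t - (1/2) ^ k)^2" by simp
   also have "... = 2 ^ k*t\<^sup>2 - 2*t + (1/2) ^ k"
    by (simp add: power2_diff power2_eq_square algebra_simps power_divide)
   finally show "cmod (d k x) <= (1/2) ^ k + 2 ^ k*(cmod (d k x))^2"
    using norm_ge_zero[of "d k x"] unfolding t_def by linarith
  qed
  hence "convergent (%n. F 0 x - (\<Sum>k<n. d k x))"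
   unfolding summable_iff_convergent by (intro convergent_diff convergent_const)
  moreover have "F 0 x - (\<Sum>k<n. d k x) = F n x" for n
   using sum_lessThan_telescope'[of "%k. F k x" n] by (simp add: d_def)
  ultimately show ?case by (simp only:)
 qed
 define f where "f = (%x. lim (%k. F k x))"
 have fm [measurable]: "f : borel_measurable M" unfolding f_def by (rule borel_measurable_lim_metric) measurable
 have close: "(%x. F n x - f x) : L2 M & L2_sqnorm M (%x. F n x - f x) <= (1/4) ^ n" for n
 proof -
  have "AE x in M. ennreal ((cmod (F n x - f x))^2) = liminf (%k. ennreal ((cmod (F n x - F k x))^2))"
   using conv
  proof eventually_elim
   case (elim x)
   hence "(%k. ennreal ((cmod (F n x - F k x))^2)) \<longlonglongrightarrow> ennreal ((cmod (F n x - f x))^2)"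
    by (intro tendsto_intros tendsto_ennrealI) (simp add: f_def convergent_LIMSEQ_iff)
   from lim_imp_Liminf[OF _ this] show ?case by simp
  qed
  hence "(\<integral>\<^sup>+x. ennreal ((cmod (F n x - f x))^2) \<partial>M) = (\<integral>\<^sup>+x. liminf (%k. ennreal ((cmod (F n x - F k x))^2)) \<partial>M)"
   by (rule nn_integral_cong_AE)
  also have "... <= liminf (%k. \<integral>\<^sup>+x. ennreal ((cmod (F n x - F k x))^2) \<partial>M)"
   by (rule nn_integral_liminf) measurable
  also have "... <= liminf (%k::nat. ennreal ((1/4) ^ n))"
  proof (rule Liminf_mono, rule eventually_sequentiallyI[of n])
   show "(\<integral>\<^sup>+x. ennreal ((cmod (F n x - F k x))^2) \<partial>M) <= ennreal ((1/4) ^ n)" if "n <= k" for k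
    using L2D(2)[OF L2_diff[OF F[of n] F[of k]]] cauchy[OF that]
    by (subst nn_integral_eq_integral) (auto simp: L2_sqnorm_def intro!: ennreal_leI)
  qed
  finally have le: "(\<integral>\<^sup>+x. ennreal ((cmod (F n x - f x))^2) \<partial>M) <= ennreal ((1/4) ^ n)"
   by (simp add: Liminf_const)
  hence int: "integrable M (%x. (cmod (F n x - f x))^2)"
   by (intro integrableI_nonneg) (auto intro: le_less_trans[OF _ ennreal_less_top])
  hence "ennreal (L2_sqnorm M (%x. F n x - f x)) <= ennreal ((1/4) ^ n)"
   using le unfolding L2_sqnorm_def by (subst nn_integral_eq_integral[symmetric]) auto
  thus ?thesis using int by (auto simp: L2_def)
 qed
 show ?thesis
 proof (rule that)
  have "(%x. F 0 x - (F 0 x - f x)) : L2 M" by (rule L2_diff[OF F conjunct1[OF close[of 0]]])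
  thus "f : L2 M" by (simp only: diff_diff_eq2 add_diff_cancel_left')
  show "(%n. L2_sqnorm M (%x. F n x - f x)) \<longlonglongrightarrow> 0"
   by (rule tendsto_sandwich[OF _ _ tendsto_const LIMSEQ_realpow_zero[of "1/4"]]) (use close in auto)
 qed
qed

section \<open>Orthogonal projection\<close>

text \<open>
 Projections are needed for tuples of functions, since a function is treated together with its
 horizontal derivatives.
\<close>

locale L2_tuples =
 fixes I :: "'i set" and M :: "'a measure"
 assumes finite_I: "finite I"
begin

definition L2t :: "('i => 'a => complex) set" where
 "L2t = {F. ALL i:I. F i : L2 M}"

definition ip :: "('i => 'a => complex) => ('i => 'a => complex) => complex" where
 "ip F G = (\<Sum>i\<in>I. L2_inner M (F i) (G i))"

definition sqn :: "('i => 'a => complex) => real" where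
 "sqn F = (\<Sum>i\<in>I. L2_sqnorm M (F i))"

abbreviation lc :: "('i => 'a => complex) => complex => ('i => 'a => complex) => ('i => 'a => complex)" where
 "lc F c G == %i x. F i x + c*G i x"

lemma sqn_nonneg [simp]: "sqn F >= 0"
 by (simp add: sqn_def sum_nonneg)

lemma L2t_lc: "F : L2t ==> G : L2t ==> lc F c G : L2t"
 by (auto simp: L2t_def intro: L2_add_scale)

lemma ip_lc: "F : L2t ==> G : L2t ==> K : L2t ==> ip (lc F c G) K = ip F K + c*ip G K"
 unfolding ip_def sum_distrib_left sum.distrib[symmetric] by (intro sum.cong refl L2_inner_add_left) (auto simp: L2t_def)

lemma sqn_lc:
 assumes "F : L2t" "G : L2t"
 shows "sqn (lc F c G) = sqn F + 2 * Re (cnj c*ip F G) + (cmod c)^2 * sqn G"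
proof -
 have "sqn (lc F c G) = (\<Sum>i\<in>I. L2_sqnorm M (F i) + 2 * Re (cnj c*L2_inner M (F i) (G i)) + (cmod c)^2*L2_sqnorm M (G i))"
  unfolding sqn_def using assms by (intro sum.cong refl L2_sqnorm_add) (auto simp: L2t_def)
 thus ?thesis
  unfolding sqn_def ip_def sum_distrib_left Re_sum by (simp only: sum.distrib)
qed

lemma sqn_minus_commute: "sqn (lc F (- 1) G) = sqn (lc G (- 1) F)"
 by (simp add: sqn_def L2_sqnorm_minus_commute[of M "F _"])

text \<open>
 Almost minimality forces almost orthogonality: compare with the multiple of \<open>G\<close> of coefficient
 \<open>- s ip F G\<close>, where \<open>s = 1 / (sqn G + 1)\<close>.
\<close>

lemma almost_orthogonal:
 assumes FG: "F : L2t" "G : L2t" and min: "!!c. d <= sqn (lc F c G)"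
 shows "(cmod (ip F G))^2 <= (sqn F - d)*(sqn G + 1)"
proof -
 define a s where "a = ip F G" and "s = 1/(sqn G + 1)"
 have p: "sqn G + 1 > 0" by (simp add: add_nonneg_pos)
 let ?c = "- (complex_of_real s * a)"
 have "Re (cnj ?c * a) = - (s*(cmod a)^2)" by (simp add: cmod_power2 power2_eq_square[of "Re _"] power2_eq_square[of "Im _"] algebra_simps)
 moreover have "(cmod ?c)^2 = s\<^sup>2*(cmod a)^2" by (simp add: norm_mult power_mult_distrib)
 ultimately have "d <= sqn F - 2*(s*(cmod a)^2) + s\<^sup>2*(cmod a)^2 * sqn G"
  using min[of ?c] unfolding sqn_lc[OF FG] a_def[symmetric] by (simp only: mult_minus_right diff_conv_add_uminus)
 moreover have "s * sqn G <= 1" "s > 0" using p by (simp_all add: s_def divide_le_eq)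
 hence "s*(cmod a)^2*(s * sqn G) <= s*(cmod a)^2*1" by (intro mult_left_mono) auto
 ultimately have "s*(cmod a)^2 <= sqn F - d" by (simp add: power2_eq_square mult_ac)
 thus ?thesis using p by (simp add: s_def a_def pos_divide_le_eq)
qed

lemma L2t_complete:
 assumes F: "!!n. F n : L2t" and cauchy: "!!k n. k <= n ==> sqn (lc (F k) (- 1) (F n)) <= (1/4) ^ k"
 obtains f where "f : L2t" "(%n. sqn (lc (F n) (- 1) f)) \<longlonglongrightarrow> 0"
proof -
 have "EX g. g : L2 M & (%n. L2_sqnorm M (%x. F n i x - g x)) \<longlonglongrightarrow> 0" if i: "i : I" for i
 proof (rule L2_complete[of "%n. F n i" M])
  show "F n i : L2 M" for n using F[of n] i by (simp add: L2t_def)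
  show "L2_sqnorm M (%x. F k i x - F n i x) <= (1/4) ^ k" if "k <= n" for k n
   using cauchy[OF that] member_le_sum[OF i, of "%i. L2_sqnorm M (%x. F k i x + - 1*F n i x)"] finite_I
   unfolding sqn_def by simp
 qed blast
 then obtain f where f: "!!i. i : I ==> f i : L2 M" "!!i. i : I ==> (%n. L2_sqnorm M (%x. F n i x - f i x)) \<longlonglongrightarrow> 0"
  using bchoice[of I "%i g. g : L2 M & (%n. L2_sqnorm M (%x. F n i x - g x)) \<longlonglongrightarrow> 0"] by blast
 have "(%n. \<Sum>i\<in>I. L2_sqnorm M (%x. F n i x - f i x)) \<longlonglongrightarrow> (\<Sum>i\<in>I. 0)" by (intro tendsto_sum f)
 thus ?thesis using that[of f] f(1) by (simp add: L2t_def sqn_def)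
qed

text \<open>The parallelogram identity makes a minimizing sequence a Cauchy sequence.\<close>

lemma projection:
 assumes V: "V <= L2t" "V ~= {}" and lin: "!!F G c. F : V ==> G : V ==> lc F c G : V" and H: "H : L2t"
 obtains F P where "!!n. F n : V" "P : L2t" "(%n. sqn (lc (F n) (- 1) P)) \<longlonglongrightarrow> 0" "!!G. G : V ==> ip (lc H (- 1) P) G = 0"
proof -
 define d where "d = (INF F\<in>V. sqn (lc H (- 1) F))"
 have bdd: "bdd_below ((%F. sqn (lc H (- 1) F)) ` V)" by (auto intro!: bdd_belowI[of _ 0])
 have d_le: "d <= sqn (lc H (- 1) F)" if "F : V" for F
  unfolding d_def by (rule cINF_lower[OF bdd that])
 have "EX F:V. sqn (lc H (- 1) F) < d + (1/4) ^ Suc n" for n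
  unfolding cINF_less_iff[OF V(2) bdd, symmetric] d_def[symmetric] by simp
 hence "ALL n. EX F. F : V & sqn (lc H (- 1) F) < d + (1/4) ^ Suc n" by blast
 from choice[OF this] obtain F where F: "!!n. F n : V" "!!n. sqn (lc H (- 1) (F n)) < d + (1/4) ^ Suc n" by blast
 have FL: "F n : L2t" for n using F(1) V(1) by blast
 have HF: "lc H (- 1) (F n) : L2t" for n by (intro L2t_lc H FL)
 have "sqn (lc (F m) (- 1) (F n)) <= (1/4) ^ m" if mn: "m <= n" for m n
 proof -
  let ?a = "lc H (- 1) (F m)" and ?b = "lc H (- 1) (F n)" and ?mid = "lc (F m) (1/2) (lc (F n) (- 1) (F m))"
  have "sqn (lc ?a 1 ?b) + sqn (lc ?a (- 1) ?b) = 2 * sqn ?a + 2 * sqn ?b"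
   unfolding sqn_lc[OF HF HF] by simp
  moreover have "sqn (lc ?a (- 1) ?b) = sqn (lc (F m) (- 1) (F n))"
   unfolding sqn_minus_commute[of "F m"] by (simp add: algebra_simps)
  moreover have eq: "lc ?a 1 ?b = (%i x. 2*lc H (- 1) ?mid i x)" by (intro ext) (simp add: algebra_simps)
  have "sqn (%i x. 2*G i x) = 4 * sqn G" for G :: "'i => 'a => complex"
   by (simp add: sqn_def L2_sqnorm_def sum_distrib_left norm_mult power_mult_distrib)
  hence "4*d <= sqn (lc ?a 1 ?b)" using d_le[of ?mid] lin[OF F(1) lin[OF F(1,1)]] unfolding eq by (simp only: mult_le_cancel_left_pos)
  moreover have "(1/4 :: real) ^ Suc n <= (1/4) ^ Suc m" by (rule power_decreasing) (use mn in auto)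
  ultimately show ?thesis using F(2)[of m] F(2)[of n] by (simp only: power_Suc)
 qed
 from L2t_complete[OF FL this] obtain P where P: "P : L2t" "(%n. sqn (lc (F n) (- 1) P)) \<longlonglongrightarrow> 0" by blast
 have "ip (lc H (- 1) P) G = 0" if G: "G : V" for G
 proof -
  have GL: "G : L2t" using G V by blast
  have 0: "(%n. ip (K n) G) \<longlonglongrightarrow> 0" if "!!n. (cmod (ip (K n) G))^2 <= e n*(sqn G + 1)" "e \<longlonglongrightarrow> 0" for K :: "nat => _" and e
  proof -
   have "(%n. e n*(sqn G + 1)) \<longlonglongrightarrow> 0" using that(2) by (rule tendsto_mult_left_zero)
   hence "(%n. (cmod (ip (K n) G))^2) \<longlonglongrightarrow> 0"
    by (rule tendsto_sandwich[OF _ _ tendsto_const, rotated 2]) (use that(1) in auto)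
   from tendsto_real_sqrt[OF this] have "(%n. cmod (ip (K n) G)) \<longlonglongrightarrow> 0"
    by (simp only: real_sqrt_abs abs_norm_cancel real_sqrt_zero)
   thus ?thesis by (rule tendsto_norm_zero_cancel)
  qed
  have "(%n. ip (lc H (- 1) (F n)) G) \<longlonglongrightarrow> 0"
  proof (rule 0)
   have "d <= sqn (lc (lc H (- 1) (F n)) c G)" for n c
    using d_le[OF lin[OF F(1)[of n] G, of "- c"]] by (simp add: algebra_simps)
   from almost_orthogonal[OF HF GL this]
   show "(cmod (ip (lc H (- 1) (F n)) G))^2 <= (1/4) ^ Suc n*(sqn G + 1)" for n
    by (rule order_trans) (use F(2)[of n] in \<open>intro mult_right_mono; simp\<close>)
   show "(%n. (1/4 :: real) ^ Suc n) \<longlonglongrightarrow> 0" by (intro LIMSEQ_Suc LIMSEQ_realpow_zero) auto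
  qed
  moreover have "(%n. ip (lc (F n) (- 1) P) G) \<longlonglongrightarrow> 0"
   by (rule 0[OF _ P(2)]) (use almost_orthogonal[OF L2t_lc[OF FL P(1), of _ "- 1"] GL, of 0] in simp)
  ultimately have "(%n. ip (lc H (- 1) (F n)) G + ip (lc (F n) (- 1) P) G) \<longlonglongrightarrow> 0 + 0" by (rule tendsto_add)
  thus ?thesis unfolding ip_lc[OF H FL GL] ip_lc[OF FL P(1) GL] ip_lc[OF H P(1) GL] by (simp add: LIMSEQ_const_iff)
 qed
 thus ?thesis using that[OF F(1) P] by blast
qed

end

lemma dense_if_orthogonal_trivial:
 assumes V: "V <= L2 M" "V ~= {}" and lin: "!!f g c. f : V ==> g : V ==> (%x. f x + c*g x) : V"
  and triv: "!!u. u : L2 M ==> (!!phi. phi : V ==> L2_inner M phi u = 0) ==> AE x in M. u x = 0"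
  and h: "h : L2 M" and e: "e > 0"
 obtains phi where "phi : V" "L2_sqnorm M (%x. h x - phi x) < e"
proof -
 interpret T: L2_tuples "{()}" M by unfold_locales simp
 obtain F P where FP: "!!n. F n : {F. F () : V}" "P : T.L2t" "(%n. T.sqn (T.lc (F n) (- 1) P)) \<longlonglongrightarrow> 0"
  "!!G. G : {F. F () : V} ==> T.ip (T.lc (%_. h) (- 1) P) G = 0"
 proof (rule T.projection[of "{F. F () : V}" "%_. h"])
  show "{F. F () : V} ~= {}" using V(2) by (auto intro: exI[of _ "%_. _"])
 qed (use V h lin in \<open>auto simp: T.L2t_def\<close>)
 have L: "F n () : L2 M" "P () : L2 M" for n using FP(1)[of n] FP(2) V(1) by (auto simp: T.L2t_def)
 have "AE x in M. h x - P () x = 0"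
 proof (rule triv[OF L2_diff[OF h L(2)]])
  fix phi assume "phi : V"
  hence "L2_inner M (%x. h x - P () x) phi = 0" using FP(4)[of "%_. phi"] by (simp add: T.ip_def)
  thus "L2_inner M phi (%x. h x - P () x) = 0" by (subst L2_inner_sym) simp
 qed
 hence ae: "AE x in M. (cmod (h x - F n () x))^2 = (cmod (F n () x - P () x))^2" for n
  by eventually_elim (simp add: norm_minus_commute)
 have "L2_sqnorm M (%x. h x - F n () x) = L2_sqnorm M (%x. F n () x - P () x)" for n
  unfolding L2_sqnorm_def by (intro integral_cong_AE borel_measurable_power measurable_compose[OF L2D(1)[OF L2_diff] borel_measurable_norm] h L ae)
 hence "(%n. L2_sqnorm M (%x. h x - F n () x)) \<longlonglongrightarrow> 0" using FP(3) by (simp add: T.sqn_def)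
 from order_tendstoD(2)[OF this e] obtain n where "L2_sqnorm M (%x. h x - F n () x) < e" by (auto simp: eventually_sequentially)
 thus ?thesis using that FP(1)[of n] by blast
qed

section \<open>Criteria for self-adjointness\<close>

lemma L2_operatorD:
 assumes "L2_operator M T" "(f, f') : T"
 shows "f : L2 M" "f' : L2 M"
 using assms by (auto simp: L2_operator_def)

lemma L2_inner_eqI_AE:
 assumes "u : L2 M" "v : L2 M" "!!F. F : L2 M ==> L2_inner M F u = L2_inner M F v"
 shows "AE x in M. u x = v x"
proof -
 have d: "(%x. u x - v x) : L2 M" by (intro L2_diff assms)
 have "L2_inner M (%x. u x - v x) (%x. u x + (- 1) * v x) = 0"
  using assms(3)[OF d] by (subst L2_inner_add_right[OF assms(1,2) d]) simp
 hence "L2_sqnorm M (%x. u x - v x) = 0" by (simp add: L2_inner_self)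
 hence "AE x in M. u x - v x = 0" using L2_sqnorm_eq_0[OF d] by simp
 thus ?thesis by eventually_elim simp
qed

text \<open>
 For \<open>(g, g')\<close> in the adjoint choose \<open>h\<close> with \<open>h + T h = g + g'\<close>; then \<open>g - h\<close> is orthogonal to the
 range of \<open>T\<^sub>0 + 1\<close>.
\<close>

lemma adjoint_subset_of_resolvent:
 assumes op: "L2_operator M T" and sym: "!!f f' g g'. (f, f') : T ==> (g, g') : T ==> L2_inner M f' g = L2_inner M f g'"
  and onto: "!!F. F : L2 M ==> \<exists>(f, f')\<in>T. AE x in M. f x + f' x = F x"
  and T0: "T0 <= T"
  and core: "!!u. u : L2 M ==> (!!phi phi'. (phi, phi') : T0 ==> L2_inner M (%x. phi x + phi' x) u = 0) ==> AE x in M. u x = 0"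
 shows "L2_adjoint M T0 <= T"
proof safe
 fix g g' assume gg: "(g, g') : L2_adjoint M T0"
 hence L: "g : L2 M" "g' : L2 M" and adj: "!!f f'. (f, f') : T0 ==> L2_inner M f' g = L2_inner M f g'"
  by (auto simp: L2_adjoint_def)
 obtain h h' where h: "(h, h') : T" "AE x in M. h x + h' x = g x + g' x" using onto[OF L2_add[OF L]] by auto
 note hL = L2_operatorD[OF op h(1)]
 have u: "(%x. g x - h x) : L2 M" by (intro L2_diff L hL)
 have m: "g : borel_measurable M" "g' : borel_measurable M" "h : borel_measurable M" "h' : borel_measurable M"
  using L hL L2D by auto
 have "AE x in M. g x - h x = 0"
 proof (rule core[OF u])
  fix phi phi' assume p: "(phi, phi') : T0"
  hence pT: "(phi, phi') : T" using T0 by blast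
  note pL = L2_operatorD[OF op pT]
  have "L2_inner M phi (%x. g x + g' x) = L2_inner M phi (%x. h x + h' x)"
   using h(2) m L2D(1)[OF pL(1)] by (intro L2_inner_cong) auto
  hence "L2_inner M phi g + L2_inner M phi g' = L2_inner M phi h + L2_inner M phi h'"
   using L2_inner_add_right[OF L pL(1), of 1] L2_inner_add_right[OF hL pL(1), of 1] by simp
  hence "L2_inner M phi g + L2_inner M phi' g = L2_inner M phi h + L2_inner M phi' h"
   using adj[OF p] sym[OF pT h(1)] by simp
  moreover have "L2_inner M (%x. phi x + phi' x) (%x. g x - h x) =
    (L2_inner M phi g + L2_inner M phi' g) - (L2_inner M phi h + L2_inner M phi' h)"
   using L2_inner_add_right[OF L(1) hL(1) L2_add[OF pL], of "- 1"]
    L2_inner_add_left[OF pL L(1), of 1] L2_inner_add_left[OF pL hL(1), of 1] by simp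
  ultimately show "L2_inner M (%x. phi x + phi' x) (%x. g x - h x) = 0" by simp
 qed
 hence 1: "AE x in M. g x = h x" by eventually_elim simp
 hence 2: "AE x in M. g' x = h' x" using h(2) by eventually_elim (metis add_left_cancel)
 have "\<forall>(f, f')\<in>T. ALL g:L2 M. ALL g':L2 M. (AE x in M. g x = f x) & (AE x in M. g' x = f' x) --> (g, g') : T"
  using op unfolding L2_operator_def by blast
 from bspec[OF this h(1)] show "(g, g') : T" using 1 2 L by auto
qed

lemma self_adjoint_of_resolvent:
 assumes op: "L2_operator M T" and dense: "densely_defined M T"
  and sym: "!!f f' g g'. (f, f') : T ==> (g, g') : T ==> L2_inner M f' g = L2_inner M f g'"
  and onto: "!!F. F : L2 M ==> \<exists>(f, f')\<in>T. AE x in M. f x + f' x = F x"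
 shows "self_adjoint M T"
proof -
 have "L2_adjoint M T <= T"
 proof (rule adjoint_subset_of_resolvent[OF op sym onto order_refl])
  fix u assume u: "u : L2 M" "!!phi phi'. (phi, phi') : T ==> L2_inner M (%x. phi x + phi' x) u = 0"
  show "AE x in M. u x = 0"
  proof (rule L2_inner_eqI_AE[OF u(1) L2_zero])
   fix F assume F: "F : L2 M"
   obtain f f' where f: "(f, f') : T" "AE x in M. f x + f' x = F x" using onto[OF F] by auto
   have "L2_inner M F u = L2_inner M (%x. f x + f' x) u"
    using f(2) L2D(1)[OF F] L2D(1)[OF u(1)] L2D(1)[OF L2_add[OF L2_operatorD[OF op f(1)]]]
    by (intro L2_inner_cong) auto
   thus "L2_inner M F u = L2_inner M F (%x. 0)" using u(2)[OF f(1)] by (simp add: L2_inner_def)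
  qed
 qed
 moreover have "T <= L2_adjoint M T"
  unfolding L2_adjoint_def using sym L2_operatorD[OF op] by auto
 ultimately show ?thesis using op dense by (auto simp: self_adjoint_def)
qed

lemma self_adjoint_extension_unique:
 assumes L: "self_adjoint M L" and S: "self_adjoint_extension M T0 S" and core: "L2_adjoint M T0 <= L"
 shows "S = L"
proof -
 have anti: "L2_adjoint M T' <= L2_adjoint M T" if "T <= T'" for T T' using that by (auto simp: L2_adjoint_def)
 have "S = L2_adjoint M S" "L = L2_adjoint M L" "T0 <= S"
  using L S by (auto simp: self_adjoint_def self_adjoint_extension_def)
 hence "S <= L" using anti core by blast
 hence "L <= S" using anti \<open>S = L2_adjoint M S\<close> \<open>L = L2_adjoint M L\<close> by blast
 thus ?thesis using \<open>S <= L\<close> by blast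
qed

context carnot
begin

section \<open>Test functions\<close>

lemma sets_mu [measurable_cong, simp]: "sets mu = sets borel"
 by (rule haar_sets[OF haar])

lemma space_mu [simp]: "space mu = UNIV"
 by (rule haar_space[OF haar])

lemma borel_mu: "borel_measurable mu = borel_measurable borel"
 by (rule measurable_cong_sets) simp_all

abbreviation nrm :: "('g => complex) => real" where "nrm == L2_sqnorm mu"
abbreviation pr :: "('g => complex) => ('g => complex) => complex" where "pr f g == LINT x|mu. f x*g x"
abbreviation ib :: "real => 'g => 'b::zero_neq_one" where "ib R x == indicator {x. N x <= R} x"

abbreviation TF :: "('g => complex) set" where
 "TF == test_functions A"

lemma TF_I:
 assumes "msmooth_on A UNIV f" "!!x. R < N x ==> f x = 0"
 shows "f : TF"
proof -
 have "closure {x. f x ~= 0} <= {x. N x <= R}"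
  using assms(2) by (intro closure_minimal compact_imp_closed N_sublevel_compact) force
 hence "closure {x. f x ~= 0} = {x. N x <= R} Int closure {x. f x ~= 0}" by blast
 hence "compact (closure {x. f x ~= 0})"
  using compact_Int_closed[OF N_sublevel_compact closed_closure] by metis
 thus ?thesis using assms(1) by (simp add: test_functions_def)
qed

lemma TF_smooth: "f : TF ==> msmooth_on A UNIV f"
 by (simp add: test_functions_def)

lemma TF_support:
 assumes "f : TF"
 obtains R where "R > 0" "!!x. R <= N x ==> f x = 0"
proof -
 obtain R where R: "R > 0" "closure {x. f x ~= 0} <= {x. N x < R}"
  using assms compact_N_bounded[of "closure {x. f x ~= 0}"] by (auto simp: test_functions_def)
 have "f x = 0" if "R <= N x" for x
  using R(2) closure_subset[of "{x. f x ~= 0}"] that by fastforce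
 thus ?thesis using that[of R] R(1) by blast
qed

lemma TF_continuous: "f : TF ==> continuous_on S f"
 by (rule continuous_on_subset[OF msmooth_continuous[OF open_UNIV TF_smooth]]) auto

lemma TF_mult:
 assumes "msmooth_on A UNIV g" "f : TF"
 shows "(%x. g x*f x) : TF"
proof -
 obtain R where "!!x. R <= N x ==> f x = 0" by (rule TF_support[OF assms(2)]) blast
 thus ?thesis by (intro TF_I[of _ R] msmooth_mult open_UNIV assms(1) TF_smooth[OF assms(2)]) auto
qed

lemma TF_scale: "f : TF ==> (%x. c*f x) : TF"
 by (rule TF_mult[OF msmooth_const])

lemma TF_add:
 assumes "f : TF" "g : TF"
 shows "(%x. f x + g x) : TF"
proof -
 obtain R where R: "!!x. R <= N x ==> f x = 0" by (rule TF_support[OF assms(1)]) blast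
 obtain R' where R': "!!x. R' <= N x ==> g x = 0" by (rule TF_support[OF assms(2)]) blast
 show ?thesis
  using R R' by (intro TF_I[of _ "max R R'"] msmooth_add open_UNIV TF_smooth[OF assms(1)] TF_smooth[OF assms(2)]) auto
qed

lemma TF_zero: "(%_. 0) : TF"
 by (rule TF_I[of _ 0]) simp_all

lemma X_zero_outside:
 assumes "!!x. R < N x ==> f x = 0" "R < N x"
 shows "X v f x = 0"
proof -
 have "open {x. R < N x}" by (intro open_Collect_less continuous_intros N_continuous)
 hence "X v f x = X v (%_. 0) x" using assms by (intro X_cong[of "{x. R < N x}"]) auto
 thus ?thesis by simp
qed

lemma TF_X:
 assumes "f : TF"
 shows "X v f : TF"
proof -
 obtain R where R: "!!x. R <= N x ==> f x = 0" by (rule TF_support[OF assms]) blast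
 have "X v f x = 0" if "R < N x" for x by (rule X_zero_outside[OF _ that]) (simp add: R)
 thus ?thesis by (rule TF_I[OF msmooth_X[OF open_UNIV TF_smooth[OF assms]]])
qed

lemma TF_cnj:
 assumes "f : TF"
 shows "(%x. cnj (f x)) : TF"
proof -
 obtain R where R: "!!x. R <= N x ==> f x = 0" by (rule TF_support[OF assms]) blast
 hence "cnj (f x) = 0" if "R < N x" for x using that by simp
 thus ?thesis by (rule TF_I[OF msmooth_cnj[OF open_UNIV TF_smooth[OF assms]]])
qed

lemma N_translate_bounded:
 assumes "compact K"
 obtains R' where "R' > 0" "!!x y. y : K ==> N (y + x) <= R ==> N x < R'" "!!x y. y : K ==> N (x + y) <= R ==> N x < R'"
proof -
 let ?S = "K \<times> {x. N x <= R}"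
 have S: "compact ?S" by (intro compact_Times assms N_sublevel_compact)
 have "compact ((%(y, z). - y + z) ` ?S \<union> (%(y, z). z - y) ` ?S)"
  unfolding case_prod_unfold by (intro compact_Un compact_continuous_image S continuous_intros)
 then obtain R' where R': "R' > 0" "(%(y, z). - y + z) ` ?S \<union> (%(y, z). z - y) ` ?S <= {x. N x < R'}"
  by (rule compact_N_bounded)
 have 1: "N x < R'" if "y : K" "N (y + x) <= R" for x y
 proof -
  have "x = (%(y, z). - y + z) (y, y + x)" by (simp add: add.assoc[symmetric])
  hence "x : (%(y, z). - y + z) ` ?S" using that by (intro image_eqI[of _ _ "(y, y + x)"]) auto
  thus ?thesis using R'(2) by blast
 qed
 have 2: "N x < R'" if "y : K" "N (x + y) <= R" for x y
 proof -
  have "x = (%(y, z). z - y) (y, x + y)" by simp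
  hence "x : (%(y, z). z - y) ` ?S" using that by (intro image_eqI[of _ _ "(y, x + y)"]) auto
  thus ?thesis using R'(2) by blast
 qed
 show ?thesis by (rule that[OF R'(1) 1 2])
qed

lemma TF_translate:
 assumes "f : TF"
 shows "(%x. f (y + x)) : TF"
proof -
 obtain R where R: "!!x. R <= N x ==> f x = 0" by (rule TF_support[OF assms]) blast
 obtain R' where R': "!!x z. z : {y} ==> N (z + x) <= R ==> N x < R'"
  by (rule N_translate_bounded[of "{y}" R]) auto
 have "msmooth_on A UNIV (%x. f (y + x))"
  using msmooth_translate[OF open_UNIV TF_smooth[OF assms], of y 0] by simp
 moreover have "f (y + x) = 0" if "R' < N x" for x using R[of "y + x"] R'[of y x] that by force
 ultimately show ?thesis by (rule TF_I)
qed

definition cut :: "real => 'g => real" where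
 "cut R x = cutoff (N x/R)"

lemma cut_range: "0 <= cut R x" "cut R x <= 1"
 by (simp_all add: cut_def cutoff_range)

lemma cut_eq: "R > 0 ==> N x <= R ==> cut R x = 1" "R > 0 ==> 2 * R <= N x ==> cut R x = 0"
 by (simp_all add: cut_def cutoff_eq_1 cutoff_eq_0 field_simps)

lemma open_punctured [simp]: "open (- {0 :: 'g})"
 by (intro open_Compl closed_singleton)

lemma cut_smooth:
 assumes R: "R > 0"
 shows "msmooth_on A UNIV (cut R)"
proof -
 have W: "open {x. N x < R}" by (intro open_Collect_less continuous_intros N_continuous)
 have "msmooth_on A (- {0}) (%x. N x/R)"
  using msmooth_linear_comp[OF bounded_linear_divide open_punctured N_smooth] .
 hence 1: "msmooth_on A (- {0}) (cut R)"
  unfolding cut_def[abs_def] using msmooth_real_comp[OF open_punctured _ smooth_on_cutoff] by blast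
 have 2: "msmooth_on A {x. N x < R} (cut R)"
  by (rule msmooth_cong[OF W msmooth_const[of _ 1]]) (simp add: cut_eq R)
 have "- {0} \<union> {x. N x < R} = UNIV" using R by auto
 thus ?thesis using msmooth_Un[OF open_punctured W 1 2] by (simp only:)
qed

lemma cut_TF: "R > 0 ==> (%x. complex_of_real (cut R x)) : TF"
 by (rule TF_I[of _ "2 * R"]) (auto simp: cut_eq intro!: msmooth_of_real cut_smooth)

text \<open>
 The gradient of the cutoff is of order \<open>1 / R\<close>, since \<open>N\<close> has bounded gradient.
\<close>

lemma X_cut_bounded: "\<exists>C\<ge>0. ALL v:B. \<forall>R>0. ALL x. \<bar>X v (cut R) x\<bar> <= C/R"
proof -
 obtain C where C0: "C >= 0 & (ALL v:B. ALL x. x ~= 0 --> \<bar>X v N x\<bar> <= C)" by (rule exE[OF X_N_bounded])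
 have C: "C >= 0" "\<bar>X v N x\<bar> <= C" if "v : B" "x ~= 0" for v x using C0 that by simp_all
 have diff: "(cutoff has_real_derivative frechet_derivative cutoff (at t) 1) (at t)" for t
 proof -
  have d: "(cutoff has_derivative frechet_derivative cutoff (at t)) (at t)"
   by (rule smooth_on_has_derivative[OF smooth_on_cutoff]) simp
  have "frechet_derivative cutoff (at t) h = frechet_derivative cutoff (at t) 1*h" for h
   using linear_cmul[OF has_derivative_linear[OF d], of h 1] by simp
  hence "frechet_derivative cutoff (at t) = (%h. frechet_derivative cutoff (at t) 1*h)" by (rule ext)
  thus ?thesis using d by (simp only: has_field_derivative_def)
 qed
 define c' where "c' = (%t. frechet_derivative cutoff (at t) (1::real))"
 have cont: "continuous_on {0..3} c'"
  unfolding c'_def by (rule continuous_on_subset[OF smooth_on_continuous[OF smooth_on_derivative[OF smooth_on_cutoff]]]) simp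
 have "bounded (c' ` {0..3})" by (intro compact_imp_bounded compact_continuous_image cont) simp
 then obtain D where "ALL y:c' ` {0..3}. norm y <= D" unfolding bounded_iff by blast
 hence D: "\<bar>c' t\<bar> <= D" if "t : {0..3}" for t using that by simp
 have "\<bar>X v (cut R) x\<bar> <= (D*C)/R" if v: "v : B" and R: "R > 0" for v R x
 proof (cases "N x < R | 2 * R < N x")
  case True
  have o: "open {x. N x < R}" "open {x. 2 * R < N x}" by (intro open_Collect_less continuous_intros N_continuous)+
  have "X v (cut R) x = X v (%_. 1) x" if "N x < R" using that o(1) R by (intro X_cong[of "{x. N x < R}"]) (auto simp: cut_eq)
  moreover have "X v (cut R) x = X v (%_. 0) x" if "2 * R < N x" using that o(2) R by (intro X_cong[of "{x. 2 * R < N x}"]) (auto simp: cut_eq)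
  moreover have "0 <= D" using D[of 0] by simp
  ultimately show ?thesis using True C0 R by auto
 next
  case False
  hence x: "x ~= 0" using R by auto
  have "((%n. cutoff (n/R)) has_real_derivative c' (N x/R)*(1/R)) (at (N x))"
  proof -
   have "((%n. n/R) has_real_derivative 1/R) (at (N x))" using R by (auto intro!: derivative_eq_intros)
   from DERIV_chain2[OF diff this] show ?thesis unfolding c'_def .
  qed
  hence "X v (cut R) x = c' (N x/R)*(1/R)*X v N x"
   unfolding cut_def[abs_def] using x by (intro X_real_comp[of "- {0}"] N_smooth open_punctured) auto
  also have "\<bar>...\<bar> = \<bar>c' (N x/R)\<bar> * \<bar>X v N x\<bar>/R" using R by (simp add: abs_mult)
  also have "... <= D*C/R"
  proof (intro divide_right_mono mult_mono)
   have "N x/R : {0..3}" using False R by (auto simp: divide_simps)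
   thus "\<bar>c' (N x/R)\<bar> <= D" by (rule D)
   thus "0 <= D" by linarith
   show "\<bar>X v N x\<bar> <= C" using C(2) v x by simp
  qed (use R in auto)
  finally show ?thesis .
 qed
 moreover have "0 <= D*C" using D[of 0] C0 by simp
 ultimately show ?thesis by (intro exI[of _ "D*C"]) auto
qed

section \<open>Local integrability\<close>

text \<open>A class of multipliers which contains test functions, indicators of balls and weighted cutoffs.\<close>

definition BC :: "('g => complex) set" where
 "BC = {g : borel_measurable borel. (EX C. ALL x. cmod (g x) <= C) & (EX R. ALL x. R < N x --> g x = 0)}"

text \<open>Square integrability on compact sets, stated with multipliers so that products need no case analysis.\<close>

definition L2loc :: "('g => complex) set" where
 "L2loc = {f : borel_measurable borel. ALL g:BC. (%x. f x*g x) : L2 mu}"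

lemma BC_I: "g : borel_measurable borel ==> (!!x. cmod (g x) <= C) ==> (!!x. R < N x ==> g x = 0) ==> g : BC"
 by (auto simp: BC_def)

lemma ball_borel [measurable]: "{x. N x <= R} : sets borel"
 by (rule borel_compact[OF N_sublevel_compact])

lemma ib_integrable: "integrable mu (%x. (C :: real)*ib R x)"
 using closed_ball_finite[of R] by (intro integrable_mult_right integrable_real_indicator) auto

lemma BC_indicator: "(%x. ib R x) : BC"
proof (rule BC_I)
 show "(%x. ib R x) : borel_measurable borel" by (rule borel_measurable_indicator[OF ball_borel])
 show "cmod (ib R x) <= 1" for x by (simp add: indicator_def)
 show "ib R x = 0" if "R < N x" for x using that by (simp add: indicator_def)
qed

lemma BC_indicator_compact: "compact K ==> (%x. indicator K x) : BC"
proof -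
 assume K: "compact K"
 obtain R where "K <= {x. N x < R}" by (rule compact_N_bounded[OF K])
 thus ?thesis using borel_compact[OF K] by (intro BC_I[of _ 1 R]) (auto simp: indicator_def)
qed

lemma BC_mult_bounded:
 assumes "g : BC" and b: "b : borel_measurable borel" "!!R. EX C. ALL x. N x <= R --> cmod (b x) <= C"
 shows "(%x. b x*g x) : BC"
proof -
 obtain C R where g: "g : borel_measurable borel" "!!x. cmod (g x) <= C" "!!x. R < N x ==> g x = 0"
  using assms(1) by (auto simp: BC_def)
 obtain D where D: "!!x. N x <= R ==> cmod (b x) <= D" using b(2) by blast
 show ?thesis
 proof (rule BC_I[of _ "\<bar>D\<bar> * \<bar>C\<bar>" R])
  show "(%x. b x*g x) : borel_measurable borel" using b g by measurable
  show "cmod (b x*g x) <= \<bar>D\<bar> * \<bar>C\<bar>" for x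
  proof (cases "N x <= R")
   case True
   have "cmod (b x) <= \<bar>D\<bar>" "cmod (g x) <= \<bar>C\<bar>" using D[OF True] g(2)[of x] by linarith+
   thus ?thesis unfolding norm_mult by (intro mult_mono) auto
  qed (simp add: g)
  show "b x*g x = 0" if "R < N x" for x using g(3)[OF that] by simp
 qed
qed

lemma continuous_locally_bounded:
 fixes f :: "'g => 'b::real_normed_vector"
 assumes "continuous_on UNIV f"
 shows "EX C. ALL x. N x <= R --> norm (f x) <= C"
proof -
 have "bounded (f ` {x. N x <= R})"
  by (intro compact_imp_bounded compact_continuous_image N_sublevel_compact continuous_on_subset[OF assms]) auto
 thus ?thesis by (auto simp: bounded_iff)
qed

lemma BC_measurable [measurable_dest]: "g : BC ==> g : borel_measurable borel"
 by (simp add: BC_def)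

lemma smooth_measurable: "msmooth_on A UNIV f ==> f : borel_measurable borel"
 by (intro borel_measurable_continuous_onI msmooth_continuous[OF open_UNIV])

lemma TF_measurable [measurable_dest]: "f : TF ==> f : borel_measurable borel"
 by (rule smooth_measurable[OF TF_smooth])

lemma TF_BC:
 assumes "f : TF"
 shows "f : BC"
proof -
 obtain R where R: "!!x. R <= N x ==> f x = 0" by (rule TF_support[OF assms]) blast
 obtain C where C: "!!x. N x <= R ==> norm (f x) <= C" using continuous_locally_bounded[OF TF_continuous[OF assms]] by blast
 have "cmod (f x) <= \<bar>C\<bar>" for x using C[of x] R[of x] by (cases "N x <= R") auto
 thus ?thesis using R
  by (intro BC_I[of _ "\<bar>C\<bar>" R] borel_measurable_continuous_onI TF_continuous assms) auto
qed

lemma BC_L2: "g : BC ==> g : L2 mu"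
proof -
 assume "g : BC"
 then obtain C R where g: "g : borel_measurable borel" "!!x. cmod (g x) <= C" "!!x. R < N x ==> g x = 0"
  by (auto simp: BC_def)
 show ?thesis
 proof (rule L2_bounded_by)
  show "g : borel_measurable mu" using g by (simp add: borel_mu)
  show "integrable mu (%x. C\<^sup>2*ib R x)"
   using closed_ball_finite[of R] by (intro integrable_mult_right integrable_real_indicator) auto
  have "(cmod (g x))^2 <= C\<^sup>2*ib R x" for x
   using g(2)[of x] g(3)[of x] by (auto simp: indicator_def intro: power_mono)
  thus "AE x in mu. (cmod (g x))^2 <= C\<^sup>2*ib R x" by simp
 qed
qed

lemma L2_mult_bounded:
 assumes "f : L2 M" "b : borel_measurable M" "!!x. cmod (b x) <= C"
 shows "(%x. f x*b x) : L2 M"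
proof (rule L2_bounded_by)
 show "(%x. f x*b x) : borel_measurable M" using assms(2) L2D(1)[OF assms(1)] by measurable
 show "integrable M (%x. C\<^sup>2*(cmod (f x))^2)" using L2D(2)[OF assms(1)] by simp
 have "(cmod (f x*b x))^2 <= C\<^sup>2*(cmod (f x))^2" for x
  unfolding norm_mult power_mult_distrib using power_mono[OF assms(3), of x 2]
  by (simp add: mult.commute mult_right_mono)
 thus "AE x in M. (cmod (f x*b x))^2 <= C\<^sup>2*(cmod (f x))^2" by simp
qed

lemma L2_L2loc: "f : L2 mu ==> f : L2loc"
proof -
 assume f: "f : L2 mu"
 have "(%x. f x*g x) : L2 mu" if g: "g : BC" for g
 proof -
  obtain C where "!!x. cmod (g x) <= C" using g by (auto simp: BC_def)
  thus ?thesis using BC_measurable[OF g] by (intro L2_mult_bounded[OF f]) (auto simp: borel_mu)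
 qed
 thus ?thesis using L2D(1)[OF f] by (simp add: L2loc_def borel_mu)
qed

lemma L2loc_measurable [measurable_dest]: "f : L2loc ==> f : borel_measurable borel"
 and L2loc_L2: "f : L2loc ==> g : BC ==> (%x. f x*g x) : L2 mu"
 by (auto simp: L2loc_def)

lemma L2loc_integrable:
 assumes f: "f : L2loc" and g: "g : BC"
 shows "integrable mu (%x. f x*g x)"
proof -
 obtain R where R: "!!x. R < N x ==> g x = 0" using g by (auto simp: BC_def)
 have "integrable mu (%x. (f x*g x)*ib R x)"
  by (rule L2_mult_integrable[OF L2loc_L2[OF f g] BC_L2[OF BC_indicator]])
 moreover have "(f x*g x)*ib R x = f x*g x" for x
  using R[of x] by (auto simp: indicator_def)
 ultimately show ?thesis by simp
qed

lemma BC_mult: "f : BC ==> g : BC ==> (%x. f x*g x) : BC"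
proof (rule BC_mult_bounded)
 assume "f : BC"
 thus "f : borel_measurable borel" "!!R. EX C. ALL x. N x <= R --> cmod (f x) <= C" by (auto simp: BC_def)
qed

lemma L2loc_mult_bounded:
 assumes "f : L2loc" and b: "b : borel_measurable borel" "!!R. EX C. ALL x. N x <= R --> cmod (b x) <= C"
 shows "(%x. b x*f x) : L2loc"
proof -
 have "(%x. b x*f x*g x) : L2 mu" if "g : BC" for g
  using L2loc_L2[OF assms(1) BC_mult_bounded[OF that b]] by (simp add: mult_ac)
 moreover have "(%x. b x*f x) : borel_measurable borel" using b L2loc_measurable[OF assms(1)] by measurable
 ultimately show ?thesis by (simp add: L2loc_def)
qed

lemma L2loc_mult_BC: "f : L2loc ==> g : BC ==> (%x. f x*g x) : L2loc"
 by (rule L2_L2loc[OF L2loc_L2])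

lemma L2loc_add_scale:
 assumes "f : L2loc" "g : L2loc"
 shows "(%x. f x + c*g x) : L2loc"
proof -
 have "(%x. (f x + c*g x) * k x) : L2 mu" if "k : BC" for k
  using L2_add_scale[OF L2loc_L2[OF assms(1) that] L2loc_L2[OF assms(2) that], of c] by (simp add: algebra_simps)
 moreover have "(%x. f x + c*g x) : borel_measurable borel"
  using L2loc_measurable[OF assms(1)] L2loc_measurable[OF assms(2)] by measurable
 ultimately show ?thesis by (simp add: L2loc_def)
qed

lemma L2loc_cnj:
 assumes "f : L2loc"
 shows "(%x. cnj (f x)) : L2loc"
proof -
 have m: "(%x. cnj (f x)) : borel_measurable borel" by (rule measurable_compose[OF L2loc_measurable[OF assms] cnj_measurable])
 have "(%x. cnj (f x)*g x) : L2 mu" if g: "g : BC" for g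
 proof -
  have "integrable mu (%x. (cmod (cnj (f x)*g x))^2)" using L2D(2)[OF L2loc_L2[OF assms g]] by (simp add: norm_mult)
  moreover have "(%x. cnj (f x)*g x) : borel_measurable mu" using m BC_measurable[OF g] by (simp add: borel_mu)
  ultimately show ?thesis by (simp add: L2_def)
 qed
 thus ?thesis using m by (simp add: L2loc_def)
qed

lemma L2loc_locally_integrable: "f : L2loc ==> locally_integrable mu f"
proof -
 assume f: "f : L2loc"
 have "set_integrable mu K f" if K: "compact K" for K
 proof -
  have "integrable mu (%x. f x*indicator K x)" by (rule L2loc_integrable[OF f BC_indicator_compact[OF K]])
  moreover have "f x*indicator K x = indicator K x *\<^sub>R f x" for x by (simp add: indicator_def)
  ultimately show ?thesis by (simp add: set_integrable_def)
 qed
 thus ?thesis using L2loc_measurable[OF f] by (simp add: locally_integrable_def borel_mu)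
qed

lemma locally_integrable_BC:
 assumes f: "locally_integrable mu f" and g: "g : BC"
 shows "integrable mu (%x. f x*g x)"
proof -
 obtain C R where C: "!!x. cmod (g x) <= C" and R: "!!x. R < N x ==> g x = 0" using g by (auto simp: BC_def)
 have i: "integrable mu (%x. ib R x *\<^sub>R f x)"
  using f N_sublevel_compact[of R] unfolding locally_integrable_def set_integrable_def by blast
 show ?thesis
 proof (rule Bochner_Integration.integrable_bound)
  show "integrable mu (%x. C*norm (ib R x *\<^sub>R f x))"
   by (rule integrable_mult_right[OF integrable_norm[OF i]])
  show "(%x. f x*g x) : borel_measurable mu" 
   using f BC_measurable[OF g] unfolding locally_integrable_def borel_mu by (intro borel_measurable_times) auto
  have "norm (f x*g x) <= norm (C*norm (ib R x *\<^sub>R f x))" for x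
  proof (cases "N x <= R")
   case True
   have "cmod (f x)*cmod (g x) <= cmod (f x) * \<bar>C\<bar>" using C[of x] by (intro mult_left_mono) auto
   thus ?thesis using True by (simp add: norm_mult abs_mult mult.commute)
  qed (simp add: R)
  thus "AE x in mu. norm (f x*g x) <= norm (C*norm (ib R x *\<^sub>R f x))" by simp
 qed
qed

end

context carnot
begin

section \<open>Integration by parts\<close>

lemma integral_left: "f : borel_measurable borel ==> (LINT x|mu. f (y + x)) = (LINT x|mu. f x)"
 for f :: "'g => 'b::{banach, second_countable_topology}"
proof -
 assume f: "f : borel_measurable borel"
 have "(%x. y + x) : measurable mu borel" by (intro measurable_haar_cont haar continuous_intros)
 from integral_distr[OF this f] show ?thesis by (simp add: mu_distr_left)
qed

lemma integral_right: "f : borel_measurable borel ==> (LINT x|mu. f (x + y)) = (LINT x|mu. f x)"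
 for f :: "'g => 'b::{banach, second_countable_topology}"
proof -
 assume f: "f : borel_measurable borel"
 have "(%x. x + y) : measurable mu borel" by (intro measurable_haar_cont haar continuous_intros)
 from integral_distr[OF this f] show ?thesis by (simp add: mu_distr_right)
qed

lemma X_flow:
 assumes f: "msmooth_on A UNIV f"
 shows "((%t. f (x + E (t *\<^sub>R v))) has_vector_derivative X v f (x + E (t *\<^sub>R v))) (at t)"
proof -
 have "msmooth_on A UNIV (%z. f (x + z))" using msmooth_translate[OF open_UNIV f, of x 0] by simp
 from cvel_X[OF open_UNIV this UNIV_I cvel_E] show ?thesis by (simp only: X_translate)
qed

lemma TF_integrable: "f : TF ==> integrable mu f"
proof -
 assume f: "f : TF"
 obtain R where R: "!!x. R <= N x ==> f x = 0" by (rule TF_support[OF f]) blast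
 have "integrable mu (%x. f x*ib R x)"
  by (rule L2loc_integrable[OF L2_L2loc[OF BC_L2[OF TF_BC[OF f]]] BC_indicator])
 moreover have "f x*ib R x = f x" for x using R[of x] by (auto simp: indicator_def)
 ultimately show ?thesis by simp
qed

text \<open>
 Right translations preserve the Haar measure, so that the difference quotients of a test function
 along the flow of \<open>v\<close> have integral zero.
\<close>

lemma integral_X:
 assumes f: "f : TF"
 shows "(LINT x|mu. X v f x) = 0"
proof -
 obtain R where R: "!!x. R <= N x ==> f x = 0" by (rule TF_support[OF f]) blast
 obtain C where C: "!!x. cmod (X v f x) <= C" using TF_BC[OF TF_X[OF f, of v]] by (auto simp: BC_def)
 have C0: "0 <= C" using C[of 0] norm_ge_zero order_trans by blast
 have Ec: "continuous_on S (%t. E (t *\<^sub>R v))" for S by (intro continuous_on_E continuous_intros)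
 have "compact ((%t. E (t *\<^sub>R v)) ` {0..1})" by (intro compact_continuous_image Ec) simp
 then obtain R' where R': "!!x y. y : (%t. E (t *\<^sub>R v)) ` {0..1} ==> N (x + y) <= R ==> N x < R'"
  by (rule N_translate_bounded) blast
 define t where "t = (%n. 1/real (Suc n))"
 have t: "0 < t n" "t n <= 1" for n by (auto simp: t_def)
 have t0: "t \<longlonglongrightarrow> 0" unfolding t_def by (rule LIMSEQ_Suc[OF lim_1_over_n])
 define q where "q = (%n x. (f (x + E (t n *\<^sub>R v)) - f x) /\<^sub>R t n)"
 have fm: "f : borel_measurable borel" by (rule BC_measurable[OF TF_BC[OF f]])
 have fr: "(%x. f (x + y)) : borel_measurable borel" for y
  by (intro borel_measurable_continuous_onI continuous_on_compose2[OF TF_continuous[OF f, of UNIV]] continuous_intros) auto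
 have fr_int: "integrable mu (%x. f (x + y))" for y
 proof -
  have "(%x. x + y) : measurable mu borel" by (intro measurable_haar_cont haar continuous_intros)
  from integrable_distr[OF this, of f] show ?thesis using TF_integrable[OF f] by (simp add: mu_distr_right)
 qed
 have "(LINT x|mu. q n x) = 0" for n
  unfolding q_def using fr_int TF_integrable[OF f] integral_right[OF fm] by simp
 moreover have "(%n. LINT x|mu. q n x) \<longlonglongrightarrow> (LINT x|mu. X v f x)"
 proof (rule integral_dominated_convergence)
  show "X v f : borel_measurable mu" using BC_measurable[OF TF_BC[OF TF_X[OF f]]] by (simp add: borel_mu)
  show "q n : borel_measurable mu" for n unfolding q_def borel_mu using fr fm by measurable
  show "integrable mu (%x. C*ib (max R R') x)"
   using closed_ball_finite[of "max R R'"] by (intro integrable_mult_right integrable_real_indicator) auto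
  have "(%n. q n x) \<longlonglongrightarrow> X v f x" for x
  proof -
   have "((%h. (1/norm (h - 0)) *\<^sub>R (f (x + E (h *\<^sub>R v)) - (f (x + E (0 *\<^sub>R v)) + (h - 0) *\<^sub>R X v f (x + E (0 *\<^sub>R v))))) \<longlongrightarrow> 0) (at 0)"
    using X_flow[OF TF_smooth[OF f], of x v 0] unfolding has_vector_derivative_def has_derivative_at2 by blast
   moreover have "filterlim t (at 0) sequentially" unfolding filterlim_at using t t0 by (auto simp: less_imp_neq[symmetric])
   ultimately have "(%n. (1/norm (t n - 0)) *\<^sub>R (f (x + E (t n *\<^sub>R v)) - (f (x + E (0 *\<^sub>R v)) + (t n - 0) *\<^sub>R X v f (x + E (0 *\<^sub>R v))))) \<longlonglongrightarrow> 0"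
    by (rule filterlim_compose)
   moreover have "(1/norm (t n - 0)) *\<^sub>R (f (x + E (t n *\<^sub>R v)) - (f (x + E (0 *\<^sub>R v)) + (t n - 0) *\<^sub>R X v f (x + E (0 *\<^sub>R v)))) = q n x - X v f x" for n
    using t(1)[of n] by (simp add: q_def scaleR_diff_right scaleR_add_right divide_inverse)
   ultimately have "(%n. q n x - X v f x) \<longlonglongrightarrow> 0" by (simp only:)
   thus ?thesis by (rule LIM_zero_cancel)
  qed
  thus "AE x in mu. (%n. q n x) \<longlonglongrightarrow> X v f x" by simp
  have "cmod (q n x) <= C*ib (max R R') x" for n x
  proof (cases "N x <= max R R'")
   case True
   have "norm (f (x + E (t n *\<^sub>R v)) - f (x + E (0 *\<^sub>R v))) <= C*norm (t n - 0)"
   proof (rule differentiable_bound[of "{0..t n}" "%h. f (x + E (h *\<^sub>R v))" "%s h. h *\<^sub>R X v f (x + E (s *\<^sub>R v))"])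
    show "((%h. f (x + E (h *\<^sub>R v))) has_derivative (%h. h *\<^sub>R X v f (x + E (s *\<^sub>R v)))) (at s within {0..t n})" for s
     using X_flow[OF TF_smooth[OF f], of x v s] unfolding has_vector_derivative_def by (rule has_derivative_at_withinI)
    show "onorm (%h. h *\<^sub>R X v f (x + E (s *\<^sub>R v))) <= C" for s
     using mult_left_mono[OF C abs_ge_zero] by (intro onorm_le) (simp add: mult.commute)
   qed (use t[of n] in auto)
   thus ?thesis using t(1)[of n] True by (simp add: q_def divide_simps mult.commute)
  next
   case False
   have "t n : {0..1}" using t[of n] by simp
   hence "\<not> N (x + E (t n *\<^sub>R v)) <= R" using R'[of "E (t n *\<^sub>R v)" x] False by fastforce
   hence "f (x + E (t n *\<^sub>R v)) = 0" "f x = 0" using R False by auto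
   thus ?thesis using C0 by (simp add: q_def)
  qed
  thus "AE x in mu. cmod (q n x) <= C*ib (max R R') x" for n by simp
 qed
 ultimately show ?thesis by (simp add: LIMSEQ_const_iff)
qed

lemma integration_by_parts:
 assumes f: "msmooth_on A UNIV f" and g: "g : TF"
 shows "(pr (X v f) g) = - (pr f (X v g))"
proof -
 have "X v (%x. f x*g x) x = f x*X v g x + X v f x*g x" for x
  by (rule X_mult[OF open_UNIV f TF_smooth[OF g]]) simp
 moreover have "(LINT x|mu. X v (%x. f x*g x) x) = 0" by (intro integral_X TF_mult f g)
 moreover have "integrable mu (%x. f x*X v g x)" "integrable mu (%x. X v f x*g x)"
  by (intro TF_integrable TF_mult TF_X f g msmooth_X open_UNIV)+
 ultimately show ?thesis by (simp add: eq_neg_iff_add_eq_0 add.commute)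
qed

section \<open>Test functions determine locally integrable functions\<close>

text \<open>Every open set is a countable union of sets where a non-negative test function is positive.\<close>

definition bumps :: "('g => real) set" where
 "bumps = {r. msmooth_on A UNIV r & (ALL x. 0 <= r x & r x <= 1)}"

lemma borel_generated_by_bumps: "(borel :: 'g measure) = sigma UNIV ((%r. {x. 0 < r x}) ` bumps)"
proof -
 let ?G = "(%r. {x. 0 < r x}) ` bumps"
 have op: "open {x. 0 < r x}" if "r : bumps" for r
  using that by (intro open_Collect_less continuous_intros msmooth_continuous[OF open_UNIV]) (auto simp: bumps_def)
 have S: "S : sigma_sets UNIV ?G" if S: "open S" for S
 proof -
  have "EX r:bumps. r x > 0 & {x. 0 < r x} <= S" if x: "x : S" for x
  proof -
   obtain f :: "'g => real" and K P where f: "msmooth_on A UNIV f" "!!y. 0 <= f y" "!!y. f y <= 1"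
    "x : P" "!!y. y : P ==> f y = 1" "K <= S" "!!y. y ~: K ==> f y = 0"
    by (rule bump[OF S x]) blast
   thus ?thesis by (intro bexI[of _ f]) (fastforce simp: bumps_def)+
  qed
  then obtain r where r: "!!x. x : S ==> r x : bumps & r x x > 0 & {y. 0 < r x y} <= S" by metis
  let ?F = "(%x. {y. 0 < r x y}) ` S"
  obtain F' where F': "F' <= ?F" "countable F'" "\<Union>F' = \<Union>?F"
   by (rule Lindelof[of ?F]) (use op r in auto)
  have "\<Union>?F = S" using r by blast
  moreover have "F' <= sigma_sets UNIV ?G" using F'(1) r by (auto intro!: sigma_sets.Basic)
  hence "\<Union>F' : sigma_sets UNIV ?G" using F'(2) by (intro sigma_sets_UNION) auto
  ultimately show ?thesis using F'(3) by simp
 qed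
 have "sigma_sets UNIV {S. open S} = sigma_sets UNIV ?G"
  by (rule sigma_sets_eqI) (use S op in \<open>auto intro: sigma_sets.Basic\<close>)
 thus ?thesis unfolding borel_def by (intro sigma_eqI) auto
qed

lemma real_AE_zero_of_set_integrals:
 fixes g :: "'g => real"
 assumes g: "integrable mu g" and z: "!!Y. Y : sets borel ==> (LINT x|mu. indicator Y x*g x) = 0"
 shows "AE x in mu. g x = 0"
proof -
 have gm [measurable]: "g : borel_measurable borel" using borel_measurable_integrable[OF g] by (simp add: borel_mu)
 have *: "AE x in mu. indicator Y x*g x = 0" if Y: "Y : sets borel" and p: "!!x. 0 <= s*(indicator Y x*g x)" and s: "s ~= 0" for Y s
 proof -
  have "integrable mu (%x. indicator Y x*g x)"
   using integrable_mult_indicator[OF _ g, of Y] Y by simp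
  hence i: "integrable mu (%x. s*(indicator Y x*g x))" by simp
  have "(LINT x|mu. s*(indicator Y x*g x)) = 0" using z[OF Y] by simp
  hence "AE x in mu. s*(indicator Y x*g x) = 0"
   using integral_nonneg_eq_0_iff_AE[OF i] p by simp
  thus ?thesis using s by simp
 qed
 have "AE x in mu. indicator {x. 0 < g x} x*g x = 0" by (rule *[of _ 1]) (auto simp: indicator_def)
 moreover have "AE x in mu. indicator {x. g x < 0} x*g x = 0"
  by (rule *[of _ "- 1"]) (auto simp: indicator_def)
 ultimately show ?thesis
 proof eventually_elim
  case (elim x)
  thus ?case by (cases "0 < g x"; cases "g x < 0") (auto simp: indicator_def)
 qed
qed

lemma AE_zero_of_set_integrals:
 fixes g :: "'g => complex"
 assumes g: "integrable mu g" and z: "!!Y. Y : sets borel ==> (LINT x|mu. indicator Y x *\<^sub>R g x) = 0"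
 shows "AE x in mu. g x = 0"
proof -
 have i: "integrable mu (%x. indicator Y x *\<^sub>R g x)" if "Y : sets borel" for Y
  using integrable_mult_indicator[OF _ g, of Y] that by simp
 have "AE x in mu. Re (g x) = 0"
 proof (rule real_AE_zero_of_set_integrals)
  fix Y :: "'g set" assume Y: "Y : sets borel"
  show "(LINT x|mu. indicator Y x * Re (g x)) = 0" using integral_Re[OF i[OF Y]] z[OF Y] by simp
 qed (use g in simp)
 moreover have "AE x in mu. Im (g x) = 0"
 proof (rule real_AE_zero_of_set_integrals)
  fix Y :: "'g set" assume Y: "Y : sets borel"
  show "(LINT x|mu. indicator Y x*Im (g x)) = 0" using integral_Im[OF i[OF Y]] z[OF Y] by simp
 qed (use g in simp)
 ultimately show ?thesis by eventually_elim (simp add: complex_eq_iff)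
qed

lemma smooth_power: "msmooth_on A UNIV r ==> msmooth_on A UNIV (%x. (r x) ^ n)" for r :: "'g => real"
 by (induction n) (auto intro!: msmooth_mult)

text \<open>
 For a bump \<open>r\<close> the functions \<open>1 - (1 - r)\<^sup>n\<close> increase to the indicator of \<open>r > 0\<close>; the sets of this
 form are closed under intersection and generate the Borel sets.
\<close>

lemma integrable_zero_of_smooth_pairing:
 fixes g :: "'g => complex"
 assumes g: "integrable mu g" and z: "!!f :: 'g => real. msmooth_on A UNIV f ==> (LINT x|mu. f x *\<^sub>R g x) = 0"
 shows "AE x in mu. g x = 0"
proof (rule AE_zero_of_set_integrals[OF g])
 have i: "integrable mu (%x. indicator Y x *\<^sub>R g x)" if "Y : sets borel" for Y
  using integrable_mult_indicator[OF _ g, of Y] that by simp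
 let ?G = "(%r. {x. 0 < r x}) ` bumps"
 fix Y :: "'g set" assume "Y : sets borel"
 hence Y: "Y : sigma_sets UNIV ?G" by (subst (asm) borel_generated_by_bumps) simp
 have borel: "Y : sigma_sets UNIV ?G ==> Y : sets borel" for Y by (subst borel_generated_by_bumps) simp
 have I: "Int_stable ?G"
 proof (rule Int_stableI)
  fix a b assume "a : ?G" "b : ?G"
  then obtain r s where rs: "r : bumps" "s : bumps" "a = {x. 0 < r x}" "b = {x. 0 < s x}" by blast
  have "(%x. r x * s x) : bumps" using rs(1,2) by (auto simp: bumps_def mult_le_one intro!: msmooth_mult)
  moreover have "a Int b = {x. 0 < r x * s x}"
   using rs by (auto simp: bumps_def zero_less_mult_iff not_less[symmetric])
  ultimately show "a Int b : ?G" by (intro image_eqI[of _ _ "%x. r x * s x"])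
 qed
 show "(LINT x|mu. indicator Y x *\<^sub>R g x) = 0"
 proof (rule sigma_sets_induct_disjoint[OF I _ Y])
  show "?G <= Pow UNIV" by simp
  show "(LINT x|mu. indicator {} x *\<^sub>R g x) = 0" by simp
  show "(LINT x|mu. indicator a x *\<^sub>R g x) = 0" if a: "a : ?G" for a
  proof -
   obtain r where r: "r : bumps" "a = {x. 0 < r x}" using a by blast
   have rr: "msmooth_on A UNIV r" "!!x. 0 <= r x" "!!x. r x <= 1" using r by (auto simp: bumps_def)
   define s where "s = (%n x. 1 + - ((1 + - r x) ^ n))"
   have sm: "msmooth_on A UNIV (s n)" for n
    unfolding s_def by (intro msmooth_add msmooth_minus smooth_power msmooth_const open_UNIV rr)
   have s01: "\<bar>s n x\<bar> <= 1" for n x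
    using rr(2,3)[of x] power_le_one[of "1 - r x" n] zero_le_power[of "1 - r x" n] by (simp add: s_def abs_if)
   have "(%n. LINT x|mu. s n x *\<^sub>R g x) \<longlonglongrightarrow> (LINT x|mu. indicator a x *\<^sub>R g x)"
   proof (rule integral_dominated_convergence)
    show "(%x. indicator a x *\<^sub>R g x) : borel_measurable mu"
     by (rule borel_measurable_integrable[OF i]) (rule borel, use a in \<open>auto intro: sigma_sets.Basic\<close>)
    show "(%x. s n x *\<^sub>R g x) : borel_measurable mu" for n
     using borel_measurable_continuous_onI[OF msmooth_continuous[OF open_UNIV sm[of n]]] borel_measurable_integrable[OF g]
     by (simp add: borel_mu)
    show "integrable mu (%x. norm (g x))" using g by simp
    have "(%n. s n x *\<^sub>R g x) \<longlonglongrightarrow> indicator a x *\<^sub>R g x" for x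
    proof (cases "x : a")
     case True
     hence "norm (1 - r x) < 1" using rr(2,3)[of x] r by simp
     hence "(%n. (1 - r x) ^ n) \<longlonglongrightarrow> 0" by (rule LIMSEQ_power_zero)
     hence "(%n. (1 - (1 - r x) ^ n) *\<^sub>R g x) \<longlonglongrightarrow> (1 - 0) *\<^sub>R g x"
      by (intro tendsto_scaleR tendsto_diff tendsto_const)
     thus ?thesis using True by (simp add: s_def)
    next
     case False
     hence "r x = 0" using rr(2)[of x] r(2) by auto
     thus ?thesis using False by (simp add: s_def)
    qed
    thus "AE x in mu. (%n. s n x *\<^sub>R g x) \<longlonglongrightarrow> indicator a x *\<^sub>R g x" by simp
    show "AE x in mu. norm (s n x *\<^sub>R g x) <= norm (g x)" for n
     using s01 by (simp add: mult_left_le_one_le)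
   qed
   thus ?thesis using z[OF sm] by (simp add: LIMSEQ_const_iff)
  qed
  show "(LINT x|mu. indicator (UNIV - a) x *\<^sub>R g x) = 0"
   if a: "a : sigma_sets UNIV ?G" "(LINT x|mu. indicator a x *\<^sub>R g x) = 0" for a
  proof -
   have "indicator (UNIV - a) x *\<^sub>R g x = 1 *\<^sub>R g x - indicator a x *\<^sub>R g x" for x by (simp add: indicator_def)
   thus ?thesis using i[OF borel[OF a(1)]] g z[OF msmooth_const, of 1] a(2) by simp
  qed
  show "(LINT x|mu. indicator (\<Union>k. D k) x *\<^sub>R g x) = 0"
   if D: "disjoint_family D" "range D <= sigma_sets UNIV ?G" "!!k::nat. (LINT x|mu. indicator (D k) x *\<^sub>R g x) = 0" for D
  proof -
   have Dm: "D k : sets borel" for k using D(2) by (intro borel) auto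
   have "(LINT x:(\<Union>k. D k)|mu. g x) = (\<Sum>k. LINT x:(D k)|mu. g x)"
   proof (rule lebesgue_integral_countable_add)
    show "set_integrable mu (\<Union>k. D k) g" using i[of "\<Union>k. D k"] Dm by (simp add: set_integrable_def)
    show "D i Int D j = {}" if "i ~= j" for i j using D(1) that by (auto simp: disjoint_family_on_def)
   qed (use Dm in simp)
   thus ?thesis using D(3) by (simp add: set_lebesgue_integral_def)
  qed
 qed
qed

text \<open>The products with the cutoffs are integrable, and all smooth functions may be paired with them.\<close>

lemma fundamental_lemma:
 assumes h: "locally_integrable mu h" and z: "!!f. f : TF ==> (pr h f) = 0"
 shows "AE x in mu. h x = 0"
proof -
 have "AE x in mu. h x * of_real (cut (real (Suc n)) x) = 0" for n
 proof (rule integrable_zero_of_smooth_pairing)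
  let ?c = "%x. complex_of_real (cut (real (Suc n)) x)"
  have c: "?c : TF" by (rule cut_TF) simp
  show "integrable mu (%x. h x*?c x)" by (intro locally_integrable_BC h TF_BC c)
  fix f :: "'g => real" assume f: "msmooth_on A UNIV f"
  have "(%x. of_real (f x)*?c x) : TF" by (intro TF_mult msmooth_of_real f open_UNIV c)
  from z[OF this] show "(LINT x|mu. f x *\<^sub>R (h x*?c x)) = 0" by (simp add: scaleR_conv_of_real mult_ac)
 qed
 hence "AE x in mu. ALL n. h x * of_real (cut (real (Suc n)) x) = 0" unfolding AE_all_countable by (rule allI)
 thus ?thesis
 proof eventually_elim
  case (elim x)
  obtain n where "N x <= real n" using real_arch_simple by blast
  hence "cut (real (Suc n)) x = 1" by (intro cut_eq) auto
  thus ?case using elim[rule_format, of n] by simp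
 qed
qed

end

context carnot
begin

section \<open>Points are removable\<close>

lemma AE_nonzero: "AE x in mu. x ~= 0"
 by (rule AE_I[of _ _ "{0}"]) (auto simp: null_identity)

lemma integral_cong_nz:
 fixes f g :: "'g => complex"
 assumes "f : borel_measurable borel" "g : borel_measurable borel" "!!x. x ~= 0 ==> f x = g x"
 shows "(LINT x|mu. f x) = (LINT x|mu. g x)"
 by (rule integral_cong_AE) (use assms AE_nonzero in \<open>auto simp: borel_mu elim: eventually_mono\<close>)

lemma L2_bounded_nz:
 assumes "f : borel_measurable borel" "integrable mu h" "!!x. x ~= 0 ==> (cmod (f x))^2 <= h x"
 shows "f : L2 mu"
 by (rule L2_bounded_by[OF _ assms(2)]) (use assms AE_nonzero in \<open>auto simp: borel_mu elim: eventually_mono\<close>)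

lemma punctured_measurable:
 fixes f :: "'g => 'b::{real_normed_vector, second_countable_topology}"
 assumes "msmooth_on A (- {0}) f"
 shows "f : borel_measurable borel"
proof -
 have "(%x. indicator (- {0}) x *\<^sub>R f x) : borel_measurable borel"
  by (intro borel_measurable_continuous_on_indicator msmooth_continuous[OF _ assms] borel_open open_punctured)
 moreover have "(%x. indicator {0 :: 'g} x *\<^sub>R f 0) : borel_measurable borel"
  by (intro borel_measurable_scaleR borel_measurable_indicator borel_measurable_const borel_closed closed_singleton)
 ultimately have "(%x. indicator (- {0}) x *\<^sub>R f x + indicator {0} x *\<^sub>R f 0) : borel_measurable borel"
  by (rule borel_measurable_add)
 moreover have "(%x. indicator (- {0}) x *\<^sub>R f x + indicator {0} x *\<^sub>R f 0) = f" by (auto simp: fun_eq_iff indicator_def)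
 ultimately show ?thesis by simp
qed

lemma L2loc_cong_nz:
 assumes f: "f : L2loc" and g [measurable]: "g : borel_measurable borel" and eq: "!!x. x ~= 0 ==> g x = f x"
 shows "g : L2loc"
proof -
 have "(%x. g x * k x) : L2 mu" if k: "k : BC" for k
  by (rule L2_bounded_nz[OF _ L2D(2)[OF L2loc_L2[OF f k]]]) (use eq BC_measurable[OF k] in auto)
 thus ?thesis using g by (simp add: L2loc_def)
qed

lemma L2loc_product_integrable:
 assumes f: "f : L2loc" and g: "g : L2loc" "!!x. R < N x ==> g x = 0"
 shows "integrable mu (%x. f x*g x)"
proof -
 have "integrable mu (%x. (f x*ib R x)*(g x*ib R x))"
  by (intro L2_mult_integrable L2loc_L2[OF f BC_indicator] L2loc_L2[OF g(1) BC_indicator])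
 moreover have "(f x*ib R x)*(g x*ib R x) = f x*g x" for x
  using g(2)[of x] by (auto simp: indicator_def)
 ultimately show ?thesis by simp
qed

lemma dyadic_ball_measure: "measure mu {x. N x <= 1/2 ^ k} <= (1/4) ^ k*measure mu {x. N x <= 1}"
proof -
 have "emeasure mu {x. N x <= 1} = ennreal (measure mu {x. N x <= 1})"
  using closed_ball_finite[of 1] by (intro emeasure_eq_ennreal_measure) auto
 hence "emeasure mu {x. N x <= 1/2 ^ k} <= ennreal ((1/4) ^ k*measure mu {x. N x <= 1})"
  using dyadic_ball[of k] by (simp add: ennreal_mult)
 thus ?thesis unfolding measure_def by (intro enn2real_leI) (auto simp: measure_def)
qed

text \<open>
 The error made by cutting off near the identity is at most
 \<open>1 / eps\<close> times the \<open>L\<^sup>1\<close>-norm of an \<open>L\<^sup>2\<close>-function over a ball of radius \<open>eps\<close>; as this ball has measure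
 \<open>O(eps\<^sup>2)\<close>, the Cauchy-Schwarz inequality shows that the error tends to zero.
\<close>

lemma tendsto_0_of_square_le:
 assumes "!!n :: nat. (cmod (a n))^2 <= b n" "b \<longlonglongrightarrow> 0"
 shows "a \<longlonglongrightarrow> 0"
proof (rule tendsto_norm_zero_cancel)
 have "(%n. (cmod (a n))^2) \<longlonglongrightarrow> 0" by (rule tendsto_sandwich[OF _ _ tendsto_const assms(2)]) (auto simp: assms(1))
 from tendsto_real_sqrt[OF this] show "(%n. cmod (a n)) \<longlonglongrightarrow> 0" by simp
qed

lemma remove_point:
 assumes F0: "F0 : L2loc" and F: "!!v. v : B ==> F v : L2loc"
  and eq: "!!f. f : TF ==> pr F0 f + (\<Sum>v\<in>B. pr (F v) (X v f)) = 0"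
  and h: "msmooth_on A (- {0}) h" and C: "!!x. cmod (h x) <= C" and R: "!!x. R < N x ==> h x = 0"
  and Xh: "!!v. v : B ==> X v h : L2loc"
 shows "pr F0 h + (\<Sum>v\<in>B. pr (F v) (X v h)) = 0"
proof -
 obtain D where "D >= 0 & (ALL v:B. \<forall>R>0. ALL x. \<bar>X v (cut R) x\<bar> <= D/R)" by (rule exE[OF X_cut_bounded])
 hence D: "D >= 0" "!!v R x. v : B ==> R > 0 ==> \<bar>X v (cut R) x\<bar> <= D/R" by auto
 define e where "e = (%k::nat. 1/(2::real) ^ Suc k)"
 have e: "e k > 0" and e2: "2*e k = 1/2 ^ k" for k by (simp_all add: e_def)
 have ev: "\<forall>\<^sub>F k in sequentially. 1/2 ^ k < N x" if "x ~= 0" for x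
  using order_tendstoD(2)[OF LIMSEQ_realpow_zero[of "1/2 :: real"], of "N x"] that by (simp add: power_one_over)
 define z where "z = (%k x. 1 + - cut (e k) x)"
 have z1: "\<bar>z k x\<bar> <= 1" for k x using cut_range[of "e k" x] by (simp add: z_def)
 have zU: "msmooth_on A UNIV (z k)" for k
  unfolding z_def by (intro msmooth_add msmooth_minus cut_smooth e open_UNIV msmooth_const)
 have zs: "msmooth_on A W (z k)" for k W by (rule msmooth_subset[OF zU]) simp
 have [measurable]: "z k : borel_measurable borel" for k by (rule smooth_measurable[OF zU])
 define hk where "hk = (%k x. complex_of_real (z k x)*h x)"
 have hk: "hk k : TF" for k
 proof (rule TF_I[of _ R])
  have W: "open {x. N x < e k}" by (intro open_Collect_less continuous_intros N_continuous)
  have 1: "msmooth_on A (- {0}) (hk k)" unfolding hk_def by (intro msmooth_mult msmooth_of_real zs h open_punctured)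
  have 2: "msmooth_on A {x. N x < e k} (hk k)"
   by (rule msmooth_cong[OF W msmooth_const[of _ 0]]) (simp add: hk_def z_def cut_eq(1)[OF e])
  have "- {0} \<union> {x. N x < e k} = UNIV" using e[of k] by auto
  thus "msmooth_on A UNIV (hk k)" using msmooth_Un[OF open_punctured W 1 2] by (simp only:)
 qed (simp add: hk_def R)
 have Xhk: "X v (hk k) x = of_real (z k x)*X v h x - of_real (X v (cut (e k)) x)*h x" if x: "x ~= 0" for v k x
 proof -
  have "X v (z k) x = - X v (cut (e k)) x"
   unfolding z_def using X_add[OF open_UNIV msmooth_const msmooth_minus[OF open_UNIV cut_smooth[OF e]]] X_minus[OF open_UNIV cut_smooth[OF e]]
   by simp
  hence "X v (%x. complex_of_real (z k x)) x = - of_real (X v (cut (e k)) x)"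
   using X_of_real[OF open_UNIV zU UNIV_I, of v k x] by simp
  moreover have "X v (hk k) x = of_real (z k x)*X v h x + X v (%x. complex_of_real (z k x)) x*h x"
   unfolding hk_def using x by (intro X_mult[OF open_punctured] msmooth_of_real zs open_punctured h) auto
  ultimately show ?thesis by simp
 qed
 have hBC: "h : BC" by (rule BC_I[OF punctured_measurable[OF h] C R])
 have lim: "(%k. LINT x|mu. of_real (z k x)*g x) \<longlonglongrightarrow> (LINT x|mu. g x)"
  and zint: "integrable mu (%x. of_real (z k x)*g x)" if g: "integrable mu g" for g :: "'g => complex" and k
 proof -
  have [measurable]: "g : borel_measurable borel" using borel_measurable_integrable[OF g] by (simp add: borel_mu)
  have le: "norm (of_real (z k x)*g x) <= norm (g x)" for k x using z1 by (simp add: norm_mult mult_left_le_one_le)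
  thus "integrable mu (%x. of_real (z k x)*g x)" by (intro Bochner_Integration.integrable_bound[OF g]) auto
  show "(%k. LINT x|mu. of_real (z k x)*g x) \<longlonglongrightarrow> (LINT x|mu. g x)"
  proof (rule integral_dominated_convergence[OF _ _ integrable_norm[OF g]])
   show "AE x in mu. (%k. of_real (z k x)*g x) \<longlonglongrightarrow> g x"
    using AE_nonzero
   proof eventually_elim
    case (elim x)
    show ?case
     by (rule tendsto_eventually, rule eventually_mono[OF ev[OF elim]]) (simp add: z_def cut_eq(2)[OF e] e2)
   qed
  qed (use le in auto)
 qed
 have limv: "(%k. pr (F v) (X v (hk k))) \<longlonglongrightarrow> pr (F v) (X v h)" if v: "v : B" for v
 proof -
  let ?c = "%k x. complex_of_real (X v (cut (e k)) x)"
  let ?i = "%k x. ib (1/2 ^ k) x :: complex"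
  note Fm [measurable] = L2loc_measurable[OF F[OF v]]
  have "X v (%x. complex_of_real (cut (e k) x)) = ?c k" for k
   by (intro ext X_of_real[OF open_UNIV cut_smooth[OF e]]) simp
  hence cB: "?c k : BC" for k using TF_BC[OF TF_X[OF cut_TF[OF e[of k]], of v]] by simp
  hence ch: "(%x. ?c k x*h x) : BC" for k by (rule BC_mult[OF _ hBC])
  have c0: "?c k x = 0" if "1/2 ^ k < N x" for k x
   using X_zero_outside[OF _ that, of "cut (e k)"] cut_eq(2)[OF e] by (simp add: e2[symmetric])
  have i1: "integrable mu (%x. F v x*X v h x)"
   by (rule L2loc_product_integrable[OF F[OF v] Xh[OF v]]) (rule X_zero_outside[OF R])
  have i2: "integrable mu (%x. F v x*(?c k x*h x))" for k by (rule L2loc_integrable[OF F[OF v] ch])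
  have "pr (F v) (X v (hk k)) = (LINT x|mu. of_real (z k x)*(F v x*X v h x) - F v x*(?c k x*h x))" for k
   using L2loc_measurable[OF Xh[OF v]] TF_X[OF hk[of k], of v] BC_measurable[OF cB[of k]] punctured_measurable[OF h]
   by (intro integral_cong_nz) (auto simp: Xhk algebra_simps)
  hence split: "pr (F v) (X v (hk k)) = (LINT x|mu. of_real (z k x)*(F v x*X v h x)) - (LINT x|mu. F v x*(?c k x*h x))" for k
   using zint[OF i1] i2 by simp
  have Fi: "(%x. F v x*?i k x) : L2 mu" for k by (intro L2loc_L2 F v BC_indicator)
  have chL: "(%x. cnj (?c k x*h x)) : L2 mu" for k by (intro L2_cnj BC_L2 ch)
  define Q where "Q = 4*D\<^sup>2*C\<^sup>2*measure mu {x. N x <= 1}"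
  have Q: "nrm (%x. cnj (?c k x*h x)) <= Q" for k
  proof -
   have "nrm (%x. cnj (?c k x*h x)) <= (LINT x|mu. (D*2 ^ Suc k*C)^2*ib (1/2 ^ k) x)"
    unfolding L2_sqnorm_def
   proof (rule integral_mono[OF L2D(2)[OF chL] ib_integrable])
    fix x
    have "cmod (?c k x) <= D*2 ^ Suc k" using D(2)[OF v e, of k x] by (simp add: e_def)
    hence "cmod (?c k x)*cmod (h x) <= D*2 ^ Suc k*C" using C[of x] D(1) by (intro mult_mono) auto
    hence "(cmod (?c k x)*cmod (h x))^2 <= (D*2 ^ Suc k*C)^2" by (intro power_mono) auto
    thus "(cmod (cnj (?c k x*h x)))^2 <= (D*2 ^ Suc k*C)^2*ib (1/2 ^ k) x"
     using c0[of k x] by (auto simp: indicator_def norm_mult)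
   qed
   also have "... <= (D*2 ^ Suc k*C)^2*((1/4) ^ k*measure mu {x. N x <= 1})"
    using dyadic_ball_measure[of k] by (simp add: mult_left_mono)
   also have "... = Q*(2 ^ k*2 ^ k*(1/4) ^ k)" by (simp add: Q_def power_mult_distrib power2_eq_square mult_ac)
   also have "(2::real) ^ k*2 ^ k*(1/4) ^ k = 1" by (simp add: power_mult_distrib[symmetric])
   finally show ?thesis by simp
  qed
  have le: "(cmod (LINT x|mu. F v x*(?c k x*h x)))^2 <= nrm (%x. F v x*?i k x)*Q" for k
  proof -
   have "F v x*(?c k x*h x) = (F v x*?i k x)*cnj (cnj (?c k x*h x))" for x
    using c0[of k x] by (auto simp: indicator_def)
   hence "(LINT x|mu. F v x*(?c k x*h x)) = L2_inner mu (%x. F v x*?i k x) (%x. cnj (?c k x*h x))"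
    unfolding L2_inner_def by (simp only:)
   thus ?thesis
    using order_trans[OF L2_Cauchy_Schwarz[OF Fi chL] mult_left_mono[OF Q L2_sqnorm_nonneg]] by (simp only:)
  qed
  have "(%k. nrm (%x. F v x*?i k x)) \<longlonglongrightarrow> (LINT x|mu. 0)"
   unfolding L2_sqnorm_def
  proof (rule integral_dominated_convergence[OF _ _ L2D(2)[OF Fi[of 0]]])
   show "AE x in mu. (%k. (cmod (F v x*?i k x))^2) \<longlonglongrightarrow> 0"
    using AE_nonzero
   proof eventually_elim
    case (elim x)
    show ?case by (rule tendsto_eventually, rule eventually_mono[OF ev[OF elim]]) (simp add: indicator_def)
   qed
   have "N x <= 1/2 ^ k ==> N x <= 1" for x k using order_trans[of "N x" "1/2 ^ k" 1] by simp
   thus "AE x in mu. norm ((cmod (F v x*?i k x))^2) <= (cmod (F v x*?i 0 x))^2" for k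
    by (auto simp: indicator_def)
  qed simp_all
  hence "(%k. nrm (%x. F v x*?i k x)*Q) \<longlonglongrightarrow> 0" using tendsto_mult_right[of _ 0 _ Q] by simp
  from tendsto_0_of_square_le[OF le this] show ?thesis unfolding split using tendsto_diff[OF lim[OF i1]] by fastforce
 qed
 have "(%k. pr F0 (hk k)) \<longlonglongrightarrow> pr F0 h"
  using lim[OF L2loc_integrable[OF F0 hBC]] by (simp add: hk_def mult_ac)
 hence "(%k. pr F0 (hk k) + (\<Sum>v\<in>B. pr (F v) (X v (hk k)))) \<longlonglongrightarrow> pr F0 h + (\<Sum>v\<in>B. pr (F v) (X v h))"
  by (intro tendsto_add tendsto_sum limv)
 thus ?thesis using eq[OF hk] by (simp add: LIMSEQ_const_iff)
qed

text \<open>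
 Summing over dyadic shells, the same volume bound shows that
 \<open>N\<^sup>alpha\<^sup>-\<^sup>1\<close> is locally square-integrable for every positive \<open>alpha\<close>.
\<close>

lemma N_powr_L2loc:
 assumes alpha: "alpha > 0"
 shows "(%x. complex_of_real (N x powr (alpha - 1))) : L2loc"
proof -
 let ?p = "%x. N x powr (alpha - 1)" and ?m = "measure mu {x. N x <= 1}"
 have [measurable]: "?p : borel_measurable borel"
  by (intro powr_real_measurable borel_measurable_continuous_onI N_continuous continuous_intros borel_measurable_const)
 define c where "c = (2::real) powr (2 - 2 * alpha)"
 have c: "0 < c" "c/4 < 1"
 proof -
  have "c < 2 powr 2" unfolding c_def using alpha by (intro powr_less_mono) auto
  thus "c/4 < 1" by simp
 qed (simp add: c_def)
 have sq: "(?p x)^2 = N x powr (2 * alpha - 2)" for x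
  unfolding power2_eq_square powr_add[symmetric] by (simp add: algebra_simps)
 have shell: "ennreal ((?p x)^2*ib 1 x) <= (\<Sum>k. ennreal ((1 + c ^ Suc k)*ib (1/2 ^ k) x))" for x
 proof (cases "x = 0 | 1 < N x")
  case False
  hence x: "0 < N x" "N x <= 1" by auto
  obtain k where k: "(1/2) ^ Suc k < N x" "N x <= (1/2) ^ k"
  proof -
   obtain K where "(1/2) ^ K < N x" using real_arch_pow_inv[of "N x" "1/2"] x by auto
   hence "\<exists>k<K. \<not> (1/2) ^ k < N x & (1/2) ^ Suc k < N x"
    using x ex_least_nat_less[of "%k. (1/2) ^ k < N x" K] by fastforce
   thus ?thesis using that by (auto simp: not_less)
  qed
  have "N x powr (2 * alpha - 2) <= 1 + c ^ Suc k"
  proof (cases "alpha >= 1")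
   case True
   thus ?thesis using powr_mono2[of "2 * alpha - 2" "N x" 1] x zero_le_power[OF less_imp_le[OF c(1)], of "Suc k"] by simp
  next
   case False
   hence "N x powr (2 * alpha - 2) <= ((1/2) ^ Suc k) powr (2 * alpha - 2)" using k by (intro powr_mono2') auto
   also have "(1/2 :: real) ^ Suc k = 2 powr (- real (Suc k))"
    unfolding powr_minus by (subst powr_realpow) (simp_all only: zero_less_numeral power_one_over inverse_eq_divide)
   also have "(2 powr (- real (Suc k))) powr (2 * alpha - 2) = c powr (real (Suc k))"
    unfolding c_def powr_powr by (rule arg_cong[of _ _ "(powr) 2"]) (simp add: algebra_simps)
   also have "... = c ^ Suc k" using c(1) by (rule powr_realpow)
   finally show ?thesis by simp
  qed
  hence "ennreal ((?p x)^2*ib 1 x) <= ennreal ((1 + c ^ Suc k)*ib (1/2 ^ k) x)"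
   using x k by (intro ennreal_leI) (simp add: sq power_one_over)
  thus ?thesis
   by (rule order_trans) (use sum_le_suminf[of "%k. ennreal ((1 + c ^ Suc k)*ib (1/2 ^ k) x)" "{k}"] in simp)
 qed (auto simp: indicator_def)
 let ?s = "%k. ((1/4) ^ k + c*(c/4) ^ k)*?m"
 have "(\<integral>\<^sup>+x. ennreal ((?p x)^2*ib 1 x) \<partial>mu) <= (\<Sum>k. \<integral>\<^sup>+x. ennreal ((1 + c ^ Suc k)*ib (1/2 ^ k) x) \<partial>mu)"
  by (subst nn_integral_suminf[symmetric]) (auto intro!: nn_integral_mono shell simp del: power_Suc)
 also have "... <= (\<Sum>k. ennreal (?s k))"
 proof (intro suminf_le allI)
  fix k
  have c0: "0 <= 1 + c ^ Suc k" using c(1) by (intro add_nonneg_nonneg) auto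
  hence "(\<integral>\<^sup>+x. ennreal ((1 + c ^ Suc k)*ib (1/2 ^ k) x) \<partial>mu) = ennreal ((1 + c ^ Suc k)*measure mu {x. N x <= 1/2 ^ k})"
   by (subst nn_integral_eq_integral[OF ib_integrable]) auto
  also have "... <= ennreal ((1 + c ^ Suc k)*((1/4) ^ k*?m))"
   using c0 by (intro ennreal_leI mult_left_mono dyadic_ball_measure)
  also have "(1 + c ^ Suc k)*((1/4) ^ k*?m) = ?s k" by (simp add: algebra_simps power_divide add_divide_distrib)
  finally show "(\<integral>\<^sup>+x. ennreal ((1 + c ^ Suc k)*ib (1/2 ^ k) x) \<partial>mu) <= ennreal (?s k)" .
 qed auto
 also have "... = ennreal (\<Sum>k. ?s k)"
  by (rule suminf_ennreal2) (use c in \<open>auto intro!: mult_nonneg_nonneg add_nonneg_nonneg summable_mult2 summable_add summable_mult summable_geometric\<close>)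
 finally have "(\<integral>\<^sup>+x. ennreal ((?p x)^2*ib 1 x) \<partial>mu) < \<infinity>" by (simp add: le_less_trans[OF _ ennreal_less_top])
 hence int1: "integrable mu (%x. (?p x)^2*ib 1 x)" by (intro integrableI_nonneg) auto
 have "(%x. complex_of_real (?p x)*g x) : L2 mu" if g: "g : BC" for g
 proof -
  note [measurable] = BC_measurable[OF g]
  obtain C R where C: "!!x. cmod (g x) <= C" and R: "!!x. R < N x ==> g x = 0" using g by (auto simp: BC_def)
  define K where "K = 1 + R powr (2 * alpha - 2)"
  have big: "(?p x)^2 <= (?p x)^2*ib 1 x + K*ib R x" if x: "N x <= R" for x
  proof (cases "N x <= 1")
   case False
   have "N x powr (2 * alpha - 2) <= K"
    using powr_mono2[of "2 * alpha - 2" "N x" R] powr_mono2'[of "2 * alpha - 2" 1 "N x"] False x by (cases "alpha >= 1") (auto simp: K_def add_increasing2)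
   thus ?thesis using False x by (simp add: sq)
  qed (simp add: K_def)
  show ?thesis
  proof (rule L2_bounded_nz)
   show "integrable mu (%x. C\<^sup>2*((?p x)^2*ib 1 x + K*ib R x))"
    by (intro integrable_mult_right Bochner_Integration.integrable_add int1 ib_integrable)
   show "(cmod (complex_of_real (?p x)*g x))^2 <= C\<^sup>2*((?p x)^2*ib 1 x + K*ib R x)" for x
   proof (cases "N x <= R")
    case True
    have "(cmod (g x))^2*(?p x)^2 <= C\<^sup>2*((?p x)^2*ib 1 x + K*ib R x)"
     using C[of x] by (intro mult_mono power_mono big True) auto
    thus ?thesis by (simp add: norm_mult power_mult_distrib mult.commute)
   qed (auto simp: R indicator_def)
  qed measurable
 qed
 thus ?thesis by (simp add: L2loc_def)
qed

end

section \<open>The weight\<close>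

lemma locally_integrable_measurable: "locally_integrable mu f ==> f : borel_measurable mu"
 by (simp add: locally_integrable_def)

locale carnot_weight = carnot A nu \<gg> B mu N
 for A :: "('g::{topological_group_add, t2_space, second_countable_topology}, 'e::euclidean_space) chart set"
  and nu :: nat and \<gg> :: "nat => 'e set" and B mu and N :: "'g => real" +
 fixes alpha :: real
 assumes alpha_pos: "alpha > 0"
begin

abbreviation w :: "'g => real" where "w == exp_weight N alpha"
abbreviation M :: "'g measure" where "M == weighted mu w"

lemma w_pos [simp]: "0 < w x" "0 <= w x" "w x ~= 0"
 by (simp_all add: exp_weight_def)

lemma w_le_1: "w x <= 1"
 by (simp add: exp_weight_def)

lemma w_continuous: "continuous_on S w"
 unfolding exp_weight_def using alpha_pos by (auto intro!: continuous_intros N_continuous continuous_on_powr')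

lemma w_measurable: "w : borel_measurable borel"
 by (intro borel_measurable_continuous_onI w_continuous)

lemma w_smooth: "msmooth_on A (- {0}) w"
proof -
 have 1: "msmooth_on A (- {0}) (%x. N x powr alpha)"
  by (rule msmooth_real_comp[OF open_punctured N_smooth smooth_on_powr]) auto
 have "msmooth_on A (- {0}) (%x. exp (- (N x powr alpha)))"
  by (rule msmooth_real_comp[OF open_punctured msmooth_minus[OF open_punctured 1] smooth_on_exp]) auto
 thus ?thesis by (simp add: exp_weight_def[abs_def])
qed

lemma w_inverse_bounded: "EX C. ALL x. N x <= R --> 1/w x <= C"
proof -
 have "EX C. ALL x. N x <= R --> norm (1/w x) <= C"
  by (intro continuous_locally_bounded continuous_intros w_continuous) auto
 thus ?thesis by auto
qed

definition drift :: "'e => 'g => real" where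
 "drift v x = X v w x/w x"

lemma drift_eq: "x ~= 0 ==> drift v x = - alpha*N x powr (alpha - 1)*X v N x"
proof -
 assume x: "x ~= 0"
 have p: "((%n. exp (- (n powr alpha))) has_real_derivative exp (- (N x powr alpha))*(- (alpha*N x powr (alpha - 1)))) (at (N x))"
  using x by (auto intro!: derivative_eq_intros)
 have "X v w x = exp (- (N x powr alpha))*(- (alpha*N x powr (alpha - 1)))*X v N x"
  unfolding exp_weight_def[abs_def] by (rule X_real_comp[OF open_punctured N_smooth _ p]) (use x in simp)
 thus ?thesis by (simp add: drift_def exp_weight_def)
qed

lemma drift_measurable: "drift v : borel_measurable borel"
 unfolding drift_def using punctured_measurable[OF msmooth_X[OF open_punctured w_smooth]] w_measurable by measurable

lemma drift_bound: "\<exists>C\<ge>0. ALL v:B. ALL x. x ~= 0 --> \<bar>drift v x\<bar> <= C*N x powr (alpha - 1)"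
proof -
 obtain C where C: "C >= 0 & (ALL v:B. ALL x. x ~= 0 --> \<bar>X v N x\<bar> <= C)" by (rule exE[OF X_N_bounded])
 have "\<bar>drift v x\<bar> <= (alpha*C)*N x powr (alpha - 1)" if "v : B" "x ~= 0" for v x
 proof -
  have "\<bar>drift v x\<bar> = (alpha*N x powr (alpha - 1)) * \<bar>X v N x\<bar>" using that alpha_pos by (simp add: drift_eq abs_mult)
  also have "... <= (alpha*N x powr (alpha - 1))*C" using C that alpha_pos by (intro mult_left_mono) auto
  finally show ?thesis by (simp add: mult_ac)
 qed
 thus ?thesis using C alpha_pos by (intro exI[of _ "alpha*C"]) auto
qed

lemma of_real_measurable: "f : borel_measurable borel ==> (%x. complex_of_real (f x)) : borel_measurable borel"
 by (rule measurable_compose[OF _ borel_measurable_of_real])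

lemma drift_L2loc:
 assumes v: "v : B"
 shows "(%x. complex_of_real (drift v x)) : L2loc"
proof -
 obtain C where C: "C >= 0 & (ALL v:B. ALL x. x ~= 0 --> \<bar>drift v x\<bar> <= C*N x powr (alpha - 1))" by (rule exE[OF drift_bound])
 note m [measurable] = of_real_measurable[OF drift_measurable[of v]]
 have "(%x. complex_of_real (drift v x)*g x) : L2 mu" if g: "g : BC" for g
 proof (rule L2_bounded_nz)
  show "integrable mu (%x. C\<^sup>2*(cmod (complex_of_real (N x powr (alpha - 1))*g x))^2)"
   by (rule integrable_mult_right[OF L2D(2)[OF L2loc_L2[OF N_powr_L2loc[OF alpha_pos] g]]])
  show "(%x. complex_of_real (drift v x)*g x) : borel_measurable borel" using g by measurable
  fix x :: 'g assume "x ~= 0"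
  hence "\<bar>drift v x\<bar>*cmod (g x) <= (C*N x powr (alpha - 1))*cmod (g x)" using C v by (intro mult_right_mono) auto
  hence "(\<bar>drift v x\<bar>*cmod (g x))^2 <= ((C*N x powr (alpha - 1))*cmod (g x))^2" by (intro power_mono) auto
  thus "(cmod (complex_of_real (drift v x)*g x))^2 <= C\<^sup>2*(cmod (complex_of_real (N x powr (alpha - 1))*g x))^2"
   by (simp add: norm_mult power_mult_distrib mult_ac)
 qed
 thus ?thesis using m by (simp add: L2loc_def)
qed

section \<open>The weighted space\<close>

lemma sets_M [measurable_cong, simp]: "sets M = sets borel"
 by (simp add: weighted_def)

lemma borel_M: "borel_measurable M = borel_measurable borel"
 by (rule measurable_cong_sets) simp_all

lemma AE_M: "(AE x in M. P x) \<longleftrightarrow> (AE x in mu. P x)"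
proof -
 have "(%x. ennreal (w x)) : borel_measurable mu" using w_measurable by (simp add: borel_mu)
 from AE_density[OF this, of P] show ?thesis unfolding weighted_def by simp
qed

lemma integrable_M: "f : borel_measurable borel ==> integrable M f \<longleftrightarrow> integrable mu (%x. w x *\<^sub>R f x)"
 and integral_M: "f : borel_measurable borel ==> (LINT x|M. f x) = (LINT x|mu. w x *\<^sub>R f x)"
 for f :: "'g => 'b::{banach, second_countable_topology}"
 unfolding weighted_def using w_measurable by (auto simp: integrable_density integral_density borel_mu)

lemma L2_M_iff: "f : L2 M \<longleftrightarrow> f : borel_measurable borel & integrable mu (%x. w x*(cmod (f x))^2)"
 using integrable_M[of "%x. (cmod (f x))^2"] by (auto simp: L2_def borel_M)

lemma L2_mu_subset_M: "f : L2 mu ==> f : L2 M"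
proof -
 assume f: "f : L2 mu"
 hence [measurable]: "f : borel_measurable borel" by (simp add: L2_def borel_mu)
 have "integrable mu (%x. w x*(cmod (f x))^2)"
  by (rule Bochner_Integration.integrable_bound[OF L2D(2)[OF f]])
   (use w_le_1 w_measurable in \<open>auto simp: abs_mult mult_left_le_one_le\<close>)
 thus ?thesis by (simp add: L2_M_iff)
qed

lemma L2_M_measurable [measurable_dest]: "f : L2 M ==> f : borel_measurable borel"
 by (simp add: L2_M_iff)

lemma L2_M_L2loc: "f : L2 M ==> f : L2loc"
proof -
 assume f: "f : L2 M"
 have "(%x. f x*g x) : L2 mu" if g: "g : BC" for g
 proof -
  obtain C R where C: "!!x. cmod (g x) <= C" and R: "!!x. R < N x ==> g x = 0" using g by (auto simp: BC_def)
  obtain D where D: "!!x. N x <= R ==> 1/w x <= D" using w_inverse_bounded by blast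
  show ?thesis
  proof (rule L2_bounded_nz)
   show "integrable mu (%x. (C\<^sup>2 * \<bar>D\<bar>)*(w x*(cmod (f x))^2))" using f by (intro integrable_mult_right) (simp add: L2_M_iff)
   show "(%x. f x*g x) : borel_measurable borel" using f g by measurable
   show "(cmod (f x*g x))^2 <= (C\<^sup>2 * \<bar>D\<bar>)*(w x*(cmod (f x))^2)" for x
   proof (cases "N x <= R")
    case True
    have "1 <= D*w x" using D[OF True] by (simp add: divide_le_eq)
    also have "... <= \<bar>D\<bar>*w x" by (rule mult_right_mono) simp_all
    finally have "1 <= \<bar>D\<bar>*w x" .
    hence "(cmod (g x))^2*1 <= C\<^sup>2*(\<bar>D\<bar>*w x)" using C[of x] by (intro mult_mono power_mono) auto
    hence "(cmod (f x))^2*((cmod (g x))^2*1) <= (cmod (f x))^2*(C\<^sup>2*(\<bar>D\<bar>*w x))" by (rule mult_left_mono) simp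
    thus ?thesis by (simp add: norm_mult power_mult_distrib mult_ac)
   qed (simp add: R)
  qed
 qed
 thus ?thesis using f by (simp add: L2loc_def L2_M_iff)
qed

lemma L2_inner_M:
 "f : borel_measurable borel ==> g : borel_measurable borel ==>
  L2_inner M f g = (LINT x|mu. of_real (w x)*(f x*cnj (g x)))"
proof -
 assume "f : borel_measurable borel" "g : borel_measurable borel"
 hence "(%x. f x*cnj (g x)) : borel_measurable borel"
  using measurable_compose[OF _ cnj_measurable, of g borel] by (intro borel_measurable_times)
 thus ?thesis by (simp add: L2_inner_def integral_M scaleR_conv_of_real)
qed

lemma TF_L2_M: "f : TF ==> f : L2 M"
 by (intro L2_mu_subset_M BC_L2 TF_BC)

lemma of_real_w_measurable: "(%x. complex_of_real (w x)) : borel_measurable borel"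
 by (rule measurable_compose[OF w_measurable borel_measurable_of_real])

lemma w_mult_L2loc: "f : L2loc ==> (%x. of_real (w x)*f x) : L2loc"
 by (rule L2loc_mult_bounded[OF _ of_real_w_measurable]) (use w_le_1 in \<open>auto intro!: exI[of _ 1]\<close>)

lemma TF_total:
 assumes u: "u : L2 M" and z: "!!f. f : TF ==> L2_inner M f u = 0"
 shows "AE x in M. u x = 0"
proof -
 have "AE x in mu. of_real (w x)*cnj (u x) = 0"
 proof (rule fundamental_lemma)
  show "locally_integrable mu (%x. of_real (w x)*cnj (u x))"
   by (intro L2loc_locally_integrable w_mult_L2loc L2loc_cnj L2_M_L2loc u)
  fix f assume f: "f : TF"
  show "(LINT x|mu. of_real (w x)*cnj (u x)*f x) = 0"
   using z[OF f] L2_inner_M[OF BC_measurable[OF TF_BC[OF f]] L2_M_measurable[OF u]] by (simp add: mult_ac)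
 qed
 thus ?thesis unfolding AE_M by eventually_elim simp
qed

lemma TF_dense:
 assumes "h : L2 M" "e > 0"
 obtains f where "f : TF" "L2_sqnorm M (%x. h x - f x) < e"
proof (rule dense_if_orthogonal_trivial[of TF M h e])
 show "TF <= L2 M" "TF ~= {}" using TF_L2_M TF_zero by auto
 show "(%x. f x + c*g x) : TF" if "f : TF" "g : TF" for f g c using that by (intro TF_add TF_scale)
qed (use TF_total assms that in blast)+

section \<open>Weak derivatives\<close>

abbreviation wderiv :: "'e => ('g => complex) => ('g => complex) => bool" where
 "wderiv == is_weak_deriv A mu"

lemma wderiv_TF: "f : TF ==> wderiv v f (X v f)"
 unfolding is_weak_deriv_def
 by (auto intro!: L2loc_locally_integrable L2_L2loc BC_L2 TF_BC TF_X integration_by_parts TF_smooth)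

lemma locally_integrable_add_scale:
 assumes f: "locally_integrable mu f" and g: "locally_integrable mu g"
 shows "locally_integrable mu (%x. f x + c*g x)"
proof -
 have "set_integrable mu K (%x. f x + c*g x)" if "compact K" for K
 proof -
  have "integrable mu (%x. indicator K x *\<^sub>R f x + c*(indicator K x *\<^sub>R g x))"
   using f g that unfolding locally_integrable_def set_integrable_def
   by (intro Bochner_Integration.integrable_add integrable_mult_right) auto
  thus ?thesis by (simp add: set_integrable_def scaleR_add_right)
 qed
 moreover have "(%x. f x + c*g x) : borel_measurable mu"
  using locally_integrable_measurable[OF f] locally_integrable_measurable[OF g] by measurable
 ultimately show ?thesis by (simp add: locally_integrable_def)
qed

lemma wderiv_iff:
 "f : L2loc ==> h : L2loc ==> wderiv v f h \<longleftrightarrow> (ALL r:TF. pr h r = - pr f (X v r))"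
 by (simp add: is_weak_deriv_def L2loc_locally_integrable)

lemma wderiv_unique:
 assumes h: "wderiv v f h" and k: "wderiv v f k"
 shows "AE x in mu. h x = k x"
proof -
 have l: "locally_integrable mu h" "locally_integrable mu k" using h k by (auto simp: is_weak_deriv_def)
 have "AE x in mu. h x + (- 1) * k x = 0"
 proof (rule fundamental_lemma[OF locally_integrable_add_scale[OF l]])
  fix r assume r: "r : TF"
  have "pr h r = pr k r" using h k r by (simp add: is_weak_deriv_def)
  thus "(LINT x|mu. (h x + (- 1) * k x)*r x) = 0"
   using locally_integrable_BC[OF l(1) TF_BC[OF r]] locally_integrable_BC[OF l(2) TF_BC[OF r]]
   by (simp add: left_diff_distrib)
 qed
 thus ?thesis by eventually_elim simp
qed

lemma inner_limit:
 assumes F: "!!n. F n : L2 M" and f: "f : L2 M" and lim: "(%n. L2_sqnorm M (%x. F n x - f x)) \<longlonglongrightarrow> 0"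
  and g: "g : TF"
 shows "(%n. pr (F n) g) \<longlonglongrightarrow> pr f g"
proof -
 let ?k = "%x. cnj (of_real (1/w x)*g x)"
 have "(%x. complex_of_real (1/w x)) : borel_measurable borel"
  by (intro borel_measurable_continuous_onI continuous_on_of_real continuous_intros w_continuous) auto
 moreover have "EX C. ALL x. N x <= R --> cmod (of_real (1/w x)) <= C" for R using w_inverse_bounded[of R] by (simp add: norm_divide)
 ultimately have "(%x. of_real (1/w x)*g x) : BC" by (rule BC_mult_bounded[OF TF_BC[OF g]])
 hence k: "?k : L2 M" by (intro L2_cnj L2_mu_subset_M BC_L2)
 have *: "pr h g = L2_inner M h ?k" if "h : L2 M" for h
  unfolding L2_inner_M[OF L2_M_measurable[OF that] L2_M_measurable[OF k]] by (simp add: mult_ac)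
 have d: "(%x. F n x - f x) : L2 M" for n by (intro L2_diff F f)
 have "(%n. L2_sqnorm M (%x. F n x - f x)*L2_sqnorm M ?k) \<longlonglongrightarrow> 0" using tendsto_mult_right[OF lim, of "L2_sqnorm M ?k"] by simp
 from tendsto_0_of_square_le[OF L2_Cauchy_Schwarz[OF d k] this]
 have "(%n. L2_inner M (F n) ?k - L2_inner M f ?k) \<longlonglongrightarrow> 0" unfolding L2_inner_diff_left[OF F f k] .
 hence "(%n. L2_inner M (F n) ?k) \<longlonglongrightarrow> L2_inner M f ?k" by (rule LIM_zero_cancel)
 thus ?thesis by (simp add: *[OF F] *[OF f])
qed

section \<open>The self-adjoint operator of the Dirichlet form\<close>

abbreviation Lw :: "(('g => complex) \<times> ('g => complex)) set" where "Lw == weighted_sublaplacian A B mu w"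

text \<open>The Sobolev functions together with a choice of their horizontal derivatives.\<close>

definition sob :: "('g => complex) => ('e => 'g => complex) => bool" where
 "sob f F \<longleftrightarrow> f : L2 M & (ALL v:B. F v : L2 M & wderiv v f (F v))"

abbreviation ipB :: "('e => 'g => complex) => ('e => 'g => complex) => complex" where
 "ipB F G == \<Sum>v\<in>B. L2_inner M (F v) (G v)"

lemma sob_TF: "f : TF ==> sob f (%v. X v f)"
 by (simp add: sob_def TF_L2_M TF_X wderiv_TF)

lemma sob_zero: "sob (%x. 0) (%v x. 0)"
proof -
 have "(%v. X v (%x. 0 :: complex)) = (%v x. 0)" by (simp add: fun_eq_iff)
 thus ?thesis using sob_TF[OF TF_zero] by simp
qed

lemma sob_iff: "sob f F \<longleftrightarrow> f : L2 M & (ALL v:B. F v : L2 M & (ALL r:TF. pr (F v) r = - pr f (X v r)))"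
 unfolding sob_def using wderiv_iff[OF L2_M_L2loc L2_M_L2loc] by blast

lemma pr_add_scale: "f : L2 M ==> g : L2 M ==> r : TF ==> (LINT x|mu. (f x + c*g x)*r x) = pr f r + c*pr g r"
 using L2loc_integrable[OF L2_M_L2loc TF_BC, of f r] L2loc_integrable[OF L2_M_L2loc TF_BC, of g r]
 by (simp add: distrib_right mult.assoc)

lemma sob_add_scale: "sob f F ==> sob g G ==> sob (%x. f x + c*g x) (%v x. F v x + c*G v x)"
 unfolding sob_iff by (auto simp: pr_add_scale TF_X intro!: L2_add_scale)

lemma sob_cong_AE:
 assumes f: "sob f F" and g: "g : L2 M" "AE x in M. g x = f x"
 shows "sob g F"
proof -
 have "pr g (X v r) = pr f (X v r)" if r: "r : TF" for r v
  using g TF_X[OF r, of v] f unfolding AE_M sob_def by (intro integral_cong_AE) (auto simp: borel_mu)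
 thus ?thesis using f g by (simp add: sob_iff)
qed

lemma dirichlet_form_eq:
 assumes "sob f F" "sob g G"
 shows "dirichlet_form A B mu w f g = ipB F G"
 unfolding dirichlet_form_def
proof (intro sum.cong refl)
 have *: "AE x in M. weak_deriv A mu v f x = h x" "weak_deriv A mu v f : borel_measurable M" if h: "wderiv v f h" for v f h
 proof -
  have d: "wderiv v f (weak_deriv A mu v f)" unfolding weak_deriv_def by (rule someI[of "wderiv v f", OF h])
  show "AE x in M. weak_deriv A mu v f x = h x" unfolding AE_M by (rule wderiv_unique[OF d h])
  show "weak_deriv A mu v f : borel_measurable M" using d by (simp add: is_weak_deriv_def locally_integrable_def borel_mu borel_M)
 qed
 fix v assume "v : B"
 hence d: "wderiv v f (F v)" "wderiv v g (G v)" "F v : L2 M" "G v : L2 M" using assms by (auto simp: sob_def)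
 show "L2_inner M (weak_deriv A mu v f) (weak_deriv A mu v g) = L2_inner M (F v) (G v)"
  by (rule L2_inner_cong[OF *(2)[OF d(1)] L2D(1)[OF d(3)] *(2)[OF d(2)] L2D(1)[OF d(4)] *(1)[OF d(1)] *(1)[OF d(2)]])
qed

lemma Lw_iff: "(f, f') : Lw \<longleftrightarrow> f' : L2 M & (EX F. sob f F & (ALL g G. sob g G --> L2_inner M f' g = ipB F G))"
proof -
 have Sob: "f : sobolev A B mu w \<longleftrightarrow> (EX F. sob f F)" for f
  unfolding sobolev_def sob_def Bex_def using bchoice[of B "%v h. h : L2 M & wderiv v f h"] by auto
 have *: "(ALL g. (EX G. sob g G) --> L2_inner M f' g = dirichlet_form A B mu w f g) \<longleftrightarrow> (ALL g G. sob g G --> L2_inner M f' g = ipB F G)"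
  if "sob f F" for F using dirichlet_form_eq[OF that] by metis
 have "(f, f') : Lw \<longleftrightarrow> f' : L2 M & (EX F. sob f F) & (ALL g. (EX G. sob g G) --> L2_inner M f' g = dirichlet_form A B mu w f g)"
  by (auto simp: weighted_sublaplacian_def Sob)
 thus ?thesis using * by blast
qed

lemma Lw_symmetric:
 assumes "(f, f') : Lw" "(g, g') : Lw"
 shows "L2_inner M f' g = L2_inner M f g'"
proof -
 obtain F G where F: "sob f F" "L2_inner M f' g = ipB F G" and G: "L2_inner M g' f = ipB G F"
  using assms unfolding Lw_iff by blast
 have "ipB G F = cnj (ipB F G)" unfolding cnj_sum by (intro sum.cong refl L2_inner_sym)
 thus ?thesis using F G L2_inner_sym[of M f g'] by simp
qed

lemma Lw_operator: "L2_operator M Lw"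
proof -
 have sL: "f : L2 M" if "sob f F" for f F using that by (simp add: sob_def)
 have 0: "((%x. 0), (%x. 0)) : Lw"
  unfolding Lw_iff using sob_zero by (auto intro!: exI[of _ "%v x. 0"] simp: L2_inner_def)
 have lin: "((%x. f x + c*g x), (%x. f' x + c*g' x)) : Lw" if fg: "(f, f') : Lw" "(g, g') : Lw" for f f' g g' c
 proof -
  obtain F where F: "f' : L2 M" "sob f F" "!!k K. sob k K ==> L2_inner M f' k = ipB F K" using fg(1) unfolding Lw_iff by blast
  obtain G where G: "g' : L2 M" "sob g G" "!!k K. sob k K ==> L2_inner M g' k = ipB G K" using fg(2) unfolding Lw_iff by blast
  have "L2_inner M (%x. f' x + c*g' x) k = ipB (%v x. F v x + c*G v x) K" if k: "sob k K" for k K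
  proof -
   have "ipB (%v x. F v x + c*G v x) K = (\<Sum>v\<in>B. L2_inner M (F v) (K v) + c*L2_inner M (G v) (K v))"
    using F(2) G(2) k by (intro sum.cong refl L2_inner_add_left) (auto simp: sob_def)
   thus ?thesis
    unfolding L2_inner_add_left[OF F(1) G(1) sL[OF k]] F(3)[OF k] G(3)[OF k] by (simp add: sum.distrib sum_distrib_left)
  qed
  thus ?thesis unfolding Lw_iff using L2_add_scale[OF F(1) G(1)] sob_add_scale[OF F(2) G(2)] by blast
 qed
 have cl: "(g, g') : Lw" if f: "(f, f') : Lw" and g: "g : L2 M" "g' : L2 M" "AE x in M. g x = f x" "AE x in M. g' x = f' x" for f f' g g'
 proof -
  obtain F where F: "f' : L2 M" "sob f F" "!!k K. sob k K ==> L2_inner M f' k = ipB F K" using f unfolding Lw_iff by blast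
  have "L2_inner M g' k = L2_inner M f' k" if "sob k K" for k K
   using L2D(1)[OF g(2)] L2D(1)[OF F(1)] L2D(1)[OF sL[OF that]] g(4) by (intro L2_inner_cong) auto
  thus ?thesis unfolding Lw_iff using sob_cong_AE[OF F(2) g(1,3)] F(3) g(2) by metis
 qed
 have sv: "AE x in M. f' x = g' x" if fg: "(f, f') : Lw" "(g, g') : Lw" "AE x in M. f x = g x" for f f' g g'
 proof -
  obtain F where F: "f' : L2 M" "sob f F" "!!k K. sob k K ==> L2_inner M f' k = ipB F K" using fg(1) unfolding Lw_iff by blast
  obtain G where G: "g' : L2 M" "sob g G" "!!k K. sob k K ==> L2_inner M g' k = ipB G K" using fg(2) unfolding Lw_iff by blast
  have fG: "sob f G" by (rule sob_cong_AE[OF G(2) sL[OF F(2)] fg(3)])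
  have "AE x in M. f' x - g' x = 0"
  proof (rule TF_total)
   show "(%x. f' x - g' x) : L2 M" by (intro L2_diff F G)
   fix k assume k: "k : TF"
   have "ipB F (%v. X v k) = ipB G (%v. X v k)"
    using dirichlet_form_eq[OF F(2) sob_TF[OF k]] dirichlet_form_eq[OF fG sob_TF[OF k]] by simp
   hence "L2_inner M (%x. f' x - g' x) k = 0"
    unfolding L2_inner_diff_left[OF F(1) G(1) TF_L2_M[OF k]] F(3)[OF sob_TF[OF k]] G(3)[OF sob_TF[OF k]] by simp
   thus "L2_inner M k (%x. f' x - g' x) = 0" by (subst L2_inner_sym) simp
  qed
  thus ?thesis by eventually_elim simp
 qed
 have sub: "Lw <= L2 M \<times> L2 M" using sL by (auto simp: Lw_iff)
 show ?thesis
  unfolding L2_operator_def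
  by (intro conjI sub 0) (use lin cl sv in blast)+
qed

text \<open>
 Solving \<open>f + L f = H\<close> amounts to the projection of \<open>(H, 0)\<close> onto the closed space of all tuples
 consisting of a Sobolev function and its horizontal derivatives.
\<close>

lemma Lw_onto:
 assumes H: "H : L2 M"
 shows "\<exists>(f, f')\<in>Lw. AE x in M. f x + f' x = H x"
proof -
 interpret T: L2_tuples "insert None (Some ` B)" M by unfold_locales (simp add: finite_B)
 define V where "V = {F. sob (F None) (%v. F (Some v))}"
 have VL: "V <= T.L2t" by (auto simp: V_def T.L2t_def sob_def)
 have ip: "T.ip F G = L2_inner M (F None) (G None) + ipB (%v. F (Some v)) (%v. G (Some v))" for F G
  unfolding T.ip_def using finite_B by (subst sum.insert) (auto simp: sum.reindex)
 define H' where "H' = (%i. case i of None => H | Some (v::'e) => (%x. 0))"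
 obtain F P where F: "!!n. F n : V" and P: "P : T.L2t" and lim: "(%n. T.sqn (T.lc (F n) (- 1) P)) \<longlonglongrightarrow> 0"
  and orth: "!!G. G : V ==> T.ip (T.lc H' (- 1) P) G = 0"
 proof (rule T.projection[of V H'])
  have "(%_ _. 0) : V" using sob_zero by (simp add: V_def)
  thus "V ~= {}" by blast
  show "T.lc F c G : V" if "F : V" "G : V" for F G c using that by (simp add: V_def sob_add_scale)
  show "H' : T.L2t" using H by (auto simp: T.L2t_def H'_def)
 qed (use VL in blast)+
 have l: "(%n. pr (F n i) r) \<longlonglongrightarrow> pr (P i) r" if i: "i : insert None (Some ` B)" and r: "r : TF" for i r
 proof (rule inner_limit[OF _ _ tendsto_sandwich[OF _ _ tendsto_const lim] r])
  have "L2_sqnorm M (%x. F n i x - P i x) <= T.sqn (T.lc (F n) (- 1) P)" for n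
   unfolding T.sqn_def using member_le_sum[OF i, of "%i. L2_sqnorm M (%x. F n i x + - 1*P i x)"] finite_B by simp
  thus "\<forall>\<^sub>F n in sequentially. L2_sqnorm M (%x. F n i x - P i x) <= T.sqn (T.lc (F n) (- 1) P)" by simp
  show "F n i : L2 M" "P i : L2 M" for n using F[of n] VL P i by (auto simp: T.L2t_def)
 qed simp
 have "pr (P (Some v)) r = - pr (P None) (X v r)" if v: "v : B" and r: "r : TF" for v r
 proof -
  have "(%n. - pr (F n None) (X v r)) \<longlonglongrightarrow> - pr (P None) (X v r)" by (intro tendsto_minus l TF_X r) simp
  moreover have "pr (F n (Some v)) r = - pr (F n None) (X v r)" for n using F[of n] v r by (simp add: V_def sob_iff)
  ultimately show ?thesis using LIMSEQ_unique[OF l[OF _ r, of "Some v"]] v by simp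
 qed
 hence PV: "sob (P None) (%v. P (Some v))" using P by (simp add: sob_iff T.L2t_def)
 let ?f = "P None" and ?f' = "%x. H x - P None x"
 have "L2_inner M ?f' g = ipB (%v. P (Some v)) G" if g: "sob g G" for g G
 proof -
  have "(%i. case i of None => g | Some v => G v) : V" using g by (simp add: V_def)
  from orth[OF this] have "L2_inner M ?f' g + ipB (%v x. - P (Some v) x) G = 0"
   unfolding ip by (simp add: H'_def)
  thus ?thesis by (simp add: L2_inner_def sum_negf)
 qed
 hence "(?f, ?f') : Lw"
  unfolding Lw_iff using PV by (auto simp: sob_def intro!: L2_diff[OF H])
 thus ?thesis by (intro bexI[of _ "(?f, ?f')"]) auto
qed

section \<open>Test functions are in the domain\<close>

abbreviation T0 :: "(('g => complex) \<times> ('g => complex)) set" where "T0 == minimal_weighted_sublaplacian A B mu w"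
abbreviation L0 :: "('g => complex) => 'g => complex" where "L0 == drift_sublaplacian A B w"

lemma L0_eq: "L0 f x = - (\<Sum>v\<in>B. X v (X v f) x + of_real (drift v x)*X v f x)"
 by (simp add: drift_sublaplacian_def drift_def sum.distrib)

lemma L0_L2:
 assumes f: "f : TF"
 shows "L0 f : L2 M"
proof -
 have t: "(%x. X v (X v f) x + of_real (drift v x)*X v f x) : L2 M" if "v : B" for v
  by (intro L2_add TF_L2_M TF_X f L2_mu_subset_M L2loc_L2 drift_L2loc that TF_BC)
 have "(%x. \<Sum>v\<in>S. X v (X v f) x + of_real (drift v x)*X v f x) : L2 M" if "S <= B" for S
  using finite_subset[OF that finite_B] that
 proof (induction S rule: finite_induct)
  case (insert v S)
  thus ?case using L2_add[OF t insert.IH, of v] by simp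
 qed simp
 from L2_scale[OF this[OF order_refl], of "- 1"] show ?thesis by (simp add: L0_eq[abs_def])
qed

text \<open>
 The weak derivative of a Sobolev function is tested with \<open>w X\<^sub>v f\<close>, which need not be smooth at the
 identity.
\<close>

lemma L0_in_Lw:
 assumes f: "f : TF"
 shows "(f, L0 f) : Lw"
proof -
 let ?h = "%v x. complex_of_real (w x)*X v f x"
 let ?t = "%u v x. of_real (w x)*(X u (X v f) x + of_real (drift u x)*X v f x)"
 have fX: "X v f : TF" for v by (rule TF_X[OF f])
 have sX: "msmooth_on A (- {0}) (X v f)" for v by (rule msmooth_subset[OF TF_smooth[OF fX]]) simp
 have hs: "msmooth_on A (- {0}) (?h v)" for v by (intro msmooth_mult msmooth_of_real w_smooth open_punctured sX)
 have Xh: "X u (?h v) x = ?t u v x" if x: "x ~= 0" for u v x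
 proof -
  have "X u (%x. complex_of_real (w x)) x = of_real (X u w x)" by (rule X_of_real[OF open_punctured w_smooth]) (use x in simp)
  thus ?thesis
   using X_mult[OF open_punctured msmooth_of_real[OF open_punctured w_smooth] sX, of x u v] x by (simp add: drift_def algebra_simps)
 qed
 have tL: "?t u v : L2loc" if u: "u : B" for u v
 proof -
  have "(%x. X u (X v f) x + 1*(of_real (drift u x)*X v f x)) : L2loc"
   by (intro L2loc_add_scale L2loc_mult_BC drift_L2loc u TF_BC TF_X f L2_L2loc BC_L2)
  thus ?thesis by (intro w_mult_L2loc) simp
 qed
 have XhL: "X u (?h v) : L2loc" if "u : B" for u v
  by (rule L2loc_cong_nz[OF tL[OF that] punctured_measurable[OF msmooth_X[OF open_punctured hs]] Xh])
 have "L2_inner M (L0 f) g = ipB (%v. X v f) G" if g: "sob g G" for g G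
 proof -
  have gL: "g : L2 M" "v : B ==> G v : L2 M" "v : B ==> r : TF ==> pr (G v) r = - pr g (X v r)" for v r
   using g by (auto simp: sob_iff)
  let ?g = "%x. cnj (g x)"
  have cg: "?g : L2loc" by (intro L2loc_cnj L2_M_L2loc gL)
  have key: "L2_inner M (X v f) (G v) = - pr ?g (?t v v)" if v: "v : B" for v
  proof -
   obtain C where C: "!!x. cmod (X v f x) <= C" using TF_BC[OF fX[of v]] by (auto simp: BC_def)
   obtain R where R: "!!x. R <= N x ==> X v f x = 0" by (rule TF_support[OF fX[of v]]) blast
   have sum_v: "(\<Sum>u\<in>B. LINT x|mu. (if u = v then ?g x else 0)*X u k x) = pr ?g (X v k)" for k
   proof -
    have "(\<Sum>u\<in>B. LINT x|mu. (if u = v then ?g x else 0)*X u k x) = (\<Sum>u\<in>B. if u = v then pr ?g (X v k) else 0)"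
     by (intro sum.cong refl) auto
    thus ?thesis using v finite_B by simp
   qed
   have "pr (%x. cnj (G v x)) (?h v) + (\<Sum>u\<in>B. LINT x|mu. (if u = v then ?g x else 0)*X u (?h v) x) = 0"
   proof (rule remove_point[of _ _ "?h v" C R])
    show "(%x. cnj (G v x)) : L2loc" by (intro L2loc_cnj L2_M_L2loc gL v)
    show "(%x. if u = v then ?g x else 0) : L2loc" for u using cg L2_L2loc[OF L2_zero] by (cases "u = v") auto
    show "pr (%x. cnj (G v x)) k + (\<Sum>u\<in>B. LINT x|mu. (if u = v then ?g x else 0)*X u k x) = 0" if k: "k : TF" for k
    proof -
     have Xc: "X v (%x. cnj (k x)) x = cnj (X v k x)" for x by (rule X_cnj[OF open_UNIV TF_smooth[OF k]]) simp
     have "cnj (LINT x|mu. G v x*cnj (k x)) = cnj (- (LINT x|mu. g x*cnj (X v k x)))"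
      using gL(3)[OF v TF_cnj[OF k]] by (simp add: Xc)
     thus ?thesis unfolding sum_v by (simp add: Bochner_Integration.integral_cnj[symmetric] del: Bochner_Integration.integral_cnj)
    qed
    show "cmod (?h v x) <= C" for x
     using C[of x] mult_left_le_one_le[of "cmod (X v f x)" "w x"] w_le_1[of x] by (simp add: norm_mult)
    show "?h v x = 0" if "R < N x" for x using R[of x] that by simp
   qed (rule hs, rule XhL)
   moreover have "pr ?g (X v (?h v)) = pr ?g (?t v v)"
    by (rule integral_cong_nz[OF borel_measurable_times[OF L2loc_measurable[OF cg] L2loc_measurable[OF XhL[OF v]]]
     borel_measurable_times[OF L2loc_measurable[OF cg] L2loc_measurable[OF tL[OF v]]]]) (simp only: Xh not_False_eq_True)
   moreover have "L2_inner M (X v f) (G v) = pr (%x. cnj (G v x)) (?h v)"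
    using L2_inner_M[OF TF_measurable[OF fX] L2_M_measurable[OF gL(2)[OF v]]] by (simp add: mult_ac)
   ultimately show ?thesis by (simp add: sum_v eq_neg_iff_add_eq_0)
  qed
  have ti: "integrable mu (%x. ?g x*?t v v x)" if v: "v : B" for v
  proof -
   obtain R where R: "!!x. R <= N x ==> X v f x = 0" by (rule TF_support[OF fX[of v]]) blast
   show ?thesis by (rule L2loc_product_integrable[OF cg tL[OF v], of R]) (simp add: R X_zero_outside[of R])
  qed
  have "L2_inner M (L0 f) g = (LINT x|mu. - (\<Sum>v\<in>B. ?g x*?t v v x))"
   unfolding L2_inner_M[OF L2_M_measurable[OF L0_L2[OF f]] L2_M_measurable[OF gL(1)]] L0_eq
   by (intro Bochner_Integration.integral_cong refl) (simp add: sum_distrib_left sum_distrib_right mult_ac)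
  also have "... = - (\<Sum>v\<in>B. pr ?g (?t v v))" using ti by simp
  finally show ?thesis by (simp add: key sum_negf)
 qed
 thus ?thesis unfolding Lw_iff using L0_L2[OF f] sob_TF[OF f] by blast
qed

lemma T0_subset: "T0 <= Lw"
proof
 fix p assume "p : T0"
 then obtain f f' k where p: "p = (f, f')" "f : borel_measurable M" "f' : borel_measurable M" "k : TF"
  "AE x in M. f x = k x" "AE x in M. f' x = L0 k x"
  unfolding minimal_weighted_sublaplacian_def by blast
 have L: "f : L2 M" "f' : L2 M"
  using L2_cong_AE[OF TF_L2_M[OF p(4)] p(2,5)] L2_cong_AE[OF L0_L2[OF p(4)] p(3,6)] .
 have "\<forall>(f, f')\<in>Lw. ALL g:L2 M. ALL g':L2 M. (AE x in M. g x = f x) & (AE x in M. g' x = f' x) --> (g, g') : Lw"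
  using Lw_operator unfolding L2_operator_def by blast
 from bspec[OF this L0_in_Lw[OF p(4)]] show "p : Lw" using p L by auto
qed

lemma T0_member:
 assumes f: "f : TF"
 shows "(f, L0 f) : T0"
 unfolding minimal_weighted_sublaplacian_def
 using L2D(1)[OF TF_L2_M[OF f]] L2D(1)[OF L0_L2[OF f]] f by auto

lemma Lw_self_adjoint: "self_adjoint M Lw"
proof (rule self_adjoint_of_resolvent[OF Lw_operator _ Lw_symmetric Lw_onto])
 show "densely_defined M Lw"
  unfolding densely_defined_def
 proof (intro ballI allI impI)
  fix h eps assume h: "h : L2 M" and e: "eps > (0::real)"
  obtain f where f: "f : TF" "L2_sqnorm M (%x. h x - f x) < eps\<^sup>2" using TF_dense[OF h, of "eps\<^sup>2"] e by auto
  have "sqrt (LINT x|M. (cmod (h x - f x))^2) < sqrt (eps\<^sup>2)" using f(2) unfolding L2_sqnorm_def by (rule real_sqrt_less_mono)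
  thus "EX f:Domain Lw. sqrt (LINT x|M. (cmod (h x - f x))^2) < eps"
   using e L0_in_Lw[OF f(1)] by (intro bexI[of _ f]) auto
 qed
qed

lemma Lw_extension: "self_adjoint_extension M T0 Lw"
 using Lw_self_adjoint T0_subset by (simp add: self_adjoint_extension_def)

end

section \<open>Smooth kernels\<close>

text \<open>
 Differentiation under the integral sign: the error term of the derivative of the kernel is uniform
 on compact sets.
\<close>

lemma integral_kernel_has_derivative:
 fixes k :: "'a::euclidean_space \<times> 'b::euclidean_space => real" and u :: "'x::topological_space => 'c::{banach, second_countable_topology}"
 assumes S: "open S" "open T" and k: "smooth_on (S \<times> T) k" and M: "sets M = sets borel" and u: "integrable M u"
  and Z: "closed Z" "!!z. z ~: Z ==> u z = 0" and eta: "continuous_on Z eta" "eta ` Z <= K" and K: "compact K" "K <= T"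
  and a: "a : S"
 shows "((%a. LINT z|M. k (a, eta z) *\<^sub>R u z) has_derivative
   (%h. LINT z|M. frechet_derivative k (at (a, eta z)) (h, 0) *\<^sub>R u z)) (at a)"
proof -
 let ?D = "%h p. frechet_derivative k (at p) (h, 0 :: 'b)"
 have um: "u : borel_measurable borel" using borel_measurable_integrable[OF u] by (simp add: measurable_cong_sets[OF M refl])
 have int: "integrable M (%z. g (x, eta z) *\<^sub>R u z)" if g: "smooth_on (S \<times> T) g" and x: "x : S" for g x
 proof -
  have cont: "continuous_on K (%b. g (x, b))"
   by (rule continuous_on_compose2[OF smooth_on_continuous[OF g]]) (use x K in \<open>auto intro!: continuous_intros\<close>)
  hence "bounded ((%b. g (x, b)) ` K)" by (intro compact_imp_bounded compact_continuous_image K)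
  then obtain C where C: "!!b. b : K ==> \<bar>g (x, b)\<bar> <= C" unfolding bounded_iff by auto
  have "continuous_on Z (%z. g (x, eta z))" by (rule continuous_on_compose2[OF cont eta])
  hence "(%z. indicator Z z *\<^sub>R g (x, eta z)) : borel_measurable borel"
   by (intro borel_measurable_continuous_on_indicator borel_closed Z)
  hence "(%z. (indicator Z z *\<^sub>R g (x, eta z)) *\<^sub>R u z) : borel_measurable borel" using um by measurable
  moreover have "(%z. (indicator Z z *\<^sub>R g (x, eta z)) *\<^sub>R u z) = (%z. g (x, eta z) *\<^sub>R u z)"
   using Z(2) by (intro ext) (auto simp: indicator_def)
  ultimately have m: "(%z. g (x, eta z) *\<^sub>R u z) : borel_measurable M" by (simp only: measurable_cong_sets[OF M refl])
  show ?thesis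
  proof (rule Bochner_Integration.integrable_bound[OF _ m])
   show "integrable M (%z. \<bar>C\<bar>*norm (u z))" using u by simp
   have "norm (g (x, eta z) *\<^sub>R u z) <= norm (\<bar>C\<bar>*norm (u z))" for z
   proof (cases "z : Z")
    case True
    hence "\<bar>g (x, eta z)\<bar> <= \<bar>C\<bar>" using C[of "eta z"] eta(2) by (meson abs_ge_self image_subset_iff order_trans)
    thus ?thesis by (simp add: abs_mult mult_right_mono)
   qed (simp add: Z)
   thus "AE z in M. norm (g (x, eta z) *\<^sub>R u z) <= norm (\<bar>C\<bar>*norm (u z))" by simp
  qed
 qed
 have ST: "open (S \<times> T)" by (intro open_Times S)
 have Ds: "smooth_on (S \<times> T) (?D h)" for h by (rule smooth_on_derivative[OF k])
 have kd: "(k has_derivative frechet_derivative k (at (x, b))) (at (x, b))" if "x : S" "b : T" for x b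
  by (rule smooth_on_has_derivative[OF k]) (use that in auto)
 have lin: "linear (%h. ?D h (x, b))" if "x : S" "b : T" for x b
 proof -
  have "linear (%h :: 'a. (h, 0 :: 'b))" by (auto intro!: linearI)
  from linear_compose[OF this has_derivative_linear[OF kd[OF that]]] show ?thesis by (simp add: o_def)
 qed
 have linV: "linear (%h. LINT z|M. ?D h (a, eta z) *\<^sub>R u z)"
 proof -
  have eqs: "?D (h + h') (a, eta z) *\<^sub>R u z = ?D h (a, eta z) *\<^sub>R u z + ?D h' (a, eta z) *\<^sub>R u z"
   "?D (c *\<^sub>R h) (a, eta z) *\<^sub>R u z = c *\<^sub>R (?D h (a, eta z) *\<^sub>R u z)" for h h' c z
  proof -
   have "u z = 0 | eta z : T" using Z(2)[of z] eta(2) K(2) by blast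
   thus "?D (h + h') (a, eta z) *\<^sub>R u z = ?D h (a, eta z) *\<^sub>R u z + ?D h' (a, eta z) *\<^sub>R u z"
    "?D (c *\<^sub>R h) (a, eta z) *\<^sub>R u z = c *\<^sub>R (?D h (a, eta z) *\<^sub>R u z)"
    using linear_add[OF lin[OF a], of "eta z" h h'] linear_scale[OF lin[OF a], of "eta z" c h]
    by (auto simp: scaleR_add_left)
  qed
  show ?thesis
   by (rule linearI) (simp_all only: eqs Bochner_Integration.integral_add[OF int[OF Ds a] int[OF Ds a]] Bochner_Integration.integral_scaleR_right)
 qed
 show ?thesis
  unfolding has_derivative_at_alt
 proof (intro conjI allI impI)
  show "bounded_linear (%h. LINT z|M. ?D h (a, eta z) *\<^sub>R u z)" using linV by (simp add: linear_conv_bounded_linear)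
  fix e :: real assume e: "0 < e"
  define I where "I = (LINT z|M. norm (u z))"
  have I: "0 <= I" by (simp add: I_def)
  define c where "c = e/((I + 1)*DIM('a))"
  have c: "c > 0" using e I by (simp add: c_def add_nonneg_pos)
  obtain r where r: "r > 0" "cball a r <= S" using S(1) a open_contains_cball by blast
  have sub: "cball a r \<times> K <= S \<times> T" using r K by auto
  have comp: "compact (cball a r \<times> K)" by (intro compact_Times compact_cball K)
  have "\<exists>d>0. ALL x:ball a d. ALL b:K. \<bar>?D i (x, b) - ?D i (a, b)\<bar> <= c" if "i : Basis" for i
  proof -
   have "uniformly_continuous_on (cball a r \<times> K) (?D i)"
    by (rule compact_uniformly_continuous[OF continuous_on_subset[OF smooth_on_continuous[OF Ds] sub] comp])
   then obtain d where d: "d > 0" "!!p q. p : cball a r \<times> K ==> q : cball a r \<times> K ==> dist q p < d ==> dist (?D i q) (?D i p) < c"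
    unfolding uniformly_continuous_on_def using c by metis
   have "\<bar>?D i (x, b) - ?D i (a, b)\<bar> <= c" if "x : ball a (min d r)" "b : K" for x b
    using d(2)[of "(a, b)" "(x, b)"] that r by (auto simp: dist_Pair_Pair dist_real_def dist_commute)
   thus ?thesis using d r by (intro exI[of _ "min d r"]) auto
  qed
  then obtain d where d: "!!i. i : Basis ==> d i > 0"
   "!!i x b. i : Basis ==> x : ball a (d i) ==> b : K ==> \<bar>?D i (x, b) - ?D i (a, b)\<bar> <= c" by metis
  define d' where "d' = min r (Min (d ` Basis))"
  have d': "d' > 0" "d' <= r" "!!i. i : Basis ==> d' <= d i" unfolding d'_def using d(1) r by (auto simp: min_le_iff_disj)
  have est: "\<bar>k (y, b) - k (a, b) - ?D (y - a) (a, b)\<bar> <= (DIM('a)*c)*norm (y - a)" if y: "norm (y - a) < d'" and b: "b : K" for y b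
  proof -
   have bT: "b : T" using b K by blast
   have xS: "x : S" if "x : ball a d'" for x using that d'(2) r(2) by auto
   let ?g = "%x. k (x, b) - ?D x (a, b)"
   have gd: "(?g has_derivative (%h. ?D h (x, b) - ?D h (a, b))) (at x within ball a d')" if x: "x : ball a d'" for x
   proof (rule has_derivative_diff)
    have "((%x. (x, b)) has_derivative (%h. (h, 0))) (at x within ball a d')" by (auto intro!: derivative_eq_intros)
    from has_derivative_compose[OF this kd[OF xS[OF x] bT]]
    show "((%x. k (x, b)) has_derivative (%h. ?D h (x, b))) (at x within ball a d')" .
    show "((%x. ?D x (a, b)) has_derivative (%h. ?D h (a, b))) (at x within ball a d')"
     using lin[OF a bT] by (intro bounded_linear_imp_has_derivative) (simp add: linear_conv_bounded_linear)
   qed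
   have on: "onorm (%h. ?D h (x, b) - ?D h (a, b)) <= DIM('a)*c" if x: "x : ball a d'" for x
   proof (rule onorm_le)
    fix h :: 'a
    have l: "linear (%h. ?D h (x, b) - ?D h (a, b))" by (intro linear_compose_sub lin a xS x bT)
    have "?D h (x, b) - ?D h (a, b) = (\<Sum>i\<in>Basis. (h \<bullet> i)*(?D i (x, b) - ?D i (a, b)))"
    proof -
     have "(%h. ?D h (x, b) - ?D h (a, b)) h = (%h. ?D h (x, b) - ?D h (a, b)) (\<Sum>i\<in>Basis. (h \<bullet> i) *\<^sub>R i)"
      by (simp only: euclidean_representation)
     thus ?thesis unfolding linear_sum[OF l] linear_scale[OF l] by simp
    qed
    also have "norm ... <= (\<Sum>i\<in>(Basis :: 'a set). norm h*c)"
    proof (rule order_trans[OF norm_sum sum_mono])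
     fix i :: 'a assume i: "i : Basis"
     have "\<bar>?D i (x, b) - ?D i (a, b)\<bar> <= c" by (rule d(2)[OF i _ b]) (use x d'(3)[OF i] in auto)
     thus "norm ((h \<bullet> i)*(?D i (x, b) - ?D i (a, b))) <= norm h*c"
      using Basis_le_norm[OF i, of h] unfolding real_norm_def abs_mult by (intro mult_mono) auto
    qed
    finally show "norm (?D h (x, b) - ?D h (a, b)) <= DIM('a)*c*norm h" by (simp add: mult_ac)
   qed
   have "norm (?g y - ?g a) <= (DIM('a)*c)*norm (y - a)"
    by (rule differentiable_bound[OF convex_ball gd on]) (use y d' in \<open>auto simp: dist_norm norm_minus_commute\<close>)
   moreover have "?D y (a, b) - ?D a (a, b) = ?D (y - a) (a, b)" using linear_diff[OF lin[OF a bT]] by simp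
   ultimately show ?thesis by (simp add: algebra_simps)
  qed
  show "\<exists>d>0. ALL y. norm (y - a) < d -->
    norm ((LINT z|M. k (y, eta z) *\<^sub>R u z) - (LINT z|M. k (a, eta z) *\<^sub>R u z) - (LINT z|M. ?D (y - a) (a, eta z) *\<^sub>R u z)) <= e*norm (y - a)"
  proof (intro exI[of _ d'] conjI allI impI d')
   fix y assume y: "norm (y - a) < d'"
   have yS: "y : S" using y d'(2) r(2) by (auto simp: dist_norm norm_minus_commute subset_iff)
   have i: "integrable M (%z. k (y, eta z) *\<^sub>R u z)" "integrable M (%z. k (a, eta z) *\<^sub>R u z)" "integrable M (%z. ?D (y - a) (a, eta z) *\<^sub>R u z)"
    by (intro int k Ds a yS)+
   have "(LINT z|M. k (y, eta z) *\<^sub>R u z) - (LINT z|M. k (a, eta z) *\<^sub>R u z) - (LINT z|M. ?D (y - a) (a, eta z) *\<^sub>R u z)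
     = (LINT z|M. (k (y, eta z) - k (a, eta z) - ?D (y - a) (a, eta z)) *\<^sub>R u z)"
    using i by (simp add: scaleR_diff_left)
   also have "norm ... <= (LINT z|M. (DIM('a)*c)*norm (y - a)*norm (u z))"
   proof (rule order_trans[OF Bochner_Integration.integral_norm_bound integral_mono])
    show "integrable M (%z. norm ((k (y, eta z) - k (a, eta z) - ?D (y - a) (a, eta z)) *\<^sub>R u z))"
     unfolding scaleR_diff_left by (intro integrable_norm Bochner_Integration.integrable_diff i)
    show "integrable M (%z. (DIM('a)*c)*norm (y - a)*norm (u z))" using u by simp
    fix z
    show "norm ((k (y, eta z) - k (a, eta z) - ?D (y - a) (a, eta z)) *\<^sub>R u z) <= (DIM('a)*c)*norm (y - a)*norm (u z)"
    proof (cases "z : Z")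
     case True
     hence "eta z : K" using eta by blast
     from est[OF y this] show ?thesis by (simp add: mult_right_mono)
    qed (simp add: Z)
   qed
   also have "... = (DIM('a)*c*I)*norm (y - a)" by (simp add: I_def)
   also have "... <= e*norm (y - a)"
   proof (rule mult_right_mono)
    have "n*(e/((I + 1)*n))*I = e*(I/(I + 1))" if "n ~= 0" for n :: real using that by simp
    from this[of "real DIM('a)"] have "DIM('a)*c*I = e*(I/(I + 1))" by (simp add: c_def)
    also have "... <= e*1" using e I by (intro mult_left_mono) auto
    finally show "DIM('a)*c*I <= e" by simp
   qed simp
   finally show "norm ((LINT z|M. k (y, eta z) *\<^sub>R u z) - (LINT z|M. k (a, eta z) *\<^sub>R u z) - (LINT z|M. ?D (y - a) (a, eta z) *\<^sub>R u z)) <= e*norm (y - a)" .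
  qed
 qed
qed

lemma smooth_integral_kernel:
 fixes k :: "'a::euclidean_space \<times> 'b::euclidean_space => real" and u :: "'x::topological_space => 'c::{banach, second_countable_topology}"
 assumes S: "open S" "open T" and k: "smooth_on (S \<times> T) k" and M: "sets M = sets borel" and u: "integrable M u"
  and Z: "closed Z" "!!z. z ~: Z ==> u z = 0" and eta: "continuous_on Z eta" "eta ` Z <= K" and K: "compact K" "K <= T"
 shows "smooth_on S (%a. LINT z|M. k (a, eta z) *\<^sub>R u z)"
proof -
 have "ck_on n S (%a. LINT z|M. k (a, eta z) *\<^sub>R u z)" for n
  using k
 proof (induction n arbitrary: k)
  case (0 k)
  have d: "((%a. LINT z|M. k (a, eta z) *\<^sub>R u z) has_derivative
   (%h. LINT z|M. frechet_derivative k (at (a, eta z)) (h, 0) *\<^sub>R u z)) (at a)" if "a : S" for a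
   by (rule integral_kernel_has_derivative[OF S 0 M u Z(1) _ eta K that]) (rule Z(2))
  have "continuous_on S (%a. LINT z|M. k (a, eta z) *\<^sub>R u z)"
   by (intro continuous_at_imp_continuous_on ballI) (rule has_derivative_continuous[OF d])
  thus ?case by simp
 next
  case (Suc n k)
  have d: "((%a. LINT z|M. k (a, eta z) *\<^sub>R u z) has_derivative
   (%h. LINT z|M. frechet_derivative k (at (a, eta z)) (h, 0) *\<^sub>R u z)) (at a)" if "a : S" for a
   by (rule integral_kernel_has_derivative[OF S Suc.prems M u Z(1) _ eta K that]) (rule Z(2))
  have "ck_on n S (%a. frechet_derivative (%a. LINT z|M. k (a, eta z) *\<^sub>R u z) (at a) v)" for v
  proof (rule ck_on_cong[OF S(1)])
   show "ck_on n S (%a. LINT z|M. frechet_derivative k (at (a, eta z)) (v, 0) *\<^sub>R u z)"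
    by (rule Suc.IH[OF smooth_on_derivative[OF Suc.prems]])
   show "(LINT z|M. frechet_derivative k (at (a, eta z)) (v, 0) *\<^sub>R u z) = frechet_derivative (%a. LINT z|M. k (a, eta z) *\<^sub>R u z) (at a) v"
    if "a : S" for a unfolding frechet_derivative_at[OF d[OF that], symmetric] ..
  qed
  moreover have "(%a. LINT z|M. k (a, eta z) *\<^sub>R u z) differentiable (at a)" if "a : S" for a
   using d[OF that] differentiable_def by blast
  ultimately show ?case by simp
 qed
 thus ?thesis by (simp add: smooth_on_def)
qed

context carnot
begin

section \<open>Convolution\<close>

definition conv :: "('g => real) => ('g => complex) => 'g => complex" where
 "conv r f x = (LINT z|mu. r (x - z) *\<^sub>R f z)"

lemma distr_reflect: "distr mu borel (%y. - y + x) = mu"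
proof -
 have 1: "(%y. y + x) : measurable borel borel" "uminus : measurable mu borel"
  by (intro measurable_haar_cont haar borel_measurable_continuous_onI continuous_intros)+
 have "distr (distr mu borel uminus) borel (%y. y + x) = distr mu borel ((%y. y + x) \<circ> uminus)"
  by (rule distr_distr[OF 1])
 thus ?thesis by (simp add: mu_distr_uminus mu_distr_right o_def)
qed

lemma reflect_measurable: "(%y. - y + x) : measurable mu borel"
 by (intro measurable_haar_cont haar continuous_intros)

lemma left_measurable: "(%x. y + x) : measurable mu borel"
 by (intro measurable_haar_cont haar continuous_intros)

lemma L2_invariant:
 assumes T: "distr mu borel T = mu" "T : measurable mu borel" and f: "f : L2 mu"
 shows "(%x. f (T x)) : L2 mu" "nrm (%x. f (T x)) = nrm f"
proof -
 have m: "f : borel_measurable borel" using L2D(1)[OF f] by (simp add: borel_mu)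
 hence q: "(%z. (cmod (f z))^2) : borel_measurable borel" by measurable
 have "integrable (distr mu borel T) (%z. (cmod (f z))^2)" using L2D(2)[OF f] by (simp only: T(1))
 hence "integrable mu (%x. (cmod (f (T x)))^2)" by (rule integrable_distr[OF T(2)])
 thus "(%x. f (T x)) : L2 mu" using measurable_compose[OF T(2) m] by (simp add: L2_def)
 show "nrm (%x. f (T x)) = nrm f" using integral_distr[OF T(2) q] by (simp add: T(1) L2_sqnorm_def)
qed

lemmas L2_reflect = L2_invariant[OF distr_reflect reflect_measurable]
 and L2_left = L2_invariant[OF mu_distr_left left_measurable]

lemma conv_eq:
 assumes r: "r : borel_measurable borel" and f: "f : borel_measurable borel"
 shows "conv r f x = (LINT y|mu. r y *\<^sub>R f (- y + x))"
proof -
 have "(%z. x - z) : measurable borel borel" by (intro borel_measurable_continuous_onI continuous_intros)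
 hence m: "(%z. r (x - z) *\<^sub>R f z) : borel_measurable borel"
  using r f by (intro borel_measurable_scaleR) (auto intro: measurable_compose)
 have "(LINT z|distr mu borel (%y. - y + x). r (x - z) *\<^sub>R f z) = (LINT y|mu. r (x - (- y + x)) *\<^sub>R f (- y + x))"
  by (rule integral_distr[OF reflect_measurable m])
 moreover have "x - (- y + x) = y" for y by (simp add: diff_conv_add_uminus minus_add add.assoc[symmetric] del: add_uminus_conv_diff)
 ultimately show ?thesis by (simp add: distr_reflect conv_def)
qed

text \<open>Kernels whose convolutions are smooth: they live in a fixed neighbourhood of the identity.\<close>

lemma conv_smooth:
 obtains W where "open W" "0 : W"
  "!!r f. msmooth_on A UNIV r ==> (!!x. x ~: W ==> r x = 0) ==> f : L2 mu ==> msmooth_on A UNIV (conv r f)"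
proof -
 have oU: "open (phi ` chU)" by (intro chart_image_open[OF id_chart_in(1) open_UNIV, simplified])
 obtain s where s: "s > 0" "cball p0 s <= phi ` chU" using oU p0(1) open_contains_cball by blast
 define Q where "Q = psi ` cball p0 s"
 have psic: "continuous_on (cball p0 s) psi" by (rule continuous_on_subset[OF gsmoothD(2)[OF gsmooth_psi] s(2)])
 have Q: "compact Q" unfolding Q_def by (rule compact_continuous_image[OF psic compact_cball])
 have phipsi: "a : phi ` chU ==> phi (psi a) = a" and psiU: "a : phi ` chU ==> psi a : chU" and psiphi: "x : chU ==> psi (phi x) = x" for a x
  using idc by auto
 have QU: "Q <= chU" unfolding Q_def using s(2) psiU by blast
 have phic: "continuous_on chU phi" using idc by (auto simp: is_chart_def homeomorphism_def)
 define Q0 where "Q0 = chU Int phi -` ball p0 s"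
 have Q0: "open Q0" "0 : Q0" "Q0 <= Q"
 proof -
  show "open Q0" unfolding Q0_def using phic idc by (intro continuous_open_preimage) auto
  show "0 : Q0" using id_chart_in(2) s(1) by (simp add: Q0_def)
  show "Q0 <= Q"
  proof
   fix x assume "x : Q0"
   hence "x = psi (phi x)" "phi x : cball p0 s" using psiphi by (auto simp: Q0_def)
   thus "x : Q" unfolding Q_def by blast
  qed
 qed
 let ?m = "%p :: 'g \<times> 'g. - fst p + snd p"
 have "open (?m -` Q0)" by (intro open_vimage Q0 continuous_intros)
 moreover have "(0, 0) : ?m -` Q0" using Q0 by simp
 ultimately obtain W P where WP: "open W" "open P" "0 : W" "0 : P" "W \<times> P <= ?m -` Q0"
  by (rule open_prod_elim) auto
 show ?thesis
 proof (rule that[OF WP(1,3)])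
  fix r :: "'g => real" and f :: "'g => complex"
  assume r: "msmooth_on A UNIV r" "!!x. x ~: W ==> r x = 0" and f: "f : L2 mu"
  show "msmooth_on A UNIV (conv r f)"
  proof (rule msmooth_locally)
   fix x0 :: 'g
   define Z where "Z = {z. z - x0 : Q}"
   have Z: "closed Z" unfolding Z_def
    using continuous_closed_vimage[of Q "%z. z - x0"] compact_imp_closed[OF Q]
    by (simp add: vimage_def continuous_on_eq_continuous_at[symmetric] continuous_intros)
   have Zc: "compact Z"
   proof -
    have "compact ((%q. q + x0) ` Q)" by (intro compact_continuous_image continuous_intros Q)
    moreover have "Z = (%q. q + x0) ` Q" unfolding Z_def by (auto intro!: image_eqI[of _ _ "_ - x0"])
    ultimately show ?thesis by simp
   qed
   define u where "u = (%z. indicator Z z *\<^sub>R f z)"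
   have u: "integrable mu u"
   proof -
    have "integrable mu (%z. f z*indicator Z z)" by (rule L2loc_integrable[OF L2_L2loc[OF f] BC_indicator_compact[OF Zc]])
    moreover have "f z*indicator Z z = u z" for z by (simp add: u_def indicator_def)
    ultimately show ?thesis by simp
   qed
   define S where "S = {a : phi ` chU. psi a : P}"
   have S: "open S" unfolding S_def using preimage_open[OF oU gsmoothD(2)[OF gsmooth_psi] WP(2)] .
   define eta where "eta = (%z. phi (z - x0))"
   let ?k = "%p. r (psi (fst p) - psi (snd p))"
   have "gsmooth (phi ` chU \<times> phi ` chU) (%p. psi (fst p) + - psi (snd p))"
    by (intro gsmooth_add gsmooth_uminus gsmooth_fst gsmooth_snd gsmooth_psi oU)
   from msmooth_compose[OF r(1) open_UNIV this] have ks: "smooth_on (phi ` chU \<times> phi ` chU) ?k" by simp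
   have sm: "smooth_on S (%a. LINT z|mu. ?k (a, eta z) *\<^sub>R u z)"
   proof (rule smooth_integral_kernel[OF S oU _ sets_mu u Z])
    show "smooth_on (S \<times> phi ` chU) ?k" by (rule smooth_on_subset[OF ks]) (auto simp: S_def)
    show "u z = 0" if "z ~: Z" for z using that by (simp add: u_def)
    show "continuous_on Z eta" unfolding eta_def
     by (rule continuous_on_compose2[OF phic]) (use QU in \<open>auto simp: Z_def intro!: continuous_intros\<close>)
    show "eta ` Z <= cball p0 s" unfolding eta_def Z_def Q_def using phipsi s(2) by (auto simp: subset_iff)
    show "compact (cball p0 s)" "cball p0 s <= phi ` chU" using s by auto
   qed
   have eq: "conv r f (psi a + x0) = (LINT z|mu. ?k (a, eta z) *\<^sub>R u z)" if a: "a : S" for a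
    unfolding conv_def
   proof (rule Bochner_Integration.integral_cong[OF refl])
    fix z
    show "r (psi a + x0 - z) *\<^sub>R f z = ?k (a, eta z) *\<^sub>R u z"
    proof (cases "z : Z")
     case True
     hence "psi (eta z) = z - x0" using QU psiphi by (auto simp: Z_def eta_def)
     hence "psi a + x0 - z = psi a - psi (eta z)" by (simp add: diff_conv_add_uminus minus_add add.assoc del: add_uminus_conv_diff)
     thus ?thesis using True by (simp add: u_def)
    next
     case False
     have "r (psi a + x0 - z) = 0"
     proof (rule r(2), rule notI)
      assume "psi a + x0 - z : W"
      hence "?m (psi a + x0 - z, psi a) : Q0" using WP(5) a by (auto simp: S_def)
      moreover have "?m (psi a + x0 - z, psi a) = z - x0"
       by (simp add: diff_conv_add_uminus minus_add add.assoc del: add_uminus_conv_diff)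
      ultimately show False using False Q0(3) by (auto simp: Z_def)
     qed
     thus ?thesis using False by (simp add: u_def)
    qed
   qed
   define P' where "P' = {x. x - x0 : chU Int P}"
   have c0: "continuous_on UNIV (%x. x - x0)" by (intro continuous_intros)
   have P': "open P'" unfolding P'_def
    using preimage_open[OF open_UNIV c0 open_Int[OF idc(1) WP(2)]] by simp
   have x0: "x0 : P'" using id_chart_in(2) WP(4) by (simp add: P'_def)
   have "smooth_on (\<theta> ` (V Int P')) (%c. conv r f (inv_into V \<theta> c))" if c: "(V, \<theta>) : A" for V \<theta>
   proof -
    let ?S = "\<theta> ` (V Int P')"
    have oS: "open ?S" by (rule chart_image_open[OF c P'])
    have "gsmooth ?S (%a. inv_into V \<theta> a)"
     by (rule gsmooth_compose[OF gsmooth_chart[OF c] oS smooth_on_id[OF oS]]) auto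
    hence g: "gsmooth ?S (%a. inv_into V \<theta> a + - x0)" by (intro gsmooth_add gsmooth_const oS)
    have inP: "inv_into V \<theta> a + - x0 : chU Int P" if "a : ?S" for a
     using that by (auto simp: chartD(5)[OF c] P'_def)
    have "{a : ?S. inv_into V \<theta> a + - x0 : chU} = ?S" using inP by blast
    hence phis: "smooth_on ?S (%a. phi (inv_into V \<theta> a + - x0))" using gsmoothD(3)[OF g id_chart_in(1)] by simp
    have "smooth_on ?S (%a. LINT z|mu. ?k (phi (inv_into V \<theta> a + - x0), eta z) *\<^sub>R u z)"
     by (rule smooth_on_compose[OF oS sm phis]) (use inP psiphi in \<open>auto simp: S_def\<close>)
    thus ?thesis
    proof (rule smooth_on_cong[OF oS, rotated])
     fix a assume a: "a : ?S"
     have "phi (inv_into V \<theta> a + - x0) : S" using inP[OF a] psiphi by (auto simp: S_def)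
     from eq[OF this] show "(LINT z|mu. ?k (phi (inv_into V \<theta> a + - x0), eta z) *\<^sub>R u z) = conv r f (inv_into V \<theta> a)"
      using inP[OF a] psiphi by (simp add: add.assoc)
    qed
   qed
   hence "msmooth_on A P' (conv r f)" by (rule msmoothI)
   thus "EX P. open P & x0 : P & msmooth_on A P (conv r f)" using P' x0 by blast
  qed
 qed
qed

end

context carnot
begin

lemma TF_dense_L2:
 assumes "h : L2 mu" "e > 0"
 obtains f where "f : TF" "nrm (%x. h x - f x) < e"
proof (rule dense_if_orthogonal_trivial[of TF mu h e])
 show "TF <= L2 mu" "TF ~= {}" using BC_L2 TF_BC TF_zero by auto
 show "(%x. f x + c*g x) : TF" if "f : TF" "g : TF" for f g c using that by (intro TF_add TF_scale)
 show "AE x in mu. u x = 0" if u: "u : L2 mu" and z: "!!f. f : TF ==> L2_inner mu f u = 0" for u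
 proof -
  have "AE x in mu. cnj (u x) = 0"
  proof (rule fundamental_lemma)
   show "locally_integrable mu (%x. cnj (u x))" by (intro L2loc_locally_integrable L2_L2loc L2_cnj u)
   show "(LINT x|mu. cnj (u x)*f x) = 0" if "f : TF" for f
    using z[OF that] by (simp add: L2_inner_def mult.commute)
  qed
  thus ?thesis by eventually_elim simp
 qed
qed (use assms that in blast)+

lemma translation_continuous_TF:
 assumes g: "g : TF" and e: "e > 0"
 shows "\<forall>\<^sub>F y in nhds 0. nrm (%x. g (- y + x) - g x) < e"
 unfolding eventually_nhds_iff_sequentially
proof (intro allI impI)
 fix s :: "nat => 'g" assume s: "s \<longlonglongrightarrow> 0"
 obtain R where R: "!!x. R <= N x ==> g x = 0" by (rule TF_support[OF g]) blast
 obtain C where C: "!!x. cmod (g x) <= C" using TF_BC[OF g] by (auto simp: BC_def)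
 obtain R' where R': "!!x y. y : {x. N x <= 1} ==> N (y + x) <= R ==> N x < R'"
  by (rule N_translate_bounded[OF N_sublevel_compact, of 1 R]) blast
 have "open {x. N x < 1}" by (rule open_unit_ball)
 from topological_tendstoD[OF s this] obtain n0 where n0: "!!n. n0 <= n ==> N (s n) < 1"
  by (auto simp: eventually_sequentially)
 define t where "t = (%n. s (n + n0))"
 have t: "t \<longlonglongrightarrow> 0" unfolding t_def using s by (rule LIMSEQ_ignore_initial_segment)
 have tN: "N (- t n) <= 1" for n using n0[of "n + n0"] by (simp add: t_def)
 have gL: "(%x. g (y + x)) : L2 mu" for y by (intro BC_L2 TF_BC TF_translate g)
 have gL0: "g : L2 mu" by (intro BC_L2 TF_BC g)
 have "(%n. nrm (%x. g (- t n + x) - g x)) \<longlonglongrightarrow> (LINT x|mu. 0)"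
  unfolding L2_sqnorm_def
 proof (rule integral_dominated_convergence)
  show "(%x. (cmod (g (- t n + x) - g x))^2) : borel_measurable mu" for n
   by (rule borel_measurable_integrable[OF L2D(2)[OF L2_diff[OF gL gL0]]])
  show "integrable mu (%x. (2*C)^2*ib (max R R') x)"
   using closed_ball_finite[of "max R R'"] by (intro integrable_mult_right integrable_real_indicator) auto
  have "(%n. (cmod (g (- t n + x) - g x))^2) \<longlonglongrightarrow> 0" for x
  proof -
   have "(%n. - t n + x) \<longlonglongrightarrow> - 0 + x" by (intro tendsto_intros t)
   hence 1: "(%n. - t n + x) \<longlonglongrightarrow> x" by simp
   have "isCont g x" using TF_continuous[OF g, of UNIV] by (simp add: continuous_on_eq_continuous_at)
   hence "(%n. g (- t n + x)) \<longlonglongrightarrow> g x" by (rule isCont_tendsto_compose[OF _ 1])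
   hence "(%n. (cmod (g (- t n + x) - g x))^2) \<longlonglongrightarrow> (cmod (g x - g x))^2" by (intro tendsto_intros)
   thus ?thesis by simp
  qed
  thus "AE x in mu. (%n. (cmod (g (- t n + x) - g x))^2) \<longlonglongrightarrow> 0" by simp
  have "norm ((cmod (g (- t n + x) - g x))^2) <= (2*C)^2*ib (max R R') x" for n x
  proof (cases "N x <= max R R'")
   case True
   have "cmod (g (- t n + x) - g x) <= cmod (g (- t n + x)) + cmod (g x)" by (rule norm_triangle_ineq4)
   also have "... <= 2*C" using C[of "- t n + x"] C[of x] by simp
   finally have "(cmod (g (- t n + x) - g x))^2 <= (2*C)^2" by (intro power_mono) auto
   thus ?thesis using True by simp
  next
   case False
   hence "\<not> N (- t n + x) <= R" using R'[of "- t n" x] tN[of n] by fastforce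
   hence "g (- t n + x) = 0" "g x = 0" using R False by auto
   thus ?thesis by simp
  qed
  thus "AE x in mu. norm ((cmod (g (- t n + x) - g x))^2) <= (2*C)^2*ib (max R R') x" for n by simp
 qed simp
 hence "\<forall>\<^sub>F n in sequentially. nrm (%x. g (- t n + x) - g x) < e"
  using e by (intro order_tendstoD(2)[of _ 0]) auto
 thus "\<forall>\<^sub>F n in sequentially. nrm (%x. g (- s n + x) - g x) < e"
  unfolding t_def by (rule eventually_sequentially_seg[THEN iffD1])
qed

text \<open>By density it suffices to consider test functions, for which the convergence is uniform.\<close>

lemma translation_continuous:
 assumes f: "f : L2 mu" and e: "e > 0"
 shows "\<forall>\<^sub>F y in nhds 0. nrm (%x. f (- y + x) - f x) < e"
proof -
 obtain g where g: "g : TF" "nrm (%x. f x - g x) < e/16"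
  using e by (auto intro: TF_dense_L2[OF f, of "e/16"])
 have gL: "g : L2 mu" by (intro BC_L2 TF_BC g)
 have "\<forall>\<^sub>F y in nhds 0. nrm (%x. g (- y + x) - g x) < e/4"
  using e by (intro translation_continuous_TF g) simp
 thus ?thesis
 proof eventually_elim
  case (elim y)
  let ?d = "%x. f x - g x"
  have d: "?d : L2 mu" by (intro L2_diff f gL)
  note dy = L2_left[OF d, of "- y"]
  have md: "(%x. - ?d x) : L2 mu" using L2_scale[OF d, of "- 1"] by simp
  have gy: "(%x. g (- y + x) - g x) : L2 mu" by (intro L2_diff L2_left gL)
  have ddy: "(%x. ?d (- y + x) + - ?d x) : L2 mu" by (rule L2_add[OF dy(1) md])
  have "nrm (%x. f (- y + x) - f x) = nrm (%x. (?d (- y + x) + - ?d x) + (g (- y + x) - g x))"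
   by (rule arg_cong[of _ _ "nrm"]) (simp add: fun_eq_iff)
  also have "... <= 2*nrm (%x. ?d (- y + x) + - ?d x) + 2*nrm (%x. g (- y + x) - g x)"
   by (rule L2_sqnorm_add_le[OF ddy gy])
  finally have 1: "nrm (%x. f (- y + x) - f x) <= 2*nrm (%x. ?d (- y + x) + - ?d x) + 2*nrm (%x. g (- y + x) - g x)" .
  have "nrm (%x. ?d (- y + x) + - ?d x) <= 2*nrm (%x. ?d (- y + x)) + 2*nrm (%x. - ?d x)"
   by (rule L2_sqnorm_add_le[OF dy(1) md])
  also have "nrm (%x. - ?d x) = nrm ?d" by (simp add: L2_sqnorm_def norm_minus_commute)
  also have "nrm (%x. ?d (- y + x)) = nrm ?d" by (rule dy(2))
  finally show ?case using 1 g(2) elim by linarith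
 qed
qed

definition mollifier :: "('g => real) => bool" where
 "mollifier r \<longleftrightarrow> msmooth_on A UNIV r & (ALL x. 0 <= r x) & (%x. complex_of_real (r x)) : TF & (LINT x|mu. r x) = 1"

lemma mollifierD:
 assumes "mollifier r"
 shows "msmooth_on A UNIV r" "0 <= r x" "(%x. complex_of_real (r x)) : TF" "(LINT x|mu. r x) = 1"
  "r : borel_measurable borel" "integrable mu r" "(\<integral>\<^sup>+x. ennreal (r x) \<partial>mu) = 1"
proof -
 show r: "msmooth_on A UNIV r" "0 <= r x" "(%x. complex_of_real (r x)) : TF" "(LINT x|mu. r x) = 1" for x
  using assms by (auto simp: mollifier_def)
 show "r : borel_measurable borel" by (intro borel_measurable_continuous_onI msmooth_continuous[OF open_UNIV r(1)])
 have "integrable mu (%x. Re (complex_of_real (r x)))" using TF_integrable[OF r(3)] by (rule integrable_Re)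
 thus i: "integrable mu r" by simp
 show "(\<integral>\<^sup>+x. ennreal (r x) \<partial>mu) = 1" using nn_integral_eq_integral[OF i] r(2,4) by simp
qed

lemma mollifier_exists:
 assumes U: "open U" "0 : U"
 obtains r where "mollifier r" "!!x. x ~: U ==> r x = 0"
proof -
 obtain f :: "'g => real" and K P where f: "msmooth_on A UNIV f" "!!y. 0 <= f y"
  "open P" "0 : P" "!!y. y : P ==> f y = 1" "compact K" "K <= U" "!!y. y ~: K ==> f y = 0"
  by (rule bump[OF U]) blast
 obtain R where R: "K <= {x. N x < R}" by (rule compact_N_bounded[OF f(6)])
 have fT: "(%x. complex_of_real (f x)) : TF"
  by (rule TF_I[OF msmooth_of_real[OF open_UNIV f(1)], of R]) (use R f(8) in force)
 have "integrable mu (%x. Re (complex_of_real (f x)))" using TF_integrable[OF fT] by (rule integrable_Re)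
 hence fi: "integrable mu f" by simp
 define I where "I = (LINT x|mu. f x)"
 have "I ~= 0"
 proof
  assume "I = 0"
  hence "AE x in mu. f x = 0" unfolding I_def using integral_nonneg_eq_0_iff_AE[OF fi] f(2) by simp
  hence "AE x in mu. x ~: P" by eventually_elim (use f(5) in force)
  hence "emeasure mu P = 0" using f(3) AE_iff_measurable[of P mu "%x. x ~: P"] by simp
  thus False using haar_open_pos[OF haar f(3,4)] by simp
 qed
 moreover have "0 <= I" unfolding I_def using f(2) by simp
 ultimately have I: "I > 0" by simp
 have "(%x. complex_of_real (f x/I)) = (%x. complex_of_real (1/I)*complex_of_real (f x))" by (simp add: fun_eq_iff)
 hence "(%x. complex_of_real (f x/I)) : TF" using TF_scale[OF fT, of "complex_of_real (1/I)"] by (simp only:)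
 moreover have "msmooth_on A UNIV (%x. f x/I)" by (rule msmooth_linear_comp[OF bounded_linear_divide open_UNIV f(1)])
 ultimately have "mollifier (%x. f x/I)" unfolding mollifier_def using I f(2) fi by (auto simp: I_def)
 thus ?thesis using that f(7,8) by fastforce
qed

interpretation mu2: pair_sigma_finite mu mu
 using haar_sigma_finite[OF haar] by (simp add: pair_sigma_finite_def)

lemma pair_measurable: "f : measurable borel borel ==> f : measurable (mu \<Otimes>\<^sub>M mu) borel"
 for f :: "'g \<times> 'g => 'b::topological_space"
 by (rule measurable_haar_pair[OF haar haar])

lemma pair_functions_measurable:
 assumes f: "f : measurable borel M"
 shows "(%p. f (- fst p + snd p)) : measurable (borel :: ('g \<times> 'g) measure) M"
  "(%p. f (fst p)) : measurable (borel :: ('g \<times> 'g) measure) M" "(%p. f (snd p)) : measurable (borel :: ('g \<times> 'g) measure) M"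
 by (rule measurable_compose[OF borel_measurable_continuous_onI f], intro continuous_intros)+

lemma conv_integrable:
 assumes r: "mollifier r" and f: "f : L2 mu"
 shows "integrable mu (%y. r y *\<^sub>R f (- y + x))"
proof -
 have "integrable mu (%y. f (- y + x) * of_real (r y))"
  by (rule L2loc_integrable[OF L2_L2loc[OF L2_reflect(1)[OF f]] TF_BC[OF mollifierD(3)[OF r]]])
 thus ?thesis by (simp add: scaleR_conv_of_real mult.commute)
qed

text \<open>Fubini, after substituting so that the translation falls on the test function.\<close>

lemma conv_pairing:
 assumes r: "mollifier r" and f: "f : L2 mu" and g: "g : TF"
 shows "(pr (conv r f) g) = (LINT y|mu. r y *\<^sub>R (LINT x|mu. f x*g (y + x)))"
  and "integrable mu (%y. r y *\<^sub>R (LINT x|mu. f x*g (y + x)))"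
proof -
 note rD = mollifierD[OF r]
 have fm: "f : borel_measurable borel" using L2D(1)[OF f] by (simp add: borel_mu)
 have gm: "g : borel_measurable borel" by (rule BC_measurable[OF TF_BC[OF g]])
 have gL: "g : L2 mu" by (intro BC_L2 TF_BC g)
 note m [measurable] = pair_functions_measurable(1)[OF fm] pair_functions_measurable(2)[OF rD(5)] pair_functions_measurable(3)[OF gm]
 define \<Phi> where "\<Phi> = (%y x. r y *\<^sub>R (f (- y + x)*g x))"
 define \<Gamma> where "\<Gamma> = (%p :: 'g \<times> 'g. r (fst p)*((cmod (f (- fst p + snd p)))^2 + (cmod (g (snd p)))^2))"
 have \<Gamma>m: "\<Gamma> : borel_measurable (mu \<Otimes>\<^sub>M mu)" unfolding \<Gamma>_def by (rule pair_measurable) (use m in measurable)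
 have \<Gamma>0: "0 <= \<Gamma> p" for p using rD(2) by (simp add: \<Gamma>_def)
 have "(\<integral>\<^sup>+p. ennreal (\<Gamma> p) \<partial>(mu \<Otimes>\<^sub>M mu)) = (\<integral>\<^sup>+y. \<integral>\<^sup>+x. ennreal (\<Gamma> (y, x)) \<partial>mu \<partial>mu)"
  by (rule sigma_finite_measure.nn_integral_fst[OF haar_sigma_finite[OF haar], symmetric]) (use \<Gamma>m in measurable)
 also have "... = (\<integral>\<^sup>+y. ennreal (r y*(nrm f + nrm g)) \<partial>mu)"
 proof (rule nn_integral_cong)
  fix y
  note fy = L2_left[OF f, of "- y"]
  have i: "integrable mu (%x. \<Gamma> (y, x))" unfolding \<Gamma>_def fst_conv snd_conv
   using L2D(2)[OF fy(1)] L2D(2)[OF gL] by (intro integrable_mult_right Bochner_Integration.integrable_add)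
  have "(LINT x|mu. \<Gamma> (y, x)) = r y*(nrm (%x. f (- y + x)) + nrm g)"
   unfolding \<Gamma>_def fst_conv snd_conv L2_sqnorm_def using L2D(2)[OF fy(1)] L2D(2)[OF gL] by simp
  thus "(\<integral>\<^sup>+x. ennreal (\<Gamma> (y, x)) \<partial>mu) = ennreal (r y*(nrm f + nrm g))"
   using nn_integral_eq_integral[OF i] \<Gamma>0 fy(2) by simp
 qed
 also have "... = (\<integral>\<^sup>+y. ennreal (r y)*ennreal (nrm f + nrm g) \<partial>mu)"
  by (intro nn_integral_cong ennreal_mult rD(2) add_nonneg_nonneg L2_sqnorm_nonneg)
 also have "... = (\<integral>\<^sup>+y. ennreal (r y) \<partial>mu)*ennreal (nrm f + nrm g)"
  using rD(5) by (intro nn_integral_multc) (simp add: borel_mu)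
 also have "... < \<infinity>" by (simp add: rD(7))
 finally have \<Gamma>i: "integrable (mu \<Otimes>\<^sub>M mu) \<Gamma>" by (intro integrableI_nonneg \<Gamma>m) (auto simp: \<Gamma>0)
 have \<Phi>i: "integrable (mu \<Otimes>\<^sub>M mu) (case_prod \<Phi>)"
 proof (rule Bochner_Integration.integrable_bound[OF \<Gamma>i])
  have "(%p. r (fst p) *\<^sub>R (f (- fst p + snd p)*g (snd p))) : borel_measurable borel" using m by measurable
  thus "case_prod \<Phi> : borel_measurable (mu \<Otimes>\<^sub>M mu)"
   unfolding \<Phi>_def case_prod_unfold by (rule pair_measurable)
  have "norm (\<Phi> y x) <= norm (\<Gamma> (y, x))" for x y
  proof -
   let ?a = "cmod (f (- y + x))" and ?b = "cmod (g x)"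
   have "0 <= ?a*?b" by simp
   hence "?a*?b <= ?a\<^sup>2 + ?b\<^sup>2" using sum_squares_bound[of ?a ?b] by linarith
   hence "r y*(?a*?b) <= r y*(?a\<^sup>2 + ?b\<^sup>2)" by (rule mult_left_mono[OF _ rD(2)])
   thus ?thesis using rD(2)[of y] \<Gamma>0[of "(y, x)"] by (simp add: \<Phi>_def \<Gamma>_def norm_mult)
  qed
  thus "AE p in mu \<Otimes>\<^sub>M mu. norm (case_prod \<Phi> p) <= norm (\<Gamma> p)" by (intro AE_I2) auto
 qed
 have inner: "(LINT x|mu. \<Phi> y x) = r y *\<^sub>R (LINT x|mu. f x*g (y + x))" for y
 proof -
  have "(%x. - y + x) : measurable borel borel" by (intro borel_measurable_continuous_onI continuous_intros)
  hence fy: "(%x. f (- y + x)*g x) : borel_measurable borel"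
   using measurable_compose[OF _ fm] gm by (intro borel_measurable_times)
  have "(LINT x|mu. f (- y + x)*g x) = (LINT x|mu. f (- y + (y + x))*g (y + x))" using integral_left[OF fy, of y] by simp
  thus ?thesis by (simp add: \<Phi>_def add.assoc[symmetric])
 qed
 show "integrable mu (%y. r y *\<^sub>R (LINT x|mu. f x*g (y + x)))"
  using mu2.integrable_fst[OF \<Phi>i] by (simp only: inner)
 have "conv r f x*g x = (LINT y|mu. \<Phi> y x)" for x
 proof -
  have "(LINT y|mu. \<Phi> y x) = (LINT y|mu. (r y *\<^sub>R f (- y + x))*g x)" by (simp add: \<Phi>_def)
  also have "... = (LINT y|mu. r y *\<^sub>R f (- y + x))*g x" by (rule integral_mult_left_zero)
  finally show ?thesis by (simp add: conv_eq[OF rD(5) fm])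
 qed
 thus "(pr (conv r f) g) = (LINT y|mu. r y *\<^sub>R (LINT x|mu. f x*g (y + x)))"
  using mu2.Fubini_integral[OF \<Phi>i] by (simp only: inner)
qed

text \<open>
 By Jensen's inequality the square of the distance between a function and its convolution is at most
 an average over the support of the kernel of the squared distances to its translates.
\<close>

lemma conv_approximates:
 assumes r: "mollifier r" and f: "f : L2 mu" and cm [measurable]: "conv r f : borel_measurable borel"
  and e: "!!y. r y ~= 0 ==> nrm (%x. f (- y + x) - f x) <= e" "0 <= e"
 shows "(%x. conv r f x - f x) : L2 mu" "nrm (%x. conv r f x - f x) <= e"
proof -
 note rD = mollifierD[OF r]
 have fm [measurable]: "f : borel_measurable borel" using L2D(1)[OF f] by (simp add: borel_mu)
 let ?s = "%y. complex_of_real (sqrt (r y))"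
 have sB: "?s : BC"
 proof -
  obtain C R where "!!x. r x <= C" "!!x. R < N x ==> r x = 0" using TF_BC[OF rD(3)] by (auto simp: BC_def) (metis abs_le_D1)
  thus ?thesis using rD(2,5) by (intro BC_I[of _ "sqrt C" R]) auto
 qed
 have "nrm ?s = 1" using rD(2,4) by (simp add: L2_sqnorm_def)
 define \<Gamma> where "\<Gamma> = (%p :: 'g \<times> 'g. r (fst p)*(cmod (f (- fst p + snd p) - f (snd p)))^2)"
 note [measurable] = pair_functions_measurable(1,3)[OF fm] pair_functions_measurable(2)[OF rD(5)]
 have \<Gamma>m: "\<Gamma> : borel_measurable (mu \<Otimes>\<^sub>M mu)" unfolding \<Gamma>_def by (rule pair_measurable) measurable
 have jensen: "ennreal ((cmod (conv r f x - f x))^2) <= (\<integral>\<^sup>+y. ennreal (\<Gamma> (y, x)) \<partial>mu)" for x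
 proof -
  let ?g = "%y. (f (- y + x) - f x)*?s y"
  have g: "?g : L2 mu"
   using L2_diff[OF L2loc_L2[OF L2_L2loc[OF L2_reflect(1)[OF f]] sB] L2_scale[OF BC_L2[OF sB]], of x "f x"]
   by (simp add: left_diff_distrib)
  have "?g y*cnj (?s y) = r y *\<^sub>R f (- y + x) - r y *\<^sub>R f x" for y
   using rD(2)[of y] by (simp add: scaleR_conv_of_real algebra_simps flip: of_real_mult)
  hence "L2_inner mu ?g ?s = conv r f x - f x"
   using conv_integrable[OF r f, of x] rD(4,6) by (simp add: L2_inner_def conv_eq[OF rD(5) fm])
  moreover have "nrm ?g = (LINT y|mu. \<Gamma> (y, x))" "integrable mu (%y. \<Gamma> (y, x))"
   using L2D(2)[OF g] rD(2) by (simp_all add: L2_sqnorm_def \<Gamma>_def norm_mult power_mult_distrib mult.commute)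
  ultimately show ?thesis
   using L2_Cauchy_Schwarz[OF g BC_L2[OF sB]] \<open>nrm ?s = 1\<close> rD(2)
   by (subst nn_integral_eq_integral) (auto simp: \<Gamma>_def ennreal_leI)
 qed
 have "(\<integral>\<^sup>+x. ennreal ((cmod (conv r f x - f x))^2) \<partial>mu) <= (\<integral>\<^sup>+x. \<integral>\<^sup>+y. ennreal (\<Gamma> (y, x)) \<partial>mu \<partial>mu)"
  by (intro nn_integral_mono jensen)
 also have "... = (\<integral>\<^sup>+y. \<integral>\<^sup>+x. ennreal (\<Gamma> (y, x)) \<partial>mu \<partial>mu)"
  by (rule mu2.Fubini') (use \<Gamma>m in \<open>simp add: case_prod_unfold\<close>)
 also have "... <= (\<integral>\<^sup>+y. ennreal (r y)*ennreal e \<partial>mu)"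
 proof (rule nn_integral_mono)
  fix y
  have d: "(%x. f (- y + x) - f x) : L2 mu" by (intro L2_diff L2_left f)
  have "(\<integral>\<^sup>+x. ennreal (\<Gamma> (y, x)) \<partial>mu) = ennreal (r y*nrm (%x. f (- y + x) - f x))"
   unfolding \<Gamma>_def fst_conv snd_conv L2_sqnorm_def using rD(2)
   by (subst nn_integral_eq_integral[OF integrable_mult_right[OF L2D(2)[OF d]]]) auto
  also have "... <= ennreal (r y*e)" using e(1)[of y] rD(2)[of y] by (intro ennreal_leI) (cases "r y = 0", auto intro: mult_left_mono)
  finally show "(\<integral>\<^sup>+x. ennreal (\<Gamma> (y, x)) \<partial>mu) <= ennreal (r y)*ennreal e" by (simp only: ennreal_mult[OF rD(2) e(2)])
 qed
 also have "... = ennreal e" using rD(5) by (subst nn_integral_multc) (simp_all add: borel_mu rD(7))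
 finally have le: "(\<integral>\<^sup>+x. ennreal ((cmod (conv r f x - f x))^2) \<partial>mu) <= ennreal e" .
 hence int: "integrable mu (%x. (cmod (conv r f x - f x))^2)"
  by (intro integrableI_nonneg) (auto intro: le_less_trans[OF _ ennreal_less_top])
 thus "(%x. conv r f x - f x) : L2 mu" using cm fm by (simp add: L2_def borel_mu)
 have "ennreal (nrm (%x. conv r f x - f x)) <= ennreal e"
  unfolding L2_sqnorm_def using le nn_integral_eq_integral[OF int] by simp
 thus "nrm (%x. conv r f x - f x) <= e" using e(2) by simp
qed

lemma mollification:
 assumes I: "finite I" and f: "!!i. i : I ==> f i : L2 mu" and e: "e > 0"
 obtains r where "mollifier r" "!!i. i : I ==> msmooth_on A UNIV (conv r (f i))"
  "!!i. i : I ==> (%x. conv r (f i) x - f i x) : L2 mu" "!!i. i : I ==> nrm (%x. conv r (f i) x - f i x) <= e"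
proof -
 obtain W where W: "open W" "0 : W"
  "!!r f. msmooth_on A UNIV r ==> (!!x. x ~: W ==> r x = 0) ==> f : L2 mu ==> msmooth_on A UNIV (conv r f)"
  by (rule conv_smooth) blast
 have "\<forall>\<^sub>F y in nhds 0. y : W" by (rule eventually_nhds_in_open[OF W(1,2)])
 moreover have "\<forall>\<^sub>F y in nhds 0. ALL i:I. nrm (%x. f i (- y + x) - f i x) < e"
  using translation_continuous[OF f e] by (intro eventually_ball_finite I ballI)
 ultimately have "\<forall>\<^sub>F y in nhds 0. y : W & (ALL i:I. nrm (%x. f i (- y + x) - f i x) < e)" by (rule eventually_conj)
 then obtain U where U: "open U" "0 : U" "!!y. y : U ==> y : W & (ALL i:I. nrm (%x. f i (- y + x) - f i x) < e)"
  unfolding eventually_nhds by blast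
 obtain r where r: "mollifier r" "!!x. x ~: U ==> r x = 0" by (rule mollifier_exists[OF U(1,2)]) blast
 have sm: "msmooth_on A UNIV (conv r (f i))" if "i : I" for i
  by (rule W(3)[OF mollifierD(1)[OF r(1)] _ f[OF that]]) (use r(2) U(3) in blast)
 have a: "(%x. conv r (f i) x - f i x) : L2 mu & nrm (%x. conv r (f i) x - f i x) <= e" if i: "i : I" for i
 proof -
  have 1: "conv r (f i) : borel_measurable borel"
   by (intro borel_measurable_continuous_onI msmooth_continuous[OF open_UNIV sm] i)
  have 2: "nrm (%x. f i (- y + x) - f i x) <= e" if "r y ~= 0" for y
   using U(3)[of y] r(2)[of y] that i less_imp_le by blast
  show ?thesis using conv_approximates[OF r(1) f[OF i] 1 2 less_imp_le[OF e]] by blast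
 qed
 show ?thesis by (rule that[OF r(1) sm]) (use a in blast)+
qed

end

section \<open>Uniqueness of the self-adjoint extension\<close>

text \<open>The difference of the two sides is a sum of three squares.\<close>

lemma energy_pointwise: "- (3*(cmod Q)^2 + 3/2*(cmod t)^2) <= Re ((s + t)*(cnj s + 2*cnj Q))"
proof -
 have "Re ((s + t)*(cnj s + 2*cnj Q)) + (3*(cmod Q)^2 + 3/2*(cmod t)^2)
   = 1/2*(cmod (s + 2*Q))^2 + 1/2*(cmod (s + t))^2 + (cmod (t + Q))^2"
  unfolding cmod_power2 by (simp add: power2_eq_square algebra_simps)
 moreover have "0 <= 1/2*(cmod (s + 2*Q))^2 + 1/2*(cmod (s + t))^2 + (cmod (t + Q))^2" by simp
 ultimately show ?thesis by linarith
qed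

context carnot
begin

lemma nrm_mult_BC:
 assumes "b : BC"
 obtains K where "K >= 0" "!!f. f : L2 mu ==> nrm (%x. f x*b x) <= K*nrm f"
proof -
 obtain C where C: "!!x. cmod (b x) <= C" using assms by (auto simp: BC_def)
 have "nrm (%x. f x*b x) <= C\<^sup>2*nrm f" if f: "f : L2 mu" for f
 proof -
  have "nrm (%x. f x*b x) <= (LINT x|mu. C\<^sup>2*(cmod (f x))^2)"
   unfolding L2_sqnorm_def
  proof (rule integral_mono)
   show "(cmod (f x*b x))^2 <= C\<^sup>2*(cmod (f x))^2" for x
    using power_mono[OF C, of x 2] by (simp add: norm_mult power_mult_distrib mult.commute mult_right_mono)
  qed (use L2D(2)[OF f] L2D(2)[OF L2loc_L2[OF L2_L2loc[OF f] assms]] in auto)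
  thus ?thesis by (simp add: L2_sqnorm_def)
 qed
 thus ?thesis using that[of "C\<^sup>2"] by simp
qed

lemma continuous_L2loc: "continuous_on UNIV f ==> f : L2loc"
proof -
 assume f: "continuous_on UNIV f"
 have fm: "f : borel_measurable borel" by (rule borel_measurable_continuous_onI[OF f])
 have "(%x. f x*g x) : L2 mu" if "g : BC" for g
  by (intro BC_L2 BC_mult_bounded that fm continuous_locally_bounded f)
 thus ?thesis using fm by (simp add: L2loc_def)
qed

lemma smooth_L2loc: "msmooth_on A UNIV f ==> f : L2loc"
 by (rule continuous_L2loc[OF msmooth_continuous[OF open_UNIV]])

lemma L2loc_mult_continuous: "f : L2loc ==> continuous_on UNIV b ==> (%x. b x*f x) : L2loc"
 by (intro L2loc_mult_bounded borel_measurable_continuous_onI continuous_locally_bounded)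

end

context carnot_weight
begin

lemma drift_locally_bounded:
 assumes alpha: "alpha >= 1" and v: "v : B"
 shows "EX C. ALL x. N x <= R --> cmod (of_real (drift v x)) <= C"
proof -
 obtain C where C: "C >= 0 & (ALL v:B. ALL x. x ~= 0 --> \<bar>drift v x\<bar> <= C*N x powr (alpha - 1))" by (rule exE[OF drift_bound])
 have "\<bar>drift v x\<bar> <= \<bar>drift v 0\<bar> + C * \<bar>R\<bar> powr (alpha - 1)" if "N x <= R" for x
 proof (cases "x = 0")
  case False
  have "C*N x powr (alpha - 1) <= C * \<bar>R\<bar> powr (alpha - 1)" using C alpha that by (intro mult_left_mono powr_mono2) auto
  moreover have "\<bar>drift v x\<bar> <= C*N x powr (alpha - 1)" using C v False by blast
  ultimately show ?thesis by linarith
 qed (use C in auto)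
 thus ?thesis by auto
qed

lemma drift_weight_bounded:
 assumes alpha: "alpha >= 1"
 shows "EX C. ALL v:B. ALL x. x ~= 0 --> (drift v x)^2*w x <= C"
proof -
 obtain C where C: "C >= 0 & (ALL v:B. ALL x. x ~= 0 --> \<bar>drift v x\<bar> <= C*N x powr (alpha - 1))" by (rule exE[OF drift_bound])
 have p: "(N x powr (alpha - 1))^2*w x <= 2" if x: "x ~= 0" for x
 proof (cases "N x <= 1")
  case True
  hence "N x powr (alpha - 1) <= 1 powr (alpha - 1)" using alpha by (intro powr_mono2) auto
  hence "(N x powr (alpha - 1))^2 <= 1\<^sup>2" by (intro power_mono) auto
  hence "(N x powr (alpha - 1))^2*w x <= 1*1" using w_le_1[of x] by (intro mult_mono) auto
  thus ?thesis by simp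
 next
  case False
  define t where "t = N x powr alpha"
  have "N x powr (alpha - 1) <= t" unfolding t_def using False by (intro powr_mono) auto
  hence "(N x powr (alpha - 1))^2 <= t\<^sup>2" by (intro power_mono) auto
  also have "t\<^sup>2 <= 2*exp t"
  proof -
   have "1 + t + t\<^sup>2/2 <= exp t" by (rule exp_lower_Taylor_quadratic) (simp add: t_def)
   moreover have "0 <= t" by (simp add: t_def)
   ultimately show ?thesis by linarith
  qed
  finally have "(N x powr (alpha - 1))^2*w x <= (2*exp t)*w x" by (rule mult_right_mono) simp
  also have "... = 2" by (simp add: exp_weight_def t_def exp_minus)
  finally show ?thesis .
 qed
 have "(drift v x)^2*w x <= C\<^sup>2*2" if "v : B" "x ~= 0" for v x
 proof -
  have "\<bar>drift v x\<bar>\<^sup>2 <= (C*N x powr (alpha - 1))^2" using C that by (intro power_mono) auto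
  hence "(drift v x)^2*w x <= (C*N x powr (alpha - 1))^2*w x" by (intro mult_right_mono) auto
  also have "... = C\<^sup>2*((N x powr (alpha - 1))^2*w x)" by (simp add: power_mult_distrib)
  also have "... <= C\<^sup>2*2" by (intro mult_left_mono p that) simp
  finally show ?thesis .
 qed
 thus ?thesis by blast
qed

text \<open>The square root of the reciprocal weight, and the weighted cutoffs.\<close>

definition isw :: "'g => real" where "isw x = exp (N x powr alpha/2)"
definition pc :: "real => 'g => complex" where "pc R x = of_real (isw x*cut R x)"
definition qc :: "real => 'e => 'g => complex" where "qc R v x = of_real (isw x*X v (cut R) x)"

lemma isw_continuous: "continuous_on S isw"
 unfolding isw_def[abs_def] using alpha_pos by (auto intro!: continuous_intros N_continuous continuous_on_powr')

lemma isw_smooth: "msmooth_on A (- {0}) isw"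
proof -
 have "msmooth_on A (- {0}) (%x. N x powr alpha)"
  by (rule msmooth_real_comp[OF open_punctured N_smooth smooth_on_powr]) auto
 from msmooth_real_comp[OF open_punctured msmooth_linear_comp[OF bounded_linear_divide open_punctured this] smooth_on_exp]
 show ?thesis by (simp add: isw_def[abs_def])
qed

lemma X_isw: "x ~= 0 ==> X v isw x = - isw x*drift v x/2"
proof -
 assume x: "x ~= 0"
 have "((%n. exp (n powr alpha/2)) has_real_derivative exp (N x powr alpha/2)*(alpha*N x powr (alpha - 1)/2)) (at (N x))"
  using x by (auto intro!: derivative_eq_intros)
 from X_real_comp[OF open_punctured N_smooth _ this] show ?thesis using x by (simp add: isw_def[abs_def] drift_eq)
qed

lemma isw_BC: "(%x. complex_of_real (f x)) : TF ==> (%x. complex_of_real (isw x*f x)) : BC"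
 using BC_mult_bounded[OF TF_BC, of _ "%x. complex_of_real (isw x)"] continuous_locally_bounded[of "%x. complex_of_real (isw x)"]
 by (simp add: borel_measurable_continuous_onI continuous_on_of_real isw_continuous)

lemma pc_BC: "R > 0 ==> pc R : BC"
 unfolding pc_def[abs_def] by (rule isw_BC[OF cut_TF])

lemma qc_BC:
 assumes R: "R > 0"
 shows "qc R v : BC"
proof -
 have "X v (%x. complex_of_real (cut R x)) = (%x. of_real (X v (cut R) x))"
  by (intro ext X_of_real[OF open_UNIV cut_smooth[OF R]]) simp
 thus ?thesis unfolding qc_def[abs_def] using TF_X[OF cut_TF[OF R], of v] by (intro isw_BC) simp
qed

text \<open>
 Testing the equation \<open>V - \<Sum> X\<^sub>v (X\<^sub>v V - H\<^sub>v) = 0\<close> with \<open>\<chi>\<^sup>2 cnj V / w\<close>, which is smooth outside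
 the identity only.
\<close>

lemma energy_estimate:
 assumes R: "R > 0" and V: "msmooth_on A UNIV V" and H: "!!v. v : B ==> msmooth_on A UNIV (H v)"
  and eq: "!!f. f : TF ==> pr V f + (\<Sum>v\<in>B. LINT x|mu. (X v V x - H v x)*X v f x) = 0"
 shows "nrm (%x. V x*pc R x) \<le>
  (\<Sum>v\<in>B. 3*nrm (%x. V x*qc R v x) + 3/2*nrm (%x. (of_real (drift v x)*V x - H v x)*pc R x))"
proof -
 let ?p = "%x. isw x*cut R x" and ?d = "%v x. complex_of_real (drift v x)"
 define h where "h = (%x. pc R x*(pc R x*cnj (V x)))"
 have cs: "msmooth_on A (- {0}) (cut R)" and Vs: "msmooth_on A (- {0}) (%x. cnj (V x))"
  using msmooth_subset[OF cut_smooth[OF R]] msmooth_subset[OF msmooth_cnj[OF open_UNIV V]] by auto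
 have ps: "msmooth_on A (- {0}) ?p" by (rule msmooth_mult[OF open_punctured isw_smooth cs])
 have pcs: "msmooth_on A (- {0}) (pc R)" unfolding pc_def[abs_def] by (rule msmooth_of_real[OF open_punctured ps])
 have hs: "msmooth_on A (- {0}) h" unfolding h_def by (intro msmooth_mult open_punctured pcs Vs)
 have Xh: "X v h x = pc R x*((2*qc R v x*cnj (V x) + pc R x*cnj (X v V x)) - pc R x*cnj (V x)*?d v x)" if x: "x ~= 0" for v x
 proof -
  have xp: "x : - {0}" using x by simp
  have "X v ?p x = isw x*X v (cut R) x - ?p x*drift v x/2"
   unfolding X_mult[OF open_punctured isw_smooth cs xp] X_isw[OF x] by simp
  hence Xp: "X v (pc R) x = qc R v x - pc R x*?d v x/2"
   unfolding pc_def[abs_def] by (subst X_of_real[OF open_punctured ps xp]) (simp add: qc_def)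
  have "X v (%x. cnj (V x)) x = cnj (X v V x)" by (rule X_cnj[OF open_UNIV V]) simp
  thus ?thesis
   unfolding h_def X_mult[OF open_punctured pcs msmooth_mult[OF open_punctured pcs Vs] xp] X_mult[OF open_punctured pcs Vs xp] Xp
   by (simp add: algebra_simps)
 qed
 have pB: "pc R : BC" "qc R v : BC" for v by (rule pc_BC[OF R], rule qc_BC[OF R])
 have VL: "V : L2loc" and VcL: "(%x. cnj (V x)) : L2loc" and XVL: "X v V : L2loc" and HL: "v : B ==> H v : L2loc" for v
  by (intro smooth_L2loc V H msmooth_cnj msmooth_X open_UNIV; assumption)+
 have cV: "continuous_on UNIV (%x. cnj (V x))" by (rule msmooth_continuous[OF open_UNIV msmooth_cnj[OF open_UNIV V]])
 have hBC: "h : BC" unfolding h_def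
  by (rule BC_mult[OF pB(1)], subst mult.commute, intro BC_mult_bounded pB borel_measurable_continuous_onI continuous_locally_bounded cV)
 then obtain C where C: "!!x. cmod (h x) <= C" by (auto simp: BC_def)
 have h0: "h x = 0" if "2 * R < N x" for x using cut_eq(2)[OF R, of x] that by (simp add: h_def pc_def)
 have XhL: "X v h : L2loc" if v: "v : B" for v
 proof (rule L2loc_cong_nz[OF _ punctured_measurable[OF msmooth_X[OF open_punctured hs]]])
  note 1 = L2loc_mult_continuous[OF L2loc_mult_BC[OF drift_L2loc[OF v] pB(1)] cV]
  note 2 = L2loc_add_scale[OF L2loc_mult_BC[OF VcL pB(2)[of v]] L2loc_mult_BC[OF L2loc_cnj[OF XVL] pB(1)], of "1/2" v]
  from L2loc_add_scale[OF L2_L2loc[OF L2_zero] L2loc_mult_BC[OF L2loc_add_scale[OF 1 2, of "- 2"] pB(1)], of "- 1"]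
  show "(%x. 0 + (- 1)*((cnj (V x)*(?d v x*pc R x) + (- 2)*(cnj (V x)*qc R v x + 1/2*(cnj (X v V x)*pc R x)))*pc R x)) : L2loc" .
  show "X v h x = 0 + (- 1)*((cnj (V x)*(?d v x*pc R x) + (- 2)*(cnj (V x)*qc R v x + 1/2*(cnj (X v V x)*pc R x)))*pc R x)" if "x ~= 0" for x
   unfolding Xh[OF that] by (simp add: algebra_simps)
 qed
 let ?F = "%v x. X v V x - H v x"
 have FL: "?F v : L2loc" if "v : B" for v using L2loc_add_scale[OF XVL HL[OF that], of v "- 1"] by simp
 have zero: "pr V h + (\<Sum>v\<in>B. pr (?F v) (X v h)) = 0" by (rule remove_point[OF VL FL eq hs C h0 XhL])
 have i: "integrable mu (%x. ?F v x*X v h x)" if v: "v : B" for v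
  by (rule L2loc_product_integrable[OF FL[OF v] XhL[OF v]]) (rule X_zero_outside[OF h0])
 have "V x*h x = of_real ((cmod (V x*pc R x))^2)" for x
 proof -
  have "cnj (pc R x) = pc R x" by (simp add: pc_def)
  thus ?thesis using complex_norm_square[of "V x*pc R x"] by (simp add: h_def mult_ac)
 qed
 hence "pr V h = of_real (nrm (%x. V x*pc R x))"
  unfolding L2_sqnorm_def by (simp only: integral_complex_of_real)
 hence "nrm (%x. V x*pc R x) = (\<Sum>v\<in>B. - Re (pr (?F v) (X v h)))"
  using arg_cong[OF zero, of Re] by (simp add: sum_negf)
 also have "... <= (\<Sum>v\<in>B. 3*nrm (%x. V x*qc R v x) + 3/2*nrm (%x. (?d v x*V x - H v x)*pc R x))"
 proof (rule sum_mono)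
  fix v assume v: "v : B"
  let ?T = "%x. (?d v x*V x - H v x)*pc R x"
  have Q: "(%x. V x*qc R v x) : L2 mu" by (intro L2loc_L2 VL pB)
  have "(%x. V x*?d v x) : L2loc" by (rule L2loc_mult_continuous[OF drift_L2loc[OF v] msmooth_continuous[OF open_UNIV V]])
  from L2loc_add_scale[OF this HL[OF v], of "- 1"] have T: "?T : L2 mu" by (intro L2loc_L2 pB) (simp add: mult.commute)
  have "(LINT x|mu. - Re (?F v x*X v h x)) <= (LINT x|mu. 3*(cmod (V x*qc R v x))^2 + 3/2*(cmod (?T x))^2)"
  proof (rule integral_mono_AE)
   show "integrable mu (%x. - Re (?F v x*X v h x))" by (rule Bochner_Integration.integrable_minus[OF integrable_Re[OF i[OF v]]])
   show "integrable mu (%x. 3*(cmod (V x*qc R v x))^2 + 3/2*(cmod (?T x))^2)"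
    by (intro Bochner_Integration.integrable_add integrable_mult_right L2D(2) Q T)
   show "AE x in mu. - Re (?F v x*X v h x) <= 3*(cmod (V x*qc R v x))^2 + 3/2*(cmod (?T x))^2"
    using AE_nonzero
   proof eventually_elim
    case (elim x)
    let ?s = "(X v V x - ?d v x*V x)*pc R x"
    have "cnj (pc R x) = pc R x" "cnj (qc R v x) = qc R v x" by (simp_all add: pc_def qc_def)
    hence "(?s + ?T x)*(cnj ?s + 2*cnj (V x*qc R v x)) = ?F v x*X v h x"
     unfolding Xh[OF elim] by (simp add: algebra_simps)
    thus ?case using energy_pointwise[of "V x*qc R v x" "?T x" ?s] by simp
   qed
  qed
  also have "... = 3*nrm (%x. V x*qc R v x) + 3/2*nrm ?T"
   unfolding L2_sqnorm_def using L2D(2)[OF Q] L2D(2)[OF T] by simp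
  finally show "- Re (pr (?F v) (X v h)) <= 3*nrm (%x. V x*qc R v x) + 3/2*nrm ?T"
   by (simp only: Bochner_Integration.integral_minus integral_Re[OF i[OF v]])
 qed
 finally show ?thesis .
qed

text \<open>Convolutions inherit the weak equation, because left-invariant fields commute with left translations.\<close>

lemma mollified_equation:
 assumes U: "U : L2 mu" and G: "!!v. v : B ==> G v : L2 mu"
  and eq: "!!f. f : TF ==> pr U f - (\<Sum>v\<in>B. pr U (X v (X v f)) + pr (G v) (X v f)) = 0"
  and r: "mollifier r" and V: "msmooth_on A UNIV (conv r U)" and H: "!!v. v : B ==> msmooth_on A UNIV (conv r (G v))" and f: "f : TF"
 shows "pr (conv r U) f + (\<Sum>v\<in>B. LINT x|mu. (X v (conv r U) x - conv r (G v) x)*X v f x) = 0"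
proof -
 have Xf: "X v f : TF" "X v (X v f) : TF" for v by (intro TF_X f)+
 let ?I = "%F f y. r y *\<^sub>R (LINT x|mu. F x*f (y + x))"
 note rU = conv_pairing[OF r U] and rG = conv_pairing[OF r G]
 have "r y *\<^sub>R ((LINT x|mu. U x*f (y + x)) - (\<Sum>v\<in>B. (LINT x|mu. U x*X v (X v f) (y + x)) + (LINT x|mu. G v x*X v f (y + x)))) = 0" for y
 proof -
  have t1: "X v (%x. f (y + x)) = (%x. X v f (y + x))" for v by (intro ext X_translate)
  have t2: "X v (X v (%x. f (y + x))) = (%x. X v (X v f) (y + x))" for v unfolding t1 by (intro ext X_translate)
  show ?thesis using eq[OF TF_translate[OF f, of y]] unfolding t2 unfolding t1 by simp
 qed
 hence "(LINT y|mu. ?I U f y - (\<Sum>v\<in>B. ?I U (X v (X v f)) y + ?I (G v) (X v f) y)) = 0"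
  by (simp add: scaleR_diff_right scaleR_sum_right scaleR_add_right)
 moreover have "(LINT y|mu. ?I U f y - (\<Sum>v\<in>B. ?I U (X v (X v f)) y + ?I (G v) (X v f) y))
   = pr (conv r U) f - (\<Sum>v\<in>B. pr (conv r U) (X v (X v f)) + pr (conv r (G v)) (X v f))"
  using rU(2)[OF f] rU(2)[OF Xf(2)] rG(2)[OF _ Xf(1)] by (simp add: rU(1)[OF f] rU(1)[OF Xf(2)] rG(1)[OF _ Xf(1)])
 moreover have "pr (conv r U) (X v (X v f)) + pr (conv r (G v)) (X v f) = - (LINT x|mu. (X v (conv r U) x - conv r (G v) x)*X v f x)"
  if v: "v : B" for v
 proof -
  have "integrable mu (%x. X v (conv r U) x*X v f x)" "integrable mu (%x. conv r (G v) x*X v f x)"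
   by (intro TF_integrable TF_mult Xf msmooth_X open_UNIV V H v)+
  thus ?thesis using integration_by_parts[OF V Xf(1), of v v] by (simp add: left_diff_distrib)
 qed
 ultimately show ?thesis by (simp add: sum_negf)
qed

text \<open>
 Mollification with error tending to zero; the commutator of convolution with the drift is controlled
 because the drift is bounded on the support of the cutoff.
\<close>

lemma limit_energy_estimate:
 assumes alpha: "alpha >= 1" and R: "R > 0" and U: "U : L2 mu" and G: "!!v. v : B ==> (%x. of_real (drift v x)*U x) : L2 mu"
  and eq: "!!f. f : TF ==> pr U f - (\<Sum>v\<in>B. pr U (X v (X v f)) + (LINT x|mu. (of_real (drift v x)*U x)*X v f x)) = 0"
 shows "nrm (%x. U x*pc R x) <= 12*(\<Sum>v\<in>B. nrm (%x. U x*qc R v x))"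
proof -
 let ?d = "%v x. complex_of_real (drift v x)"
 let ?G = "%v x. ?d v x*U x"
 have dp: "(%x. ?d v x*pc R x) : BC" if "v : B" for v
  by (rule BC_mult_bounded[OF pc_BC[OF R] L2loc_measurable[OF drift_L2loc[OF that]] drift_locally_bounded[OF alpha that]])
 let ?bd = "%b K. K >= 0 & (ALL f. f : L2 mu --> nrm (%x. f x*b x) <= K*nrm f)"
 obtain Kp where Kp: "?bd (pc R) Kp" by (rule nrm_mult_BC[OF pc_BC[OF R]]) blast
 have "ALL v:B. EX K. ?bd (qc R v) K" using nrm_mult_BC[OF qc_BC[OF R]] by metis
 from bchoice[OF this] obtain Kq where Kq: "!!v. v : B ==> ?bd (qc R v) (Kq v)" by blast
 have "ALL v:B. EX K. ?bd (%x. ?d v x*pc R x) K" using nrm_mult_BC[OF dp] by metis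
 from bchoice[OF this] obtain Kd where Kd: "!!v. v : B ==> ?bd (%x. ?d v x*pc R x) (Kd v)" by blast
 define K where "K = 2*Kp + 2*(\<Sum>v\<in>B. 6*Kq v + 3*Kd v + 3*Kp)"
 have K: "0 <= K" unfolding K_def using Kp Kq Kd by (intro add_nonneg_nonneg mult_nonneg_nonneg sum_nonneg) auto
 have main: "nrm (%x. U x*pc R x) <= 12*(\<Sum>v\<in>B. nrm (%x. U x*qc R v x)) + K*e" if e: "e > 0" for e
 proof -
  define F where "F = (%i. case i of None => U | Some v => ?G v)"
  let ?J = "insert None (Some ` B)"
  have FL: "F i : L2 mu" if "i : ?J" for i using that U G by (auto simp: F_def)
  obtain r where r: "mollifier r" "!!i. i : ?J ==> msmooth_on A UNIV (conv r (F i))"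
   "!!i. i : ?J ==> (%x. conv r (F i) x - F i x) : L2 mu" "!!i. i : ?J ==> nrm (%x. conv r (F i) x - F i x) <= e"
  proof (rule mollification[of ?J F e])
   show "F i : L2 mu" if "i : ?J" for i by (rule FL[OF that])
  qed (use finite_B e in blast)+
  define V where "V = conv r U"
  define H where "H = (%v. conv r (?G v))"
  have V: "msmooth_on A UNIV V" "(%x. V x - U x) : L2 mu" "nrm (%x. V x - U x) <= e"
   using r(2-4)[of None] by (simp_all add: F_def V_def)
  have H: "msmooth_on A UNIV (H v)" "(%x. H v x - ?G v x) : L2 mu" "nrm (%x. H v x - ?G v x) <= e" if "v : B" for v
   using r(2-4)[of "Some v"] that by (simp_all add: F_def H_def)
  have est: "nrm (%x. V x*pc R x) <= (\<Sum>v\<in>B. 3*nrm (%x. V x*qc R v x) + 3/2*nrm (%x. (?d v x*V x - H v x)*pc R x))"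
   by (rule energy_estimate[OF R V(1) H(1)])
    (use mollified_equation[OF U G eq r(1) V(1)[unfolded V_def] H(1)[unfolded H_def]] in \<open>auto simp: V_def H_def\<close>)
  have small: "nrm (%x. d x*b x) <= K*e" if "?bd b K" "d : L2 mu" "nrm d <= e" for d b K
   using that mult_left_mono[of "nrm d" e K] by force
  have neg: "(%x. g x - f x) : L2 mu" "nrm (%x. g x - f x) <= e" if "(%x. f x - g x) : L2 mu" "nrm (%x. f x - g x) <= e" for f g
   using L2_scale[OF that(1), of "- 1"] that(2) by (simp_all add: L2_sqnorm_minus_commute[of mu g f])
  have add: "nrm f <= 2 * a + 2*b" if "f = (%x. g x + k x)" "g : L2 mu" "k : L2 mu" "nrm g <= a" "nrm k <= b" for f g k a b
   using L2_sqnorm_add_le[OF that(2,3)] that(1,4,5) by simp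
  note BCL = L2loc_L2[OF L2_L2loc]
  have summand: "3*nrm (%x. V x*qc R v x) + 3/2*nrm (%x. (?d v x*V x - H v x)*pc R x)
   <= 6*nrm (%x. U x*qc R v x) + (6*Kq v + 3*Kd v + 3*Kp)*e" if v: "v : B" for v
  proof -
   have 1: "nrm (%x. V x*qc R v x) <= 2*nrm (%x. U x*qc R v x) + 2*(Kq v * e)"
    by (rule add[OF _ BCL[OF U qc_BC[OF R]] BCL[OF V(2) qc_BC[OF R]] order_refl small[OF Kq[OF v] V(2,3)]])
     (simp add: fun_eq_iff algebra_simps)
   have 2: "nrm (%x. (?d v x*V x - H v x)*pc R x) <= 2*(Kd v * e) + 2*(Kp*e)"
    by (rule add[OF _ BCL[OF V(2) dp[OF v]] BCL[OF neg(1)[OF H(2,3)[OF v]] pc_BC[OF R]]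
      small[OF Kd[OF v] V(2,3)] small[OF Kp neg[OF H(2,3)[OF v]]]]) (simp add: fun_eq_iff algebra_simps)
   show ?thesis using 1 2 by (simp add: algebra_simps)
  qed
  have "nrm (%x. U x*pc R x) <= 2*nrm (%x. V x*pc R x) + 2*(Kp*e)"
   by (rule add[OF _ L2loc_L2[OF smooth_L2loc[OF V(1)] pc_BC[OF R]] BCL[OF neg(1)[OF V(2,3)] pc_BC[OF R]] order_refl small[OF Kp neg[OF V(2,3)]]])
    (simp add: fun_eq_iff algebra_simps)
  moreover have "nrm (%x. V x*pc R x) <= (\<Sum>v\<in>B. 6*nrm (%x. U x*qc R v x) + (6*Kq v + 3*Kd v + 3*Kp)*e)"
   by (rule order_trans[OF est sum_mono]) (rule summand)
  moreover have "... = 6*(\<Sum>v\<in>B. nrm (%x. U x*qc R v x)) + (\<Sum>v\<in>B. 6*Kq v + 3*Kd v + 3*Kp)*e"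
   unfolding sum_distrib_left sum_distrib_right by (rule sum.distrib)
  ultimately show ?thesis by (simp add: K_def algebra_simps)
 qed
 show ?thesis
 proof (rule field_le_epsilon)
  fix e :: real assume e: "0 < e"
  have "K*(e/(K + 1)) <= e" using K e by (simp add: divide_le_eq mult_left_mono)
  moreover have "0 < e/(K + 1)" using K e by simp
  ultimately show "nrm (%x. U x*pc R x) <= 12*(\<Sum>v\<in>B. nrm (%x. U x*qc R v x)) + e"
   using main[of "e/(K + 1)"] by linarith
 qed
qed

text \<open>
 As \<open>R\<close> tends to infinity, the right-hand side of the energy estimate is \<open>O(1 / R\<^sup>2)\<close>, while the left-hand
 side dominates the norm of \<open>u\<close> over any fixed ball.
\<close>

lemma range_dense:
 assumes alpha: "alpha >= 1" and u: "u : L2 M" and orth: "!!f. f : TF ==> L2_inner M (%x. f x + L0 f x) u = 0"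
 shows "AE x in M. u x = 0"
proof -
 define U where "U = (%x. complex_of_real (w x)*cnj (u x))"
 let ?a = "%x. w x*(cmod (u x))^2" and ?d = "%v x. complex_of_real (drift v x)"
 have a: "integrable mu ?a" using u by (simp add: L2_M_iff)
 have Um [measurable]: "U : borel_measurable borel" unfolding U_def by (rule L2loc_measurable[OF w_mult_L2loc[OF L2loc_cnj[OF L2_M_L2loc[OF u]]]])
 have Usq: "(cmod (U x))^2 = w x*?a x" for x by (simp add: U_def norm_mult power_mult_distrib power2_eq_square)
 have UL: "U : L2 mu" by (rule L2_bounded_nz[OF Um a]) (use w_le_1 in \<open>simp add: Usq mult_left_le_one_le\<close>)
 obtain Cd where "ALL v:B. ALL x. x ~= 0 --> (drift v x)^2*w x <= Cd" by (rule exE[OF drift_weight_bounded[OF alpha]])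
 hence Cd: "(drift v x)^2*w x <= Cd" if "v : B" "x ~= 0" for v x using that by blast
 have GL: "(%x. ?d v x*U x) : L2 mu" if v: "v : B" for v
 proof (rule L2_bounded_nz)
  show "(%x. ?d v x*U x) : borel_measurable borel" by (rule borel_measurable_times[OF L2loc_measurable[OF drift_L2loc[OF v]] Um])
  show "integrable mu (%x. Cd*?a x)" by (rule integrable_mult_right[OF a])
  show "(cmod (?d v x*U x))^2 <= Cd*?a x" if "x ~= 0" for x
   using mult_right_mono[OF Cd[OF v that], of "?a x"] by (simp add: norm_mult power_mult_distrib Usq mult_ac)
 qed
 have eq: "pr U f - (\<Sum>v\<in>B. pr U (X v (X v f)) + (LINT x|mu. (?d v x*U x)*X v f x)) = 0" if f: "f : TF" for f
 proof -
  have i: "integrable mu (%x. U x*f x)" "integrable mu (%x. U x*X v (X v f) x)" "v : B ==> integrable mu (%x. (?d v x*U x)*X v f x)" for v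
   by (intro L2loc_integrable L2_L2loc UL GL TF_BC f TF_X; assumption?)+
  have "L2_inner M (%x. f x + L0 f x) u = (LINT x|mu. U x*f x - (\<Sum>v\<in>B. U x*X v (X v f) x + (?d v x*U x)*X v f x))"
   unfolding L2_inner_M[OF L2_M_measurable[OF L2_add[OF TF_L2_M[OF f] L0_L2[OF f]]] L2_M_measurable[OF u]]
   by (intro Bochner_Integration.integral_cong refl) (simp add: L0_eq U_def algebra_simps sum_distrib_left sum.distrib)
  also have "... = pr U f - (\<Sum>v\<in>B. pr U (X v (X v f)) + (LINT x|mu. (?d v x*U x)*X v f x))" using i by simp
  finally show ?thesis using orth[OF f] by simp
 qed
 obtain D where "D >= 0 & (ALL v:B. \<forall>R>0. ALL x. \<bar>X v (cut R) x\<bar> <= D/R)" by (rule exE[OF X_cut_bounded])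
 hence D: "!!v R x. v : B ==> R > 0 ==> \<bar>X v (cut R) x\<bar> <= D/R" by auto
 define c where "c = 12*(real (card B)*(D\<^sup>2*(LINT x|mu. ?a x)))"
 have isq: "(cmod (U x * of_real (isw x*b)))^2 = b\<^sup>2*?a x" for x b
 proof -
  have "(isw x)^2*w x = 1" by (simp add: power2_eq_square isw_def exp_weight_def exp_add[symmetric])
  moreover have "(cmod (U x * of_real (isw x*b)))^2 = ((isw x)^2*w x)*(b\<^sup>2*?a x)"
   by (simp add: norm_mult power_mult_distrib Usq mult_ac)
  ultimately show ?thesis by simp
 qed
 have iI: "integrable mu (%x. ib n x*?a x)" for n using integrable_mult_indicator[OF _ a, of "{x. N x <= n}"] by simp
 have bound: "(LINT x|mu. ib n x*?a x) <= c/R\<^sup>2" if R: "0 < R" "n <= R" for n R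
 proof -
  have "(LINT x|mu. ib n x*?a x) <= nrm (%x. U x*pc R x)"
   unfolding L2_sqnorm_def
  proof (rule integral_mono[OF iI L2D(2)[OF L2loc_L2[OF L2_L2loc[OF UL] pc_BC[OF R(1)]]]])
   show "ib n x*?a x <= (cmod (U x*pc R x))^2" for x
    unfolding pc_def isq using cut_eq(1)[OF R(1), of x] R(2) by (auto simp: indicator_def)
  qed
  also have "... <= 12*(\<Sum>v\<in>B. nrm (%x. U x*qc R v x))"
   by (rule limit_energy_estimate[OF alpha R(1) UL GL eq])
  also have "... <= 12*(\<Sum>v\<in>B. (LINT x|mu. (D/R)^2*?a x))"
   unfolding L2_sqnorm_def
  proof (intro mult_left_mono sum_mono integral_mono)
   fix v x assume v: "v : B"
   show "integrable mu (%x. (cmod (U x*qc R v x))^2)" by (intro L2D(2) L2loc_L2 L2_L2loc UL qc_BC R)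
   have "\<bar>X v (cut R) x\<bar>\<^sup>2 <= (D/R)^2" using D[OF v R(1), of x] by (intro power_mono) auto
   thus "(cmod (U x*qc R v x))^2 <= (D/R)^2*?a x" unfolding qc_def isq by (intro mult_right_mono) auto
  qed (use a in auto)
  also have "... = c/R\<^sup>2" by (simp add: c_def power_divide)
  finally show ?thesis .
 qed
 have "AE x in mu. ib (real n) x*?a x = 0" for n
 proof -
  have "(LINT x|mu. ib (real n) x*?a x) <= 0"
  proof (rule LIMSEQ_le_const)
   have "(%k. c*(1/real k) ^ 2) \<longlonglongrightarrow> c*0 ^ 2" by (intro tendsto_intros lim_1_over_n)
   thus "(%k. c/(real k)^2) \<longlonglongrightarrow> 0" by (simp add: power_divide)
   show "EX K. \<forall>k\<ge>K. (LINT x|mu. ib (real n) x*?a x) <= c/(real k)^2"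
    by (intro exI[of _ "Suc n"] allI impI bound) auto
  qed
  moreover have "0 <= (LINT x|mu. ib (real n) x*?a x)" by simp
  ultimately show ?thesis using integral_nonneg_eq_0_iff_AE[OF iI] by simp
 qed
 hence "AE x in mu. ALL n. ib (real n) x*?a x = 0" unfolding AE_all_countable by (rule allI)
 thus ?thesis
  unfolding AE_M
 proof eventually_elim
  case (elim x)
  obtain n where "N x <= real n" using real_arch_simple by blast
  thus ?case using elim[rule_format, of n] by simp
 qed
qed

lemma adjoint_T0:
 assumes alpha: "alpha >= 1"
 shows "L2_adjoint M T0 <= Lw"
proof (rule adjoint_subset_of_resolvent[OF Lw_operator Lw_symmetric Lw_onto T0_subset])
 fix u assume u: "u : L2 M" and orth: "!!f f'. (f, f') : T0 ==> L2_inner M (%x. f x + f' x) u = 0"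
 show "AE x in M. u x = 0" by (rule range_dense[OF alpha u orth[OF T0_member]])
qed

lemma Lw_unique:
 assumes "alpha >= 1" "self_adjoint_extension M T0 T"
 shows "T = Lw"
 by (rule self_adjoint_extension_unique[OF Lw_self_adjoint assms(2) adjoint_T0[OF assms(1)]])

end

theorem corollary2p7:
  fixes A :: "('g::{topological_group_add, t2_space, second_countable_topology},
               'e::euclidean_space) chart set"
    and \<nu> :: nat and \<gg> :: "nat \<Rightarrow> 'e set" and B :: "'e set"
    and \<mu> :: "'g measure" and N :: "'g \<Rightarrow> real"
  assumes stratified: "stratified_group A \<nu> \<gg>"
    and noncommutative: "\<exists>x y :: 'g. x + y \<noteq> y + x"
    and basis: "independent B" "span B = \<gg> 1"
    and haar: "haar_measure \<mu>"
    and norm: "homogeneous_norm A \<nu> \<gg> N"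
  shows "(\<forall>\<alpha>>0. self_adjoint_extension (weighted \<mu> (exp_weight N \<alpha>))
            (minimal_weighted_sublaplacian A B \<mu> (exp_weight N \<alpha>))
            (weighted_sublaplacian A B \<mu> (exp_weight N \<alpha>))) \<and>
         (\<forall>\<alpha>\<ge>1. \<forall>T. self_adjoint_extension (weighted \<mu> (exp_weight N \<alpha>))
            (minimal_weighted_sublaplacian A B \<mu> (exp_weight N \<alpha>)) T
            \<longrightarrow> T = weighted_sublaplacian A B \<mu> (exp_weight N \<alpha>))"
proof -
 have "lie_group A" using stratified by (simp add: stratified_group_def)
 then have c: "carnot_weight A \<nu> \<gg> B \<mu> N \<alpha>" if "\<alpha> > 0" for \<alpha>
  using assms that by unfold_locales auto
 show ?thesis
  using carnot_weight.Lw_extension[OF c] carnot_weight.Lw_unique[OF c] by auto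
qed

end
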